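(* Let $Y=\hat P(k,n)$, $G=\mathrm{Aut}_g(S)$, and let $\mathscr L_i=n_i\mathscr L$ ($i=1,\dots,s$) with positive integers $n_i$, $\sum_i n_i=n$, so that $-K_Y=\mathscr L_1+\cdots+\mathscr L_s$. Then the tautological system $\tau_Y(G,\mathscr L_1,\dots,\mathscr L_s,\beta_\chi)$ governs the period integrals of the Calabi–Yau complete intersections in $Y$ cut out by sections of the $\mathscr L_i$; that is, every operator in its defining left ideal annihilates the period integrals $$\Pi_\gamma=\int_\gamma\mathrm{Res}\,\frac{1}{\sigma_1\cdots\sigma_s}\bigwedge_{i=1}^{N}\frac{dt_i}{t_i},\qquad \sigma_i\in H^0(Y,\mathscr L_i),\quad N=\dim\hat P(k,n).$$
   Context: Definition of $\hat P(k,n)$. Take dots at positions $(i,j)$, $1\le i\le k$, $1\le j\le n-k$ (row $i$ counted from the top, column $j$ from the left), plus one extra dot above $(1,1)$ and one extra dot to the right of $(k,n-k)$. Let $E$ be the set of edges joining adjacent dots (horizontally or vertically, including the two edges to the extra dots), oriented downward or to the right. Let the lattice be $\mathbb Z^{N}$, $N=k(n-k)$, with basis indexed by the non-extra dots, and for $e\in E$ let $\delta(e)=\mathrm{head}(e)-\mathrm{tail}(e)$, extra dots being set to $0$. $P(k,n)$ is the toric variety of the fan $\Sigma$ of cones over the proper faces of the convex hull of $\{\delta(e)\}_{e\in E}$; it is a Gorenstein toric Fano variety, and $\hat P(k,n)\to P(k,n)$ is its small toric resolution of Batyrev–Ciocan-Fontanine–Kim–van Straten, a smooth projective toric variety whose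 fan refines $\Sigma$ with the same rays $\rho_1,\dots,\rho_r$ ($r=|E|$). $D_j$ is the toric divisor of $\rho_j$. $\mathscr L$ is the divisor class of the toric divisor of the edge joining the upper extra dot to $(1,1)$; it is base-point free and $-K_Y=n\mathscr L$. $S=\mathbb C[w_1,\dots,w_r]$ is the homogeneous coordinate ring of $Y$, graded by $\mathrm{Cl}(Y)$, $\mathrm{Aut}_g(S)$ its group of graded $\mathbb C$-algebra automorphisms. Choose integers $a_{ij}$ with $\mathscr L_i\sim\sum_j a_{ij}D_j$ and $\sum_i a_{ij}=1$ for all $j$. Let $\Delta_{\mathscr L_i}=\{m:\langle m,\rho_j\rangle\ge-a_{ij}\ \forall j\}$; a section is $\sigma_i=\sum_{\mu_i}b_{\mu_i}t^{\mu_i}$ (sum over lattice points of $\Delta_{\mathscr L_i}$, $t$ torus coordinates), and $H^0(Y,\mathscr L_i)$ is identified with a graded piece of $S$ by $t^{\mu_i}\mapsto\prod_jw_j^{\langle\mu_i,\rho_j\rangle+a_{ij}}$, which makes it a $G$-module. $\gamma$ is a cycle in the smooth complete intersection $\{\sigma_1=\dots=\sigma_s=0\}$, and $\int_\gamma\mathrm{Res}(\cdot)$ means (up to a constant) the integral over the tube $\tau(\gamma)$ around $\gamma$; $\Pi_\gamma$ is viewed as a local function of the coefficients $(b_{\mu_i})$. Character: partition the rays according to equality of $\deg w_j\in\mathrm{Cl}(Y)$; $\chi:\mathrm{Aut}_g(S)\to\mathbb C^\times$ is the product over the classes of the determinants of the induced action on the span of the variables in the class (inside the corresponding graded piece of $S$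 modulo the span of the remaining monomials of that degree). Tautological system: let $V_i=H^0(Y,\mathscr L_i)^*$, $V=V_1\times\cdots\times V_s$, $\hat G=G\times(\mathbb C^\times)^s$ with the $i$-th $\mathbb C^\times$ scaling $V_i$, $Z:\hat{\mathfrak g}=\mathfrak g\times\mathbb C^s\to\mathrm{End}(V)$ the Lie algebra map, elements of $\mathrm{End}(V)$ being viewed as linear derivations on $V^*$ (a degree-preserving derivation $x$ of $S$ with $t^{\mu_i}\mapsto\sum_\nu c^{(i)}_{\nu\mu_i}t^{\nu}$ on $H^0(Y,\mathscr L_i)$ gives $Z(x)=\sum_i\sum_{\mu_i,\nu}c^{(i)}_{\nu\mu_i}b_{\mu_i}\partial/\partial b_{\nu}$, and the $i$-th generator of $\mathbb C^s$ gives $\sum_{\mu_i}b_{\mu_i}\partial/\partial b_{\mu_i}$). $\beta_\chi=(d\chi;\mathrm{id},\dots,\mathrm{id}):\hat{\mathfrak g}\to\mathbb C$, i.e. $\beta_\chi(x,c_1,\dots,c_s)=d\chi(x)+\sum c_i$. $\hat Y\subset V$ is the (multi-)cone over the image of $Y\to\mathbb P V_1\times\cdots\times\mathbb P V_s$, $I=I(\hat Y,V)\subset\mathbb C[V]$ its ideal, $\partial_\zeta$ ($\zeta\in V^*$) the derivation on $V^*$ with $\partial_\zeta(a)=\langle a,\zeta\rangle$ for $a\in V$, and $$\tau_Y(G,\mathscr L_1,\dots,\mathscr L_s,\beta_\chi)=D_{V^*}\big/\big(D_{V^*}\langle p(\partial_\zeta):p(\zeta)\in I\rangle+D_{V^*}\langle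 Z(x)+\beta_\chi(x):x\in\hat{\mathfrak g}\rangle\big).$$ *)

theory Defs
  imports "HOL-Analysis.Analysis" "HOL-Homology.Homology"
begin

section \<open>The ladder diagram and the fan of the small resolution\<close>

type_synonym dot = "nat \<times> nat"
type_synonym edge = "dot \<times> dot"

definition dots :: "nat \<Rightarrow> nat \<Rightarrow> dot set" where
  "dots k n = {1..k} \<times> {1..n - k}"

text \<open>An edge is the pair (tail, head); the extra dots are \<open>(0, 1)\<close> and \<open>(k, n - k + 1)\<close>.\<close>

definition top_edge :: edge where
  "top_edge = ((0, 1), (1, 1))"

definition end_edge :: "nat \<Rightarrow> nat \<Rightarrow> edge" where
  "end_edge k n = ((k, n - k), (k, n - k + 1))"

definition edges :: "nat \<Rightarrow> nat \<Rightarrow> edge set" where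
  "edges k n = {top_edge, end_edge k n}
     \<union> {((i, j), (i + 1, j)) | i j. (i, j) \<in> dots k n \<and> (i + 1, j) \<in> dots k n}
     \<union> {((i, j), (i, j + 1)) | i j. (i, j) \<in> dots k n \<and> (i, j + 1) \<in> dots k n}"

text \<open>The non-extra dots are labelled by \<open>'d\<close>, so that the lattice is \<open>int ^ 'd\<close>. The extra dots lie
  outside the range of \<open>dot\<close> and hence contribute 0.\<close>

definition edge_vec :: "('d \<Rightarrow> dot) \<Rightarrow> edge \<Rightarrow> int ^ 'd::finite" where
  "edge_vec dot e = (\<chi> d. (if snd e = dot d then 1 else 0) - (if fst e = dot d then 1 else 0))"

text \<open>The fan of the small resolution of Batyrev, Ciocan-Fontanine, Kim and van Straten is given by its
  primitive collections: the roof (the path from one extra dot to the other along the upper right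
  boundary, whose edge vectors sum to 0) and, for each box, the two edges meeting at its lower left
  vertex (the sum of their vectors equals the sum of the vectors of the other two edges of the box).
  A set of rays spans a cone of the fan iff it contains no primitive collection.\<close>

definition roof :: "nat \<Rightarrow> nat \<Rightarrow> edge set" where
  "roof k n = {top_edge, end_edge k n}
     \<union> {((1, j), (1, j + 1)) | j. 1 \<le> j \<and> j < n - k}
     \<union> {((i, n - k), (i + 1, n - k)) | i. 1 \<le> i \<and> i < k}"

definition corner :: "nat \<Rightarrow> nat \<Rightarrow> edge set" where
  "corner i j = {((i, j), (i + 1, j)), ((i + 1, j), (i + 1, j + 1))}"

definition ladder_cones :: "nat \<Rightarrow> nat \<Rightarrow> edge set set" where
  "ladder_cones k n = {J. J \<subseteq> edges k n \<and> \<not> roof k n \<subseteq> J \<and>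
     (\<forall>i j. 1 \<le> i \<and> i < k \<and> 1 \<le> j \<and> j < n - k \<longrightarrow> \<not> corner i j \<subseteq> J)}"


section \<open>Toric varieties in homogeneous coordinates\<close>

text \<open>Throughout, \<open>\<rho> j\<close> is the primitive generator of the \<open>j\<close>-th ray and \<open>K\<close> is the set of those
  sets of rays that span a cone of the fan.  The (smooth complete) toric variety is the set of orbits of
  \<open>class_torus \<rho>\<close>, the group \<open>Hom (Cl Y, C\<^sup>*)\<close>, on \<open>cox_open K\<close>.\<close>

definition pairing :: "int ^ 'd::finite \<Rightarrow> int ^ 'd \<Rightarrow> int" where
  "pairing m v = (\<Sum>d\<in>UNIV. m $ d * v $ d)"

definition cox_open :: "'r::finite set set \<Rightarrow> (complex ^ 'r) set" where
  "cox_open K = {w. {j. w $ j = 0} \<in> K}"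

definition class_torus :: "('r::finite \<Rightarrow> int ^ 'd::finite) \<Rightarrow> (complex ^ 'r) set" where
  "class_torus \<rho> = {h. (\<forall>j. h $ j \<noteq> 0) \<and> (\<forall>m. (\<Prod>j\<in>UNIV. h $ j powi pairing m (\<rho> j)) = 1)}"

definition act :: "complex ^ 'r \<Rightarrow> complex ^ 'r \<Rightarrow> complex ^ 'r::finite" where
  "act h w = (\<chi> j. h $ j * w $ j)"

definition orbit :: "('r::finite \<Rightarrow> int ^ 'd::finite) \<Rightarrow> complex ^ 'r \<Rightarrow> (complex ^ 'r) set" where
  "orbit \<rho> w = (\<lambda>h. act h w) ` class_torus \<rho>"

definition lin_equiv :: "('r::finite \<Rightarrow> int ^ 'd::finite) \<Rightarrow> ('r \<Rightarrow> int) \<Rightarrow> ('r \<Rightarrow> int) \<Rightarrow> bool" where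
  "lin_equiv \<rho> A B \<longleftrightarrow> (\<exists>m. \<forall>j. A j - B j = pairing m (\<rho> j))"

definition polytope_points :: "('r::finite \<Rightarrow> int ^ 'd::finite) \<Rightarrow> ('r \<Rightarrow> int) \<Rightarrow> (int ^ 'd) set" where
  "polytope_points \<rho> A = {m. \<forall>j. pairing m (\<rho> j) \<ge> - A j}"


subsection \<open>Sections of the line bundles\<close>

text \<open>The divisor of the \<open>i\<close>-th line bundle is \<open>a i\<close>.  The coefficients of all sections together form a
  function \<open>b\<close> on pairs \<open>(i, \<mu>)\<close>; only its values on \<open>coeff_index \<rho> a\<close> are coordinates, the others are
  never used.\<close>

type_synonym ('s, 'd) idx = "'s \<times> (int ^ 'd)"

definition coeff_index ::
    "('r::finite \<Rightarrow> int ^ 'd::finite) \<Rightarrow> ('s \<Rightarrow> 'r \<Rightarrow> int) \<Rightarrow> ('s, 'd) idx set" where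
  "coeff_index \<rho> a = {(i, \<mu>). \<mu> \<in> polytope_points \<rho> (a i)}"

definition cox_exponent ::
    "('r::finite \<Rightarrow> int ^ 'd::finite) \<Rightarrow> ('r \<Rightarrow> int) \<Rightarrow> int ^ 'd \<Rightarrow> ('r \<Rightarrow>\<^sub>0 nat)" where
  "cox_exponent \<rho> A \<mu> = Poly_Mapping.Abs_poly_mapping (\<lambda>j. nat (pairing \<mu> (\<rho> j) + A j))"

definition eval_monom :: "('r::finite \<Rightarrow>\<^sub>0 nat) \<Rightarrow> complex ^ 'r \<Rightarrow> complex" where
  "eval_monom \<alpha> w = (\<Prod>j\<in>UNIV. w $ j ^ Poly_Mapping.lookup \<alpha> j)"

definition cox_section :: "('r::finite \<Rightarrow> int ^ 'd::finite) \<Rightarrow> ('s \<Rightarrow> 'r \<Rightarrow> int) \<Rightarrow>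
    (('s, 'd) idx \<Rightarrow> complex) \<Rightarrow> 's \<Rightarrow> complex ^ 'r \<Rightarrow> complex" where
  "cox_section \<rho> a b i w =
     (\<Sum>\<mu>\<in>polytope_points \<rho> (a i). b (i, \<mu>) * eval_monom (cox_exponent \<rho> (a i) \<mu>) w)"

definition zero_locus :: "'r set set \<Rightarrow> ('r::finite \<Rightarrow> int ^ 'd::finite) \<Rightarrow> ('s \<Rightarrow> 'r \<Rightarrow> int) \<Rightarrow>
    (('s, 'd) idx \<Rightarrow> complex) \<Rightarrow> (complex ^ 'r) set" where
  "zero_locus K \<rho> a b = {w \<in> cox_open K. \<forall>i. cox_section \<rho> a b i w = 0}"

text \<open>The quotient map is a principal bundle under the class torus, so that smoothness of the
  complete intersection can be tested by the Jacobian criterion in homogeneous coordinates.\<close>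

definition smooth_ci :: "'r set set \<Rightarrow> ('r::finite \<Rightarrow> int ^ 'd::finite) \<Rightarrow> ('s::finite \<Rightarrow> 'r \<Rightarrow> int) \<Rightarrow>
    (('s, 'd) idx \<Rightarrow> complex) \<Rightarrow> bool" where
  "smooth_ci K \<rho> a b \<longleftrightarrow> (\<forall>w\<in>zero_locus K \<rho> a b. \<forall>c.
     (\<forall>j. (\<Sum>i\<in>UNIV. c i * deriv (\<lambda>z. cox_section \<rho> a b i (w + axis j z)) 0) = 0)
       \<longrightarrow> (\<forall>i. c i = 0))"

text \<open>The form \<open>1 / (\<sigma>\<^sub>1 \<cdots> \<sigma>\<^sub>s) \<And> dt\<^sub>d / t\<^sub>d\<close>, pulled back to homogeneous coordinates via
  \<open>t\<^sub>d = \<Prod>\<^sub>j w\<^sub>j powi (\<rho> j $ d)\<close> and evaluated at the point \<open>w\<close> on the tangent vectors \<open>\<tau> c\<close>.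
  Expanding \<open>\<And>\<^sub>d (\<Sum>\<^sub>j \<rho> j $ d * dw\<^sub>j / w\<^sub>j)\<close> multilinearly and multiplying by \<open>\<Prod>\<^sub>j w\<^sub>j\<close> gives the numerator,
  which is polynomial in \<open>w\<close>; the sections contribute
  \<open>\<Prod>\<^sub>i \<sigma>\<^sub>i = (\<Prod>\<^sub>i cox_section i) / \<Prod>\<^sub>j w\<^sub>j\<close>, because \<open>\<Sum>\<^sub>i a i j = 1\<close>.
  Lemma \<open>period_form_on_torus\<close> below confirms this on the torus.\<close>

definition euler_form ::
    "('r::finite \<Rightarrow> int ^ 'd::finite) \<Rightarrow> complex ^ 'r \<Rightarrow> ('d \<Rightarrow> complex ^ 'r) \<Rightarrow> complex" where
  "euler_form \<rho> w \<tau> = (\<Sum>f\<in>{f. inj f}. (\<Prod>d\<in>UNIV. of_int (\<rho> (f d) $ d)) *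
     (\<Prod>j\<in>- range f. w $ j) * det (\<chi> d c. \<tau> c $ f d))"

definition period_form :: "('r::finite \<Rightarrow> int ^ 'd::finite) \<Rightarrow> ('s::finite \<Rightarrow> 'r \<Rightarrow> int) \<Rightarrow>
    (('s, 'd) idx \<Rightarrow> complex) \<Rightarrow> complex ^ 'r \<Rightarrow> ('d \<Rightarrow> complex ^ 'r) \<Rightarrow> complex" where
  "period_form \<rho> a b w \<tau> = euler_form \<rho> w \<tau> / (\<Prod>i\<in>UNIV. cox_section \<rho> a b i w)"

definition torus_coord :: "('r::finite \<Rightarrow> int ^ 'd::finite) \<Rightarrow> complex ^ 'r \<Rightarrow> 'd \<Rightarrow> complex" where
  "torus_coord \<rho> w d = (\<Prod>j\<in>UNIV. w $ j powi (\<rho> j $ d))"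

definition laurent_section :: "('r::finite \<Rightarrow> int ^ 'd::finite) \<Rightarrow> ('s \<Rightarrow> 'r \<Rightarrow> int) \<Rightarrow>
    (('s, 'd) idx \<Rightarrow> complex) \<Rightarrow> 's \<Rightarrow> ('d \<Rightarrow> complex) \<Rightarrow> complex" where
  "laurent_section \<rho> a b i t =
     (\<Sum>\<mu>\<in>polytope_points \<rho> (a i). b (i, \<mu>) * (\<Prod>d\<in>UNIV. t d powi (\<mu> $ d)))"

lemma lookup_cox_exponent [simp]:
  "Poly_Mapping.lookup (cox_exponent \<rho> A \<mu>) j = nat (pairing \<mu> (\<rho> j) + A j)"
  by (simp add: cox_exponent_def)

lemma powi_prod_distrib:
  "(\<Prod>j\<in>A. f j :: complex) powi k = (\<Prod>j\<in>A. f j powi k)"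
  by (induction A rule: infinite_finite_induct) (auto simp: power_int_mult_distrib)

lemma powi_sum_distrib:
  assumes "x \<noteq> (0::complex)"
  shows "x powi (\<Sum>d\<in>A. k d) = (\<Prod>d\<in>A. x powi k d)"
  using assms by (induction A rule: infinite_finite_induct) (auto simp: power_int_add)

lemma cox_section_eq_laurent:
  assumes w: "\<And>j. w $ j \<noteq> 0"
  shows "cox_section \<rho> a b i w =
    (\<Prod>j\<in>UNIV. w $ j powi a i j) * laurent_section \<rho> a b i (torus_coord \<rho> w)"
proof -
  have "eval_monom (cox_exponent \<rho> (a i) \<mu>) w =
      (\<Prod>j\<in>UNIV. w $ j powi a i j) * (\<Prod>d\<in>UNIV. torus_coord \<rho> w d powi (\<mu> $ d))"
    if mu: "\<mu> \<in> polytope_points \<rho> (a i)" for \<mu>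
  proof -
    have "eval_monom (cox_exponent \<rho> (a i) \<mu>) w
        = (\<Prod>j\<in>UNIV. w $ j powi (pairing \<mu> (\<rho> j) + a i j))"
      unfolding eval_monom_def
    proof (rule prod.cong[OF refl])
      fix j
      have "pairing \<mu> (\<rho> j) + a i j \<ge> 0"
        using mu by (auto simp: polytope_points_def dest: spec[of _ j])
      then show "w $ j ^ Poly_Mapping.lookup (cox_exponent \<rho> (a i) \<mu>) j = w $ j powi (pairing \<mu> (\<rho> j) + a i j)"
        by (simp add: power_int_def)
    qed
    also have "\<dots> = (\<Prod>j\<in>UNIV. w $ j powi a i j) *
        (\<Prod>j\<in>UNIV. \<Prod>d\<in>UNIV. w $ j powi (\<rho> j $ d * \<mu> $ d))"
      using w by (simp add: power_int_add prod.distrib pairing_def powi_sum_distrib mult.commute)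
    also have "(\<Prod>j\<in>UNIV. \<Prod>d\<in>UNIV. w $ j powi (\<rho> j $ d * \<mu> $ d)) =
        (\<Prod>d\<in>UNIV. torus_coord \<rho> w d powi (\<mu> $ d))"
      by (subst prod.swap) (simp add: torus_coord_def powi_prod_distrib power_int_mult)
    finally show ?thesis .
  qed
  then show ?thesis
    by (simp add: cox_section_def laurent_section_def sum_distrib_left mult.left_commute)
qed

lemma euler_form_on_torus:
  fixes w :: "complex ^ 'r::finite" and \<rho> :: "'r \<Rightarrow> int ^ 'd::finite"
  assumes w: "\<And>j. w $ j \<noteq> 0"
  shows "euler_form \<rho> w \<tau> =
    (\<Prod>j\<in>UNIV. w $ j) * det (\<chi> d c. \<Sum>j\<in>UNIV. of_int (\<rho> j $ d) * \<tau> c $ j / w $ j)"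
proof -
  have "det (\<chi> d c. \<Sum>j\<in>UNIV. of_int (\<rho> j $ d) * \<tau> c $ j / w $ j)
      = (\<Sum>q | q permutes UNIV. of_int (sign q) *
          (\<Prod>d\<in>UNIV. \<Sum>j\<in>UNIV. of_int (\<rho> j $ d) / w $ j * \<tau> (q d) $ j))"
    by (simp add: det_def)
  also have "\<dots> = (\<Sum>q | q permutes UNIV. \<Sum>f\<in>UNIV. of_int (sign q) *
          (\<Prod>d\<in>UNIV. of_int (\<rho> (f d) $ d) / w $ f d * \<tau> (q d) $ f d))"
    by (simp add: prod_sum_PiE PiE_UNIV_domain sum_distrib_left)
  also have "\<dots> = (\<Sum>f\<in>UNIV. (\<Prod>d\<in>UNIV. of_int (\<rho> (f d) $ d) / w $ f d) *
      det (\<chi> d c. \<tau> c $ f d))"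
    unfolding det_def sum_distrib_left
    by (subst sum.swap) (simp add: prod.distrib prod_dividef mult_ac)
  also have "\<dots> = (\<Sum>f\<in>{f. inj f}. (\<Prod>d\<in>UNIV. of_int (\<rho> (f d) $ d) / w $ f d) *
      det (\<chi> d c. \<tau> c $ f d))"
  proof (rule sum.mono_neutral_right)
    show "\<forall>f\<in>UNIV - {f. inj f}. (\<Prod>d\<in>UNIV. of_int (\<rho> (f d) $ d) / w $ f d) *
      det (\<chi> d c. \<tau> c $ f d) = 0"
    proof
      fix f :: "'d \<Rightarrow> 'r" assume "f \<in> UNIV - {f. inj f}"
      then obtain d d' where "d \<noteq> d'" "f d = f d'" by (auto simp: inj_on_def)
      then have "det (\<chi> d c. \<tau> c $ f d) = 0"
        by (intro det_identical_rows[of d d']) (auto simp: row_def vec_eq_iff)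
      then show "(\<Prod>d\<in>UNIV. of_int (\<rho> (f d) $ d) / w $ f d) * det (\<chi> d c. \<tau> c $ f d) = 0"
        by simp
    qed
  qed auto
  finally have *: "det (\<chi> d c. \<Sum>j\<in>UNIV. of_int (\<rho> j $ d) * \<tau> c $ j / w $ j) = \<dots>" .
  show ?thesis
    unfolding * euler_form_def sum_distrib_left
  proof (rule sum.cong[OF refl])
    fix f :: "'d \<Rightarrow> 'r" assume "f \<in> {f. inj f}"
    then have "(\<Prod>d\<in>UNIV. w $ f d) = (\<Prod>j\<in>range f. w $ j)"
      by (simp add: prod.reindex)
    moreover have "(\<Prod>j\<in>UNIV. w $ j) = (\<Prod>j\<in>range f. w $ j) * (\<Prod>j\<in>- range f. w $ j)"
      by (subst prod.union_disjoint[symmetric]) auto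
    moreover have "(\<Prod>j\<in>range f. w $ j) \<noteq> 0" using w by simp
    ultimately show "(\<Prod>d\<in>UNIV. of_int (\<rho> (f d) $ d)) * (\<Prod>j\<in>- range f. w $ j) *
        det (\<chi> d c. \<tau> c $ f d) =
      (\<Prod>j\<in>UNIV. w $ j) * ((\<Prod>d\<in>UNIV. of_int (\<rho> (f d) $ d) / w $ f d) *
        det (\<chi> d c. \<tau> c $ f d))"
      by (simp add: prod_dividef)
  qed
qed

lemma period_form_on_torus:
  fixes w :: "complex ^ 'r::finite" and \<rho> :: "'r \<Rightarrow> int ^ 'd::finite"
  assumes w: "\<And>j. w $ j \<noteq> 0" and a: "\<And>j. (\<Sum>i\<in>UNIV. a i j) = 1"
  shows "period_form \<rho> a b w \<tau> =
    det (\<chi> d c. \<Sum>j\<in>UNIV. of_int (\<rho> j $ d) * \<tau> c $ j / w $ j) /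
    (\<Prod>i\<in>UNIV. laurent_section \<rho> a b i (torus_coord \<rho> w))"
proof -
  have "(\<Prod>i\<in>UNIV. \<Prod>j\<in>UNIV. w $ j powi a i j) = (\<Prod>j\<in>UNIV. w $ j powi (\<Sum>i\<in>UNIV. a i j))"
    by (subst prod.swap) (simp add: powi_sum_distrib w)
  then have "(\<Prod>i\<in>UNIV. \<Prod>j\<in>UNIV. w $ j powi a i j) = (\<Prod>j\<in>UNIV. w $ j)"
    by (simp add: a)
  moreover have "(\<Prod>j\<in>UNIV. w $ j) \<noteq> 0" using w by simp
  ultimately show ?thesis
    unfolding period_form_def euler_form_on_torus[of w, OF w] cox_section_eq_laurent[of w, OF w] prod.distrib
    by simp
qed


section \<open>Periods\<close>

fun k_smooth_on :: "nat \<Rightarrow> 'a::real_normed_vector set \<Rightarrow> ('a \<Rightarrow> 'b::real_normed_vector) \<Rightarrow> bool" where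
  "k_smooth_on 0 U f \<longleftrightarrow> continuous_on U f"
| "k_smooth_on (Suc m) U f \<longleftrightarrow> (\<forall>x\<in>U. f differentiable (at x)) \<and>
     (\<forall>v. k_smooth_on m U (\<lambda>x. frechet_derivative f (at x) v))"

definition smooth_near :: "'a::real_normed_vector set \<Rightarrow> ('a \<Rightarrow> 'b::real_normed_vector) \<Rightarrow> bool" where
  "smooth_near A f \<longleftrightarrow> (\<exists>U. open U \<and> A \<subseteq> U \<and> (\<forall>m. k_smooth_on m U f))"


subsection \<open>Cycles and tubes\<close>

text \<open>The parameter space of an \<open>s\<close>-torus bundle over a simplex of dimension \<open>N - s\<close> is a subset of
  \<open>real ^ 'd\<close>; the bijection \<open>slot\<close> from \<open>{1..N - s}\<close> and the section labels \<open>'s\<close> to \<open>'d\<close> tells the simplex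
  coordinates from the angles (its choice only affects the orientation).\<close>

definition slots :: "(nat + 's::finite \<Rightarrow> 'd::finite) \<Rightarrow> bool" where
  "slots slot \<longleftrightarrow> bij_betw slot (Inl ` {1..CARD('d) - CARD('s)} \<union> range Inr) UNIV"

definition simplex_point :: "nat \<Rightarrow> (nat + 's \<Rightarrow> 'd::finite) \<Rightarrow> real ^ 'd \<Rightarrow> nat \<Rightarrow> real" where
  "simplex_point p slot u l =
     (if l = 0 then 1 - (\<Sum>l'=1..p. u $ slot (Inl l')) else if l \<le> p then u $ slot (Inl l) else 0)"

definition tube_cell :: "nat \<Rightarrow> (nat + 's \<Rightarrow> 'd::finite) \<Rightarrow> (real ^ 'd) set" where
  "tube_cell p slot = {u. simplex_point p slot u \<in> standard_simplex p \<and>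
     (\<forall>i. 0 \<le> u $ slot (Inr i) \<and> u $ slot (Inr i) \<le> 1)}"

text \<open>A singular \<open>p\<close>-cycle in the complete intersection, all of whose simplices \<open>\<phi>\<close> (maps into the set of
  orbits) have a smooth lift \<open>lift \<phi>\<close> to homogeneous coordinates.  Smooth simplices always lift, because a
  principal bundle over a simplex is trivial.\<close>

definition smooth_cycle :: "'r set set \<Rightarrow> ('r::finite \<Rightarrow> int ^ 'd::finite) \<Rightarrow> ('s \<Rightarrow> 'r \<Rightarrow> int) \<Rightarrow>
    (('s, 'd) idx \<Rightarrow> complex) \<Rightarrow> nat \<Rightarrow> (nat + 's \<Rightarrow> 'd) \<Rightarrow> (complex ^ 'r) set chain \<Rightarrow>
    (((nat \<Rightarrow> real) \<Rightarrow> (complex ^ 'r) set) \<Rightarrow> (nat \<Rightarrow> real) \<Rightarrow> complex ^ 'r) \<Rightarrow> bool" where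
  "smooth_cycle K \<rho> a b p slot \<gamma> lift \<longleftrightarrow> chain_boundary p \<gamma> = 0 \<and>
     (\<forall>\<phi>\<in>Poly_Mapping.keys \<gamma>.
        \<phi> = restrict (\<lambda>x. orbit \<rho> (lift \<phi> x)) (standard_simplex p) \<and>
        lift \<phi> ` standard_simplex p \<subseteq> zero_locus K \<rho> a b \<and>
        smooth_near (tube_cell p slot) (\<lambda>u. lift \<phi> (simplex_point p slot u)))"

text \<open>The character through which the class torus acts on the fibres of the line bundle of \<open>A\<close>.\<close>

definition bundle_char :: "('r::finite \<Rightarrow> int) \<Rightarrow> complex ^ 'r \<Rightarrow> complex" where
  "bundle_char A h = (\<Prod>j\<in>UNIV. h $ j powi A j)"

text \<open>A tubular neighbourhood of the complete intersection, as an embedding of the polydisc bundle of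
  polyradius \<open>rad\<close> in its normal bundle, the direct sum of the line bundles, lifted
  equivariantly to homogeneous coordinates: the point with normal coordinate \<open>v\<close> over \<open>w\<close> is \<open>\<Phi> (w, v)\<close>,
  and the normal coordinates are the values of the sections.\<close>

definition disc_bundle :: "'r set set \<Rightarrow> ('r::finite \<Rightarrow> int ^ 'd::finite) \<Rightarrow> ('s::finite \<Rightarrow> 'r \<Rightarrow> int) \<Rightarrow>
    (('s, 'd) idx \<Rightarrow> complex) \<Rightarrow> (complex ^ 'r \<Rightarrow> real ^ 's) \<Rightarrow> ((complex ^ 'r) \<times> (complex ^ 's)) set" where
  "disc_bundle K \<rho> a b rad =
     {(w, v). w \<in> zero_locus K \<rho> a b \<and> (\<forall>i. norm (v $ i) \<le> rad w $ i)}"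

definition tubular_nbhd :: "'r set set \<Rightarrow> ('r::finite \<Rightarrow> int ^ 'd::finite) \<Rightarrow> ('s::finite \<Rightarrow> 'r \<Rightarrow> int) \<Rightarrow>
    (('s, 'd) idx \<Rightarrow> complex) \<Rightarrow> ((complex ^ 'r) \<times> (complex ^ 's) \<Rightarrow> complex ^ 'r) \<Rightarrow>
    (complex ^ 'r \<Rightarrow> real ^ 's) \<Rightarrow> bool" where
  "tubular_nbhd K \<rho> a b \<Phi> rad \<longleftrightarrow>
     smooth_near (zero_locus K \<rho> a b) rad \<and>
     smooth_near (disc_bundle K \<rho> a b rad) \<Phi> \<and>
     inj_on \<Phi> (disc_bundle K \<rho> a b rad) \<and>
     (\<forall>w\<in>zero_locus K \<rho> a b. \<Phi> (w, 0) = w \<and> (\<forall>i. rad w $ i > 0) \<and>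
        (\<forall>h\<in>class_torus \<rho>. \<forall>i. rad (act h w) $ i = norm (bundle_char (a i) h) * rad w $ i)) \<and>
     (\<forall>(w, v)\<in>disc_bundle K \<rho> a b rad.
        \<Phi> (w, v) \<in> cox_open K \<and>
        (\<forall>i. cox_section \<rho> a b i (\<Phi> (w, v)) = v $ i) \<and>
        (\<forall>h\<in>class_torus \<rho>. \<Phi> (act h w, \<chi> i. bundle_char (a i) h * v $ i) = act h (\<Phi> (w, v))))"

text \<open>The tube over a lifted simplex \<open>g\<close>: the torus bundle \<open>|\<sigma>\<^sub>i| = rad\<^sub>i\<close>.\<close>

definition tube_map :: "nat \<Rightarrow> (nat + 's::finite \<Rightarrow> 'd::finite) \<Rightarrow>
    ((complex ^ 'r) \<times> (complex ^ 's) \<Rightarrow> complex ^ 'r) \<Rightarrow> (complex ^ 'r \<Rightarrow> real ^ 's) \<Rightarrow>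
    ((nat \<Rightarrow> real) \<Rightarrow> complex ^ 'r) \<Rightarrow> real ^ 'd \<Rightarrow> complex ^ 'r::finite" where
  "tube_map p slot \<Phi> rad g u = (let w = g (simplex_point p slot u) in
     \<Phi> (w, \<chi> i. of_real (rad w $ i) * cis (2 * pi * u $ slot (Inr i))))"

definition period :: "('r::finite \<Rightarrow> int ^ 'd::finite) \<Rightarrow> ('s::finite \<Rightarrow> 'r \<Rightarrow> int) \<Rightarrow> nat \<Rightarrow>
    (nat + 's \<Rightarrow> 'd) \<Rightarrow> ((complex ^ 'r) \<times> (complex ^ 's) \<Rightarrow> complex ^ 'r) \<Rightarrow> (complex ^ 'r \<Rightarrow> real ^ 's) \<Rightarrow>
    (complex ^ 'r) set chain \<Rightarrow>
    (((nat \<Rightarrow> real) \<Rightarrow> (complex ^ 'r) set) \<Rightarrow> (nat \<Rightarrow> real) \<Rightarrow> complex ^ 'r) \<Rightarrow>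
    (('s, 'd) idx \<Rightarrow> complex) \<Rightarrow> complex" where
  "period \<rho> a p slot \<Phi> rad \<gamma> lift b =
     (\<Sum>\<phi>\<in>Poly_Mapping.keys \<gamma>. of_int (Poly_Mapping.lookup \<gamma> \<phi>) *
        integral (tube_cell p slot) (\<lambda>u.
          let T = tube_map p slot \<Phi> rad (lift \<phi>)
          in period_form \<rho> a b (T u) (\<lambda>c. frechet_derivative T (at u) (axis c 1))))"


section \<open>Weyl algebras\<close>

text \<open>An element of the Weyl algebra in the variables \<open>x\<^sub>v\<close> is given by its normally ordered form: the
  coefficient at \<open>(\<alpha>, \<beta>)\<close> is that of \<open>x\<^sup>\<alpha> \<partial>\<^sup>\<beta>\<close>.  The product is \<open>weyl_mult\<close>, which by the Leibniz rule
  satisfies \<open>\<partial>\<^sup>\<beta> x\<^sup>\<gamma> = \<Sum>\<^sub>\<kappa> (\<beta> choose \<kappa>) (\<gamma> choose \<kappa>) \<kappa>! x\<^sup>(\<gamma>-\<kappa>) \<partial>\<^sup>(\<beta>-\<kappa>)\<close>; it is not the commutative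
  multiplication \<open>(*)\<close> of the type.\<close>

type_synonym 'v weyl = "(('v \<Rightarrow>\<^sub>0 nat) \<times> ('v \<Rightarrow>\<^sub>0 nat)) \<Rightarrow>\<^sub>0 complex"

definition weyl_algebra :: "'v set \<Rightarrow> 'v weyl set" where
  "weyl_algebra B = {A. \<forall>(\<alpha>, \<beta>)\<in>Poly_Mapping.keys A.
     Poly_Mapping.keys \<alpha> \<subseteq> B \<and> Poly_Mapping.keys \<beta> \<subseteq> B}"

definition weyl_mult :: "'v weyl \<Rightarrow> 'v weyl \<Rightarrow> 'v weyl" where
  "weyl_mult P Q = (\<Sum>(\<alpha>, \<beta>)\<in>Poly_Mapping.keys P. \<Sum>(\<gamma>, \<delta>)\<in>Poly_Mapping.keys Q.
     \<Sum>\<kappa>\<in>{\<kappa>. \<forall>v. Poly_Mapping.lookup \<kappa> v \<le> Poly_Mapping.lookup \<beta> v \<and> Poly_Mapping.lookup \<kappa> v \<le> Poly_Mapping.lookup \<gamma> v}.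
       Poly_Mapping.single (\<alpha> + (\<gamma> - \<kappa>), (\<beta> - \<kappa>) + \<delta>)
         (Poly_Mapping.lookup P (\<alpha>, \<beta>) * Poly_Mapping.lookup Q (\<gamma>, \<delta>) *
          of_nat (\<Prod>v\<in>Poly_Mapping.keys \<kappa>.
            (Poly_Mapping.lookup \<beta> v choose Poly_Mapping.lookup \<kappa> v) * (Poly_Mapping.lookup \<gamma> v choose Poly_Mapping.lookup \<kappa> v) * fact (Poly_Mapping.lookup \<kappa> v))))"

definition weyl_left_ideal :: "'v set \<Rightarrow> 'v weyl set \<Rightarrow> 'v weyl set" where
  "weyl_left_ideal B gens = {Q. \<exists>m A g. (\<forall>l<m. A l \<in> weyl_algebra B \<and> g l \<in> gens) \<and>
     Q = (\<Sum>l<(m::nat). weyl_mult (A l) (g l))}"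

definition partial :: "'v \<Rightarrow> (('v \<Rightarrow> complex) \<Rightarrow> complex) \<Rightarrow> ('v \<Rightarrow> complex) \<Rightarrow> complex" where
  "partial v F b = deriv (\<lambda>z. F (b(v := z))) (b v)"

text \<open>The order in which the partial derivatives are taken is irrelevant for holomorphic functions.\<close>

definition mixed_partial ::
    "('v \<Rightarrow>\<^sub>0 nat) \<Rightarrow> (('v \<Rightarrow> complex) \<Rightarrow> complex) \<Rightarrow> ('v \<Rightarrow> complex) \<Rightarrow> complex" where
  "mixed_partial \<beta> F = foldr (\<lambda>v. partial v ^^ Poly_Mapping.lookup \<beta> v)
     (SOME vs. distinct vs \<and> set vs = Poly_Mapping.keys \<beta>) F"

definition weyl_apply ::
    "'v weyl \<Rightarrow> (('v \<Rightarrow> complex) \<Rightarrow> complex) \<Rightarrow> ('v \<Rightarrow> complex) \<Rightarrow> complex" where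
  "weyl_apply P F b = (\<Sum>(\<alpha>, \<beta>)\<in>Poly_Mapping.keys P.
     Poly_Mapping.lookup P (\<alpha>, \<beta>) * (\<Prod>v\<in>Poly_Mapping.keys \<alpha>. b v ^ Poly_Mapping.lookup \<alpha> v) * mixed_partial \<beta> F b)"

definition holomorphic_in ::
    "'v set \<Rightarrow> ('v \<Rightarrow> complex) set \<Rightarrow> (('v \<Rightarrow> complex) \<Rightarrow> complex) \<Rightarrow> bool" where
  "holomorphic_in B U F \<longleftrightarrow> continuous_on U F \<and>
     (\<forall>b\<in>U. \<forall>v\<in>B. (\<lambda>z. F (b(v := z))) field_differentiable at (b v))"


section \<open>Graded automorphisms of the homogeneous coordinate ring\<close>

type_synonym 'r cox_ring = "('r \<Rightarrow>\<^sub>0 nat) \<Rightarrow>\<^sub>0 complex"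

definition same_degree :: "('r::finite \<Rightarrow> int ^ 'd::finite) \<Rightarrow> ('r \<Rightarrow>\<^sub>0 nat) \<Rightarrow> ('r \<Rightarrow>\<^sub>0 nat) \<Rightarrow> bool" where
  "same_degree \<rho> \<alpha> \<beta> \<longleftrightarrow> lin_equiv \<rho> (\<lambda>j. int (Poly_Mapping.lookup \<alpha> j)) (\<lambda>j. int (Poly_Mapping.lookup \<beta> j))"

abbreviation var :: "'r \<Rightarrow> ('r \<Rightarrow>\<^sub>0 nat)" where
  "var j \<equiv> Poly_Mapping.single j 1"

abbreviation monom_of :: "('r \<Rightarrow>\<^sub>0 nat) \<Rightarrow> 'r cox_ring" where
  "monom_of \<alpha> \<equiv> Poly_Mapping.single \<alpha> 1"

definition Aut_g :: "('r::finite \<Rightarrow> int ^ 'd::finite) \<Rightarrow> ('r cox_ring \<Rightarrow> 'r cox_ring) set" where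
  "Aut_g \<rho> = {\<phi>. bij \<phi> \<and> (\<forall>p q. \<phi> (p + q) = \<phi> p + \<phi> q) \<and> (\<forall>p q. \<phi> (p * q) = \<phi> p * \<phi> q) \<and>
     (\<forall>c. \<phi> (Poly_Mapping.single 0 c) = Poly_Mapping.single 0 c) \<and>
     (\<forall>\<alpha>. \<forall>\<beta>\<in>Poly_Mapping.keys (\<phi> (monom_of \<alpha>)). same_degree \<rho> \<alpha> \<beta>)}"

definition ray_classes :: "('r::finite \<Rightarrow> int ^ 'd::finite) \<Rightarrow> 'r set set" where
  "ray_classes \<rho> = UNIV // {(j, l). same_degree \<rho> (var j) (var l)}"

definition det_on :: "'r set \<Rightarrow> ('r \<Rightarrow> 'r \<Rightarrow> complex) \<Rightarrow> complex" where
  "det_on C M = (\<Sum>p | p permutes C. of_int (sign p) * (\<Prod>j\<in>C. M j (p j)))"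

definition aut_char ::
    "('r::finite \<Rightarrow> int ^ 'd::finite) \<Rightarrow> ('r cox_ring \<Rightarrow> 'r cox_ring) \<Rightarrow> complex" where
  "aut_char \<rho> \<phi> = (\<Prod>C\<in>ray_classes \<rho>. det_on C (\<lambda>j l. Poly_Mapping.lookup (\<phi> (monom_of (var j))) (var l)))"

text \<open>\<open>aut_curve \<rho> \<phi> x\<close>: a curve \<open>\<phi>\<close> in the automorphism group through the identity, with velocity \<open>x\<close>
  there (differentiation is coefficientwise).\<close>

definition aut_curve :: "('r::finite \<Rightarrow> int ^ 'd::finite) \<Rightarrow>
    (complex \<Rightarrow> 'r cox_ring \<Rightarrow> 'r cox_ring) \<Rightarrow> ('r cox_ring \<Rightarrow> 'r cox_ring) \<Rightarrow> bool" where
  "aut_curve \<rho> \<phi> x \<longleftrightarrow> (\<forall>t. \<phi> t \<in> Aut_g \<rho>) \<and> \<phi> 0 = id \<and>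
     (\<forall>p \<alpha>. ((\<lambda>t. Poly_Mapping.lookup (\<phi> t p) \<alpha>) has_field_derivative Poly_Mapping.lookup (x p) \<alpha>) (at 0))"

definition lie_Aut_g :: "('r::finite \<Rightarrow> int ^ 'd::finite) \<Rightarrow> ('r cox_ring \<Rightarrow> 'r cox_ring) set" where
  "lie_Aut_g \<rho> = {x. \<exists>\<phi>. aut_curve \<rho> \<phi> x}"

definition d_aut_char ::
    "('r::finite \<Rightarrow> int ^ 'd::finite) \<Rightarrow> ('r cox_ring \<Rightarrow> 'r cox_ring) \<Rightarrow> complex" where
  "d_aut_char \<rho> x = (THE c. \<forall>\<phi>. aut_curve \<rho> \<phi> x \<longrightarrow>
     ((\<lambda>t. aut_char \<rho> (\<phi> t)) has_field_derivative c) (at 0))"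


section \<open>The tautological system\<close>

text \<open>The coordinates on the product \<open>V\<close> of the duals of the spaces of sections, and on its dual, are
  both indexed by \<open>coeff_index \<rho> a\<close>; points of \<open>V\<close> are functions on this set, extended by 0.\<close>

definition multicone :: "'r set set \<Rightarrow> ('r::finite \<Rightarrow> int ^ 'd::finite) \<Rightarrow> ('s \<Rightarrow> 'r \<Rightarrow> int) \<Rightarrow>
    (('s, 'd) idx \<Rightarrow> complex) set" where
  "multicone K \<rho> a = {\<lambda>(i, \<mu>). if \<mu> \<in> polytope_points \<rho> (a i)
       then c i * eval_monom (cox_exponent \<rho> (a i) \<mu>) w else 0 | c w. w \<in> cox_open K}"

definition cone_ideal :: "'r set set \<Rightarrow> ('r::finite \<Rightarrow> int ^ 'd::finite) \<Rightarrow> ('s \<Rightarrow> 'r \<Rightarrow> int) \<Rightarrow>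
    ((('s, 'd) idx \<Rightarrow>\<^sub>0 nat) \<Rightarrow>\<^sub>0 complex) set" where
  "cone_ideal K \<rho> a = {p. (\<forall>\<alpha>\<in>Poly_Mapping.keys p. Poly_Mapping.keys \<alpha> \<subseteq> coeff_index \<rho> a) \<and>
     (\<forall>y\<in>multicone K \<rho> a.
        (\<Sum>\<alpha>\<in>Poly_Mapping.keys p. Poly_Mapping.lookup p \<alpha> * (\<Prod>v\<in>Poly_Mapping.keys \<alpha>. y v ^ Poly_Mapping.lookup \<alpha> v)) = 0)}"

text \<open>\<open>p(\<partial>)\<close>: every coordinate of \<open>V\<close> is replaced by the corresponding partial derivative.\<close>

definition const_coeff_op :: "(('v \<Rightarrow>\<^sub>0 nat) \<Rightarrow>\<^sub>0 complex) \<Rightarrow> 'v weyl" where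
  "const_coeff_op p = (\<Sum>\<beta>\<in>Poly_Mapping.keys p. Poly_Mapping.single (0, \<beta>) (Poly_Mapping.lookup p \<beta>))"

definition Z_op :: "('r::finite \<Rightarrow> int ^ 'd::finite) \<Rightarrow> ('s::finite \<Rightarrow> 'r \<Rightarrow> int) \<Rightarrow>
    ('r cox_ring \<Rightarrow> 'r cox_ring) \<Rightarrow> ('s \<Rightarrow> complex) \<Rightarrow> ('s, 'd) idx weyl" where
  "Z_op \<rho> a x c =
     (\<Sum>i\<in>UNIV. \<Sum>\<mu>\<in>polytope_points \<rho> (a i). \<Sum>\<nu>\<in>polytope_points \<rho> (a i).
        Poly_Mapping.single (Poly_Mapping.single (i, \<mu>) 1, Poly_Mapping.single (i, \<nu>) 1)
          (Poly_Mapping.lookup (x (monom_of (cox_exponent \<rho> (a i) \<mu>))) (cox_exponent \<rho> (a i) \<nu>)))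
     + (\<Sum>i\<in>UNIV. \<Sum>\<mu>\<in>polytope_points \<rho> (a i).
        Poly_Mapping.single (Poly_Mapping.single (i, \<mu>) 1, Poly_Mapping.single (i, \<mu>) 1) (c i))"

definition beta_char :: "('r::finite \<Rightarrow> int ^ 'd::finite) \<Rightarrow>
    ('r cox_ring \<Rightarrow> 'r cox_ring) \<Rightarrow> ('s::finite \<Rightarrow> complex) \<Rightarrow> complex" where
  "beta_char \<rho> x c = d_aut_char \<rho> x + (\<Sum>i\<in>UNIV. c i)"

text \<open>The left ideal by which the tautological system is the quotient of the Weyl algebra.\<close>

definition tautological_ideal :: "'r set set \<Rightarrow> ('r::finite \<Rightarrow> int ^ 'd::finite) \<Rightarrow>
    ('s::finite \<Rightarrow> 'r \<Rightarrow> int) \<Rightarrow> ('s, 'd) idx weyl set" where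
  "tautological_ideal K \<rho> a = weyl_left_ideal (coeff_index \<rho> a)
     (const_coeff_op ` cone_ideal K \<rho> a \<union>
      {Z_op \<rho> a x c + Poly_Mapping.single 0 (beta_char \<rho> x c) | x c. x \<in> lie_Aut_g \<rho>})"

end

theory Submission
  imports Defs "HOL-Complex_Analysis.Cauchy_Integral_Theorem"
begin

text \<open>
  On the locus where no section vanishes, the period integral can be differentiated under the integral
  sign, and a differential operator acts on the integrand \<open>1 / (\<sigma>\<^sub>1 \<cdots> \<sigma>\<^sub>s)\<close> pointwise.  For \<open>p(\<partial>)\<close> with
  \<open>p\<close> in the ideal of the multicone, each multihomogeneous component of \<open>p\<close> vanishes at the point of the
  cone given by \<open>w\<close>, and so the integrand vanishes.  For \<open>Z(x) + \<beta>(x)\<close>, the integrand becomes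
  \<open>(div X - \<Sum>\<^sub>i X(\<sigma>\<^sub>i) / \<sigma>\<^sub>i)\<close> times the period form, where \<open>X\<close> is the vector field on the homogeneous
  coordinate space defined by \<open>x\<close>; here \<open>d\<chi>(x) = div X\<close>, because a monomial of the degree of \<open>w\<^sub>j\<close> other
  than \<open>w\<^sub>j\<close> does not contain \<open>w\<^sub>j\<close>.  This is the Lie derivative of the period form along \<open>X\<close>, hence the
  exterior derivative of its contraction with \<open>X\<close>, and Stokes' theorem on the cells of the tube leaves
  the integrals of the contraction over the faces.  Two lifts of the same singular face differ by a
  function with values in the class torus, under which these integrals are invariant, so that they
  cancel because the boundary of the cycle is 0.
\<close>

section \<open>Integration over one coordinate at a time\<close>

text \<open>Stokes' theorem is applied to an exact form of top degree on a cell, so it reduces to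
  the fundamental theorem of calculus in one coordinate at a time. A face has one parameter fewer
  than its cell, but the dimension of \<open>real ^ 'd\<close> is fixed; faces therefore keep a
  dummy coordinate in [0,1], which integrates to 1. Partial sums of barycentric coordinates bring
  all faces of the simplex into one form, the equality of two neighbouring coordinates.

  The cancellation of faces is the delicate point. Equality of singular faces gives only equality of
  orbits, point by point. The smoothness of the cones allows the factor relating two lifts to be
  computed from them, so that it is differentiable. Through the bundle characters this factor also
  rotates the circles of the tube. The principal arguments involved may jump, but a measurable shift
  of angles modulo 1 still preserves integrals.

  All partial derivatives of the period are written down in closed form, as a family indexed by
  multi-indices. The Weyl algebra then acts on this family by pure algebra.\<close>

definition upd :: "real ^ 'd \<Rightarrow> 'd \<Rightarrow> real \<Rightarrow> real ^ 'd::finite" where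
  "upd u c x = (\<chi> k. if k = c then x else u $ k)"

lemma upd_nth [simp]: "upd u c x $ k = (if k = c then x else u $ k)"
  by (simp add: upd_def)

lemma upd_same [simp]: "upd u c (u $ c) = u"
  by (simp add: vec_eq_iff)

lemma upd_upd [simp]: "upd (upd u c x) c y = upd u c y"
  by (simp add: vec_eq_iff)

lemma upd_eq_add: "upd u c x = u + (x - u $ c) *\<^sub>R axis c 1"
  by (simp add: vec_eq_iff axis_def)

lemma continuous_on_upd [continuous_intros]:
  assumes "continuous_on S f" "continuous_on S g"
  shows "continuous_on S (\<lambda>x. upd (f x) c (g x))"
proof -
  have "continuous_on S (\<lambda>x. if k = c then g x else f x $ k)" for k
    using assms by (cases "k = c") (auto intro!: continuous_intros)
  then show ?thesis unfolding upd_def by (intro continuous_on_vec_lambda)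
qed

lemma lborel_distr_permute_Basis:
  fixes S :: "'a::euclidean_space \<Rightarrow> 'a"
  assumes \<pi>: "bij_betw \<pi> Basis Basis" and S: "\<And>x b. b \<in> Basis \<Longrightarrow> S x \<bullet> b = x \<bullet> \<pi> b"
    and [measurable]: "S \<in> borel_measurable borel"
  shows "distr lborel borel S = lborel"
proof (rule lborel_eqI[symmetric])
  fix l u :: 'a assume lu: "\<And>b. b \<in> Basis \<Longrightarrow> l \<bullet> b \<le> u \<bullet> b"
  define T where "T x = (\<Sum>b\<in>Basis. (x \<bullet> inv_into Basis \<pi> b) *\<^sub>R b)" for x :: 'a
  have T: "T x \<bullet> \<pi> b = x \<bullet> b" if "b \<in> Basis" for x b
  proof -
    have "\<pi> b \<in> Basis" "inv_into Basis \<pi> (\<pi> b) = b"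
      using \<pi> that by (auto simp: bij_betw_def)
    then show ?thesis by (simp add: T_def)
  qed
  have B: "Basis = \<pi> ` (Basis :: 'a set)" using \<pi> by (simp add: bij_betw_def)
  have "S -` box l u = {x. \<forall>b\<in>Basis. T l \<bullet> \<pi> b < x \<bullet> \<pi> b \<and> x \<bullet> \<pi> b < T u \<bullet> \<pi> b}"
    by (auto simp: box_def S T)
  also have "\<dots> = {x. \<forall>b\<in>\<pi> ` Basis. T l \<bullet> b < x \<bullet> b \<and> x \<bullet> b < T u \<bullet> b}" by blast
  also have "\<dots> = box (T l) (T u)" unfolding box_def using B by simp
  finally have "S -` box l u = box (T l) (T u)" .
  moreover have le: "T l \<bullet> b \<le> T u \<bullet> b" if "b \<in> Basis" for b
  proof -
    have "b \<in> \<pi> ` Basis" using that \<pi> by (simp add: bij_betw_def)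
    then obtain c where c: "c \<in> Basis" "b = \<pi> c" by (elim imageE)
    show ?thesis unfolding c(2) T[OF c(1)] by (rule lu[OF c(1)])
  qed
  ultimately have "emeasure (distr lborel borel S) (box l u) = (\<Prod>b\<in>Basis. (T u - T l) \<bullet> b)"
    by (simp add: emeasure_distr emeasure_lborel_box)
  also have "(\<Prod>b\<in>Basis. (T u - T l) \<bullet> b) = (\<Prod>b\<in>Basis. (T u - T l) \<bullet> \<pi> b)"
    using prod.reindex_bij_betw[OF \<pi>, of "\<lambda>b. (T u - T l) \<bullet> b"] by simp
  also have "\<dots> = (\<Prod>b\<in>Basis. (u - l) \<bullet> b)"
    by (intro prod.cong refl) (simp add: inner_diff_left T)
  finally show "emeasure (distr lborel borel S) (box l u) = (\<Prod>b\<in>Basis. (u - l) \<bullet> b)" .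
qed simp

lemma lborel_distr_permute_coords:
  fixes \<pi> :: "'d::finite \<Rightarrow> 'd"
  assumes "bij \<pi>"
  shows "distr lborel borel (\<lambda>z::real^'d. \<chi> c. z $ \<pi> c) = lborel"
proof -
  define p where "p b = (if b \<in> Basis then axis (\<pi> (THE c. b = axis c 1)) 1 else b)" for b :: "real^'d"
  have p: "p (axis c 1) = axis (\<pi> c) 1" for c
    by (auto simp: p_def axis_eq_axis axis_in_Basis_iff)
  have bij: "bij_betw p Basis Basis"
  proof (rule bij_betw_imageI)
    show "inj_on p Basis"
      using assms by (auto simp: inj_on_def Basis_vec_def p axis_eq_axis bij_def)
    have "axis c 1 \<in> p ` Basis" for c
    proof -
      obtain d where "c = \<pi> d" using assms by (metis bij_pointE)
      then have "axis c 1 = p (axis d 1)" by (simp add: p)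
      then show ?thesis by (simp add: axis_in_Basis_iff)
    qed
    then show "p ` Basis = Basis"
      by (auto simp: Basis_vec_def p)
  qed
  have meas: "(\<lambda>z::real^'d. \<chi> c. z $ \<pi> c) \<in> borel_measurable borel"
    by (intro borel_measurable_continuous_onI continuous_on_vec_lambda continuous_on_component continuous_on_id)
  have "(\<chi> c. z $ \<pi> c) \<bullet> b = z \<bullet> p b" if "b \<in> Basis" for z b :: "real^'d"
    using that by (auto simp: Basis_vec_def p inner_axis)
  then show ?thesis
    by (rule lborel_distr_permute_Basis[OF bij _ meas])
qed

text \<open>Exchanges coordinate \<open>c\<close> with an auxiliary real variable. This replaces a
  splitting of \<open>real ^ 'd\<close> into one coordinate and the rest, as the remaining
  coordinates do not form a vector type of their own.\<close>

definition coord_swap :: "'d \<Rightarrow> (real ^ 'd) \<times> real \<Rightarrow> (real ^ 'd::finite) \<times> real" where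
  "coord_swap c p = (upd (fst p) c (snd p), fst p $ c)"

lemma measurable_upd [measurable]:
  assumes "f \<in> borel_measurable M" "g \<in> borel_measurable M"
  shows "(\<lambda>x. upd (f x) c (g x) :: real ^ 'd::finite) \<in> borel_measurable M"
proof -
  have 1: "(\<lambda>p::(real^'d) \<times> real. upd (fst p) c (snd p)) \<in> borel_measurable borel"
    by (intro borel_measurable_continuous_onI continuous_intros)
  have 2: "(\<lambda>x. (f x, g x)) \<in> M \<rightarrow>\<^sub>M borel"
    unfolding borel_prod[symmetric] using assms by measurable
  show ?thesis
    using measurable_compose[OF 2 1] by (simp only: fst_conv snd_conv)
qed

lemma measurable_coord [measurable]: "(\<lambda>u::real^'d::finite. u $ c) \<in> borel_measurable borel"
  by (intro borel_measurable_continuous_onI continuous_on_component continuous_on_id)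

lemma measurable_coord_swap: "coord_swap c \<in> borel_measurable borel"
proof -
  have "continuous_on UNIV (coord_swap c)"
    unfolding coord_swap_def by (intro continuous_intros)
  then show ?thesis by (rule borel_measurable_continuous_onI)
qed

text \<open>On basis vectors the map is the transposition of \<open>(axis c 1, 0)\<close> and
  \<open>(0, 1)\<close>.\<close>

lemma distr_coord_swap: "distr lborel borel (coord_swap c) = (lborel :: ((real^'d::finite) \<times> real) measure)"
proof (rule lborel_distr_permute_Basis)
  define t where "t = Transposition.transpose (axis c 1 :: real^'d, 0::real) (0, 1)"
  have "t permutes Basis"
    unfolding t_def by (rule permutes_swap_id) (auto simp: Basis_prod_def axis_in_Basis_iff)
  then show "bij_betw t Basis Basis" by (rule permutes_imp_bij)
  fix x b :: "(real^'d) \<times> real" assume "b \<in> Basis"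
  then consider d where "d \<noteq> c" "b = (axis d 1, 0)" | "b = (axis c 1, 0)" | "b = (0, 1)"
    by (fastforce simp: Basis_prod_def Basis_vec_def axis_eq_axis)
  then show "coord_swap c x \<bullet> b = x \<bullet> t b"
  proof cases
    case 1
    then have "t b = b" by (auto simp: t_def Transposition.transpose_def axis_eq_axis)
    then show ?thesis using 1 by (cases x) (simp add: coord_swap_def inner_axis)
  next
    case 2
    then have "t b = (0, 1)" by (simp add: t_def)
    then show ?thesis using 2 by (cases x) (simp add: coord_swap_def inner_axis)
  next
    case 3
    then have "t b = (axis c 1, 0)" by (simp add: t_def)
    then show ?thesis using 3 by (cases x) (simp add: coord_swap_def inner_axis)
  qed
qed (rule measurable_coord_swap)

text \<open>An extra variable over [0,1] has total mass 1. Exchanging it with coordinate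
  \<open>c\<close> makes that coordinate the inner variable of integration and leaves the indicator
  on \<open>u $ c\<close>.\<close>

lemma nn_integral_coord:
  fixes f :: "real ^ 'd::finite \<Rightarrow> ennreal"
  assumes f [measurable]: "f \<in> borel_measurable borel"
  shows "(\<integral>\<^sup>+u. f u \<partial>lborel) =
    (\<integral>\<^sup>+u. (\<integral>\<^sup>+x. f (upd u c x) \<partial>lborel) * indicator {0..1} (u $ c) \<partial>lborel)"
proof -
  define g where "g = (\<lambda>p. f (fst p) * indicator {0..1::real} (snd p))"
  have g: "g \<in> borel_measurable borel"
    unfolding g_def borel_prod[symmetric] by measurable
  have "(\<integral>\<^sup>+u. f u \<partial>lborel) = (\<integral>\<^sup>+u. (\<integral>\<^sup>+x. g (u, x) \<partial>lborel) \<partial>lborel)"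
    by (simp add: nn_integral_cmult g_def)
  also have "\<dots> = integral\<^sup>N (lborel \<Otimes>\<^sub>M lborel) g"
    by (rule lborel.nn_integral_fst) (simp add: g lborel_prod)
  also have "\<dots> = integral\<^sup>N (distr lborel borel (coord_swap c)) g"
    by (simp only: distr_coord_swap lborel_prod)
  also have "\<dots> = (\<integral>\<^sup>+p. g (coord_swap c p) \<partial>(lborel \<Otimes>\<^sub>M lborel))"
    using g by (subst nn_integral_distr) (simp_all add: measurable_coord_swap lborel_prod)
  also have "\<dots> = (\<integral>\<^sup>+u. (\<integral>\<^sup>+x. g (coord_swap c (u, x)) \<partial>lborel) \<partial>lborel)"
    by (rule lborel.nn_integral_fst[symmetric])
      (use measurable_compose[OF measurable_coord_swap g] in \<open>simp add: lborel_prod\<close>)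
  also have "\<dots> = (\<integral>\<^sup>+u. (\<integral>\<^sup>+x. f (upd u c x) \<partial>lborel) * indicator {0..1} (u $ c) \<partial>lborel)"
    by (rule nn_integral_cong) (simp add: g_def coord_swap_def nn_integral_multc)
  finally show ?thesis .
qed

text \<open>The same exchange as for nonnegative functions; integrability on the product comes from
  Tonelli.\<close>

lemma integral_coord:
  fixes f :: "real ^ 'd::finite \<Rightarrow> 'b::{banach, second_countable_topology}"
  assumes f: "integrable lborel f"
  shows "integral\<^sup>L lborel f = (\<integral>u. indicator {0..1} (u $ c) *\<^sub>R (\<integral>x. f (upd u c x) \<partial>lborel) \<partial>lborel)"
proof -
  have [measurable]: "f \<in> borel_measurable borel" using f by auto
  define g where "g = (\<lambda>p. indicator {0..1::real} (snd p) *\<^sub>R f (fst p))"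
  have g: "g \<in> borel_measurable borel"
    unfolding g_def borel_prod[symmetric] by measurable
  have "(\<integral>\<^sup>+p. ennreal (norm (g p)) \<partial>(lborel \<Otimes>\<^sub>M lborel)) =
      (\<integral>\<^sup>+u. (\<integral>\<^sup>+x. ennreal (norm (g (u, x))) \<partial>lborel) \<partial>lborel)"
    by (rule lborel.nn_integral_fst[symmetric]) (use g in \<open>simp add: lborel_prod\<close>)
  also have "\<dots> = (\<integral>\<^sup>+u. (\<integral>\<^sup>+x. ennreal (norm (f u)) * indicator {0..1::real} x \<partial>lborel) \<partial>lborel)"
  proof -
    have "ennreal (norm (g (u, x))) = ennreal (norm (f u)) * indicator {0..1} x" for u x
      by (simp add: g_def split: split_indicator)
    then show ?thesis by simp
  qed
  also have "\<dots> = (\<integral>\<^sup>+u. ennreal (norm (f u)) \<partial>lborel)"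
    by (simp add: nn_integral_cmult)
  also have "\<dots> < \<infinity>" using f by (simp add: integrable_iff_bounded)
  finally have ig: "integrable (lborel \<Otimes>\<^sub>M lborel) g"
    using g by (simp add: integrable_iff_bounded lborel_prod)
  have "integral\<^sup>L lborel f = (\<integral>u. (\<integral>x. g (u, x) \<partial>lborel) \<partial>lborel)"
    by (simp add: g_def)
  also have "\<dots> = integral\<^sup>L (lborel \<Otimes>\<^sub>M lborel) g"
    by (rule lborel_pair.integral_fst'[OF ig])
  also have "\<dots> = integral\<^sup>L (distr lborel borel (coord_swap c)) g"
    by (simp only: distr_coord_swap lborel_prod)
  also have "\<dots> = (\<integral>p. g (coord_swap c p) \<partial>(lborel \<Otimes>\<^sub>M lborel))"
    using g by (subst integral_distr) (simp_all add: measurable_coord_swap lborel_prod)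
  also have "\<dots> = (\<integral>u. (\<integral>x. g (coord_swap c (u, x)) \<partial>lborel) \<partial>lborel)"
  proof (rule lborel_pair.integral_fst'[symmetric])
    have "integrable (distr lborel borel (coord_swap c)) g"
      using ig by (simp only: distr_coord_swap lborel_prod)
    then show "integrable (lborel \<Otimes>\<^sub>M lborel) (\<lambda>p. g (coord_swap c p))"
      using g by (subst (asm) integrable_distr_eq) (simp_all add: measurable_coord_swap lborel_prod)
  qed
  also have "\<dots> = (\<integral>u. indicator {0..1} (u $ c) *\<^sub>R (\<integral>x. f (upd u c x) \<partial>lborel) \<partial>lborel)"
    by (simp add: g_def coord_swap_def)
  finally show ?thesis .
qed

lemma nn_integral_coord_cong:
  fixes f g :: "real ^ 'd::finite \<Rightarrow> ennreal"
  assumes "f \<in> borel_measurable borel" "g \<in> borel_measurable borel"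
    and "\<And>u. (\<integral>\<^sup>+x. f (upd u c x) \<partial>lborel) = (\<integral>\<^sup>+x. g (upd u c x) \<partial>lborel)"
  shows "(\<integral>\<^sup>+u. f u \<partial>lborel) = (\<integral>\<^sup>+u. g u \<partial>lborel)"
  by (simp add: nn_integral_coord[of _ c] assms)

text \<open>On every line in direction \<open>c\<close> the map is a reflection, because
  \<open>\<alpha>\<close> is constant along the line.\<close>

lemma lborel_distr_reflect_coord:
  fixes \<alpha> :: "real ^ 'd::finite \<Rightarrow> real"
  assumes \<alpha>: "\<alpha> \<in> borel_measurable borel" and ind: "\<And>u x. \<alpha> (upd u c x) = \<alpha> u"
  shows "distr lborel borel (\<lambda>u. upd u c (\<alpha> u - u $ c)) = lborel"
proof (rule measure_eqI)
  let ?S = "\<lambda>u. upd u c (\<alpha> u - u $ c)"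
  have S [measurable]: "?S \<in> borel_measurable borel"
    using \<alpha> by measurable
  show "emeasure (distr lborel borel ?S) A = emeasure lborel A" if "A \<in> sets (distr lborel borel ?S)" for A
  proof -
    from that have A [measurable]: "A \<in> sets borel" by simp
    have "emeasure (distr lborel borel ?S) A = (\<integral>\<^sup>+u. indicator A u \<partial>distr lborel borel ?S)"
      by simp
    also have "\<dots> = (\<integral>\<^sup>+u. indicator A (?S u) \<partial>lborel)"
      by (rule nn_integral_distr) simp_all
    also have "\<dots> = (\<integral>\<^sup>+u. indicator A u \<partial>lborel)"
    proof (rule nn_integral_coord_cong[where c = c])
      show "(\<lambda>u. indicator A (?S u)) \<in> borel_measurable borel"
        using S by measurable
      fix u :: "real^'d"
      have "(\<lambda>x. upd u c x) \<in> borel_measurable borel"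
        by (intro borel_measurable_continuous_onI continuous_on_upd continuous_on_const continuous_on_id)
      then have "(\<lambda>x. indicator A (upd u c x) :: ennreal) \<in> borel_measurable borel"
        by measurable
      from nn_integral_real_affine[OF this, of "-1" "\<alpha> u"]
      show "(\<integral>\<^sup>+x. indicator A (?S (upd u c x)) \<partial>lborel) = (\<integral>\<^sup>+x. indicator A (upd u c x) \<partial>lborel)"
        by (simp add: ind)
    qed measurable
    finally show ?thesis using A by simp
  qed
qed simp

text \<open>Fubini in direction \<open>c\<close>, and the fundamental theorem on each segment from
  \<open>lo u\<close> to \<open>hi u\<close>. The result lives on \<open>E\<close>, where coordinate
  \<open>c\<close> has become a dummy variable of length 1: the new integrand does not depend on
  it.\<close>

lemma integral_coord_fundamental:
  fixes f F :: "real ^ 'd::finite \<Rightarrow> complex" and lo hi :: "real ^ 'd \<Rightarrow> real"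
    and B :: "(real ^ 'd) set" and c :: 'd
  defines "D \<equiv> {u. upd u c 0 \<in> B \<and> lo u \<le> u $ c \<and> u $ c \<le> hi u}"
    and "E \<equiv> {u. upd u c 0 \<in> B \<and> 0 \<le> u $ c \<and> u $ c \<le> 1}"
  assumes D: "compact D" and f: "continuous_on D f"
    and E: "compact E" and F: "continuous_on E (\<lambda>u. F (upd u c (hi u)))" "continuous_on E (\<lambda>u. F (upd u c (lo u)))"
    and lo: "\<And>u x. lo (upd u c x) = lo u" and hi: "\<And>u x. hi (upd u c x) = hi u"
    and le: "\<And>u. upd u c 0 \<in> B \<Longrightarrow> lo u \<le> hi u"
    and deriv: "\<And>u. u \<in> D \<Longrightarrow> ((\<lambda>x. F (upd u c x)) has_vector_derivative f u) (at (u $ c))"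
  shows "integral D f = integral E (\<lambda>u. F (upd u c (hi u)) - F (upd u c (lo u)))"
proof -
  have iD: "integrable lborel (\<lambda>u. indicator D u *\<^sub>R f u)"
    using D f by (rule borel_integrable_compact)
  have iE: "integrable lborel (\<lambda>u. indicator E u *\<^sub>R (F (upd u c (hi u)) - F (upd u c (lo u))))"
    using E F by (intro borel_integrable_compact continuous_intros)
  have eq: "indicator {0..1} (u $ c) *\<^sub>R (\<integral>x. indicator D (upd u c x) *\<^sub>R f (upd u c x) \<partial>lborel) =
      indicator E u *\<^sub>R (F (upd u c (hi u)) - F (upd u c (lo u)))" for u
  proof (cases "upd u c 0 \<in> B")
    case True
    have D_upd: "upd u c x \<in> D \<longleftrightarrow> x \<in> {lo u..hi u}" for x
      using True by (simp add: D_def lo hi)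
    have "(\<integral>x. indicator {lo u..hi u} x *\<^sub>R f (upd u c x) \<partial>lborel) = F (upd u c (hi u)) - F (upd u c (lo u))"
    proof (rule integral_FTC_atLeastAtMost)
      show "lo u \<le> hi u" using True by (rule le)
      show "((\<lambda>x. F (upd u c x)) has_vector_derivative f (upd u c x)) (at x within {lo u..hi u})"
        if "lo u \<le> x" "x \<le> hi u" for x
        using deriv[of "upd u c x"] that by (auto simp: D_upd intro: has_vector_derivative_at_within)
      show "continuous_on {lo u..hi u} (\<lambda>x. f (upd u c x))"
        by (rule continuous_on_compose2[OF f]) (auto simp: D_upd intro!: continuous_intros)
    qed
    moreover have "indicator D (upd u c x) = (indicator {lo u..hi u} x :: real)" for x
      by (simp add: D_upd indicator_def)
    ultimately show ?thesis using True by (simp add: E_def indicator_def)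
  qed (simp add: D_def E_def)
  have "integral D f = (\<integral>u. indicator D u *\<^sub>R f u \<partial>lborel)"
    using set_borel_integral_eq_integral(2)[of D f] iD
    by (simp add: set_integrable_def set_lebesgue_integral_def)
  also have "\<dots> = (\<integral>u. indicator E u *\<^sub>R (F (upd u c (hi u)) - F (upd u c (lo u))) \<partial>lborel)"
    by (subst integral_coord[OF iD, of c]) (simp only: eq)
  also have "\<dots> = integral E (\<lambda>u. F (upd u c (hi u)) - F (upd u c (lo u)))"
    using set_borel_integral_eq_integral(2)[of E] iE
    by (simp add: set_integrable_def set_lebesgue_integral_def)
  finally show ?thesis .
qed

section \<open>Measurable shifts of coordinates modulo 1\<close>

text \<open>Rotations preserve the measure of the circle: the interval is cut at
  \<open>b = frac a\<close> and the two pieces are translated past each other.\<close>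

lemma nn_integral_frac_shift:
  fixes h :: "real \<Rightarrow> ennreal"
  assumes [measurable]: "h \<in> borel_measurable borel"
  shows "(\<integral>\<^sup>+x. h (frac (x - a)) * indicator {0..1} x \<partial>lborel) = (\<integral>\<^sup>+x. h x * indicator {0..1} x \<partial>lborel)"
proof -
  define b where "b = frac a"
  have b: "0 \<le> b" "b < 1" by (simp_all add: b_def frac_lt_1)
  have frac: "frac (x - a) = (if x < b then x - b + 1 else x - b)" if "0 \<le> x" "x < 1" for x
  proof -
    have "b - a \<in> \<int>" by (simp add: b_def frac_def)
    then have "x - a - (x - b) \<in> \<int>" "x - a - (x - b + 1) \<in> \<int>"
      using Ints_diff[of "b - a" 1] by (simp_all add: algebra_simps)
    then show ?thesis using that b by (simp only: frac_unique_iff split: if_split) auto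
  qed
  \<comment> \<open>At the endpoint 1 the formula for \<open>frac\<close> may fail; the point is
    discarded as a null set.\<close>
  have ae: "AE x in lborel. x \<noteq> (1::real)" using AE_lborel_singleton by blast
  have "(\<integral>\<^sup>+x. h (frac (x - a)) * indicator {0..1} x \<partial>lborel) =
      (\<integral>\<^sup>+x. h (x - b + 1) * indicator {0..<b} x + h (x - b) * indicator {b..<1} x \<partial>lborel)"
    by (rule nn_integral_cong_AE, rule AE_mp[OF ae], rule AE_I2)
      (use b in \<open>auto simp: frac split: split_indicator\<close>)
  also have "\<dots> = (\<integral>\<^sup>+x. h (x - b + 1) * indicator {0..<b} x \<partial>lborel) + (\<integral>\<^sup>+x. h (x - b) * indicator {b..<1} x \<partial>lborel)"
    by (rule nn_integral_add) measurable
  also have "(\<integral>\<^sup>+x. h (x - b + 1) * indicator {0..<b} x \<partial>lborel) = (\<integral>\<^sup>+x. h x * indicator {1 - b..<1} x \<partial>lborel)"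
    by (subst nn_integral_real_affine[of _ 1 "b - 1"])
      (auto intro!: nn_integral_cong simp: algebra_simps split: split_indicator)
  also have "(\<integral>\<^sup>+x. h (x - b) * indicator {b..<1} x \<partial>lborel) = (\<integral>\<^sup>+x. h x * indicator {0..<1 - b} x \<partial>lborel)"
    by (subst nn_integral_real_affine[of _ 1 b])
      (auto intro!: nn_integral_cong simp: algebra_simps split: split_indicator)
  also have "(\<integral>\<^sup>+x. h x * indicator {1 - b..<1} x \<partial>lborel) + (\<integral>\<^sup>+x. h x * indicator {0..<1 - b} x \<partial>lborel) =
      (\<integral>\<^sup>+x. h x * indicator {1 - b..<1} x + h x * indicator {0..<1 - b} x \<partial>lborel)"
    by (rule nn_integral_add[symmetric]) measurable
  also have "\<dots> = (\<integral>\<^sup>+x. h x * indicator {0..1} x \<partial>lborel)"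
    by (rule nn_integral_cong_AE, rule AE_mp[OF ae], rule AE_I2)
      (use b in \<open>auto split: split_indicator\<close>)
  finally show ?thesis .
qed

text \<open>Lebesgue measure restricted to \<open>D\<close>, but kept as a measure on all of
  \<open>real ^ 'd\<close>, so that it can be compared with its image under a map defined
  everywhere.\<close>

definition cylinder_density :: "(real ^ 'd::finite) set \<Rightarrow> (real ^ 'd) measure" where
  "cylinder_density D = density lborel (indicator D)"

text \<open>The shifts are performed for one coordinate of \<open>C\<close> at a time, each being a
  rotation on the lines inside \<open>D\<close>. Since every \<open>\<alpha> c\<close> reads only
  coordinates outside \<open>C\<close>, earlier shifts do not disturb later ones.\<close>

lemma distr_shift_coords:
  fixes D :: "(real ^ 'd::finite) set" and \<alpha> :: "'d \<Rightarrow> real ^ 'd \<Rightarrow> real" and C :: "'d set"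
  assumes D: "D \<in> sets borel"
    and cyl: "\<And>u c x. c \<in> C \<Longrightarrow> upd u c x \<in> D \<longleftrightarrow> upd u c 0 \<in> D \<and> 0 \<le> x \<and> x \<le> 1"
    and \<alpha>: "\<And>c. c \<in> C \<Longrightarrow> \<alpha> c \<in> borel_measurable borel"
    and ind: "\<And>c u v. c \<in> C \<Longrightarrow> (\<And>d. d \<notin> C \<Longrightarrow> u $ d = v $ d) \<Longrightarrow> \<alpha> c u = \<alpha> c v"
  shows "(\<lambda>u. \<chi> c. if c \<in> C then frac (u $ c - \<alpha> c u) else u $ c) \<in> borel_measurable borel \<and>
    distr (cylinder_density D) borel (\<lambda>u. \<chi> c. if c \<in> C then frac (u $ c - \<alpha> c u) else u $ c) = cylinder_density D"
proof -
  define \<Psi> where "\<Psi> A u = (\<chi> c. if c \<in> A then frac (u $ c - \<alpha> c u) else u $ c)" for A u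
  have one: "(\<lambda>u. upd u c (frac (u $ c - \<alpha> c u))) \<in> borel_measurable borel"
    "distr (cylinder_density D) borel (\<lambda>u. upd u c (frac (u $ c - \<alpha> c u))) = cylinder_density D"
    if c: "c \<in> C" for c
  proof -
    let ?S = "\<lambda>u. upd u c (frac (u $ c - \<alpha> c u))"
    note [measurable] = \<alpha>[OF c] D
    show S [measurable]: "?S \<in> borel_measurable borel"
      unfolding frac_def by measurable
    show "distr (cylinder_density D) borel ?S = cylinder_density D"
    proof (rule measure_eqI)
      fix A assume "A \<in> sets (distr (cylinder_density D) borel ?S)"
      then have [measurable]: "A \<in> sets borel" by simp
      have "emeasure (distr (cylinder_density D) borel ?S) A =
          (\<integral>\<^sup>+u. indicator A u \<partial>distr (cylinder_density D) borel ?S)" by simp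
      also have "\<dots> = (\<integral>\<^sup>+u. indicator D u * indicator A (?S u) \<partial>lborel)"
        unfolding cylinder_density_def by (subst nn_integral_distr) (simp_all add: nn_integral_density)
      also have "\<dots> = (\<integral>\<^sup>+u. indicator D u * indicator A u \<partial>lborel)"
      proof (rule nn_integral_coord_cong[where c = c])
        fix u :: "real^'d"
        have a: "\<alpha> c (upd u c x) = \<alpha> c u" for x
          by (rule ind[OF c]) (use c in auto)
        have "(indicator D (upd u c x) :: ennreal) = indicator D (upd u c 0) * indicator {0..1} x" for x
          using cyl[OF c, of u x] by (auto split: split_indicator)
        then obtain k :: ennreal where d: "\<And>x. indicator D (upd u c x) = k * indicator {0..1} x" by blast
        have "(\<lambda>x. indicator A (upd u c x) :: ennreal) \<in> borel_measurable borel" by measurable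
        note * = nn_integral_frac_shift[OF this, of "\<alpha> c u"]
        have m: "(\<lambda>x. indicator A (upd u c (frac (x - \<alpha> c u))) * indicator {0..1} x :: ennreal) \<in> borel_measurable lborel"
          "(\<lambda>x. indicator A (upd u c x) * indicator {0..1} x :: ennreal) \<in> borel_measurable lborel"
          unfolding frac_def by measurable
        from *
        have "(\<integral>\<^sup>+x. k * (indicator A (upd u c (frac (x - \<alpha> c u))) * indicator {0..1} x) \<partial>lborel) =
          (\<integral>\<^sup>+x. k * (indicator A (upd u c x) * indicator {0..1} x) \<partial>lborel)"
          by (simp only: nn_integral_cmult[OF m(1)] nn_integral_cmult[OF m(2)])
        then show "(\<integral>\<^sup>+x. indicator D (upd u c x) * indicator A (?S (upd u c x)) \<partial>lborel) =
          (\<integral>\<^sup>+x. indicator D (upd u c x) * indicator A (upd u c x) \<partial>lborel)"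
          by (simp add: a d mult_ac)
      qed measurable
      also have "\<dots> = emeasure (cylinder_density D) A"
        by (simp add: cylinder_density_def emeasure_density)
      finally show "emeasure (distr (cylinder_density D) borel ?S) A = emeasure (cylinder_density D) A" .
    qed (simp add: cylinder_density_def)
  qed
  have "\<Psi> A \<in> borel_measurable borel \<and> distr (cylinder_density D) borel (\<Psi> A) = cylinder_density D"
    if "A \<subseteq> C" for A
    using finite[of A] that
  proof (induction A rule: finite_induct)
    case empty
    have "\<Psi> {} = (\<lambda>u. u)" by (simp add: \<Psi>_def fun_eq_iff vec_eq_iff)
    then show ?case by (simp add: cylinder_density_def distr_id2)
  next
    case (insert c A)
    let ?S = "\<lambda>u. upd u c (frac (u $ c - \<alpha> c u))"
    have c: "c \<in> C" and A: "A \<subseteq> C" using insert.prems by auto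
    have "\<alpha> c (\<Psi> A u) = \<alpha> c u" for u
      by (rule ind[OF c]) (use A in \<open>auto simp: \<Psi>_def\<close>)
    then have eq: "\<Psi> (insert c A) = ?S \<circ> \<Psi> A"
      using insert.hyps by (auto simp: \<Psi>_def fun_eq_iff vec_eq_iff)
    note IH = insert.IH[OF A]
    have m: "\<Psi> A \<in> cylinder_density D \<rightarrow>\<^sub>M borel"
      using IH by (simp add: cylinder_density_def)
    have "distr (cylinder_density D) borel (\<Psi> (insert c A)) = distr (distr (cylinder_density D) borel (\<Psi> A)) borel ?S"
      unfolding eq by (rule distr_distr[symmetric, OF one(1)[OF c] m])
    moreover have "\<Psi> (insert c A) \<in> borel_measurable borel"
      unfolding eq using IH one(1)[OF c] by (auto intro: measurable_comp)
    ultimately show ?case using IH one(2)[OF c] by simp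
  qed
  moreover have "\<Psi> C = (\<lambda>u. \<chi> c. if c \<in> C then frac (u $ c - \<alpha> c u) else u $ c)"
    by (rule ext) (simp add: \<Psi>_def)
  ultimately show ?thesis by (metis order_refl)
qed

text \<open>This serves to compare the face integrals of two lifts. There \<open>\<alpha>\<close>
  consists of arguments of complex numbers, which may jump, so that only measurability is asked of
  it; \<open>N\<close> will be the boundary of the cell.\<close>

lemma integral_eq_shift_coords:
  fixes D :: "(real ^ 'd::finite) set" and \<alpha> :: "'d \<Rightarrow> real ^ 'd \<Rightarrow> real" and C :: "'d set"
    and f g :: "real ^ 'd \<Rightarrow> complex"
  assumes D: "compact D" and f: "continuous_on D f" and g: "continuous_on D g"
    and cyl: "\<And>u c x. c \<in> C \<Longrightarrow> upd u c x \<in> D \<longleftrightarrow> upd u c 0 \<in> D \<and> 0 \<le> x \<and> x \<le> 1"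
    and \<alpha>: "\<And>c. c \<in> C \<Longrightarrow> \<alpha> c \<in> borel_measurable borel"
    and ind: "\<And>c u v. c \<in> C \<Longrightarrow> (\<And>d. d \<notin> C \<Longrightarrow> u $ d = v $ d) \<Longrightarrow> \<alpha> c u = \<alpha> c v"
    and N: "negligible N"
    and fg: "\<And>u. u \<in> D - N \<Longrightarrow>
      (\<chi> c. if c \<in> C then frac (u $ c - \<alpha> c u) else u $ c) \<in> D \<and>
      f (\<chi> c. if c \<in> C then frac (u $ c - \<alpha> c u) else u $ c) = g u"
  shows "integral D f = integral D g"
proof -
  define \<Psi> where "\<Psi> u = (\<chi> c. if c \<in> C then frac (u $ c - \<alpha> c u) else u $ c)" for u
  define f' where "f' u = indicator D u *\<^sub>R f u" for u
  define g' where "g' u = indicator D u *\<^sub>R g u" for u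
  have D_sets: "D \<in> sets borel" using D by (simp add: borel_compact)
  have if': "integrable lborel f'" and ig': "integrable lborel g'"
    unfolding f'_def g'_def using D f g by (auto intro: borel_integrable_compact)
  then have f'[measurable]: "f' \<in> borel_measurable borel" and g'[measurable]: "g' \<in> borel_measurable borel" by auto
  have I: "integral D h = (\<integral>u. indicator D u *\<^sub>R h u \<partial>lborel)" if "continuous_on D h" for h :: "real^'d \<Rightarrow> complex"
    using set_borel_integral_eq_integral(2)[of D h] borel_integrable_compact[OF D that]
    by (simp add: set_integrable_def set_lebesgue_integral_def)
  have J: "integral\<^sup>L (cylinder_density D) h = (\<integral>u. indicator D u *\<^sub>R h u \<partial>lborel)"
    if "h \<in> borel_measurable borel" for h :: "real^'d \<Rightarrow> complex"
  proof -
    have "indicator D = (\<lambda>x. ennreal (indicator D x))" by (auto simp: fun_eq_iff split: split_indicator)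
    then show ?thesis
      unfolding cylinder_density_def using that D_sets by (simp add: integral_density)
  qed
  have shift: "\<Psi> \<in> borel_measurable borel \<and> distr (cylinder_density D) borel \<Psi> = cylinder_density D"
    unfolding \<Psi>_def[abs_def] by (rule distr_shift_coords[OF D_sets cyl \<alpha> ind])
  then have \<Psi>: "\<Psi> \<in> borel_measurable borel" and distr_\<Psi>: "distr (cylinder_density D) borel \<Psi> = cylinder_density D"
    by auto
  have "integral D f = integral\<^sup>L (cylinder_density D) f'"
    by (subst J) (simp_all add: I[OF f] f'_def mult.assoc[symmetric] indicator_inter_arith[symmetric])
  also have "\<dots> = integral\<^sup>L (distr (cylinder_density D) borel \<Psi>) f'"
    by (simp only: distr_\<Psi>)
  also have "\<dots> = (\<integral>u. f' (\<Psi> u) \<partial>cylinder_density D)"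
    by (rule integral_distr) (use \<Psi> f' in \<open>simp_all add: cylinder_density_def\<close>)
  also have "\<dots> = (\<integral>u. indicator D u *\<^sub>R f' (\<Psi> u) \<partial>lborel)"
    by (rule J) (rule measurable_compose[OF \<Psi> f'])
  also have "\<dots> = (\<integral>u. g' u \<partial>lborel)"
  proof (rule integral_cong_AE)
    have "AE u in lebesgue. u \<notin> N"
      using N by (auto simp: negligible_iff_null_sets intro: AE_not_in)
    then have "AE u in lborel. u \<notin> N" by (simp add: AE_completion_iff)
    then show "AE u in lborel. indicator D u *\<^sub>R f' (\<Psi> u) = g' u"
      by (rule AE_mp) (auto intro!: AE_I2 simp: f'_def g'_def fg[folded \<Psi>_def] split: split_indicator)
    show "(\<lambda>u. indicator D u *\<^sub>R f' (\<Psi> u)) \<in> borel_measurable lborel"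
      using measurable_compose[OF \<Psi> f'] D_sets by (intro borel_measurable_scaleR) simp_all
  qed simp
  also have "\<dots> = integral D g" by (simp add: I[OF g] g'_def)
  finally show ?thesis .
qed

section \<open>Stokes' theorem on an ordered simplex times a cube\<close>

lemma integral_measure_preserving:
  fixes \<psi> :: "real ^ 'd::finite \<Rightarrow> real ^ 'd" and f :: "real ^ 'd \<Rightarrow> complex"
  assumes \<psi>: "distr lborel borel \<psi> = lborel" "\<psi> \<in> borel_measurable borel"
    and S: "compact S" and f: "continuous_on S f"
  shows "integral S f = integral (\<psi> -` S) (\<lambda>u. f (\<psi> u))"
proof -
  define g where "g u = indicator S u *\<^sub>R f u" for u
  have g: "integrable lborel g"
    unfolding g_def using S f by (rule borel_integrable_compact)
  have "integral S f = integral\<^sup>L lborel g"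
    using set_borel_integral_eq_integral(2)[of S f] g
    by (simp add: g_def[abs_def] set_integrable_def set_lebesgue_integral_def)
  also have "\<dots> = integral\<^sup>L (distr lborel borel \<psi>) g" by (simp only: \<psi>(1))
  also have "\<dots> = (\<integral>u. g (\<psi> u) \<partial>lborel)"
    by (rule integral_distr) (use \<psi>(2) g in auto)
  also have "\<dots> = integral (\<psi> -` S) (\<lambda>u. f (\<psi> u))"
  proof -
    have "integrable (distr lborel borel \<psi>) g" using g by (simp only: \<psi>(1))
    then have "integrable lborel (\<lambda>u. g (\<psi> u))"
      using \<psi>(2) g by (subst (asm) integrable_distr_eq) auto
    then show ?thesis
      using set_borel_integral_eq_integral(2)[of "\<psi> -` S" "\<lambda>u. f (\<psi> u)"]
      by (simp add: g_def set_integrable_def set_lebesgue_integral_def indicator_def)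
  qed
  finally show ?thesis .
qed

locale tube_slots =
  fixes p :: nat and slot :: "nat + 's::finite \<Rightarrow> 'd::finite"
  assumes slot: "bij_betw slot (Inl ` {1..p} \<union> range Inr) UNIV"
begin

definition unslot :: "'d \<Rightarrow> nat + 's" where
  "unslot = the_inv_into (Inl ` {1..p} \<union> range Inr) slot"

lemma inj_slot: "inj_on slot (Inl ` {1..p} \<union> range Inr)"
  using slot by (simp add: bij_betw_def)

lemma unslot_Inl [simp]: "1 \<le> l \<Longrightarrow> l \<le> p \<Longrightarrow> unslot (slot (Inl l)) = Inl l"
  unfolding unslot_def by (rule the_inv_into_f_f[OF inj_slot]) simp

lemma unslot_Inr [simp]: "unslot (slot (Inr i)) = Inr i"
  unfolding unslot_def by (rule the_inv_into_f_f[OF inj_slot]) simp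

lemma slot_cases:
  obtains (Inl) l where "c = slot (Inl l)" "1 \<le> l" "l \<le> p" | (Inr) i where "c = slot (Inr i)"
proof -
  have "c \<in> slot ` (Inl ` {1..p} \<union> range Inr)" using slot by (simp add: bij_betw_def)
  then show ?thesis using Inl Inr by auto
qed

lemma slot_Inl_eq [simp]:
  "1 \<le> l \<Longrightarrow> l \<le> p \<Longrightarrow> 1 \<le> k \<Longrightarrow> k \<le> p \<Longrightarrow> slot (Inl l) = slot (Inl k) \<longleftrightarrow> l = k"
  by (metis unslot_Inl sum.inject(1))

lemma slot_Inl_Inr [simp]:
  "1 \<le> l \<Longrightarrow> l \<le> p \<Longrightarrow> slot (Inl l) \<noteq> slot (Inr i)"
  "1 \<le> l \<Longrightarrow> l \<le> p \<Longrightarrow> slot (Inr i) \<noteq> slot (Inl l)"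
  by (metis unslot_Inl unslot_Inr sum.distinct(1))+

lemma slot_Inr_eq [simp]: "slot (Inr i) = slot (Inr i') \<longleftrightarrow> i = i'"
  by (metis unslot_Inr sum.inject(2))

lemma vec_eq_slots:
  assumes "\<And>l. 1 \<le> l \<Longrightarrow> l \<le> p \<Longrightarrow> u $ slot (Inl l) = v $ slot (Inl l)"
    and "\<And>i. u $ slot (Inr i) = v $ slot (Inr i)"
  shows "u = v"
  unfolding vec_eq_iff
proof
  fix c show "u $ c = v $ c" by (cases c rule: slot_cases) (use assms in auto)
qed

lemma sum_slots: "(\<Sum>c\<in>UNIV. f c) = (\<Sum>l=1..p. f (slot (Inl l))) + (\<Sum>i\<in>UNIV. f (slot (Inr i)))"
proof -
  have "(\<Sum>c\<in>UNIV. f c) = (\<Sum>x\<in>Inl ` {1..p} \<union> range Inr. f (slot x))"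
    using sum.reindex_bij_betw[OF slot, of f] by simp
  also have "\<dots> = (\<Sum>x\<in>Inl ` {1..p}. f (slot x)) + (\<Sum>x\<in>range Inr. f (slot x))"
    by (rule sum.union_disjoint) auto
  finally show ?thesis by (simp add: sum.reindex)
qed

text \<open>The end values make the ordered simplex the chain 0 = z_0 <= z_1 <= ... <= z_q <=
  z_(q+1) = 1, which avoids special cases at both ends.\<close>

definition ord_coord :: "nat \<Rightarrow> real ^ 'd \<Rightarrow> nat \<Rightarrow> real" where
  "ord_coord q z l = (if l = 0 then 0 else if l \<le> q then z $ slot (Inl l) else 1)"

text \<open>For \<open>q < p\<close> the slots \<open>q + 1\<close> to \<open>p\<close> range freely
  over [0,1]. If the integrand ignores slot \<open>p\<close>, an integral over
  \<open>ord_cell (p - 1)\<close> is thus an integral over a face of the simplex times the cube of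
  angles.\<close>

definition ord_cell :: "nat \<Rightarrow> (real ^ 'd) set" where
  "ord_cell q = {z. (\<forall>c. 0 \<le> z $ c \<and> z $ c \<le> 1) \<and> (\<forall>l<q. 1 \<le> l \<longrightarrow> z $ slot (Inl l) \<le> z $ slot (Inl (Suc l)))}"

text \<open>Face \<open>k\<close> repeats the coordinate z_k; the end values of
  \<open>ord_coord\<close> insert 0 for k = 0 and 1 for k = p.\<close>

definition face :: "nat \<Rightarrow> real ^ 'd \<Rightarrow> real ^ 'd" where
  "face k z = (\<chi> c. case unslot c of Inl l \<Rightarrow> ord_coord (p - 1) z (if l \<le> k then l else l - 1) | Inr i \<Rightarrow> z $ c)"

text \<open>A cycle of the slots from \<open>l\<close> to \<open>p\<close>. It allows slot
  \<open>p\<close>, the dummy coordinate of the faces, to play the role of the direction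
  \<open>l\<close> along which is integrated.\<close>

definition cycle_slots :: "nat \<Rightarrow> 'd \<Rightarrow> 'd" where
  "cycle_slots l c = (case unslot c of
     Inl k \<Rightarrow> slot (Inl (if k < l then k else if k = l then p else k - 1)) | Inr i \<Rightarrow> c)"

lemma ord_cell_bounds: "z \<in> ord_cell q \<Longrightarrow> 0 \<le> z $ c" "z \<in> ord_cell q \<Longrightarrow> z $ c \<le> 1"
  by (auto simp: ord_cell_def)

lemma compact_ord_cell: "compact (ord_cell q)"
proof -
  have "ord_cell q = cbox 0 1 \<inter> (\<Inter>l\<in>{1..<q}. {z. z $ slot (Inl l) \<le> z $ slot (Inl (Suc l))})"
    by (auto simp: ord_cell_def mem_box_cart)
  moreover have "closed {z::real^'d. z $ a \<le> z $ b}" for a b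
    by (intro closed_Collect_le continuous_on_component continuous_on_id)
  ultimately show ?thesis by (auto intro!: compact_Int_closed closed_INT)
qed

lemma convex_ord_cell: "convex (ord_cell q)"
proof -
  have "ord_cell q = cbox 0 1 \<inter> (\<Inter>l\<in>{1..<q}. {z. (axis (slot (Inl l)) 1 - axis (slot (Inl (Suc l))) 1) \<bullet> z \<le> 0})"
    by (auto simp: ord_cell_def mem_box_cart inner_diff_left inner_axis')
  then show ?thesis by (auto intro!: convex_Int convex_INT convex_halfspace_le)
qed

lemma ord_coord_mono:
  assumes z: "z \<in> ord_cell q"
  shows "ord_coord q z l \<le> ord_coord q z (Suc l)"
  using z ord_cell_bounds[OF z] by (auto simp: ord_coord_def ord_cell_def)

lemma ord_coord_bounds:
  assumes z: "z \<in> ord_cell q"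
  shows "0 \<le> ord_coord q z l" "ord_coord q z l \<le> 1"
  using ord_cell_bounds[OF z] by (auto simp: ord_coord_def)

lemma ord_coord_upd:
  assumes "\<And>l. 1 \<le> l \<Longrightarrow> l \<le> q \<Longrightarrow> slot (Inl l) \<noteq> c"
  shows "ord_coord q (upd z c x) l = ord_coord q z l"
  using assms[of l] by (auto simp: ord_coord_def)

lemma ord_cell_upd:
  assumes c: "\<And>l. 1 \<le> l \<Longrightarrow> l \<le> q \<Longrightarrow> slot (Inl l) \<noteq> c"
  shows "upd z c x \<in> ord_cell q \<longleftrightarrow> upd z c 0 \<in> ord_cell q \<and> 0 \<le> x \<and> x \<le> 1"
proof -
  have "(\<forall>d. 0 \<le> upd z c x $ d \<and> upd z c x $ d \<le> 1) \<longleftrightarrow>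
      (\<forall>d. 0 \<le> upd z c 0 $ d \<and> upd z c 0 $ d \<le> 1) \<and> 0 \<le> x \<and> x \<le> 1"
    by (auto split: if_splits)
  moreover have "upd z c x $ slot (Inl l) = upd z c 0 $ slot (Inl l)" if "1 \<le> l" "l \<le> q" for l
    using c[OF that] by simp
  then have "(\<forall>l<q. 1 \<le> l \<longrightarrow> upd z c x $ slot (Inl l) \<le> upd z c x $ slot (Inl (Suc l))) \<longleftrightarrow>
      (\<forall>l<q. 1 \<le> l \<longrightarrow> upd z c 0 $ slot (Inl l) \<le> upd z c 0 $ slot (Inl (Suc l)))"
    by (metis Suc_leI le_SucI less_or_eq_imp_le)
  ultimately show ?thesis unfolding ord_cell_def by blast
qed

lemma ord_cell_eq_upd:
  assumes c: "\<And>l. 1 \<le> l \<Longrightarrow> l \<le> q \<Longrightarrow> slot (Inl l) \<noteq> c"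
  shows "ord_cell q = {z. upd z c 0 \<in> ord_cell q \<and> 0 \<le> z $ c \<and> z $ c \<le> 1}"
proof -
  have "z \<in> ord_cell q \<longleftrightarrow> upd z c 0 \<in> ord_cell q \<and> 0 \<le> z $ c \<and> z $ c \<le> 1" for z
    using ord_cell_upd[of q c z "z $ c", OF c] by simp
  then show ?thesis by blast
qed

lemma face_Inl: "1 \<le> l \<Longrightarrow> l \<le> p \<Longrightarrow> face k z $ slot (Inl l) = ord_coord (p - 1) z (if l \<le> k then l else l - 1)"
  by (simp add: face_def)

lemma face_Inr [simp]: "face k z $ slot (Inr i) = z $ slot (Inr i)"
  by (simp add: face_def)

lemma face_in_ord_cell:
  assumes z: "z \<in> ord_cell (p - 1)"
  shows "face k z \<in> ord_cell p"
proof -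
  note b = ord_coord_bounds[OF z]
  have "0 \<le> face k z $ c \<and> face k z $ c \<le> 1" for c
    by (cases c rule: slot_cases) (use b ord_cell_bounds[OF z] in \<open>auto simp: face_Inl\<close>)
  moreover have "face k z $ slot (Inl l) \<le> face k z $ slot (Inl (Suc l))" if "l < p" "1 \<le> l" for l
    using that ord_coord_mono[OF z, of l] ord_coord_mono[OF z, of "l - 1"] by (auto simp: face_Inl)
  ultimately show ?thesis by (simp add: ord_cell_def)
qed

lemma continuous_on_ord_coord [continuous_intros]: "continuous_on A (\<lambda>z. ord_coord q z l)"
  unfolding ord_coord_def by (cases "l = 0"; cases "l \<le> q") (auto intro!: continuous_on_component continuous_on_id)

lemma continuous_on_face: "continuous_on A (face k)"
proof -
  have "continuous_on A (\<lambda>z. face k z $ c)" for c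
    by (cases c rule: slot_cases) (auto simp: face_Inl intro!: continuous_intros continuous_on_component)
  then show ?thesis
    using continuous_on_vec_lambda[of A "\<lambda>c z. face k z $ c"] by simp
qed

lemma bij_cycle_slots:
  assumes l: "1 \<le> l" "l \<le> p"
  shows "bij (cycle_slots l)"
proof -
  have "inj (cycle_slots l)"
  proof (rule injI)
    fix c d assume eq: "cycle_slots l c = cycle_slots l d"
    show "c = d"
    proof (cases c rule: slot_cases)
      case c: (Inl k)
      show ?thesis
      proof (cases d rule: slot_cases)
        case d: (Inl k')
        define h where "h k = (if k < l then k else if k = l then p else k - 1)" for k
        have "cycle_slots l c = slot (Inl (h k))" "cycle_slots l d = slot (Inl (h k'))"
          using c d by (simp_all add: cycle_slots_def h_def)
        moreover have "1 \<le> h k" "h k \<le> p" "1 \<le> h k'" "h k' \<le> p"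
          using c d l by (auto simp: h_def)
        ultimately have "h k = h k'" using eq by simp
        then have "k = k'" using c d l by (auto simp: h_def split: if_splits)
        then show ?thesis using c d by simp
      next
        case d: (Inr i)
        then show ?thesis using eq c l by (auto simp: cycle_slots_def split: if_splits)
      qed
    next
      case c: (Inr i)
      show ?thesis
      proof (cases d rule: slot_cases)
        case d: (Inl k')
        then show ?thesis using eq c l by (auto simp: cycle_slots_def split: if_splits)
      next
        case d: (Inr i)
        then show ?thesis using eq c by (auto simp: cycle_slots_def)
      qed
    qed
  qed
  then show ?thesis by (simp add: finite_UNIV_inj_surj bij_def)
qed

text \<open>A line in direction z_l meets the ordered cell in the segment from z_l = z_(l-1), which
  is face l - 1, to z_l = z_(l+1), which is face l.\<close>

lemma integral_simplex_direction:
  fixes G G' :: "real ^ 'd \<Rightarrow> complex"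
  assumes l: "1 \<le> l" "l \<le> p"
    and G: "continuous_on (ord_cell p) G" and G': "continuous_on (ord_cell p) G'"
    and deriv: "\<And>s. s \<in> ord_cell p \<Longrightarrow>
      ((\<lambda>x. G (upd s (slot (Inl l)) x)) has_vector_derivative G' s) (at (s $ slot (Inl l)))"
  shows "integral (ord_cell p) G' = integral (ord_cell (p - 1)) (\<lambda>z. G (face l z) - G (face (l - 1) z))"
proof -
  define A where "A z = (\<chi> c. z $ cycle_slots l c)" for z :: "real ^ 'd"
  define c where "c = slot (Inl p)"
  define lo where "lo z = ord_coord (p - 1) z (l - 1)" for z
  define hi where "hi z = ord_coord (p - 1) z l" for z
  have c: "slot (Inl k) \<noteq> c" if "1 \<le> k" "k \<le> p - 1" for k
    using that l by (simp add: c_def)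
  have lo_upd: "lo (upd u c x) = lo u" and hi_upd: "hi (upd u c x) = hi u" for u x
    unfolding lo_def hi_def by (rule ord_coord_upd, erule (1) c)+
  have lo_eq: "lo z = (if l = 1 then 0 else z $ slot (Inl (l - 1)))"
    and hi_eq: "hi z = (if l = p then 1 else z $ slot (Inl l))" for z
    using l by (auto simp: lo_def hi_def ord_coord_def)
  have A_Inl: "A z $ slot (Inl k) = z $ slot (Inl (if k < l then k else if k = l then p else k - 1))"
    if "1 \<le> k" "k \<le> p" for z k
    using that by (simp add: A_def cycle_slots_def)
  have A_Inr: "A z $ slot (Inr i) = z $ slot (Inr i)" for z i
    by (simp add: A_def cycle_slots_def)
  have A_hi: "A (upd z c (hi z)) = face l z" for z
  proof (rule vec_eq_slots)
    fix k assume k: "1 \<le> k" "k \<le> p"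
    consider "k < l" | "k = l" | "l < k" by linarith
    then show "A (upd z c (hi z)) $ slot (Inl k) = face l z $ slot (Inl k)"
      by cases (use k l in \<open>auto simp: A_Inl face_Inl c_def hi_def ord_coord_def\<close>)
  qed (use l in \<open>simp add: A_Inr c_def\<close>)
  have A_lo: "A (upd z c (lo z)) = face (l - 1) z" for z
  proof (rule vec_eq_slots)
    fix k assume k: "1 \<le> k" "k \<le> p"
    consider "k < l" | "k = l" | "l < k" by linarith
    then show "A (upd z c (lo z)) $ slot (Inl k) = face (l - 1) z $ slot (Inl k)"
      by cases (use k l in \<open>auto simp: A_Inl face_Inl c_def lo_def ord_coord_def\<close>)
  qed (use l in \<open>simp add: A_Inr c_def\<close>)
  have A_upd: "A (upd z c x) = upd (A z) (slot (Inl l)) x" for z x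
    using l by (auto intro!: vec_eq_slots simp: A_Inl A_Inr c_def)
  have Ac: "A z $ slot (Inl l) = z $ c" for z
    using l by (simp add: A_Inl c_def)
  \<comment> \<open>In the relabelled coordinates the cell is the region between the graphs of
    \<open>lo\<close> and \<open>hi\<close> over the cell of one dimension less.\<close>
  have vim: "A -` ord_cell p = {z. upd z c 0 \<in> ord_cell (p - 1) \<and> lo z \<le> z $ c \<and> z $ c \<le> hi z}" (is "_ = ?D")
  proof (rule equalityI[OF subsetI subsetI], goal_cases)
    case (2 z)
    then have z: "upd z c 0 \<in> ord_cell (p - 1)" and lh: "lo z \<le> z $ c" "z $ c \<le> hi z" by auto
    have b: "0 \<le> z $ d \<and> z $ d \<le> 1" for d
    proof (cases "d = c")
      case True
      have "0 \<le> lo z" "hi z \<le> 1"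
        using ord_coord_bounds[OF z, of "l - 1"] ord_coord_bounds[OF z, of l] lo_upd[of z 0] hi_upd[of z 0]
        by (simp_all add: lo_def hi_def)
      then show ?thesis using lh True by auto
    next
      case False
      then show ?thesis using ord_cell_bounds[OF z, of d] by simp
    qed
    have mono: "z $ slot (Inl k) \<le> z $ slot (Inl (Suc k))" if "1 \<le> k" "k < p - 1" for k
    proof -
      have "upd z c 0 $ slot (Inl k) \<le> upd z c 0 $ slot (Inl (Suc k))"
        using z that by (simp add: ord_cell_def)
      then show ?thesis using that c[of k] c[of "Suc k"] by simp
    qed
    have "A z $ slot (Inl k) \<le> A z $ slot (Inl (Suc k))" if k: "1 \<le> k" "k < p" for k
    proof -
      consider "Suc k < l" | "Suc k = l" | "k = l" | "l < k" by linarith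
      then show ?thesis
      proof cases
        case 1
        then show ?thesis using k l mono[of k] by (simp add: A_Inl)
      next
        case 2
        then show ?thesis using k l lh(1) by (auto simp: A_Inl lo_eq c_def)
      next
        case 3
        then show ?thesis using k l lh(2) by (auto simp: A_Inl hi_eq c_def)
      next
        case 4
        then show ?thesis using k l mono[of "k - 1"] by (simp add: A_Inl)
      qed
    qed
    then show ?case using b by (auto simp: ord_cell_def A_def)
  next
    case (1 z)
    then have z: "A z \<in> ord_cell p" by simp
    have b: "0 \<le> z $ d \<and> z $ d \<le> 1" for d
    proof -
      obtain e where "d = cycle_slots l e" using bij_cycle_slots[OF l] by (metis bij_pointE)
      then show ?thesis using ord_cell_bounds[OF z, of e] by (simp add: A_def)
    qed
    have mono: "A z $ slot (Inl k) \<le> A z $ slot (Inl (Suc k))" if "1 \<le> k" "k < p" for k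
      using z that by (auto simp: ord_cell_def)
    have "lo z \<le> z $ c"
      using mono[of "l - 1"] l b[of c] by (auto simp: lo_eq c_def A_Inl)
    moreover have "z $ c \<le> hi z"
      using mono[of l] l b[of c] by (auto simp: hi_eq c_def A_Inl)
    moreover have "z $ slot (Inl k) \<le> z $ slot (Inl (Suc k))" if k: "1 \<le> k" "k < p - 1" for k
    proof -
      consider "Suc k < l" | "Suc k = l" | "l \<le> k" by linarith
      then show ?thesis
      proof cases
        case 1
        then show ?thesis using k l mono[of k] by (simp add: A_Inl)
      next
        case 2
        then have "z $ slot (Inl k) \<le> z $ slot (Inl p)" "z $ slot (Inl p) \<le> z $ slot (Inl l)"
          using k l mono[of k] mono[of l] by (auto simp: A_Inl)
        then show ?thesis using 2 by simp
      next
        case 3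
        then show ?thesis using k l mono[of "Suc k"] by (simp add: A_Inl)
      qed
    qed
    ultimately show ?case using b by (auto simp: ord_cell_def c_def)
  qed
  have cell: "ord_cell (p - 1) = {z. upd z c 0 \<in> ord_cell (p - 1) \<and> 0 \<le> z $ c \<and> z $ c \<le> 1}"
    by (rule ord_cell_eq_upd, erule (1) c)
  have contA: "continuous_on S A" for S
    unfolding A_def by (intro continuous_on_vec_lambda continuous_on_component continuous_on_id)
  have distrA: "distr lborel borel A = lborel"
    unfolding A_def[abs_def] by (rule lborel_distr_permute_coords[OF bij_cycle_slots[OF l]])
  have "bounded (A -` ord_cell p)"
  proof (rule bounded_subset[OF bounded_cbox])
    show "A -` ord_cell p \<subseteq> cbox 0 1"
    proof
      fix z assume "z \<in> A -` ord_cell p"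
      then have z: "A z \<in> ord_cell p" by simp
      have "0 \<le> z $ d \<and> z $ d \<le> 1" for d
      proof -
        obtain e where "d = cycle_slots l e" using bij_cycle_slots[OF l] by (metis bij_pointE)
        then show ?thesis using ord_cell_bounds[OF z, of e] by (simp add: A_def)
      qed
      then show "z \<in> cbox 0 1" by (simp add: mem_box_cart)
    qed
  qed
  moreover have "closed (A -` ord_cell p)"
    by (rule closed_vimage[OF compact_imp_closed[OF compact_ord_cell] contA])
  ultimately have cD: "compact ?D" unfolding vim[symmetric] by (simp add: compact_eq_bounded_closed)
  have "integral (ord_cell p) G' = integral (A -` ord_cell p) (\<lambda>u. G' (A u))"
    by (rule integral_measure_preserving[OF distrA _ compact_ord_cell G'])
      (rule borel_measurable_continuous_onI[OF contA])
  also have "\<dots> = integral {z. upd z c 0 \<in> ord_cell (p - 1) \<and> 0 \<le> z $ c \<and> z $ c \<le> 1}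
      (\<lambda>u. G (A (upd u c (hi u))) - G (A (upd u c (lo u))))"
    unfolding vim
  proof (rule integral_coord_fundamental[OF cD, where F = "\<lambda>u. G (A u)"])
    show "continuous_on ?D (\<lambda>u. G' (A u))"
      unfolding vim[symmetric] by (rule continuous_on_compose2[OF G' contA]) auto
    show "compact {z. upd z c 0 \<in> ord_cell (p - 1) \<and> 0 \<le> z $ c \<and> z $ c \<le> 1}"
      unfolding cell[symmetric] by (rule compact_ord_cell)
    show "continuous_on {z. upd z c 0 \<in> ord_cell (p - 1) \<and> 0 \<le> z $ c \<and> z $ c \<le> 1} (\<lambda>u. G (A (upd u c (hi u))))"
      "continuous_on {z. upd z c 0 \<in> ord_cell (p - 1) \<and> 0 \<le> z $ c \<and> z $ c \<le> 1} (\<lambda>u. G (A (upd u c (lo u))))"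
      unfolding cell[symmetric] A_hi A_lo
      by (auto intro!: continuous_on_compose2[OF G continuous_on_face] face_in_ord_cell)
    show "lo (upd u c x) = lo u" "hi (upd u c x) = hi u" for u x
      by (rule lo_upd hi_upd)+
    show "lo u \<le> hi u" if "upd u c 0 \<in> ord_cell (p - 1)" for u
      using ord_coord_mono[OF that, of "l - 1"] l lo_upd[of u 0] hi_upd[of u 0] by (simp add: lo_def hi_def)
    show "((\<lambda>x. G (A (upd u c x))) has_vector_derivative G' (A u)) (at (u $ c))" if "u \<in> ?D" for u
      using deriv[of "A u"] that unfolding vim[symmetric] by (simp add: A_upd Ac)
  qed
  finally show ?thesis unfolding cell[symmetric] A_hi A_lo .
qed

text \<open>The two ends of the circle cancel, so that angle directions have no boundary.\<close>

lemma integral_angle_direction: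
  fixes G G' :: "real ^ 'd \<Rightarrow> complex"
  assumes G: "continuous_on (ord_cell q) G" and G': "continuous_on (ord_cell q) G'" and q: "q \<le> p"
    and deriv: "\<And>s. s \<in> ord_cell q \<Longrightarrow>
      ((\<lambda>x. G (upd s (slot (Inr i)) x)) has_vector_derivative G' s) (at (s $ slot (Inr i)))"
    and per: "\<And>s. s \<in> ord_cell q \<Longrightarrow> G (upd s (slot (Inr i)) 1) = G (upd s (slot (Inr i)) 0)"
  shows "integral (ord_cell q) G' = 0"
proof -
  define c where "c = slot (Inr i)"
  have c: "slot (Inl l) \<noteq> c" if "1 \<le> l" "l \<le> q" for l using that q by (auto simp: c_def)
  have cell: "ord_cell q = {z. upd z c 0 \<in> ord_cell q \<and> 0 \<le> z $ c \<and> z $ c \<le> 1}"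
    by (rule ord_cell_eq_upd, erule (1) c)
  have upd: "upd z c x \<in> ord_cell q" if "upd z c 0 \<in> ord_cell q" "0 \<le> x" "x \<le> 1" for z x
    using that ord_cell_upd[of q c z x] c by blast
  have "integral {z. upd z c 0 \<in> ord_cell q \<and> 0 \<le> z $ c \<and> z $ c \<le> 1} G' =
    integral {z. upd z c 0 \<in> ord_cell q \<and> 0 \<le> z $ c \<and> z $ c \<le> 1} (\<lambda>u. G (upd u c 1) - G (upd u c 0))"
  proof (rule integral_coord_fundamental)
    show "compact {z. upd z c 0 \<in> ord_cell q \<and> 0 \<le> z $ c \<and> z $ c \<le> 1}"
      "compact {z. upd z c 0 \<in> ord_cell q \<and> 0 \<le> z $ c \<and> z $ c \<le> 1}"
      "continuous_on {z. upd z c 0 \<in> ord_cell q \<and> 0 \<le> z $ c \<and> z $ c \<le> 1} G'"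
      using compact_ord_cell G' by (simp_all only: cell[symmetric])
    show "continuous_on {z. upd z c 0 \<in> ord_cell q \<and> 0 \<le> z $ c \<and> z $ c \<le> 1} (\<lambda>u. G (upd u c 1))"
      "continuous_on {z. upd z c 0 \<in> ord_cell q \<and> 0 \<le> z $ c \<and> z $ c \<le> 1} (\<lambda>u. G (upd u c 0))"
      by (rule continuous_on_compose2[OF G], intro continuous_on_upd continuous_on_id continuous_on_const,
        use upd in auto)+
    show "((\<lambda>x. G (upd u c x)) has_vector_derivative G' u) (at (u $ c))"
      if "u \<in> {z. upd z c 0 \<in> ord_cell q \<and> 0 \<le> z $ c \<and> z $ c \<le> 1}" for u
      using deriv[of u] that cell unfolding c_def by blast
  qed simp_all
  also have "\<dots> = integral (ord_cell q) (\<lambda>u. 0)"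
    unfolding cell[symmetric] by (rule integral_cong) (simp add: per c_def)
  finally show ?thesis by (simp add: cell[symmetric])
qed

section \<open>Ordered and barycentric coordinates\<close>

text \<open>Differences of neighbouring ordered coordinates, taken in the first \<open>m\<close>
  simplex slots only. The case \<open>m = p\<close> is the change of coordinates; the smaller values
  serve the induction for invariance of the measure.\<close>

definition diff_coords :: "nat \<Rightarrow> real ^ 'd \<Rightarrow> real ^ 'd" where
  "diff_coords m s = (\<chi> c. case unslot c of
     Inl l \<Rightarrow> if l \<le> m then ord_coord p s (Suc l) - s $ c else s $ c | Inr i \<Rightarrow> s $ c)"

lemma diff_coords_Inl: "1 \<le> l \<Longrightarrow> l \<le> p \<Longrightarrow> diff_coords m s $ slot (Inl l) =
    (if l \<le> m then ord_coord p s (Suc l) - s $ slot (Inl l) else s $ slot (Inl l))"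
  by (simp add: diff_coords_def)

lemma diff_coords_Inr [simp]: "diff_coords m s $ slot (Inr i) = s $ slot (Inr i)"
  by (simp add: diff_coords_def)

lemma continuous_on_diff_coords: "continuous_on A (diff_coords m)"
proof -
  have "continuous_on A (\<lambda>z. diff_coords m z $ c)" for c
  proof (cases c rule: slot_cases)
    case (Inl l)
    then show ?thesis
      by (cases "l \<le> m") (auto simp: diff_coords_Inl intro!: continuous_intros continuous_on_component)
  qed (auto intro!: continuous_on_component continuous_on_id)
  then show ?thesis
    using continuous_on_vec_lambda[of A "\<lambda>c z. diff_coords m z $ c"] by simp
qed

text \<open>One step of the induction reflects a single coordinate z_l to z_(l+1) - z_l, at a time
  when z_(l+1) is still unchanged.\<close>

lemma lborel_distr_diff_coords: "m \<le> p \<Longrightarrow> distr lborel borel (diff_coords m) = lborel"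
proof (induction m)
  case 0
  have "diff_coords 0 = (\<lambda>s. s)"
    by (rule ext, rule vec_eq_slots) (auto simp: diff_coords_Inl)
  then show ?case by (simp add: distr_id2)
next
  case (Suc m)
  define c where "c = slot (Inl (Suc m))"
  define \<alpha> where "\<alpha> u = ord_coord p u (Suc (Suc m))" for u
  let ?R = "\<lambda>u. upd u c (\<alpha> u - u $ c)"
  have \<alpha>: "\<alpha> \<in> borel_measurable borel"
    unfolding \<alpha>_def by (intro borel_measurable_continuous_onI continuous_intros)
  have ind: "\<alpha> (upd u c x) = \<alpha> u" for u x
    using Suc.prems by (auto simp: \<alpha>_def c_def ord_coord_def)
  have R: "?R \<in> borel_measurable borel" using \<alpha> by measurable
  have D: "diff_coords m \<in> lborel \<rightarrow>\<^sub>M borel"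
    using borel_measurable_continuous_onI[OF continuous_on_diff_coords] by simp
  have "diff_coords (Suc m) = ?R \<circ> diff_coords m"
  proof (rule ext, rule vec_eq_slots)
    fix s l assume l: "1 \<le> l" "l \<le> p"
    have "\<alpha> (diff_coords m s) = \<alpha> s"
      by (auto simp: \<alpha>_def ord_coord_def diff_coords_Inl)
    then show "diff_coords (Suc m) s $ slot (Inl l) = (?R \<circ> diff_coords m) s $ slot (Inl l)"
      using l Suc.prems by (auto simp: diff_coords_Inl c_def \<alpha>_def)
  qed (use Suc.prems in \<open>auto simp: c_def\<close>)
  then have "distr lborel borel (diff_coords (Suc m)) = distr (distr lborel borel (diff_coords m)) borel ?R"
    using distr_distr[OF R D] by simp
  then show ?case
    using Suc lborel_distr_reflect_coord[OF \<alpha> ind] by simp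
qed

text \<open>The barycentric coordinates of the ordered point, including t_0 = z_1.\<close>

definition ord_point :: "nat \<Rightarrow> real ^ 'd \<Rightarrow> nat \<Rightarrow> real" where
  "ord_point q z l = (if l \<le> q then ord_coord q z (Suc l) - ord_coord q z l else 0)"

text \<open>Coordinate 0 is 1 minus the sum of the others, and this sum of differences
  telescopes.\<close>

lemma simplex_point_diff_coords: "simplex_point p slot (diff_coords p s) = ord_point p s"
proof
  fix l
  have "(\<Sum>l=1..m. ord_coord p s (Suc l) - ord_coord p s l) = ord_coord p s (Suc m) - ord_coord p s 1" for m
    by (induction m) auto
  moreover have "(\<Sum>l=1..p. diff_coords p s $ slot (Inl l)) = (\<Sum>l=1..p. ord_coord p s (Suc l) - ord_coord p s l)"
    by (rule sum.cong) (auto simp: diff_coords_Inl ord_coord_def)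
  ultimately have "(\<Sum>l=1..p. diff_coords p s $ slot (Inl l)) = ord_coord p s (Suc p) - ord_coord p s 1"
    by (simp only:)
  then have "1 - (\<Sum>l=1..p. diff_coords p s $ slot (Inl l)) = ord_coord p s 1"
    by (simp add: ord_coord_def[of p s "Suc p"])
  then show "simplex_point p slot (diff_coords p s) l = ord_point p s l"
    by (auto simp: simplex_point_def ord_point_def diff_coords_Inl ord_coord_def)
qed

lemma sum_ord_point: "(\<Sum>l\<le>q. ord_point q z l) = 1"
proof -
  have "(\<Sum>l\<le>m. ord_coord q z (Suc l) - ord_coord q z l) = ord_coord q z (Suc m)" for m
    by (induction m) (auto simp: ord_coord_def)
  from this[of q] show ?thesis by (simp add: ord_point_def ord_coord_def)
qed

lemma ord_point_in_simplex:
  assumes "z \<in> ord_cell q"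
  shows "ord_point q z \<in> standard_simplex q"
  unfolding standard_simplex_def
proof (intro CollectI conjI allI impI)
  show nonneg: "0 \<le> ord_point q z l" for l
    using ord_coord_mono[OF assms, of l] by (simp add: ord_point_def)
  show "ord_point q z l \<le> 1" for l
    using ord_coord_bounds[OF assms, of "Suc l"] ord_coord_bounds[OF assms, of l] by (simp add: ord_point_def)
  show "ord_point q z l = 0" if "q < l" for l using that by (simp add: ord_point_def)
qed (rule sum_ord_point)

text \<open>A repeated ordered coordinate is a vanishing barycentric one, and the later indices are
  shifted exactly as \<open>simplical_face\<close> does.\<close>

lemma ord_point_face:
  assumes "1 \<le> p" "k \<le> p"
  shows "ord_point p (face k z) = simplical_face k (ord_point (p - 1) z)"
proof -
  have "ord_coord p (face k z) l = ord_coord (p - 1) z (if l \<le> k then l else l - 1)" for l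
    using assms by (auto simp: ord_coord_def face_Inl)
  then show ?thesis
    using assms by (auto simp: fun_eq_iff ord_point_def simplical_face_def)
qed

lemma diff_coords_vimage_tube_cell: "diff_coords p -` tube_cell p slot = ord_cell p"
proof (intro equalityI subsetI)
  fix s assume "s \<in> ord_cell p"
  then show "s \<in> diff_coords p -` tube_cell p slot"
    using ord_point_in_simplex[of s p] ord_cell_bounds[of s p]
    by (simp add: tube_cell_def simplex_point_diff_coords)
next
  fix s assume "s \<in> diff_coords p -` tube_cell p slot"
  then have s: "ord_point p s \<in> standard_simplex p" "\<And>i. 0 \<le> s $ slot (Inr i) \<and> s $ slot (Inr i) \<le> 1"
    by (auto simp: tube_cell_def simplex_point_diff_coords)
  have mono: "ord_coord p s l \<le> ord_coord p s (Suc l)" if "l \<le> p" for l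
    using s(1) that unfolding standard_simplex_def by (auto simp: ord_point_def dest!: spec[of _ l])
  have le: "ord_coord p s l \<le> ord_coord p s m" if "l \<le> m" "m \<le> Suc p" for l m
    using that by (induction m rule: dec_induct) (auto intro: order_trans mono)
  have "0 \<le> s $ c \<and> s $ c \<le> 1" for c
  proof (cases c rule: slot_cases)
    case (Inl l)
    then show ?thesis using le[of 0 l] le[of l "Suc p"] by (simp add: ord_coord_def)
  qed (use s(2) in auto)
  moreover have "s $ slot (Inl l) \<le> s $ slot (Inl (Suc l))" if "1 \<le> l" "l < p" for l
    using mono[of l] that by (simp add: ord_coord_def)
  ultimately show "s \<in> ord_cell p" by (simp add: ord_cell_def)
qed

lemma integral_tube_cell:
  fixes f :: "real ^ 'd \<Rightarrow> complex"
  assumes "compact (tube_cell p slot)" "continuous_on (tube_cell p slot) f"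
  shows "integral (tube_cell p slot) f = integral (ord_cell p) (\<lambda>s. f (diff_coords p s))"
  using integral_measure_preserving[OF lborel_distr_diff_coords[of p] _ assms]
    borel_measurable_continuous_onI[OF continuous_on_diff_coords]
  by (simp add: diff_coords_vimage_tube_cell)

end

section \<open>Derivatives of determinants\<close>

lemma has_vector_derivative_prod:
  fixes f :: "'i \<Rightarrow> real \<Rightarrow> complex"
  assumes "\<And>i. i \<in> I \<Longrightarrow> (f i has_vector_derivative f' i) (at x)"
  shows "((\<lambda>x. \<Prod>i\<in>I. f i x) has_vector_derivative (\<Sum>i\<in>I. f' i * (\<Prod>j\<in>I - {i}. f j x))) (at x)"
proof -
  have "((\<lambda>x. \<Prod>i\<in>I. f i x) has_derivative (\<lambda>y. \<Sum>i\<in>I. (y *\<^sub>R f' i) * (\<Prod>j\<in>I - {i}. f j x))) (at x)"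
    using assms by (intro has_derivative_prod) (simp add: has_vector_derivative_def)
  then show ?thesis by (simp add: has_vector_derivative_def scaleR_sum_right)
qed

lemma has_vector_derivative_divide_complex:
  fixes f g :: "real \<Rightarrow> complex"
  assumes "(f has_vector_derivative f') (at x)" "(g has_vector_derivative g') (at x)" "g x \<noteq> 0"
  shows "((\<lambda>x. f x / g x) has_vector_derivative (f' / g x - f x * g' / (g x)\<^sup>2)) (at x)"
proof -
  have "((\<lambda>x. f x / g x) has_derivative
      (\<lambda>h. - f x * (inverse (g x) * (h *\<^sub>R g') * inverse (g x)) + (h *\<^sub>R f') / g x)) (at x)"
    using assms by (intro has_derivative_divide) (simp_all add: has_vector_derivative_def)
  moreover have "(\<lambda>h. - f x * (inverse (g x) * (h *\<^sub>R g') * inverse (g x)) + (h *\<^sub>R f') / g x) =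
      (\<lambda>h. h *\<^sub>R (f' / g x - f x * g' / (g x)\<^sup>2))"
    using assms(3) by (auto simp: fun_eq_iff power2_eq_square field_simps scaleR_conv_of_real)
  ultimately show ?thesis by (simp add: has_vector_derivative_def)
qed

lemma has_vector_derivative_det:
  fixes M :: "real \<Rightarrow> complex ^ 'n ^ 'n::finite"
  assumes M: "\<And>i j. ((\<lambda>s. M s $ i $ j) has_vector_derivative M' $ i $ j) (at x)"
  shows "((\<lambda>s. det (M s)) has_vector_derivative
    (\<Sum>c\<in>UNIV. det (\<chi> i j. if j = c then M' $ i $ j else M x $ i $ j))) (at x)"
proof -
  have "((\<lambda>s. det (M s)) has_vector_derivative
      (\<Sum>p | p permutes UNIV. of_int (sign p) * (\<Sum>i\<in>UNIV. M' $ i $ p i * (\<Prod>j\<in>UNIV - {i}. M x $ j $ p j)))) (at x)"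
    unfolding det_def
    by (intro has_vector_derivative_sum has_vector_derivative_mult_right has_vector_derivative_prod M)
  moreover have "(\<Sum>i\<in>UNIV. M' $ i $ p i * (\<Prod>j\<in>UNIV - {i}. M x $ j $ p j)) =
      (\<Sum>c\<in>UNIV. \<Prod>i\<in>UNIV. (\<chi> i j. if j = c then M' $ i $ j else M x $ i $ j) $ i $ p i)"
    if p: "p permutes UNIV" for p
  proof -
    \<comment> \<open>In the term of the permutation \<open>p\<close>, differentiating the factor of
      row \<open>i\<close> means differentiating column \<open>p i\<close>.\<close>
    have "M' $ i $ p i * (\<Prod>j\<in>UNIV - {i}. M x $ j $ p j) =
        (\<Prod>j\<in>UNIV. if p j = p i then M' $ j $ p j else M x $ j $ p j)" for i
    proof -
      have "(\<Prod>j\<in>UNIV - {i}. if p j = p i then M' $ j $ p j else M x $ j $ p j) = (\<Prod>j\<in>UNIV - {i}. M x $ j $ p j)"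
        using permutes_inj[OF p] by (intro prod.cong) (auto dest: injD)
      then show ?thesis by (subst prod.remove[of UNIV i]) auto
    qed
    then have "(\<Sum>i\<in>UNIV. M' $ i $ p i * (\<Prod>j\<in>UNIV - {i}. M x $ j $ p j)) =
        (\<Sum>i\<in>UNIV. \<Prod>j\<in>UNIV. if p j = p i then M' $ j $ p j else M x $ j $ p j)" by simp
    also have "\<dots> = (\<Sum>c\<in>UNIV. \<Prod>j\<in>UNIV. if p j = c then M' $ j $ p j else M x $ j $ p j)"
      by (rule sum.reindex_bij_betw[OF permutes_imp_bij[OF p]])
    finally show ?thesis by simp
  qed
  ultimately show ?thesis
    unfolding det_def by (subst sum.swap) (simp add: sum_distrib_left)
qed

text \<open>Both sides are the derivative of det ((1 + s B) A) at s = 0: once column by column, once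
  through Jacobi's formula for det (1 + s B).\<close>

lemma sum_det_replace_column:
  fixes A B :: "complex ^ 'n ^ 'n::finite"
  shows "(\<Sum>c\<in>UNIV. det (\<chi> i j. if j = c then (B ** A) $ i $ j else A $ i $ j)) = trace B * det A"
proof -
  have d: "((\<lambda>s. det (\<chi> i j. M $ i $ j + of_real s * N $ i $ j)) has_vector_derivative
      (\<Sum>c\<in>UNIV. det (\<chi> i j. if j = c then N $ i $ j else M $ i $ j))) (at 0)" for M N :: "complex ^ 'n ^ 'n"
  proof -
    have "((\<lambda>s. (\<chi> i j. M $ i $ j + of_real s * N $ i $ j) $ i $ j) has_vector_derivative N $ i $ j) (at 0)" for i j
      by (auto intro!: derivative_eq_intros has_vector_derivative_mult_left[OF has_vector_derivative_of_real, THEN has_vector_derivative_eq_rhs])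
    from has_vector_derivative_det[where M' = N, OF this] show ?thesis by (simp cong: if_cong)
  qed
  have "det (\<chi> i j. A $ i $ j + of_real s * (B ** A) $ i $ j) =
      det (\<chi> i j. mat 1 $ i $ j + of_real s * B $ i $ j) * det A" for s :: real
  proof -
    have "(\<chi> i j. A $ i $ j + of_real s * (B ** A) $ i $ j) = (\<chi> i j. mat 1 $ i $ j + of_real s * B $ i $ j) ** A"
      by (simp add: vec_eq_iff matrix_matrix_mult_def mat_def distrib_right sum.distrib sum_distrib_left mult.assoc
          if_distrib[of "\<lambda>x. x * _"] cong: if_cong)
    then show ?thesis by (simp add: det_mul)
  qed
  then have "((\<lambda>s. det (\<chi> i j. mat 1 $ i $ j + of_real s * B $ i $ j) * det A) has_vector_derivative
      (\<Sum>c\<in>UNIV. det (\<chi> i j. if j = c then (B ** A) $ i $ j else A $ i $ j))) (at 0)"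
    using d[of A "B ** A"] by simp
  moreover have "((\<lambda>s. det (\<chi> i j. mat 1 $ i $ j + of_real s * B $ i $ j) * det A) has_vector_derivative
      (\<Sum>c\<in>UNIV. det (\<chi> i j. if j = c then B $ i $ j else mat 1 $ i $ j)) * det A) (at 0)"
    by (intro has_vector_derivative_mult_left d)
  \<comment> \<open>Cramer's rule for the identity matrix.\<close>
  moreover have "det (\<chi> i j. if j = c then B $ i $ j else mat 1 $ i $ j) = B $ c $ c" for c
  proof -
    have "(\<chi> i j. if j = c then B $ i $ j else mat 1 $ i $ j) =
        (\<chi> i j. if j = c then (mat 1 *v column c B) $ i else mat 1 $ i $ j)"
      by (auto simp: vec_eq_iff column_def)
    then show ?thesis using cramer_lemma[where A = "mat 1 :: complex^'n^'n" and x = "column c B" and k = c]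
      by (simp add: column_def)
  qed
  ultimately show ?thesis
    by (simp add: vector_derivative_unique_at trace_def)
qed

text \<open>Exchanging \<open>c\<close> and \<open>e\<close> reverses the sign of the determinant
  and, \<open>S\<close> being symmetric, changes nothing else.\<close>

lemma sum_det_two_columns:
  fixes A :: "complex ^ 'n ^ 'n::finite" and \<xi> :: "complex ^ 'n" and S :: "'n \<Rightarrow> 'n \<Rightarrow> complex ^ 'n"
  assumes S: "\<And>c e. S c e = S e c"
  shows "(\<Sum>c\<in>UNIV. \<Sum>e\<in>UNIV - {c}. det (\<chi> i j. if j = e then S c e $ i else if j = c then \<xi> $ i else A $ i $ j)) = 0"
proof -
  define f where "f c e = det (\<chi> i j. if j = e then S c e $ i else if j = c then \<xi> $ i else A $ i $ j)" for c e
  have anti: "f c e = - f e c" if "c \<noteq> e" for c e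
  proof -
    let ?p = "Transposition.transpose c e"
    let ?M = "\<chi> i j. if j = c then S e c $ i else if j = e then \<xi> $ i else A $ i $ j"
    have "(\<chi> i j. ?M $ i $ ?p j) = (\<chi> i j. if j = e then S c e $ i else if j = c then \<xi> $ i else A $ i $ j)"
      using that S[of c e] by (auto simp: vec_eq_iff Transposition.transpose_def)
    then show ?thesis
      using det_permute_columns[of ?p ?M] that
      by (simp add: f_def permutes_swap_id sign_swap_id)
  qed
  define g where "g c e = (if c = e then 0 else f c e)" for c e
  have "(\<Sum>e\<in>UNIV - {c}. f c e) = (\<Sum>e\<in>UNIV. g c e)" for c
    by (rule sum.mono_neutral_cong_left) (auto simp: g_def)
  then have "(\<Sum>c\<in>UNIV. \<Sum>e\<in>UNIV - {c}. f c e) = (\<Sum>c\<in>UNIV. \<Sum>e\<in>UNIV. g c e)" by simp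
  moreover have "g c e = - g e c" for c e
    using anti[of c e] by (auto simp: g_def)
  then have "(\<Sum>c\<in>UNIV. \<Sum>e\<in>UNIV. g c e) = (\<Sum>c\<in>UNIV. \<Sum>e\<in>UNIV. - g e c)"
    by (intro sum.cong refl)
  then have "(\<Sum>c\<in>UNIV. \<Sum>e\<in>UNIV. g c e) = - (\<Sum>c\<in>UNIV. \<Sum>e\<in>UNIV. g c e)"
    by (subst (asm) (2) sum.swap) (simp add: sum_negf)
  ultimately show ?thesis by (simp add: f_def)
qed

section \<open>The period form and graded vector fields\<close>

lemma det_scale_column:
  fixes A :: "complex ^ 'n ^ 'n::finite"
  shows "det (\<chi> i j. if j = c then k * v $ i else A $ i $ j) = k * det (\<chi> i j. if j = c then v $ i else A $ i $ j)"
proof -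
  have t: "det (\<chi> i j. if j = c then v $ i else A $ i $ j) = det (\<chi> i. if i = c then v else transpose A $ i)"
    for v
    by (subst det_transpose[symmetric], rule arg_cong[of _ _ det]) (auto simp: transpose_def vec_eq_iff)
  have "(\<chi> i j. if j = c then k * v $ i else A $ i $ j) = (\<chi> i j. if j = c then (k *s v) $ i else A $ i $ j)"
    by (simp add: vec_eq_iff)
  then show ?thesis
    by (simp only: t det_row_mul)
qed

lemma sum_prod_remove:
  fixes f f' :: "'i::finite \<Rightarrow> complex"
  assumes "\<And>i. f i \<noteq> 0"
  shows "(\<Sum>i\<in>UNIV. f' i * (\<Prod>j\<in>UNIV - {i}. f j)) = (\<Prod>i\<in>UNIV. f i) * (\<Sum>i\<in>UNIV. f' i / f i)"
  unfolding sum_distrib_left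
proof (rule sum.cong[OF refl])
  fix i show "f' i * (\<Prod>j\<in>UNIV - {i}. f j) = (\<Prod>i\<in>UNIV. f i) * (f' i / f i)"
    using prod.remove[of UNIV i f] assms[of i] by simp
qed

lemma has_vector_derivative_vec_nth:
  "(f has_vector_derivative f') F \<Longrightarrow> ((\<lambda>s. f s $ i) has_vector_derivative f' $ i) F"
  by (rule bounded_linear.has_vector_derivative[OF bounded_linear_vec_nth])

text \<open>Written without division by coordinates, so that it is also correct where some w_l
  vanish. The truncated exponent occurs only together with the factor 0.\<close>

definition deriv_monom :: "('r::finite \<Rightarrow>\<^sub>0 nat) \<Rightarrow> complex ^ 'r \<Rightarrow> complex ^ 'r \<Rightarrow> complex" where
  "deriv_monom \<alpha> w \<tau> = (\<Sum>l\<in>UNIV. of_nat (Poly_Mapping.lookup \<alpha> l) * w $ l ^ (Poly_Mapping.lookup \<alpha> l - 1) * \<tau> $ l *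
     (\<Prod>j\<in>UNIV - {l}. w $ j ^ Poly_Mapping.lookup \<alpha> j))"

lemma has_vector_derivative_eval_monom:
  assumes "(w has_vector_derivative w') (at s)"
  shows "((\<lambda>s. eval_monom \<alpha> (w s)) has_vector_derivative deriv_monom \<alpha> (w s) w') (at s)"
proof -
  have "((\<lambda>s. w s $ l ^ n) has_vector_derivative of_nat n * w s $ l ^ (n - 1) * w' $ l) (at s)" for l n
  proof -
    have "((\<lambda>s. w s $ l ^ n) has_derivative (\<lambda>h. of_nat n * (h *\<^sub>R w' $ l) * w s $ l ^ (n - 1))) (at s)"
      using has_vector_derivative_vec_nth[OF assms, of l]
      by (intro has_derivative_power) (simp add: has_vector_derivative_def)
    then show ?thesis by (simp add: has_vector_derivative_def mult_ac)
  qed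
  then show ?thesis
    unfolding eval_monom_def deriv_monom_def by (rule has_vector_derivative_prod)
qed

lemma deriv_monom_torus:
  assumes "\<And>j. w $ j \<noteq> 0"
  shows "deriv_monom \<alpha> w \<tau> = eval_monom \<alpha> w * (\<Sum>l\<in>UNIV. of_nat (Poly_Mapping.lookup \<alpha> l) * \<tau> $ l / w $ l)"
proof -
  have "of_nat n * w $ l ^ (n - 1) * \<tau> $ l / w $ l ^ n = of_nat n * \<tau> $ l / w $ l" for n l
    using assms by (cases n) auto
  then show ?thesis
    unfolding deriv_monom_def eval_monom_def using assms by (subst sum_prod_remove) simp_all
qed

definition deriv_section :: "('r::finite \<Rightarrow> int ^ 'd::finite) \<Rightarrow> ('s \<Rightarrow> 'r \<Rightarrow> int) \<Rightarrow>
    (('s, 'd) idx \<Rightarrow> complex) \<Rightarrow> 's \<Rightarrow> complex ^ 'r \<Rightarrow> complex ^ 'r \<Rightarrow> complex" where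
  "deriv_section \<rho> a b i w \<tau> =
     (\<Sum>\<mu>\<in>polytope_points \<rho> (a i). b (i, \<mu>) * deriv_monom (cox_exponent \<rho> (a i) \<mu>) w \<tau>)"

lemma has_vector_derivative_cox_section:
  assumes "(w has_vector_derivative w') (at s)"
  shows "((\<lambda>s. cox_section \<rho> a b i (w s)) has_vector_derivative deriv_section \<rho> a b i (w s) w') (at s)"
  unfolding cox_section_def deriv_section_def
  by (intro has_vector_derivative_sum has_vector_derivative_mult_right has_vector_derivative_eval_monom assms)

text \<open>The part of the derivative that comes from moving the point while the frame is held
  fixed.\<close>

definition deriv_euler ::
    "('r::finite \<Rightarrow> int ^ 'd::finite) \<Rightarrow> complex ^ 'r \<Rightarrow> complex ^ 'r \<Rightarrow> ('d \<Rightarrow> complex ^ 'r) \<Rightarrow> complex" where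
  "deriv_euler \<rho> w w' \<tau> = (\<Sum>f\<in>{f. inj f}. (\<Prod>d\<in>UNIV. of_int (\<rho> (f d) $ d)) *
     (\<Sum>i\<in>- range f. w' $ i * (\<Prod>j\<in>- range f - {i}. w $ j)) * det (\<chi> d c. \<tau> c $ f d))"

lemma has_vector_derivative_euler_form:
  assumes w: "(w has_vector_derivative w') (at s)" and \<tau>: "\<And>c. ((\<lambda>s. \<tau> s c) has_vector_derivative \<tau>' c) (at s)"
  shows "((\<lambda>s. euler_form \<rho> (w s) (\<tau> s)) has_vector_derivative
    (deriv_euler \<rho> (w s) w' (\<tau> s) + (\<Sum>c\<in>UNIV. euler_form \<rho> (w s) ((\<tau> s)(c := \<tau>' c))))) (at s)"
proof -
  let ?K = "\<lambda>f. \<Prod>d\<in>UNIV. of_int (\<rho> (f d) $ d) :: complex"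
  let ?P = "\<lambda>f s. \<Prod>j\<in>- range f. w s $ j" and ?D = "\<lambda>f s. det (\<chi> d c. \<tau> s c $ f d)"
  let ?D' = "\<lambda>f. \<Sum>c\<in>UNIV. det (\<chi> d e. ((\<tau> s)(c := \<tau>' c)) e $ f d)"
  let ?P' = "\<lambda>f. \<Sum>i\<in>- range f. w' $ i * (\<Prod>j\<in>- range f - {i}. w s $ j)"
  have D: "(?D f has_vector_derivative ?D' f) (at s)" for f
  proof -
    have "((\<lambda>s. (\<chi> d c. \<tau> s c $ f d) $ d $ c) has_vector_derivative (\<chi> d c. \<tau>' c $ f d) $ d $ c) (at s)" for d c
      using has_vector_derivative_vec_nth[OF \<tau>] by simp
    from has_vector_derivative_det[OF this] show ?thesis
      by (rule has_vector_derivative_eq_rhs) (auto intro!: sum.cong arg_cong[of _ _ det] simp: vec_eq_iff)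
  qed
  have P: "(?P f has_vector_derivative ?P' f) (at s)" for f
    by (rule has_vector_derivative_prod) (rule has_vector_derivative_vec_nth[OF w])
  have "((\<lambda>s. \<Sum>f\<in>{f. inj f}. ?K f * ?P f s * ?D f s) has_vector_derivative
      (\<Sum>f\<in>{f. inj f}. ?K f * ?P f s * ?D' f + ?K f * ?P' f * ?D f s)) (at s)"
    by (intro has_vector_derivative_sum has_vector_derivative_mult has_vector_derivative_mult_right P D)
  then show ?thesis
    unfolding euler_form_def deriv_euler_def
    by (rule has_vector_derivative_eq_rhs)
      (simp add: sum.distrib sum_distrib_left, subst sum.swap, simp)
qed

text \<open>The derivative of the period form when the point has velocity \<open>w'\<close> and the
  frame has velocity \<open>\<tau>'\<close>. The explicit formula makes it continuous in all
  arguments, on which the extension beyond the torus rests.\<close>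

definition deriv_period :: "('r::finite \<Rightarrow> int ^ 'd::finite) \<Rightarrow> ('s::finite \<Rightarrow> 'r \<Rightarrow> int) \<Rightarrow>
    (('s, 'd) idx \<Rightarrow> complex) \<Rightarrow> complex ^ 'r \<Rightarrow> complex ^ 'r \<Rightarrow> ('d \<Rightarrow> complex ^ 'r) \<Rightarrow> ('d \<Rightarrow> complex ^ 'r) \<Rightarrow> complex" where
  "deriv_period \<rho> a b w w' \<tau> \<tau>' =
     (deriv_euler \<rho> w w' \<tau> + (\<Sum>c\<in>UNIV. euler_form \<rho> w (\<tau>(c := \<tau>' c)))) / (\<Prod>i\<in>UNIV. cox_section \<rho> a b i w) -
     period_form \<rho> a b w \<tau> * (\<Sum>i\<in>UNIV. deriv_section \<rho> a b i w w' / cox_section \<rho> a b i w)"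

lemma has_vector_derivative_period_form:
  assumes w: "(w has_vector_derivative w') (at s)" and \<tau>: "\<And>c. ((\<lambda>s. \<tau> s c) has_vector_derivative \<tau>' c) (at s)"
    and nz: "\<And>i. cox_section \<rho> a b i (w s) \<noteq> 0"
  shows "((\<lambda>s. period_form \<rho> a b (w s) (\<tau> s)) has_vector_derivative deriv_period \<rho> a b (w s) w' (\<tau> s) \<tau>') (at s)"
proof -
  have P: "((\<lambda>s. \<Prod>i\<in>UNIV. cox_section \<rho> a b i (w s)) has_vector_derivative
      (\<Prod>i\<in>UNIV. cox_section \<rho> a b i (w s)) * (\<Sum>i\<in>UNIV. deriv_section \<rho> a b i (w s) w' / cox_section \<rho> a b i (w s))) (at s)"
    using has_vector_derivative_prod[of UNIV "\<lambda>i s. cox_section \<rho> a b i (w s)" "\<lambda>i. deriv_section \<rho> a b i (w s) w'" s]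
      has_vector_derivative_cox_section[OF w, of \<rho> a b]
    by (simp add: sum_prod_remove nz)
  have "(\<Prod>i\<in>UNIV. cox_section \<rho> a b i (w s)) \<noteq> 0" using nz by simp
  from has_vector_derivative_divide_complex[OF has_vector_derivative_euler_form[OF w, of \<tau> \<tau>' \<rho>, OF \<tau>] P this] show ?thesis
    unfolding period_form_def deriv_period_def
    by (rule has_vector_derivative_eq_rhs) (use nz in \<open>simp add: power2_eq_square\<close>)
qed

section \<open>Graded vector fields and logarithmic coordinates\<close>

definition field_at :: "('r::finite \<Rightarrow> 'r cox_ring) \<Rightarrow> complex ^ 'r \<Rightarrow> complex ^ 'r" where
  "field_at x w = (\<chi> j. \<Sum>\<alpha>\<in>Poly_Mapping.keys (x j). Poly_Mapping.lookup (x j) \<alpha> * eval_monom \<alpha> w)"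

definition deriv_field :: "('r::finite \<Rightarrow> 'r cox_ring) \<Rightarrow> complex ^ 'r \<Rightarrow> complex ^ 'r \<Rightarrow> complex ^ 'r" where
  "deriv_field x w \<tau> = (\<chi> j. \<Sum>\<alpha>\<in>Poly_Mapping.keys (x j). Poly_Mapping.lookup (x j) \<alpha> * deriv_monom \<alpha> w \<tau>)"

definition div_field :: "('r::finite \<Rightarrow> 'r cox_ring) \<Rightarrow> complex ^ 'r \<Rightarrow> complex" where
  "div_field x w = (\<Sum>j\<in>UNIV. deriv_field x w (axis j 1) $ j)"

text \<open>Component \<open>j\<close> has the degree of w_j, which makes the field equivariant
  under the class torus.\<close>

definition graded_field :: "('r::finite \<Rightarrow> int ^ 'd::finite) \<Rightarrow> ('r \<Rightarrow> 'r cox_ring) \<Rightarrow> bool" where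
  "graded_field \<rho> x \<longleftrightarrow> (\<forall>j. \<forall>\<alpha>\<in>Poly_Mapping.keys (x j). same_degree \<rho> \<alpha> (var j))"

lemma has_vector_derivative_vec_lambda:
  fixes f :: "'r::finite \<Rightarrow> real \<Rightarrow> complex"
  assumes "\<And>i. (f i has_vector_derivative f' i) (at s)"
  shows "((\<lambda>s. \<chi> i. f i s) has_vector_derivative (\<chi> i. f' i)) (at s)"
proof -
  have bl: "bounded_linear (axis i :: complex \<Rightarrow> complex ^ 'r)" for i
    by (rule linear_conv_bounded_linear[THEN iffD1], rule linearI) (simp_all add: vec_eq_iff axis_def)
  have "((\<lambda>s. \<Sum>i\<in>UNIV. axis i (f i s)) has_vector_derivative (\<Sum>i\<in>UNIV. axis i (f' i) :: complex ^ 'r)) (at s)"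
    by (rule has_vector_derivative_sum) (rule bounded_linear.has_vector_derivative[OF bl assms])
  moreover have "(\<Sum>i\<in>UNIV. axis i (g i)) = (\<chi> i. g i)" for g :: "'r \<Rightarrow> complex"
    by (simp add: vec_eq_iff axis_def)
  ultimately show ?thesis by simp
qed

lemma has_vector_derivative_field_at:
  assumes "(w has_vector_derivative w') (at s)"
  shows "((\<lambda>s. field_at x (w s)) has_vector_derivative deriv_field x (w s) w') (at s)"
  unfolding field_at_def deriv_field_def
proof (rule has_vector_derivative_vec_lambda)
  fix j
  show "((\<lambda>s. \<Sum>\<alpha>\<in>Poly_Mapping.keys (x j). Poly_Mapping.lookup (x j) \<alpha> * eval_monom \<alpha> (w s)) has_vector_derivative
      (\<Sum>\<alpha>\<in>Poly_Mapping.keys (x j). Poly_Mapping.lookup (x j) \<alpha> * deriv_monom \<alpha> (w s) w')) (at s)"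
    by (intro has_vector_derivative_sum has_vector_derivative_mult_right has_vector_derivative_eval_monom assms)
qed

text \<open>The values of the forms dt_d / t_d on a tangent vector.\<close>

definition log_frame :: "('r::finite \<Rightarrow> int ^ 'd::finite) \<Rightarrow> complex ^ 'r \<Rightarrow> complex ^ 'r \<Rightarrow> complex ^ 'd" where
  "log_frame \<rho> w \<tau> = (\<chi> d. \<Sum>j\<in>UNIV. of_int (\<rho> j $ d) * \<tau> $ j / w $ j)"

lemma sum_pairing_log:
  "(\<Sum>l\<in>UNIV. of_int (pairing m (\<rho> l)) * \<tau> $ l / w $ l) = (\<Sum>d\<in>UNIV. of_int (m $ d) * log_frame \<rho> w \<tau> $ d)"
proof -
  have "of_int (pairing m (\<rho> l)) * \<tau> $ l / w $ l = (\<Sum>d\<in>UNIV. of_int (m $ d) * (of_int (\<rho> l $ d) * \<tau> $ l / w $ l))" for l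
    by (simp add: pairing_def sum_distrib_right sum_divide_distrib mult.assoc)
  then have "(\<Sum>l\<in>UNIV. of_int (pairing m (\<rho> l)) * \<tau> $ l / w $ l) =
      (\<Sum>l\<in>UNIV. \<Sum>d\<in>UNIV. of_int (m $ d) * (of_int (\<rho> l $ d) * \<tau> $ l / w $ l))"
    by (rule sum.cong[OF refl])
  also have "\<dots> = (\<Sum>d\<in>UNIV. \<Sum>l\<in>UNIV. of_int (m $ d) * (of_int (\<rho> l $ d) * \<tau> $ l / w $ l))"
    by (rule sum.swap)
  finally show ?thesis by (simp add: log_frame_def sum_distrib_left)
qed

text \<open>By \<open>cox_section_eq_laurent\<close> a section is the monomial in w with exponents
  \<open>a i\<close> times a Laurent polynomial in t; the two summands come from these two
  factors.\<close>

lemma log_deriv_section: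
  assumes w: "\<And>j. w $ j \<noteq> 0"
  shows "deriv_section \<rho> a b i w \<tau> = cox_section \<rho> a b i w * (\<Sum>l\<in>UNIV. of_int (a i l) * \<tau> $ l / w $ l) +
    (\<Sum>d\<in>UNIV. (\<Sum>\<mu>\<in>polytope_points \<rho> (a i). b (i, \<mu>) * eval_monom (cox_exponent \<rho> (a i) \<mu>) w * of_int (\<mu> $ d)) * log_frame \<rho> w \<tau> $ d)"
proof -
  have "deriv_monom (cox_exponent \<rho> (a i) \<mu>) w \<tau> = eval_monom (cox_exponent \<rho> (a i) \<mu>) w *
      ((\<Sum>l\<in>UNIV. of_int (a i l) * \<tau> $ l / w $ l) + (\<Sum>d\<in>UNIV. of_int (\<mu> $ d) * log_frame \<rho> w \<tau> $ d))"
    if \<mu>: "\<mu> \<in> polytope_points \<rho> (a i)" for \<mu>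
  proof -
    have "(of_nat (Poly_Mapping.lookup (cox_exponent \<rho> (a i) \<mu>) l) :: complex) =
        of_int (pairing \<mu> (\<rho> l)) + of_int (a i l)" for l
    proof -
      have "pairing \<mu> (\<rho> l) + a i l \<ge> 0"
        using \<mu> by (auto simp: polytope_points_def dest: spec[of _ l])
      then show ?thesis by (simp add: of_nat_nat)
    qed
    then show ?thesis
      unfolding deriv_monom_torus[of w, OF w] sum_pairing_log[symmetric]
      by (simp add: distrib_right add_divide_distrib sum.distrib add.commute)
  qed
  note monom = this
  have swap: "(\<Sum>\<mu>\<in>polytope_points \<rho> (a i). \<Sum>d\<in>UNIV.
        b (i, \<mu>) * eval_monom (cox_exponent \<rho> (a i) \<mu>) w * of_int (\<mu> $ d) * log_frame \<rho> w \<tau> $ d) =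
      (\<Sum>d\<in>UNIV. (\<Sum>\<mu>\<in>polytope_points \<rho> (a i). b (i, \<mu>) * eval_monom (cox_exponent \<rho> (a i) \<mu>) w * of_int (\<mu> $ d)) *
        log_frame \<rho> w \<tau> $ d)"
    by (subst sum.swap) (simp add: sum_distrib_right)
  from monom have "deriv_section \<rho> a b i w \<tau> = (\<Sum>\<mu>\<in>polytope_points \<rho> (a i). b (i, \<mu>) * (eval_monom (cox_exponent \<rho> (a i) \<mu>) w *
      ((\<Sum>l\<in>UNIV. of_int (a i l) * \<tau> $ l / w $ l) + (\<Sum>d\<in>UNIV. of_int (\<mu> $ d) * log_frame \<rho> w \<tau> $ d))))"
    by (simp add: deriv_section_def)
  also have "\<dots> = cox_section \<rho> a b i w * (\<Sum>l\<in>UNIV. of_int (a i l) * \<tau> $ l / w $ l) +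
      (\<Sum>\<mu>\<in>polytope_points \<rho> (a i). \<Sum>d\<in>UNIV.
        b (i, \<mu>) * eval_monom (cox_exponent \<rho> (a i) \<mu>) w * of_int (\<mu> $ d) * log_frame \<rho> w \<tau> $ d)"
    unfolding cox_section_def sum_distrib_right[of _ "polytope_points \<rho> (a i)"] sum.distrib[symmetric]
    by (rule sum.cong[OF refl]) (simp add: distrib_left sum_distrib_left mult.assoc)
  finally show ?thesis by (simp only: swap)
qed

text \<open>For small e other than 0 the point w + (e, ..., e) has no vanishing coordinate, so that
  \<open>w\<close> is a limit of points of the torus.\<close>

lemma dense_torus:
  fixes F :: "complex ^ 'r::finite \<Rightarrow> complex"
  assumes F: "continuous_on S F" and S: "open S" and w: "w \<in> S"
    and zero: "\<And>v. v \<in> S \<Longrightarrow> (\<And>j. v $ j \<noteq> 0) \<Longrightarrow> F v = 0"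
  shows "F w = 0"
proof -
  let ?v = "\<lambda>e::real. w + (\<chi> j. of_real e)"
  have lim: "(?v \<longlongrightarrow> w) (at 0)"
  proof -
    have "((\<lambda>e. \<chi> j. w $ j + of_real e) \<longlongrightarrow> (\<chi> j. w $ j + of_real 0)) (at 0)"
      by (intro tendsto_vec_lambda tendsto_intros)
    moreover have "(\<lambda>e. \<chi> j. w $ j + of_real e) = ?v" by (simp add: vec_eq_iff fun_eq_iff)
    ultimately show ?thesis by simp
  qed
  have ev_S: "eventually (\<lambda>e. ?v e \<in> S) (at 0)"
    using topological_tendstoD[OF lim S w] .
  have "eventually (\<lambda>e. ?v e $ j \<noteq> 0) (at 0)" for j
  proof (cases "w $ j = 0")
    case True
    then show ?thesis by (auto simp: eventually_at_filter)
  next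
    case False
    have "((\<lambda>e. ?v e $ j) \<longlongrightarrow> w $ j) (at 0)" using lim by (rule tendsto_vec_nth)
    then show ?thesis using False by (rule tendsto_imp_eventually_ne)
  qed
  then have "eventually (\<lambda>e. \<forall>j. ?v e $ j \<noteq> 0) (at 0)" by (rule eventually_all_finite)
  with ev_S have "eventually (\<lambda>e. F (?v e) = 0) (at 0)"
    by eventually_elim (auto intro: zero)
  moreover have "((\<lambda>e. F (?v e)) \<longlongrightarrow> F w) (at 0)"
    using F S w lim by (metis continuous_on_eq_continuous_at isCont_tendsto_compose)
  ultimately show ?thesis
    using tendsto_eventually[of "\<lambda>e. F (?v e)" 0 "at (0::real)"] tendsto_unique[OF trivial_limit_at] by blast
qed

lemma period_form_torus:
  assumes w: "\<And>j. w $ j \<noteq> 0"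
  shows "period_form \<rho> a b w \<tau> = (\<Prod>j\<in>UNIV. w $ j) / (\<Prod>i\<in>UNIV. cox_section \<rho> a b i w) *
    det (\<chi> d c. log_frame \<rho> w (\<tau> c) $ d)"
  using euler_form_on_torus[of w \<rho> \<tau>, OF w] by (simp add: period_form_def log_frame_def)

text \<open>For every monomial \<open>\<alpha>\<close> of component \<open>j\<close> the quotient of
  this monomial by w_j has degree 0 and is a character of the torus. The logarithmic components of
  the field are therefore functions of t alone, and \<open>B\<close> is their derivative in
  logarithmic coordinates.\<close>

lemma log_frame_deriv_field:
  fixes w :: "complex ^ 'r::finite" and \<rho> :: "'r \<Rightarrow> int ^ 'd::finite"
  assumes w: "\<And>j. w $ j \<noteq> 0" and x: "graded_field \<rho> x"
  shows "\<exists>B :: complex ^ 'd ^ 'd.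
    (\<forall>\<tau> d. (\<Sum>j\<in>UNIV. of_int (\<rho> j $ d) * (deriv_field x w \<tau> $ j / w $ j - field_at x w $ j * \<tau> $ j / (w $ j)\<^sup>2)) =
      (B *v log_frame \<rho> w \<tau>) $ d) \<and>
    trace B = div_field x w - (\<Sum>j\<in>UNIV. field_at x w $ j / w $ j)"
proof -
  have ex: "\<exists>m. \<forall>l. int (Poly_Mapping.lookup \<alpha> l) - int (Poly_Mapping.lookup (var j) l) = pairing m (\<rho> l)"
    if "\<alpha> \<in> Poly_Mapping.keys (x j)" for j \<alpha>
    using x that unfolding graded_field_def same_degree_def lin_equiv_def by blast
  define m where "m j \<alpha> = (SOME m. \<forall>l. int (Poly_Mapping.lookup \<alpha> l) - int (Poly_Mapping.lookup (var j) l) = pairing m (\<rho> l))"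
    for j \<alpha>
  have m: "int (Poly_Mapping.lookup \<alpha> l) - int (Poly_Mapping.lookup (var j) l) = pairing (m j \<alpha>) (\<rho> l)"
    if "\<alpha> \<in> Poly_Mapping.keys (x j)" for j \<alpha> l
    using someI_ex[OF ex[OF that]] unfolding m_def by blast
  have m': "of_nat (Poly_Mapping.lookup \<alpha> l) - of_nat (Poly_Mapping.lookup (var j) l) = (of_int (pairing (m j \<alpha>) (\<rho> l)) :: complex)"
    if "\<alpha> \<in> Poly_Mapping.keys (x j)" for j \<alpha> l
    by (metis m[OF that] of_int_diff of_int_of_nat_eq)
  define k where "k j \<alpha> = Poly_Mapping.lookup (x j) \<alpha> * eval_monom \<alpha> w / w $ j" for j \<alpha>
  have single: "(\<Sum>l\<in>UNIV. of_nat (Poly_Mapping.lookup (var j) l) * v $ l / w $ l) = v $ j / w $ j" for v :: "complex ^ 'r" and j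
  proof -
    have "(\<Sum>l\<in>UNIV. of_nat (Poly_Mapping.lookup (var j) l) * v $ l / w $ l) = (\<Sum>l\<in>UNIV. if l = j then v $ l / w $ l else 0)"
      by (rule sum.cong[OF refl]) (auto simp: lookup_single when_def)
    then show ?thesis by simp
  qed
  have log: "deriv_monom \<alpha> w \<tau> = eval_monom \<alpha> w * (\<tau> $ j / w $ j + (\<Sum>l\<in>UNIV. of_int (pairing (m j \<alpha>) (\<rho> l)) * \<tau> $ l / w $ l))"
    if "\<alpha> \<in> Poly_Mapping.keys (x j)" for j \<alpha> \<tau>
    unfolding deriv_monom_torus[of w, OF w] m'[OF that, symmetric] single[where v = \<tau> and j = j, symmetric] sum.distrib[symmetric]
    by (intro arg_cong2[where f = "(*)"] refl sum.cong) (simp add: diff_divide_distrib left_diff_distrib)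
  have termj: "deriv_field x w \<tau> $ j / w $ j - field_at x w $ j * \<tau> $ j / (w $ j)\<^sup>2 =
      (\<Sum>\<alpha>\<in>Poly_Mapping.keys (x j). k j \<alpha> * (\<Sum>l\<in>UNIV. of_int (pairing (m j \<alpha>) (\<rho> l)) * \<tau> $ l / w $ l))" for j \<tau>
  proof -
    have "deriv_field x w \<tau> $ j / w $ j - field_at x w $ j * \<tau> $ j / (w $ j)\<^sup>2 =
      (\<Sum>\<alpha>\<in>Poly_Mapping.keys (x j). Poly_Mapping.lookup (x j) \<alpha> * deriv_monom \<alpha> w \<tau> / w $ j -
        Poly_Mapping.lookup (x j) \<alpha> * eval_monom \<alpha> w * \<tau> $ j / (w $ j)\<^sup>2)"
      by (simp add: deriv_field_def field_at_def sum_subtractf sum_divide_distrib sum_distrib_right)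
    also have "\<dots> = (\<Sum>\<alpha>\<in>Poly_Mapping.keys (x j). k j \<alpha> * (\<Sum>l\<in>UNIV. of_int (pairing (m j \<alpha>) (\<rho> l)) * \<tau> $ l / w $ l))"
      by (rule sum.cong[OF refl]) (use w in \<open>simp add: log k_def field_simps power2_eq_square\<close>)
    finally show ?thesis .
  qed
  define B :: "complex ^ 'd ^ 'd" where
    "B = (\<chi> d d'. \<Sum>j\<in>UNIV. \<Sum>\<alpha>\<in>Poly_Mapping.keys (x j). of_int (\<rho> j $ d) * k j \<alpha> * of_int (m j \<alpha> $ d'))"
  show ?thesis
  proof (intro exI[of _ B] conjI allI)
    fix \<tau> d
    have "(\<Sum>j\<in>UNIV. of_int (\<rho> j $ d) * (deriv_field x w \<tau> $ j / w $ j - field_at x w $ j * \<tau> $ j / (w $ j)\<^sup>2)) =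
        (\<Sum>j\<in>UNIV. \<Sum>\<alpha>\<in>Poly_Mapping.keys (x j). \<Sum>d'\<in>UNIV. of_int (\<rho> j $ d) * k j \<alpha> * of_int (m j \<alpha> $ d') * log_frame \<rho> w \<tau> $ d')"
      unfolding termj sum_pairing_log by (simp add: sum_distrib_left mult.assoc)
    also have "\<dots> = (\<Sum>j\<in>UNIV. \<Sum>d'\<in>UNIV. \<Sum>\<alpha>\<in>Poly_Mapping.keys (x j). of_int (\<rho> j $ d) * k j \<alpha> * of_int (m j \<alpha> $ d') * log_frame \<rho> w \<tau> $ d')"
      by (rule sum.cong[OF refl]) (rule sum.swap)
    also have "\<dots> = (\<Sum>d'\<in>UNIV. \<Sum>j\<in>UNIV. \<Sum>\<alpha>\<in>Poly_Mapping.keys (x j). of_int (\<rho> j $ d) * k j \<alpha> * of_int (m j \<alpha> $ d') * log_frame \<rho> w \<tau> $ d')"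
      by (rule sum.swap)
    also have "\<dots> = (B *v log_frame \<rho> w \<tau>) $ d"
      by (simp add: B_def matrix_vector_mult_def sum_distrib_right)
    finally show "(\<Sum>j\<in>UNIV. of_int (\<rho> j $ d) * (deriv_field x w \<tau> $ j / w $ j - field_at x w $ j * \<tau> $ j / (w $ j)\<^sup>2)) =
      (B *v log_frame \<rho> w \<tau>) $ d" .
  next
    have "trace B = (\<Sum>d\<in>UNIV. \<Sum>j\<in>UNIV. \<Sum>\<alpha>\<in>Poly_Mapping.keys (x j). of_int (\<rho> j $ d) * k j \<alpha> * of_int (m j \<alpha> $ d))"
      by (simp add: trace_def B_def)
    also have "\<dots> = (\<Sum>j\<in>UNIV. \<Sum>d\<in>UNIV. \<Sum>\<alpha>\<in>Poly_Mapping.keys (x j). of_int (\<rho> j $ d) * k j \<alpha> * of_int (m j \<alpha> $ d))"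
      by (rule sum.swap)
    also have "\<dots> = (\<Sum>j\<in>UNIV. \<Sum>\<alpha>\<in>Poly_Mapping.keys (x j). \<Sum>d\<in>UNIV. of_int (\<rho> j $ d) * k j \<alpha> * of_int (m j \<alpha> $ d))"
      by (rule sum.cong[OF refl]) (rule sum.swap)
    also have "\<dots> = (\<Sum>j\<in>UNIV. \<Sum>\<alpha>\<in>Poly_Mapping.keys (x j). k j \<alpha> * of_int (pairing (m j \<alpha>) (\<rho> j)))"
      by (simp add: pairing_def sum_distrib_left mult_ac)
    \<comment> \<open>The pairing with the ray \<open>j\<close> is isolated by evaluating
      \<open>termj\<close> on the basis vector \<open>axis j 1\<close>.\<close>
    also have "\<dots> = (\<Sum>j\<in>UNIV. deriv_field x w (axis j 1) $ j - field_at x w $ j / w $ j)"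
    proof (rule sum.cong[OF refl])
      fix j
      have ax: "(\<Sum>l\<in>UNIV. f l * axis j (1::complex) $ l / w $ l) = f j / w $ j" for f :: "'r \<Rightarrow> complex"
      proof -
        have "(\<Sum>l\<in>UNIV. f l * axis j (1::complex) $ l / w $ l) = (\<Sum>l\<in>UNIV. if l = j then f l / w $ l else 0)"
          by (rule sum.cong[OF refl]) (auto simp: axis_def)
        then show ?thesis by simp
      qed
      from termj[of "axis j 1" j]
      have "deriv_field x w (axis j 1) $ j / w $ j - field_at x w $ j / (w $ j)\<^sup>2 =
          (\<Sum>\<alpha>\<in>Poly_Mapping.keys (x j). k j \<alpha> * of_int (pairing (m j \<alpha>) (\<rho> j))) / w $ j"
        by (simp add: ax sum_divide_distrib)
      then have "(deriv_field x w (axis j 1) $ j / w $ j - field_at x w $ j / (w $ j)\<^sup>2) * w $ j =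
          (\<Sum>\<alpha>\<in>Poly_Mapping.keys (x j). k j \<alpha> * of_int (pairing (m j \<alpha>) (\<rho> j)))"
        using w[of j] by simp
      then show "(\<Sum>\<alpha>\<in>Poly_Mapping.keys (x j). k j \<alpha> * of_int (pairing (m j \<alpha>) (\<rho> j))) =
          deriv_field x w (axis j 1) $ j - field_at x w $ j / w $ j"
        using w[of j] by (simp add: left_diff_distrib power2_eq_square)
    qed
    finally show "trace B = div_field x w - (\<Sum>j\<in>UNIV. field_at x w $ j / w $ j)"
      by (simp add: div_field_def sum_subtractf)
  qed
qed

text \<open>On the torus the period form is a function times \<open>\<And>\<^sub>d dt\<^sub>d / t\<^sub>d\<close>.  The terms with second derivatives
  cancel in pairs, and what remains is \<open>tr (B + L)\<close>, where \<open>B\<close> is the derivative of the field in logarithmic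
  coordinates and \<open>L\<close> has rank one and comes from the derivative of the function.\<close>

lemma lie_derivative_torus:
  fixes w :: "complex ^ 'r::finite" and \<rho> :: "'r \<Rightarrow> int ^ 'd::finite" and a :: "'s::finite \<Rightarrow> 'r \<Rightarrow> int"
  assumes w: "\<And>j. w $ j \<noteq> 0" and nz: "\<And>i. cox_section \<rho> a b i w \<noteq> 0"
    and a: "\<And>j. (\<Sum>i\<in>UNIV. a i j) = 1" and x: "graded_field \<rho> x" and q: "\<And>c e. q c e = q e c"
  shows "(\<Sum>c\<in>UNIV. deriv_period \<rho> a b w (\<tau> c) (\<tau>(c := field_at x w))
      (\<lambda>e. if e = c then deriv_field x w (\<tau> c) else q c e)) =
    (div_field x w - (\<Sum>i\<in>UNIV. deriv_section \<rho> a b i w (field_at x w) / cox_section \<rho> a b i w)) *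
      period_form \<rho> a b w \<tau>"
proof -
  define A where "A = (\<chi> d c. log_frame \<rho> w (\<tau> c) $ d)"
  define \<xi> where "\<xi> = log_frame \<rho> w (field_at x w)"
  \<comment> \<open>The coefficient of the period form with respect to the wedge of the forms dt_d /
    t_d.\<close>
  define Q where "Q w = (\<Prod>j\<in>UNIV. w $ j) / (\<Prod>i\<in>UNIV. cox_section \<rho> a b i w)" for w
  \<comment> \<open>The mixed second derivatives \<open>q\<close> of a parametrization, rewritten in
    logarithmic coordinates.\<close>
  define S where "S c e = (\<chi> d. \<Sum>j\<in>UNIV. of_int (\<rho> j $ d) * (q c e $ j / w $ j - \<tau> e $ j * \<tau> c $ j / (w $ j)\<^sup>2))" for c e
  have S_sym: "S c e = S e c" for c e
    by (simp add: S_def q[of c e] mult.commute[of "\<tau> e $ _"])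
  obtain B where B: "\<And>\<tau> d. (\<Sum>j\<in>UNIV. of_int (\<rho> j $ d) * (deriv_field x w \<tau> $ j / w $ j - field_at x w $ j * \<tau> $ j / (w $ j)\<^sup>2)) =
      (B *v log_frame \<rho> w \<tau>) $ d"
    and trB: "trace B = div_field x w - (\<Sum>j\<in>UNIV. field_at x w $ j / w $ j)"
    using log_frame_deriv_field[of w \<rho> x, OF w x] by blast
  \<comment> \<open>The components of d log Q in logarithmic coordinates. The monomial factors of
    the sections contribute nothing: their exponents \<open>a i j\<close> sum to 1 over i and cancel
    against the product of the w_j.\<close>
  define \<Lambda> where "\<Lambda> d = - (\<Sum>i\<in>UNIV. (\<Sum>\<mu>\<in>polytope_points \<rho> (a i). b (i, \<mu>) * eval_monom (cox_exponent \<rho> (a i) \<mu>) w * of_int (\<mu> $ d)) /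
      cox_section \<rho> a b i w)" for d
  define logQ where "logQ v = (\<Sum>j\<in>UNIV. v $ j / w $ j) - (\<Sum>i\<in>UNIV. deriv_section \<rho> a b i w v / cox_section \<rho> a b i w)" for v
  have logQ: "logQ v = (\<Sum>d\<in>UNIV. \<Lambda> d * log_frame \<rho> w v $ d)" for v
  proof -
    define U where "U i d = (\<Sum>\<mu>\<in>polytope_points \<rho> (a i). b (i, \<mu>) * eval_monom (cox_exponent \<rho> (a i) \<mu>) w * of_int (\<mu> $ d))" for i d
    have "deriv_section \<rho> a b i w v / cox_section \<rho> a b i w =
        (\<Sum>l\<in>UNIV. of_int (a i l) * (v $ l / w $ l)) + (\<Sum>d\<in>UNIV. U i d / cox_section \<rho> a b i w * log_frame \<rho> w v $ d)" for i
      unfolding log_deriv_section[of w, OF w] U_def[symmetric] using nz[of i] by (simp add: add_divide_distrib sum_divide_distrib)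
    then have "(\<Sum>i\<in>UNIV. deriv_section \<rho> a b i w v / cox_section \<rho> a b i w) =
        (\<Sum>i\<in>UNIV. \<Sum>l\<in>UNIV. of_int (a i l) * (v $ l / w $ l)) +
        (\<Sum>i\<in>UNIV. \<Sum>d\<in>UNIV. U i d / cox_section \<rho> a b i w * log_frame \<rho> w v $ d)"
      by (simp add: sum.distrib)
    moreover have "(\<Sum>i\<in>UNIV. \<Sum>l\<in>UNIV. of_int (a i l) * (v $ l / w $ l)) = (\<Sum>l\<in>UNIV. v $ l / w $ l)"
    proof -
      have "(\<Sum>i\<in>UNIV. of_int (a i l)) = (1::complex)" for l
        using a[of l] by (metis of_int_1 of_int_sum)
      then have "(\<Sum>i\<in>UNIV. of_int (a i l) * (v $ l / w $ l)) = v $ l / w $ l" for l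
        by (simp only: sum_distrib_right[symmetric] mult_1)
      then show ?thesis by (subst sum.swap) (simp only:)
    qed
    moreover have "(\<Sum>i\<in>UNIV. \<Sum>d\<in>UNIV. U i d / cox_section \<rho> a b i w * log_frame \<rho> w v $ d) =
        - (\<Sum>d\<in>UNIV. \<Lambda> d * log_frame \<rho> w v $ d)"
      by (subst sum.swap) (simp add: \<Lambda>_def U_def[symmetric] sum_distrib_right sum_negf)
    ultimately show ?thesis by (simp add: logQ_def)
  qed
  define M where "M c = (\<chi> d e. if e = c then \<xi> $ d else A $ d $ e)" for c
  define M' where "M' c = (\<chi> d e. if e = c then (B ** A) $ d $ e else S c e $ d)" for c
  have Q_deriv: "((\<lambda>s. Q (u s)) has_vector_derivative Q w * logQ v) (at 0)"
    if u: "(u has_vector_derivative v) (at 0)" and u0: "u 0 = w" for u v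
  proof -
    have "((\<lambda>s. \<Prod>j\<in>UNIV. u s $ j) has_vector_derivative (\<Sum>i\<in>UNIV. v $ i * (\<Prod>j\<in>UNIV - {i}. u 0 $ j))) (at 0)"
      by (rule has_vector_derivative_prod) (rule has_vector_derivative_vec_nth[OF u])
    then have n: "((\<lambda>s. \<Prod>j\<in>UNIV. u s $ j) has_vector_derivative (\<Prod>j\<in>UNIV. w $ j) * (\<Sum>i\<in>UNIV. v $ i / w $ i)) (at 0)"
      by (simp add: u0 sum_prod_remove w)
    have "((\<lambda>s. \<Prod>i\<in>UNIV. cox_section \<rho> a b i (u s)) has_vector_derivative
        (\<Sum>i\<in>UNIV. deriv_section \<rho> a b i (u 0) v * (\<Prod>j\<in>UNIV - {i}. cox_section \<rho> a b j (u 0)))) (at 0)"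
      by (rule has_vector_derivative_prod) (rule has_vector_derivative_cox_section[OF u])
    then have d: "((\<lambda>s. \<Prod>i\<in>UNIV. cox_section \<rho> a b i (u s)) has_vector_derivative
        (\<Prod>i\<in>UNIV. cox_section \<rho> a b i w) * (\<Sum>i\<in>UNIV. deriv_section \<rho> a b i w v / cox_section \<rho> a b i w)) (at 0)"
      by (simp add: u0 sum_prod_remove nz)
    have nz0: "(\<Prod>i\<in>UNIV. cox_section \<rho> a b i (u 0)) \<noteq> 0" using nz by (simp add: u0)
    show ?thesis
      unfolding Q_def using has_vector_derivative_divide_complex[OF n d nz0]
      by (rule has_vector_derivative_eq_rhs) (use nz in \<open>simp add: u0 logQ_def power2_eq_square right_diff_distrib\<close>)
  qed
  have "deriv_period \<rho> a b w (\<tau> c) (\<tau>(c := field_at x w)) (\<lambda>e. if e = c then deriv_field x w (\<tau> c) else q c e) =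
      Q w * logQ (\<tau> c) * det (M c) + Q w * (\<Sum>e\<in>UNIV. det (\<chi> d f. if f = e then M' c $ d $ f else M c $ d $ f))" for c
  proof -
    \<comment> \<open>A test curve with a moving frame that has the prescribed velocities. The
      period form along it is differentiated in two ways, directly and in logarithmic
      coordinates.\<close>
    define u where "u s = w + s *\<^sub>R \<tau> c" for s :: real
    define \<theta> where "\<theta> s e = (if e = c then field_at x (u s) else \<tau> e + s *\<^sub>R q c e)" for s e
    have u: "(u has_vector_derivative \<tau> c) (at 0)"
      unfolding u_def by (auto intro!: derivative_eq_intros)
    have u0: "u 0 = w" by (simp add: u_def)
    have \<theta>: "((\<lambda>s. \<theta> s e) has_vector_derivative (if e = c then deriv_field x w (\<tau> c) else q c e)) (at 0)" for e
    proof (cases "e = c")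
      case True
      then show ?thesis using has_vector_derivative_field_at[OF u, of x] by (simp add: \<theta>_def u0)
    next
      case False
      then show ?thesis by (auto simp: \<theta>_def intro!: derivative_eq_intros)
    qed
    have \<theta>0: "\<theta> 0 = \<tau>(c := field_at x w)" by (auto simp: \<theta>_def u0)
    have 1: "((\<lambda>s. period_form \<rho> a b (u s) (\<theta> s)) has_vector_derivative
        deriv_period \<rho> a b w (\<tau> c) (\<tau>(c := field_at x w)) (\<lambda>e. if e = c then deriv_field x w (\<tau> c) else q c e)) (at 0)"
      using has_vector_derivative_period_form[of u "\<tau> c" 0 \<theta> "\<lambda>e. if e = c then deriv_field x w (\<tau> c) else q c e" \<rho> a b, OF u \<theta>] nz
      by (simp add: u0 \<theta>0)
    define N where "N s = (\<chi> d e. log_frame \<rho> (u s) (\<theta> s e) $ d)" for s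
    have N0: "N 0 = M c"
      by (simp add: N_def M_def vec_eq_iff \<theta>_def u0 A_def \<xi>_def)
    have N: "((\<lambda>s. N s $ d $ e) has_vector_derivative M' c $ d $ e) (at 0)" for d e
    proof -
      define \<theta>' where "\<theta>' = (if e = c then deriv_field x w (\<tau> c) else q c e)"
      have "((\<lambda>s. \<theta> s e $ j / u s $ j) has_vector_derivative
          (\<theta>' $ j / u 0 $ j - \<theta> 0 e $ j * \<tau> c $ j / (u 0 $ j)\<^sup>2)) (at 0)" for j
      proof (rule has_vector_derivative_divide_complex)
        show "((\<lambda>s. \<theta> s e $ j) has_vector_derivative \<theta>' $ j) (at 0)"
          unfolding \<theta>'_def by (rule has_vector_derivative_vec_nth[OF \<theta>])
        show "((\<lambda>s. u s $ j) has_vector_derivative \<tau> c $ j) (at 0)"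
          by (rule has_vector_derivative_vec_nth[OF u])
      qed (simp add: u0 w)
      then have "((\<lambda>s. \<Sum>j\<in>UNIV. of_int (\<rho> j $ d) * (\<theta> s e $ j / u s $ j)) has_vector_derivative
          (\<Sum>j\<in>UNIV. of_int (\<rho> j $ d) * (\<theta>' $ j / u 0 $ j - \<theta> 0 e $ j * \<tau> c $ j / (u 0 $ j)\<^sup>2))) (at 0)"
        by (intro has_vector_derivative_sum has_vector_derivative_mult_right)
      moreover have "(\<Sum>j\<in>UNIV. of_int (\<rho> j $ d) * (\<theta>' $ j / u 0 $ j - \<theta> 0 e $ j * \<tau> c $ j / (u 0 $ j)\<^sup>2)) = M' c $ d $ e"
      proof (cases "e = c")
        case True
        then show ?thesis using B[of d "\<tau> c"]
          by (simp add: \<theta>'_def u0 \<theta>_def M'_def matrix_matrix_mult_def matrix_vector_mult_def A_def)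
      next
        case False
        then show ?thesis by (simp add: \<theta>'_def u0 \<theta>_def M'_def S_def)
      qed
      ultimately show ?thesis by (simp add: N_def log_frame_def)
    qed
    have 2: "((\<lambda>s. Q (u s) * det (N s)) has_vector_derivative
        Q (u 0) * (\<Sum>e\<in>UNIV. det (\<chi> d f. if f = e then M' c $ d $ f else N 0 $ d $ f)) + Q w * logQ (\<tau> c) * det (N 0)) (at 0)"
      by (intro has_vector_derivative_mult Q_deriv u u0 has_vector_derivative_det N)
    define T where "T = (\<Inter>j. {s. u s $ j \<noteq> 0})"
    have cont: "continuous_on UNIV (\<lambda>s. u s $ j)" for j
      unfolding u_def by (intro continuous_intros)
    have T: "open T" unfolding T_def
      by (intro open_INT ballI finite open_Collect_neq cont continuous_on_const)
    have T0: "0 \<in> T" using w by (simp add: u0 T_def)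
    have eq: "Q (u s) * det (N s) = period_form \<rho> a b (u s) (\<theta> s)" if "s \<in> T" for s
      using that period_form_torus[of "u s" \<rho> a b "\<theta> s"] by (simp add: Q_def N_def T_def)
    have "((\<lambda>s. period_form \<rho> a b (u s) (\<theta> s)) has_vector_derivative
        Q (u 0) * (\<Sum>e\<in>UNIV. det (\<chi> d f. if f = e then M' c $ d $ f else N 0 $ d $ f)) + Q w * logQ (\<tau> c) * det (N 0)) (at 0)"
      by (rule has_vector_derivative_transform_within_open[OF 2 T T0 eq])
    from vector_derivative_unique_at[OF 1 this] show ?thesis
      by (simp only: u0 N0 add.commute)
  qed
  then have "(\<Sum>c\<in>UNIV. deriv_period \<rho> a b w (\<tau> c) (\<tau>(c := field_at x w)) (\<lambda>e. if e = c then deriv_field x w (\<tau> c) else q c e)) =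
      Q w * ((\<Sum>c\<in>UNIV. logQ (\<tau> c) * det (M c)) +
        (\<Sum>c\<in>UNIV. \<Sum>e\<in>UNIV. det (\<chi> d f. if f = e then M' c $ d $ f else M c $ d $ f)))"
    by (simp add: sum.distrib sum_distrib_left distrib_left mult.assoc)
  moreover have "(\<Sum>c\<in>UNIV. logQ (\<tau> c) * det (M c)) = logQ (field_at x w) * det A"
  proof -
    \<comment> \<open>The matrix of rank one built from the field and d log Q; its trace is the
      derivative of log Q along the field.\<close>
    define L where "L = (\<chi> i d. \<xi> $ i * \<Lambda> d)"
    have "logQ (\<tau> c) * det (M c) = det (\<chi> i j. if j = c then (L ** A) $ i $ j else A $ i $ j)" for c
    proof -
      have "(L ** A) $ i $ c = logQ (\<tau> c) * \<xi> $ i" for i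
        by (simp add: L_def matrix_matrix_mult_def A_def logQ sum_distrib_left mult_ac)
      then have "(\<chi> i j. if j = c then (L ** A) $ i $ j else A $ i $ j) = (\<chi> i j. if j = c then logQ (\<tau> c) * \<xi> $ i else A $ i $ j)"
        by (simp add: vec_eq_iff)
      then show ?thesis by (simp only: det_scale_column M_def)
    qed
    then have "(\<Sum>c\<in>UNIV. logQ (\<tau> c) * det (M c)) = trace L * det A"
      by (simp only: sum_det_replace_column)
    moreover have "trace L = logQ (field_at x w)"
      by (simp add: trace_def L_def logQ \<xi>_def mult.commute)
    ultimately show ?thesis by simp
  qed
  moreover have "(\<Sum>c\<in>UNIV. \<Sum>e\<in>UNIV. det (\<chi> d f. if f = e then M' c $ d $ f else M c $ d $ f)) = trace B * det A"
  proof -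
    have "(\<Sum>e\<in>UNIV. det (\<chi> d f. if f = e then M' c $ d $ f else M c $ d $ f)) =
        det (\<chi> i j. if j = c then (B ** A) $ i $ j else A $ i $ j) +
        (\<Sum>e\<in>UNIV - {c}. det (\<chi> i j. if j = e then S c e $ i else if j = c then \<xi> $ i else A $ i $ j))" for c
    proof -
      have "(\<chi> d f. if f = c then M' c $ d $ f else M c $ d $ f) = (\<chi> i j. if j = c then (B ** A) $ i $ j else A $ i $ j)"
        by (simp add: vec_eq_iff M'_def M_def)
      moreover have "(\<chi> d f. if f = e then M' c $ d $ f else M c $ d $ f) =
          (\<chi> i j. if j = e then S c e $ i else if j = c then \<xi> $ i else A $ i $ j)" if "e \<noteq> c" for e
        using that by (simp add: vec_eq_iff M'_def M_def)
      ultimately show ?thesis by (subst sum.remove[of UNIV c]) (auto intro!: sum.cong)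
    qed
    then show ?thesis
      by (simp only: sum.distrib sum_det_two_columns[of S, OF S_sym] sum_det_replace_column add_0_right)
  qed
  moreover have "period_form \<rho> a b w \<tau> = Q w * det A"
    using period_form_torus[of w, OF w] by (simp add: Q_def A_def)
  moreover have "logQ (field_at x w) * det A + trace B * det A =
      (div_field x w - (\<Sum>i\<in>UNIV. deriv_section \<rho> a b i w (field_at x w) / cox_section \<rho> a b i w)) * det A"
    by (simp add: trB logQ_def distrib_right[symmetric])
  ultimately show ?thesis by (simp only: mult_ac)
qed

section \<open>Continuity of the forms in the point and the frame\<close>

lemma continuous_on_det:
  fixes M :: "'a::topological_space \<Rightarrow> complex ^ 'n ^ 'n::finite"
  assumes "\<And>i j. continuous_on S (\<lambda>x. M x $ i $ j)"
  shows "continuous_on S (\<lambda>x. det (M x))"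
  unfolding det_def by (intro continuous_intros assms)

lemma continuous_on_nth:
  "continuous_on S f \<Longrightarrow> continuous_on S (\<lambda>x. f x $ i)"
  by (rule continuous_on_component)

lemma continuous_on_eval_monom:
  "continuous_on S f \<Longrightarrow> continuous_on S (\<lambda>x. eval_monom \<alpha> (f x))"
  unfolding eval_monom_def by (intro continuous_intros continuous_on_nth)

lemma continuous_on_deriv_monom:
  "continuous_on S f \<Longrightarrow> continuous_on S g \<Longrightarrow> continuous_on S (\<lambda>x. deriv_monom \<alpha> (f x) (g x))"
  unfolding deriv_monom_def by (intro continuous_intros continuous_on_nth)

lemma continuous_on_cox_section:
  "continuous_on S f \<Longrightarrow> continuous_on S (\<lambda>x. cox_section \<rho> a b i (f x))"
  unfolding cox_section_def by (intro continuous_intros continuous_on_eval_monom)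

lemma continuous_on_deriv_section:
  "continuous_on S f \<Longrightarrow> continuous_on S g \<Longrightarrow> continuous_on S (\<lambda>x. deriv_section \<rho> a b i (f x) (g x))"
  unfolding deriv_section_def by (intro continuous_intros continuous_on_deriv_monom)

lemma continuous_on_field_at:
  "continuous_on S f \<Longrightarrow> continuous_on S (\<lambda>w. field_at x (f w))"
  unfolding field_at_def by (intro continuous_on_vec_lambda continuous_intros continuous_on_eval_monom)

lemma continuous_on_deriv_field:
  "continuous_on S f \<Longrightarrow> continuous_on S g \<Longrightarrow> continuous_on S (\<lambda>w. deriv_field x (f w) (g w))"
  unfolding deriv_field_def by (intro continuous_on_vec_lambda continuous_intros continuous_on_deriv_monom)

lemma continuous_on_div_field:
  "continuous_on S f \<Longrightarrow> continuous_on S (\<lambda>w. div_field x (f w))"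
  unfolding div_field_def
  by (intro continuous_intros continuous_on_nth continuous_on_deriv_field)

lemma continuous_on_euler_form:
  assumes "continuous_on S f" "\<And>c. continuous_on S (\<lambda>x. g x c)"
  shows "continuous_on S (\<lambda>x. euler_form \<rho> (f x) (g x))"
  unfolding euler_form_def
  by (intro continuous_on_sum continuous_on_mult continuous_on_const continuous_on_prod continuous_on_det)
    (simp_all add: continuous_on_nth assms)

lemma continuous_on_deriv_euler:
  assumes "continuous_on S f" "continuous_on S f'" "\<And>c. continuous_on S (\<lambda>x. g x c)"
  shows "continuous_on S (\<lambda>x. deriv_euler \<rho> (f x) (f' x) (g x))"
  unfolding deriv_euler_def
  by (intro continuous_on_sum continuous_on_mult continuous_on_const continuous_on_prod continuous_on_det)
    (simp_all add: continuous_on_nth assms)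

lemma continuous_on_period_form:
  assumes "continuous_on S f" "\<And>c. continuous_on S (\<lambda>x. g x c)"
    and "\<And>x i. x \<in> S \<Longrightarrow> cox_section \<rho> a b i (f x) \<noteq> 0"
  shows "continuous_on S (\<lambda>x. period_form \<rho> a b (f x) (g x))"
  unfolding period_form_def
  by (intro continuous_on_divide continuous_on_euler_form continuous_on_prod continuous_on_cox_section assms)
    (simp add: assms)

lemma continuous_on_deriv_period:
  assumes "continuous_on S f" "continuous_on S f'" "\<And>c. continuous_on S (\<lambda>x. g x c)" "\<And>c. continuous_on S (\<lambda>x. g' x c)"
    and "\<And>x i. x \<in> S \<Longrightarrow> cox_section \<rho> a b i (f x) \<noteq> 0"
  shows "continuous_on S (\<lambda>x. deriv_period \<rho> a b (f x) (f' x) (g x) (g' x))"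
proof -
  have "continuous_on S (\<lambda>x. ((g x)(c := g' x c)) d)" for c d
    by (cases "d = c") (simp_all add: assms)
  then show ?thesis
    unfolding deriv_period_def
    by (intro continuous_on_divide continuous_on_diff continuous_on_add continuous_on_mult continuous_on_sum
        continuous_on_deriv_euler continuous_on_period_form continuous_on_deriv_section
        continuous_on_euler_form continuous_on_prod continuous_on_cox_section assms)
      (simp_all add: assms)
qed

text \<open>Both sides are continuous in \<open>w\<close> where no section vanishes, and the torus
  is dense. The symmetric family \<open>q\<close> stands for the second partial derivatives of a
  parametrization whose first ones are \<open>\<tau>\<close>.\<close>

theorem lie_derivative_period_form:
  fixes w :: "complex ^ 'r::finite" and \<rho> :: "'r \<Rightarrow> int ^ 'd::finite" and a :: "'s::finite \<Rightarrow> 'r \<Rightarrow> int"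
  assumes nz: "\<And>i. cox_section \<rho> a b i w \<noteq> 0"
    and a: "\<And>j. (\<Sum>i\<in>UNIV. a i j) = 1" and x: "graded_field \<rho> x" and q: "\<And>c e. q c e = q e c"
  shows "(\<Sum>c\<in>UNIV. deriv_period \<rho> a b w (\<tau> c) (\<tau>(c := field_at x w))
      (\<lambda>e. if e = c then deriv_field x w (\<tau> c) else q c e)) =
    (div_field x w - (\<Sum>i\<in>UNIV. deriv_section \<rho> a b i w (field_at x w) / cox_section \<rho> a b i w)) *
      period_form \<rho> a b w \<tau>"
proof -
  define S where "S = (\<Inter>i. {v. cox_section \<rho> a b i v \<noteq> 0})"
  define F where "F v = (\<Sum>c\<in>UNIV. deriv_period \<rho> a b v (\<tau> c) (\<tau>(c := field_at x v))
      (\<lambda>e. if e = c then deriv_field x v (\<tau> c) else q c e)) -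
    (div_field x v - (\<Sum>i\<in>UNIV. deriv_section \<rho> a b i v (field_at x v) / cox_section \<rho> a b i v)) *
      period_form \<rho> a b v \<tau>" for v
  have S: "open S" unfolding S_def
    by (intro open_INT ballI finite open_Collect_neq continuous_on_cox_section continuous_on_id continuous_on_const)
  have 1: "continuous_on S (\<lambda>v. (\<tau>(c := field_at x v)) d)" for c d
    by (cases "d = c") (simp_all add: continuous_on_field_at continuous_on_id)
  have 2: "continuous_on S (\<lambda>v. if e = c then deriv_field x v (\<tau> c) else q c e)" for c e
    by (cases "e = c") (simp_all add: continuous_on_deriv_field continuous_on_id)
  have "continuous_on S F"
    unfolding F_def
    by (intro continuous_on_diff continuous_on_sum continuous_on_mult continuous_on_divide
        continuous_on_deriv_period continuous_on_div_field continuous_on_deriv_section continuous_on_field_at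
        continuous_on_cox_section continuous_on_period_form continuous_on_id continuous_on_const 1 2)
      (auto simp: S_def)
  then have "F w = 0"
    using S
  proof (rule dense_torus)
    show "w \<in> S" using nz by (simp add: S_def)
    fix v assume "v \<in> S" "\<And>j. v $ j \<noteq> 0"
    then show "F v = 0"
      using lie_derivative_torus[of v \<rho> a b x q \<tau>, OF _ _ a x q] by (simp add: F_def S_def)
  qed
  then show ?thesis by (simp add: F_def)
qed

section \<open>Invariance under the class torus\<close>

lemma euler_form_matrix:
  fixes R :: "complex ^ 'd ^ 'd::finite"
  shows "euler_form \<rho> w (\<lambda>c. \<Sum>e\<in>UNIV. R $ e $ c *s \<tau> e) = det R * euler_form \<rho> w \<tau>"
proof -
  have "det (\<chi> d c. (\<Sum>e\<in>UNIV. R $ e $ c *s \<tau> e) $ f d) = det (\<chi> d c. \<tau> c $ f d) * det R" for f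
  proof -
    have "(\<chi> d c. (\<Sum>e\<in>UNIV. R $ e $ c *s \<tau> e) $ f d) = (\<chi> d c. \<tau> c $ f d) ** R"
      by (simp add: vec_eq_iff matrix_matrix_mult_def mult.commute)
    then show ?thesis by (simp only: det_mul)
  qed
  then show ?thesis
    by (simp add: euler_form_def sum_distrib_left mult_ac)
qed

text \<open>Matrices of this shape satisfy (1 + A)(1 + B) = 1 + (A + B). Conjugation by a diagonal
  matrix of signs turns A into -A, so that the determinant of 1 + A has square 1; and 1 + E is the
  square of 1 + E / 2.\<close>

lemma det_unipotent:
  fixes E :: "complex ^ 'n ^ 'n::finite"
  assumes E: "\<And>i j. E $ i $ j \<noteq> 0 \<Longrightarrow> i \<in> P \<and> j \<notin> P"
  shows "det (mat 1 + E) = 1"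
proof -
  define D :: "complex ^ 'n ^ 'n" where "D = (\<chi> i j. if i = j then if i \<in> P then -1 else 1 else 0)"
  have mult: "(mat 1 + A) ** (mat 1 + B) = mat 1 + (A + B)"
    if "\<And>i j. A $ i $ j \<noteq> 0 \<Longrightarrow> i \<in> P \<and> j \<notin> P" "\<And>i j. B $ i $ j \<noteq> 0 \<Longrightarrow> i \<in> P \<and> j \<notin> P" for A B :: "complex ^ 'n ^ 'n"
  proof -
    have "A $ i $ k * B $ k $ j = 0" for i k j using that by (metis mult_eq_0_iff)
    then have "(\<Sum>k\<in>UNIV. A $ i $ k * B $ k $ j) = 0" for i j by (intro sum.neutral) blast
    then have AB: "A ** B = 0" by (simp add: vec_eq_iff matrix_matrix_mult_def)
    have "(mat 1 + A) ** (mat 1 + B) = (mat 1 + A) ** mat 1 + (mat 1 + A) ** B"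
      by (rule matrix_add_ldistrib)
    also have "(mat 1 + A) ** B = mat 1 ** B + A ** B"
      by (simp add: vec_eq_iff matrix_matrix_mult_def sum.distrib distrib_right)
    finally show ?thesis by (simp add: AB add_ac)
  qed
  have sq: "(det (mat 1 + A))\<^sup>2 = 1" if A: "\<And>i j. A $ i $ j \<noteq> 0 \<Longrightarrow> i \<in> P \<and> j \<notin> P" for A :: "complex ^ 'n ^ 'n"
  proof -
    have "D ** D = mat 1"
      by (auto simp: vec_eq_iff matrix_matrix_mult_def D_def mat_def if_distrib[of "\<lambda>x. x * _"] cong: if_cong)
    then have detD: "det D * det D = 1" by (metis det_I det_mul)
    have entry: "(D ** X ** D) $ i $ j = (if i \<in> P then -1 else 1) * X $ i $ j * (if j \<in> P then -1 else 1)" for X i j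
    proof -
      have "(D ** X) $ i $ k = (if i \<in> P then -1 else 1) * X $ i $ k" for k
      proof -
        have "(D ** X) $ i $ k = (\<Sum>l\<in>UNIV. if l = i then (if i \<in> P then -1 else 1) * X $ l $ k else 0)"
          unfolding matrix_matrix_mult_def vec_lambda_beta by (rule sum.cong) (auto simp: D_def)
        then show ?thesis by simp
      qed
      moreover have "((D ** X) ** D) $ i $ j = (\<Sum>l\<in>UNIV. if l = j then (D ** X) $ i $ l * (if j \<in> P then -1 else 1) else 0)"
        unfolding matrix_matrix_mult_def[of "D ** X" D] vec_lambda_beta by (rule sum.cong) (auto simp: D_def)
      ultimately show ?thesis by simp
    qed
    have "(D ** (mat 1 + A) ** D) $ i $ j = (mat 1 + - A) $ i $ j" for i j
      unfolding entry using A[of i j] by (cases "A $ i $ j = 0") (auto simp: mat_def)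
    then have "D ** (mat 1 + A) ** D = mat 1 + - A" by (simp add: vec_eq_iff)
    then have "det (mat 1 + - A) = det D * det (mat 1 + A) * det D" by (metis det_mul)
    then have "det (mat 1 + - A) = det (mat 1 + A)" using detD by (simp add: mult_ac)
    moreover have "(mat 1 + A) ** (mat 1 + - A) = mat 1"
      by (subst mult) (use A in auto)
    ultimately show ?thesis by (metis det_I det_mul power2_eq_square)
  qed
  define H :: "complex ^ 'n ^ 'n" where "H = (\<chi> i j. E $ i $ j / 2)"
  have H: "H $ i $ j \<noteq> 0 \<Longrightarrow> i \<in> P \<and> j \<notin> P" for i j using E by (simp add: H_def)
  have "mat 1 + E = (mat 1 + H) ** (mat 1 + H)"
    by (subst mult[OF H H]) (simp_all add: vec_eq_iff H_def)
  then have "det (mat 1 + E) = (det (mat 1 + H))\<^sup>2" by (simp add: det_mul power2_eq_square)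
  then show ?thesis using sq[OF H] by simp
qed

lemma act_nth [simp]: "act h w $ j = h $ j * w $ j"
  by (simp add: act_def)

text \<open>In each summand the rays chosen by \<open>f\<close> receive their factors from the rows
  of the determinant and the others from the remaining coordinates, so that every h_j occurs
  once.\<close>

lemma euler_form_act:
  "euler_form \<rho> (act h w) (\<lambda>c. act h (\<tau> c)) = (\<Prod>j\<in>UNIV. h $ j) * euler_form \<rho> w \<tau>"
proof -
  have "(\<Prod>j\<in>- range f. h $ j * w $ j) * det (\<chi> d c. h $ f d * \<tau> c $ f d) =
      (\<Prod>j\<in>UNIV. h $ j) * ((\<Prod>j\<in>- range f. w $ j) * det (\<chi> d c. \<tau> c $ f d))" if "inj f" for f
  proof -
    have "det (\<chi> d c. h $ f d * \<tau> c $ f d) = (\<Prod>d\<in>UNIV. h $ f d) * det (\<chi> d c. \<tau> c $ f d)"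
      using det_rows_mul[of "\<lambda>d. h $ f d" "\<lambda>d. \<chi> c. \<tau> c $ f d"] by (simp add: vector_scalar_mult_def)
    moreover have "(\<Prod>d\<in>UNIV. h $ f d) = (\<Prod>j\<in>range f. h $ j)"
      using that by (simp add: prod.reindex)
    moreover have "(\<Prod>j\<in>UNIV. h $ j) = (\<Prod>j\<in>range f. h $ j) * (\<Prod>j\<in>- range f. h $ j)"
      by (subst prod.union_disjoint[symmetric]) auto
    ultimately show ?thesis by (simp add: prod.distrib)
  qed
  then show ?thesis
    by (simp add: euler_form_def sum_distrib_left mult.assoc mult.left_commute)
qed

text \<open>Vectors tangent to orbits of the class torus have logarithmic components 0. This settles
  points of the torus; the others follow by density.\<close>

lemma euler_form_vertical:
  fixes w :: "complex ^ 'r::finite" and \<rho> :: "'r \<Rightarrow> int ^ 'd::finite"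
  assumes \<xi>: "\<And>c m. (\<Sum>j\<in>UNIV. of_int (pairing m (\<rho> j)) * \<xi> c $ j) = 0"
  shows "euler_form \<rho> w (\<lambda>c. \<tau> c + act (\<xi> c) w) = euler_form \<rho> w \<tau>"
proof -
  have "euler_form \<rho> w (\<lambda>c. \<tau> c + act (\<xi> c) w) - euler_form \<rho> w \<tau> = 0"
  proof (rule dense_torus[where S = UNIV])
    have act: "continuous_on UNIV (\<lambda>w. act (\<xi> c) w)" for c
      unfolding act_def by (intro continuous_on_vec_lambda continuous_on_mult continuous_on_const continuous_on_component continuous_on_id)
    show "continuous_on UNIV (\<lambda>w. euler_form \<rho> w (\<lambda>c. \<tau> c + act (\<xi> c) w) - euler_form \<rho> w \<tau>)"
      by (intro continuous_on_diff continuous_on_euler_form continuous_on_add act continuous_on_id continuous_on_const)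
    fix v :: "complex ^ 'r" assume v: "\<And>j. v $ j \<noteq> 0"
    have pd: "pairing (axis d 1) (\<rho> j) = \<rho> j $ d" for d j
      by (simp add: pairing_def axis_def if_distrib[of "\<lambda>x. x * _"] cong: if_cong)
    have "(\<Sum>j\<in>UNIV. of_int (\<rho> j $ d) * (\<tau> c + act (\<xi> c) v) $ j / v $ j) =
        (\<Sum>j\<in>UNIV. of_int (\<rho> j $ d) * \<tau> c $ j / v $ j)" for c d
    proof -
      have "(\<Sum>j\<in>UNIV. of_int (\<rho> j $ d) * (\<tau> c + act (\<xi> c) v) $ j / v $ j) =
          (\<Sum>j\<in>UNIV. of_int (\<rho> j $ d) * \<tau> c $ j / v $ j) + (\<Sum>j\<in>UNIV. of_int (\<rho> j $ d) * \<xi> c $ j)"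
        unfolding sum.distrib[symmetric] by (rule sum.cong[OF refl]) (use v in \<open>simp add: field_simps\<close>)
      then show ?thesis using \<xi>[of "axis d 1" c] by (simp add: pd)
    qed
    then show "euler_form \<rho> v (\<lambda>c. \<tau> c + act (\<xi> c) v) - euler_form \<rho> v \<tau> = 0"
      by (simp add: euler_form_on_torus[of v, OF v])
  qed auto
  then show ?thesis by simp
qed

lemma prod_powi_pairing:
  assumes "h \<in> class_torus \<rho>"
  shows "(\<Prod>j\<in>UNIV. h $ j powi (pairing m (\<rho> j) + k j)) = (\<Prod>j\<in>UNIV. h $ j powi k j)"
  using assms by (simp add: class_torus_def power_int_add prod.distrib)

lemma eval_monom_act: "eval_monom \<alpha> (act h w) = (\<Prod>j\<in>UNIV. h $ j ^ Poly_Mapping.lookup \<alpha> j) * eval_monom \<alpha> w"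
  by (simp add: eval_monom_def power_mult_distrib prod.distrib)

lemma cox_section_act:
  assumes h: "h \<in> class_torus \<rho>"
  shows "cox_section \<rho> a b i (act h w) = bundle_char (a i) h * cox_section \<rho> a b i w"
proof -
  have "eval_monom (cox_exponent \<rho> (a i) \<mu>) (act h w) = bundle_char (a i) h * eval_monom (cox_exponent \<rho> (a i) \<mu>) w"
    if \<mu>: "\<mu> \<in> polytope_points \<rho> (a i)" for \<mu>
  proof -
    have "h $ j ^ nat (pairing \<mu> (\<rho> j) + a i j) = h $ j powi (pairing \<mu> (\<rho> j) + a i j)" for j
    proof -
      have "pairing \<mu> (\<rho> j) + a i j \<ge> 0"
        using \<mu> by (auto simp: polytope_points_def dest: spec[of _ j])
      then show ?thesis by (simp add: power_int_def)
    qed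
    then show ?thesis
      by (simp add: eval_monom_act bundle_char_def prod_powi_pairing[OF h])
  qed
  then show ?thesis by (simp add: cox_section_def sum_distrib_left mult_ac)
qed

lemma prod_bundle_char:
  fixes a :: "'s::finite \<Rightarrow> 'r::finite \<Rightarrow> int"
  assumes h: "h \<in> class_torus \<rho>" and a: "\<And>j. (\<Sum>i\<in>UNIV. a i j) = 1"
  shows "(\<Prod>i\<in>UNIV. bundle_char (a i) h) = (\<Prod>j\<in>UNIV. h $ j)"
proof -
  have "h $ j \<noteq> 0" for j using h by (simp add: class_torus_def)
  then have "(\<Prod>i\<in>UNIV. h $ j powi a i j) = h $ j" for j
    using a[of j] by (simp add: powi_sum_distrib[symmetric])
  then show ?thesis unfolding bundle_char_def by (subst prod.swap) simp
qed

text \<open>The numerator is multiplied by the product of the h_j, the denominator by the product of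
  the bundle characters, and these agree because the \<open>a i j\<close> sum to 1 over i.\<close>

lemma period_form_act:
  assumes h: "h \<in> class_torus \<rho>" and a: "\<And>j. (\<Sum>i\<in>UNIV. a i j) = 1"
  shows "period_form \<rho> a b (act h w) (\<lambda>c. act h (\<tau> c)) = period_form \<rho> a b w \<tau>"
proof -
  have "h $ j \<noteq> 0" for j using h by (simp add: class_torus_def)
  then show ?thesis
    by (simp add: period_form_def cox_section_act[OF h] prod.distrib prod_bundle_char[OF h a] euler_form_act)
qed

text \<open>A monomial of the degree of w_j is multiplied by the same character of the class torus
  as w_j.\<close>

lemma field_at_act:
  assumes h: "h \<in> class_torus \<rho>" and x: "graded_field \<rho> x"
  shows "field_at x (act h w) = act h (field_at x w)"
proof -
  have "(\<Prod>l\<in>UNIV. h $ l ^ Poly_Mapping.lookup \<alpha> l) = h $ j" if \<alpha>: "\<alpha> \<in> Poly_Mapping.keys (x j)" for j \<alpha>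
  proof -
    obtain m where "\<And>l. int (Poly_Mapping.lookup \<alpha> l) - int (Poly_Mapping.lookup (var j) l) = pairing m (\<rho> l)"
      using x \<alpha> unfolding graded_field_def same_degree_def lin_equiv_def by blast
    then have "h $ l ^ Poly_Mapping.lookup \<alpha> l = h $ l powi (pairing m (\<rho> l) + int (Poly_Mapping.lookup (var j) l))" for l
      by (metis diff_add_cancel power_int_of_nat)
    then have "(\<Prod>l\<in>UNIV. h $ l ^ Poly_Mapping.lookup \<alpha> l) = (\<Prod>l\<in>UNIV. h $ l ^ Poly_Mapping.lookup (var j) l)"
      by (simp add: prod_powi_pairing[OF h])
    also have "\<dots> = (\<Prod>l\<in>UNIV. if l = j then h $ l else 1)"
      by (rule prod.cong[OF refl]) (auto simp: lookup_single when_def)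
    finally show ?thesis by simp
  qed
  then show ?thesis
    by (simp add: vec_eq_iff field_at_def eval_monom_act sum_distrib_left mult_ac)
qed

section \<open>Smooth maps\<close>

lemma k_smooth_on_cong:
  assumes "open U" "\<And>x. x \<in> U \<Longrightarrow> f x = g x"
  shows "k_smooth_on m U f \<longleftrightarrow> k_smooth_on m U g"
proof -
  have *: "k_smooth_on m U g" if "k_smooth_on m U f" "\<And>x. x \<in> U \<Longrightarrow> f x = g x"
    for f g :: "'a \<Rightarrow> 'c::real_normed_vector"
    using that
  proof (induction m arbitrary: f g)
    case 0
    then show ?case using continuous_on_cong[of U U f g] by simp
  next
    case (Suc m)
    have d: "(g has_derivative frechet_derivative f (at x)) (at x)" if "x \<in> U" for x
    proof (rule has_derivative_transform_within_open)
      show "(f has_derivative frechet_derivative f (at x)) (at x)"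
        using Suc.prems that by (simp add: frechet_derivative_works)
    qed (use that assms(1) Suc.prems in auto)
    then have "frechet_derivative f (at x) = frechet_derivative g (at x)" if "x \<in> U" for x
      using frechet_derivative_at that by blast
    then have "k_smooth_on m U (\<lambda>x. frechet_derivative g (at x) v)" for v
      using Suc.IH[of "\<lambda>x. frechet_derivative f (at x) v" "\<lambda>x. frechet_derivative g (at x) v"] Suc.prems by simp
    then show ?case using d by (auto simp: differentiable_def)
  qed
  from *[of f g] *[of g f] assms(2) show ?thesis by auto
qed

lemma k_smooth_on_subset: "k_smooth_on m U f \<Longrightarrow> V \<subseteq> U \<Longrightarrow> k_smooth_on m V f"
  by (induction m arbitrary: f) (auto intro: continuous_on_subset)

text \<open>An introduction rule that accepts any formula for the derivative in place of
  \<open>frechet_derivative\<close>.\<close>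

lemma k_smooth_on_Suc:
  assumes U: "open U" and f: "\<And>x. x \<in> U \<Longrightarrow> (f has_derivative f' x) (at x)"
    and f': "\<And>v. k_smooth_on m U (\<lambda>x. f' x v)"
  shows "k_smooth_on (Suc m) U f"
proof -
  have "k_smooth_on m U (\<lambda>x. frechet_derivative f (at x) v)" for v
    using f'[of v] frechet_derivative_at[OF f]
    by (subst k_smooth_on_cong[OF U, of _ "\<lambda>x. f' x v"]) (auto simp: fun_eq_iff)
  then show ?thesis using f by (auto simp: differentiable_def)
qed

lemma k_smooth_on_SucD: "k_smooth_on (Suc m) U f \<Longrightarrow> k_smooth_on m U f"
proof (induction m arbitrary: f)
  case 0
  then show ?case
    by (auto intro!: continuous_at_imp_continuous_on differentiable_imp_continuous_within)
qed simp

lemma k_smooth_on_derivative: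
  "k_smooth_on (Suc m) U f \<Longrightarrow> x \<in> U \<Longrightarrow> (f has_derivative frechet_derivative f (at x)) (at x)"
  by (simp add: frechet_derivative_works)

lemma k_smooth_on_continuous: "k_smooth_on m U f \<Longrightarrow> continuous_on U f"
  by (induction m) (auto intro!: continuous_at_imp_continuous_on differentiable_imp_continuous_within)

lemma k_smooth_on_const: "open U \<Longrightarrow> k_smooth_on m U (\<lambda>x. c)"
proof (induction m arbitrary: c)
  case (Suc m)
  then show ?case by (intro k_smooth_on_Suc[where f' = "\<lambda>x v. 0"]) auto
qed simp

lemma k_smooth_on_bounded_linear:
  assumes L: "bounded_linear L" and U: "open U"
  shows "k_smooth_on m U f \<Longrightarrow> k_smooth_on m U (\<lambda>x. L (f x))"
proof (induction m arbitrary: f)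
  case 0
  then show ?case by (simp add: bounded_linear.continuous_on[OF L])
next
  case (Suc m)
  show ?case
  proof (rule k_smooth_on_Suc[OF U])
    show "((\<lambda>x. L (f x)) has_derivative (\<lambda>v. L (frechet_derivative f (at x) v))) (at x)" if "x \<in> U" for x
      using bounded_linear.has_derivative[OF L k_smooth_on_derivative[OF Suc.prems that]] .
  qed (use Suc in simp)
qed

lemma k_smooth_on_id_linear:
  assumes L: "bounded_linear L" and U: "open U"
  shows "k_smooth_on m U L"
proof (cases m)
  case 0
  then show ?thesis using linear_continuous_on[OF L] by simp
next
  case (Suc n)
  have "k_smooth_on (Suc n) U L"
    by (rule k_smooth_on_Suc[OF U bounded_linear_imp_has_derivative[OF L]]) (rule k_smooth_on_const[OF U])
  then show ?thesis by (simp only: Suc)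
qed

lemma k_smooth_on_add:
  assumes U: "open U"
  shows "k_smooth_on m U f \<Longrightarrow> k_smooth_on m U g \<Longrightarrow> k_smooth_on m U (\<lambda>x. f x + g x)"
proof (induction m arbitrary: f g)
  case 0
  then show ?case by (simp add: continuous_on_add)
next
  case (Suc m)
  show ?case
  proof (rule k_smooth_on_Suc[OF U])
    show "((\<lambda>x. f x + g x) has_derivative (\<lambda>v. frechet_derivative f (at x) v + frechet_derivative g (at x) v)) (at x)"
      if "x \<in> U" for x
      by (intro has_derivative_add k_smooth_on_derivative[OF Suc.prems(1) that] k_smooth_on_derivative[OF Suc.prems(2) that])
  qed (use Suc in simp)
qed

lemma k_smooth_on_sum:
  assumes U: "open U"
  shows "(\<And>i. i \<in> I \<Longrightarrow> k_smooth_on m U (f i)) \<Longrightarrow> k_smooth_on m U (\<lambda>x. \<Sum>i\<in>I. f i x)"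
  by (induction I rule: infinite_finite_induct) (auto simp: k_smooth_on_const[OF U] k_smooth_on_add[OF U])

lemma k_smooth_on_scaleR:
  assumes U: "open U"
  shows "k_smooth_on m U f \<Longrightarrow> k_smooth_on m U g \<Longrightarrow> k_smooth_on m U (\<lambda>x. f x *\<^sub>R g x)"
proof (induction m arbitrary: f g)
  case 0
  then show ?case by (simp add: continuous_on_scaleR)
next
  case (Suc m)
  show ?case
  proof (rule k_smooth_on_Suc[OF U])
    show "((\<lambda>x. f x *\<^sub>R g x) has_derivative (\<lambda>v. f x *\<^sub>R frechet_derivative g (at x) v + frechet_derivative f (at x) v *\<^sub>R g x)) (at x)"
      if "x \<in> U" for x
      by (intro has_derivative_scaleR k_smooth_on_derivative[OF Suc.prems(1) that] k_smooth_on_derivative[OF Suc.prems(2) that])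
    show "k_smooth_on m U (\<lambda>x. f x *\<^sub>R frechet_derivative g (at x) v + frechet_derivative f (at x) v *\<^sub>R g x)" for v
      by (rule k_smooth_on_add[OF U]; rule Suc.IH)
        (use Suc.prems k_smooth_on_SucD[OF Suc.prems(1)] k_smooth_on_SucD[OF Suc.prems(2)] in auto)
  qed
qed

text \<open>The directions in \<open>k_smooth_on\<close> are fixed, whereas the chain rule
  differentiates \<open>f\<close> in a direction that depends on the point. Expanding this direction
  in a basis restores fixed directions; hence the sort of \<open>'b\<close>.\<close>

lemma k_smooth_on_compose:
  fixes f :: "'b::euclidean_space \<Rightarrow> 'c::real_normed_vector" and g :: "'a::real_normed_vector \<Rightarrow> 'b"
  assumes U: "open U" and gU: "g ` U \<subseteq> V"
  shows "k_smooth_on m V f \<Longrightarrow> k_smooth_on m U g \<Longrightarrow> k_smooth_on m U (\<lambda>x. f (g x))"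
proof (induction m arbitrary: f)
  case 0
  then show ?case using gU by (auto intro: continuous_on_compose2)
next
  case (Suc m)
  let ?f' = "\<lambda>y. frechet_derivative f (at y)" and ?g' = "\<lambda>x. frechet_derivative g (at x)"
  have g: "k_smooth_on m U g" by (rule k_smooth_on_SucD[OF Suc.prems(2)])
  show ?case
  proof (rule k_smooth_on_Suc[OF U])
    show "((\<lambda>x. f (g x)) has_derivative (\<lambda>v. \<Sum>k\<in>Basis. (?g' x v \<bullet> k) *\<^sub>R ?f' (g x) k)) (at x)" if x: "x \<in> U" for x
    proof -
      have f: "(f has_derivative ?f' (g x)) (at (g x))"
        using gU x by (intro k_smooth_on_derivative[OF Suc.prems(1)]) auto
      interpret linear "?f' (g x)" using f by (rule has_derivative_linear)
      have "(\<Sum>k\<in>Basis. (?g' x v \<bullet> k) *\<^sub>R ?f' (g x) k) = ?f' (g x) (?g' x v)" for v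
        by (metis (no_types, lifting) euclidean_representation scale sum sum.cong)
      then show ?thesis
        using has_derivative_compose[OF k_smooth_on_derivative[OF Suc.prems(2) x] f] by simp
    qed
    show "k_smooth_on m U (\<lambda>x. \<Sum>k\<in>Basis. (?g' x v \<bullet> k) *\<^sub>R ?f' (g x) k)" for v
    proof (rule k_smooth_on_sum[OF U], rule k_smooth_on_scaleR[OF U])
      fix k :: 'b assume "k \<in> Basis"
      show "k_smooth_on m U (\<lambda>x. ?g' x v \<bullet> k)"
        by (rule k_smooth_on_bounded_linear[OF bounded_linear_inner_left U]) (use Suc.prems in simp)
      show "k_smooth_on m U (\<lambda>x. ?f' (g x) k)"
        by (rule Suc.IH[OF _ g]) (use Suc.prems in simp)
    qed
  qed
qed

text \<open>The coefficient \<open>c\<close> makes the induction work, since differentiation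
  multiplies it by the imaginary unit.\<close>

lemma k_smooth_on_cis: "open U \<Longrightarrow> k_smooth_on m U (\<lambda>u::real^'d::finite. c * cis (2 * pi * u $ s))"
proof (induction m arbitrary: c)
  case 0
  then show ?case by (auto intro!: continuous_intros continuous_on_component)
next
  case (Suc m)
  show ?case
  proof (rule k_smooth_on_Suc[OF Suc.prems])
    fix x :: "real^'d"
    have "((\<lambda>u. 2 * pi * u $ s) has_derivative (\<lambda>v. 2 * pi * v $ s)) (at x)"
      by (intro has_derivative_mult_right bounded_linear_imp_has_derivative bounded_linear_vec_nth)
    then have "((\<lambda>u. c * cis (2 * pi * u $ s)) has_derivative (\<lambda>v. c * ((2 * pi * v $ s) *\<^sub>R (\<i> * cis (2 * pi * x $ s))))) (at x)"
      by (rule has_derivative_mult_right[OF has_derivative_cis])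
    then show "((\<lambda>u. c * cis (2 * pi * u $ s)) has_derivative (\<lambda>v. (2 * pi * v $ s) *\<^sub>R ((c * \<i>) * cis (2 * pi * x $ s)))) (at x)"
      by (simp add: scaleR_conv_of_real mult_ac)
    show "k_smooth_on m U (\<lambda>x. (2 * pi * v $ s) *\<^sub>R ((c * \<i>) * cis (2 * pi * x $ s)))" for v
      by (rule k_smooth_on_bounded_linear[OF bounded_linear_scaleR_right Suc.prems Suc.IH[OF Suc.prems]])
  qed
qed

text \<open>The mean value inequality is applied along \<open>b\<close> to the derivative in
  direction \<open>a\<close>, and then along \<open>a\<close> to a difference of values of
  \<open>f\<close>. Continuity of the second derivative at \<open>x\<close> controls both
  errors.\<close>

lemma second_difference_bound:
  fixes f :: "'a::real_normed_vector \<Rightarrow> 'b::real_inner"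
  assumes U: "open U" and x: "x \<in> U" and f: "k_smooth_on 2 U f" and e: "0 < e"
  defines "D \<equiv> \<lambda>v x. frechet_derivative f (at x) v"
  shows "\<exists>d>0. \<forall>h. 0 < h \<and> h < d \<longrightarrow> norm (f (x + h *\<^sub>R a + h *\<^sub>R b) - f (x + h *\<^sub>R a) - (f (x + h *\<^sub>R b) - f x) -
    (h * h) *\<^sub>R frechet_derivative (D a) (at x) b) \<le> e * h * h"
proof -
  have f1: "k_smooth_on 1 U (D v)" and f0: "k_smooth_on 0 U (\<lambda>x. frechet_derivative (D v) (at x) w)" for v w
    using f by (simp_all add: numeral_2_eq_2 D_def)
  define L where "L = frechet_derivative (D a) (at x) b"
  have cont: "isCont (\<lambda>y. frechet_derivative (D a) (at y) b) x"
    using f0[of a b] U x by (simp add: continuous_on_eq_continuous_at)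
  then obtain r where r: "0 < r" "\<And>y. dist y x < r \<Longrightarrow> dist (frechet_derivative (D a) (at y) b) L < e"
    unfolding L_def using e unfolding continuous_at_eps_delta by blast
  obtain r' where r': "0 < r'" "ball x r' \<subseteq> U" using U x by (meson open_contains_ball)
  define d where "d = min r r' / (norm a + norm b + 1)"
  have pos: "0 < norm a + norm b + 1" by (smt (verit) norm_ge_zero)
  have d: "0 < d" unfolding d_def using r(1) r'(1) pos by simp
  have near: "dist (x + s *\<^sub>R a + t *\<^sub>R b) x < r \<and> x + s *\<^sub>R a + t *\<^sub>R b \<in> U" if "0 \<le> s" "s < d" "0 \<le> t" "t < d" for s t
  proof -
    have "norm (s *\<^sub>R a + t *\<^sub>R b) \<le> s * norm a + t * norm b"
      using that norm_triangle_ineq[of "s *\<^sub>R a" "t *\<^sub>R b"] by simp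
    also have "\<dots> \<le> d * norm a + d * norm b"
      using that by (intro add_mono mult_right_mono) auto
    also have "\<dots> < d * (norm a + norm b + 1)" using d by (simp add: distrib_left)
    also have "\<dots> = min r r'" using pos by (simp add: d_def)
    finally have "norm (s *\<^sub>R a + t *\<^sub>R b) < min r r'" .
    then have "dist (x + s *\<^sub>R a + t *\<^sub>R b) x < min r r'" by (simp add: dist_norm add.assoc)
    then show ?thesis using r'(2) by (auto simp: dist_commute subset_iff)
  qed
  have "norm (f (x + h *\<^sub>R a + h *\<^sub>R b) - f (x + h *\<^sub>R a) - (f (x + h *\<^sub>R b) - f x) - (h * h) *\<^sub>R L) \<le> e * h * h"
    if h: "0 < h" "h < d" for h
  proof -
    have inner: "norm (D a (x + s *\<^sub>R a + h *\<^sub>R b) - D a (x + s *\<^sub>R a) - h *\<^sub>R L) \<le> e * h" if s: "0 \<le> s" "s < d" for s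
    proof -
      define \<phi> where "\<phi> t = D a (x + s *\<^sub>R a + t *\<^sub>R b) - t *\<^sub>R L" for t
      have der: "(\<phi> has_derivative (\<lambda>k. k *\<^sub>R (frechet_derivative (D a) (at (x + s *\<^sub>R a + t *\<^sub>R b)) b - L))) (at t)"
        if t: "0 \<le> t" "t \<le> h" for t
      proof -
        have "(D a has_derivative frechet_derivative (D a) (at (x + s *\<^sub>R a + t *\<^sub>R b))) (at (x + s *\<^sub>R a + t *\<^sub>R b))"
          using f1[of a] near[of s t] s t h by (intro k_smooth_on_derivative[of 0 U]) auto
        moreover have "((\<lambda>t. x + s *\<^sub>R a + t *\<^sub>R b) has_derivative (\<lambda>k. k *\<^sub>R b)) (at t)"
          by (auto intro!: derivative_eq_intros)
        ultimately have "((\<lambda>t. D a (x + s *\<^sub>R a + t *\<^sub>R b)) has_derivative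
            (\<lambda>k. frechet_derivative (D a) (at (x + s *\<^sub>R a + t *\<^sub>R b)) (k *\<^sub>R b))) (at t)"
          by (rule has_derivative_compose[rotated])
        moreover have "linear (frechet_derivative (D a) (at (x + s *\<^sub>R a + t *\<^sub>R b)))"
          using \<open>(D a has_derivative _) _\<close> by (rule has_derivative_linear)
        ultimately have "((\<lambda>t. D a (x + s *\<^sub>R a + t *\<^sub>R b)) has_derivative
            (\<lambda>k. k *\<^sub>R frechet_derivative (D a) (at (x + s *\<^sub>R a + t *\<^sub>R b)) b)) (at t)"
          by (simp add: linear_cmul)
        then show ?thesis unfolding \<phi>_def
          by (auto intro!: derivative_eq_intros simp: scaleR_diff_right)
      qed
      have "continuous_on {0..h} \<phi>"
        using der by (auto intro!: continuous_at_imp_continuous_on has_derivative_continuous)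
      then obtain t where t: "t \<in> {0<..<h}" "norm (\<phi> h - \<phi> 0) \<le> norm ((h - 0) *\<^sub>R (frechet_derivative (D a) (at (x + s *\<^sub>R a + t *\<^sub>R b)) b - L))"
        using mvt_general[of 0 h \<phi> "\<lambda>t k. k *\<^sub>R (frechet_derivative (D a) (at (x + s *\<^sub>R a + t *\<^sub>R b)) b - L)"] der h by auto
      have "dist (frechet_derivative (D a) (at (x + s *\<^sub>R a + t *\<^sub>R b)) b) L < e"
        using near[of s t] t s h by (intro r(2)) auto
      then have "norm ((h - 0) *\<^sub>R (frechet_derivative (D a) (at (x + s *\<^sub>R a + t *\<^sub>R b)) b - L)) \<le> e * h"
        using h by (simp add: dist_norm mult.commute mult_left_mono)
      with t(2) have "norm (\<phi> h - \<phi> 0) \<le> e * h" by linarith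
      then show ?thesis by (simp add: \<phi>_def algebra_simps)
    qed
    define \<psi> where "\<psi> s = f (x + s *\<^sub>R a + h *\<^sub>R b) - f (x + s *\<^sub>R a) - s *\<^sub>R (h *\<^sub>R L)" for s
    have der: "(\<psi> has_derivative (\<lambda>k. k *\<^sub>R (D a (x + s *\<^sub>R a + h *\<^sub>R b) - D a (x + s *\<^sub>R a) - h *\<^sub>R L))) (at s)"
      if s: "0 \<le> s" "s \<le> h" for s
    proof -
      have 1: "((\<lambda>s. f (x + s *\<^sub>R a + c)) has_derivative (\<lambda>k. k *\<^sub>R D a (x + s *\<^sub>R a + c))) (at s)"
        if c: "x + s *\<^sub>R a + c \<in> U" for c
      proof -
        have f: "(f has_derivative frechet_derivative f (at (x + s *\<^sub>R a + c))) (at (x + s *\<^sub>R a + c))"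
          using f c by (intro k_smooth_on_derivative[of 1 U]) (auto simp: numeral_2_eq_2)
        have "((\<lambda>s. x + s *\<^sub>R a + c) has_derivative (\<lambda>k. k *\<^sub>R a)) (at s)"
          by (auto intro!: derivative_eq_intros)
        from has_derivative_compose[OF this f] show ?thesis
          using linear_cmul[OF has_derivative_linear[OF f]] by (simp add: D_def)
      qed
      show ?thesis
        unfolding \<psi>_def using 1[of "h *\<^sub>R b"] 1[of 0] near[of s h] near[of s 0] s h
        by (auto intro!: derivative_eq_intros simp: scaleR_diff_right)
    qed
    have "continuous_on {0..h} \<psi>"
      using der by (auto intro!: continuous_at_imp_continuous_on has_derivative_continuous)
    then obtain s where s: "s \<in> {0<..<h}" "norm (\<psi> h - \<psi> 0) \<le> norm ((h - 0) *\<^sub>R (D a (x + s *\<^sub>R a + h *\<^sub>R b) - D a (x + s *\<^sub>R a) - h *\<^sub>R L))"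
      using mvt_general[of 0 h \<psi> "\<lambda>s k. k *\<^sub>R (D a (x + s *\<^sub>R a + h *\<^sub>R b) - D a (x + s *\<^sub>R a) - h *\<^sub>R L)"] der h by auto
    have "norm (D a (x + s *\<^sub>R a + h *\<^sub>R b) - D a (x + s *\<^sub>R a) - h *\<^sub>R L) \<le> e * h"
      using inner[of s] s h by simp
    then have "norm ((h - 0) *\<^sub>R (D a (x + s *\<^sub>R a + h *\<^sub>R b) - D a (x + s *\<^sub>R a) - h *\<^sub>R L)) \<le> e * h * h"
      using h by (simp add: mult.commute mult_left_mono)
    with s(2) have "norm (\<psi> h - \<psi> 0) \<le> e * h * h" by linarith
    then show ?thesis by (simp add: \<psi>_def algebra_simps)
  qed
  then show ?thesis using d unfolding L_def by blast
qed

text \<open>The second difference of \<open>f\<close> is symmetric in \<open>a\<close> and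
  \<open>b\<close>, and divided by the square of h it approximates either side.\<close>

lemma second_derivative_symmetric:
  fixes f :: "'a::real_normed_vector \<Rightarrow> 'b::real_inner"
  assumes U: "open U" and x: "x \<in> U" and f: "k_smooth_on 2 U f"
  shows "frechet_derivative (\<lambda>x. frechet_derivative f (at x) a) (at x) b =
    frechet_derivative (\<lambda>x. frechet_derivative f (at x) b) (at x) a" (is "?L = ?M")
proof -
  have "norm (?L - ?M) \<le> 0"
  proof (rule field_le_epsilon)
    fix e :: real assume "0 < e"
    then have e: "0 < e / 2" by simp
    obtain d where d: "0 < d" "\<And>h. 0 < h \<Longrightarrow> h < d \<Longrightarrow> norm (f (x + h *\<^sub>R a + h *\<^sub>R b) - f (x + h *\<^sub>R a) - (f (x + h *\<^sub>R b) - f x) -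
        (h * h) *\<^sub>R ?L) \<le> e / 2 * h * h"
      using second_difference_bound[OF U x f e, of a b] by blast
    obtain d' where d': "0 < d'" "\<And>h. 0 < h \<Longrightarrow> h < d' \<Longrightarrow> norm (f (x + h *\<^sub>R b + h *\<^sub>R a) - f (x + h *\<^sub>R b) - (f (x + h *\<^sub>R a) - f x) -
        (h * h) *\<^sub>R ?M) \<le> e / 2 * h * h"
      using second_difference_bound[OF U x f e, of b a] by blast
    define h where "h = min d d' / 2"
    have h: "0 < h" "h < d" "h < d'" using d d' by (auto simp: h_def)
    define A where "A = f (x + h *\<^sub>R a + h *\<^sub>R b) - f (x + h *\<^sub>R a) - (f (x + h *\<^sub>R b) - f x) - (h * h) *\<^sub>R ?L"
    define B where "B = f (x + h *\<^sub>R b + h *\<^sub>R a) - f (x + h *\<^sub>R b) - (f (x + h *\<^sub>R a) - f x) - (h * h) *\<^sub>R ?M"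
    have "(h * h) *\<^sub>R (?L - ?M) = B - A"
      unfolding A_def B_def by (simp add: algebra_simps)
    then have "norm ((h * h) *\<^sub>R (?L - ?M)) \<le> norm B + norm A"
      using norm_triangle_ineq4[of B A] by simp
    also have "\<dots> \<le> e / 2 * h * h + e / 2 * h * h"
      using d(2)[OF h(1,2)] d'(2)[OF h(1,3)] unfolding A_def B_def by (intro add_mono)
    finally have "norm ((h * h) *\<^sub>R (?L - ?M)) \<le> e / 2 * h * h + e / 2 * h * h" .
    then have "(h * h) * norm (?L - ?M) \<le> (h * h) * e" by (simp add: mult_ac)
    then show "norm (?L - ?M) \<le> 0 + e" using h by simp
  qed
  then show ?thesis by simp
qed

section \<open>Linear functionals on finitely supported functions\<close>

definition lin_ext :: "('k \<Rightarrow> complex) \<Rightarrow> ('k \<Rightarrow>\<^sub>0 complex) \<Rightarrow> complex" where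
  "lin_ext f P = (\<Sum>k\<in>Poly_Mapping.keys P. Poly_Mapping.lookup P k * f k)"

lemma lin_ext_superset:
  assumes "finite S" "Poly_Mapping.keys P \<subseteq> S"
  shows "lin_ext f P = (\<Sum>k\<in>S. Poly_Mapping.lookup P k * f k)"
  unfolding lin_ext_def by (rule sum.mono_neutral_left) (use assms in \<open>auto simp: in_keys_iff\<close>)

lemma lin_ext_add: "lin_ext f (P + Q) = lin_ext f P + lin_ext f Q"
proof -
  let ?S = "Poly_Mapping.keys P \<union> Poly_Mapping.keys Q"
  have "lin_ext f (P + Q) = (\<Sum>k\<in>?S. Poly_Mapping.lookup (P + Q) k * f k)"
    by (rule lin_ext_superset) (use Poly_Mapping.keys_add[of P Q] in auto)
  then show ?thesis
    by (simp add: lin_ext_superset[of ?S P] lin_ext_superset[of ?S Q] lookup_add distrib_right sum.distrib)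
qed

lemma lin_ext_zero [simp]: "lin_ext f 0 = 0"
  by (simp add: lin_ext_def)

lemma lin_ext_single [simp]: "lin_ext f (Poly_Mapping.single k c) = c * f k"
  by (simp add: lin_ext_def)

lemma lin_ext_sum: "lin_ext f (\<Sum>i\<in>I. P i) = (\<Sum>i\<in>I. lin_ext f (P i))"
  by (induction I rule: infinite_finite_induct) (simp_all add: lin_ext_add)

section \<open>Left ideals of the Weyl algebra\<close>

definition monom_value :: "('v \<Rightarrow> complex) \<Rightarrow> ('v \<Rightarrow>\<^sub>0 nat) \<Rightarrow> complex" where
  "monom_value b \<alpha> = (\<Prod>v\<in>Poly_Mapping.keys \<alpha>. b v ^ Poly_Mapping.lookup \<alpha> v)"

text \<open>The value at \<open>b\<close> of an operator applied to \<open>J 0\<close>, where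
  \<open>J \<beta>\<close> stands for the derivative of multi-index \<open>\<beta>\<close>.\<close>

definition weyl_value :: "(('v \<Rightarrow>\<^sub>0 nat) \<Rightarrow> ('v \<Rightarrow> complex) \<Rightarrow> complex) \<Rightarrow> ('v \<Rightarrow> complex) \<Rightarrow> 'v weyl \<Rightarrow> complex" where
  "weyl_value J b = lin_ext (\<lambda>(\<alpha>, \<beta>). monom_value b \<alpha> * J \<beta> b)"

text \<open>A function \<open>J 0\<close> together with all its partial derivatives. Indexing them
  by multi-indices builds in that the order of differentiation is irrelevant. Openness refers to the
  product topology on coefficient functions.\<close>

definition jets :: "('v \<Rightarrow> complex) set \<Rightarrow> (('v \<Rightarrow>\<^sub>0 nat) \<Rightarrow> ('v \<Rightarrow> complex) \<Rightarrow> complex) \<Rightarrow> bool" where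
  "jets U J \<longleftrightarrow> open U \<and> (\<forall>\<beta>. \<forall>b\<in>U. \<forall>v.
     ((\<lambda>z. J \<beta> (b(v := z))) has_field_derivative J (\<beta> + Poly_Mapping.single v 1) b) (at (b v)))"

lemma monom_value_superset:
  assumes "finite S" "Poly_Mapping.keys \<alpha> \<subseteq> S"
  shows "monom_value b \<alpha> = (\<Prod>v\<in>S. b v ^ Poly_Mapping.lookup \<alpha> v)"
  unfolding monom_value_def by (rule prod.mono_neutral_left) (use assms in \<open>auto simp: in_keys_iff\<close>)

lemma monom_value_add: "monom_value b (\<alpha> + \<beta>) = monom_value b \<alpha> * monom_value b \<beta>"
proof -
  let ?S = "Poly_Mapping.keys \<alpha> \<union> Poly_Mapping.keys \<beta>"
  have "monom_value b (\<alpha> + \<beta>) = (\<Prod>v\<in>?S. b v ^ Poly_Mapping.lookup (\<alpha> + \<beta>) v)"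
    by (rule monom_value_superset) (use Poly_Mapping.keys_add[of \<alpha> \<beta>] in auto)
  then show ?thesis
    by (simp add: monom_value_superset[of ?S \<alpha>] monom_value_superset[of ?S \<beta>] lookup_add power_add prod.distrib)
qed

lemma monom_value_single [simp]: "monom_value b (Poly_Mapping.single v n) = b v ^ n"
  by (cases "n = 0") (simp_all add: monom_value_def)

lemma monom_value_zero [simp]: "monom_value b 0 = 1"
  by (simp add: monom_value_def)

lemma monom_value_deriv:
  "((\<lambda>z. monom_value (b(v := z)) \<alpha>) has_field_derivative
    of_nat (Poly_Mapping.lookup \<alpha> v) * monom_value b (\<alpha> - Poly_Mapping.single v 1)) (at (b v))"
proof (cases "v \<in> Poly_Mapping.keys \<alpha>")
  case True
  let ?K = "Poly_Mapping.keys \<alpha> - {v}"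
  have 1: "monom_value (b(v := z)) \<alpha> = z ^ Poly_Mapping.lookup \<alpha> v * (\<Prod>u\<in>?K. b u ^ Poly_Mapping.lookup \<alpha> u)" for z
    unfolding monom_value_def by (subst prod.remove[OF finite_keys True]) simp
  have "monom_value b (\<alpha> - Poly_Mapping.single v 1) =
      (\<Prod>u\<in>Poly_Mapping.keys \<alpha>. b u ^ Poly_Mapping.lookup (\<alpha> - Poly_Mapping.single v 1) u)"
    by (rule monom_value_superset) (auto simp: in_keys_iff lookup_minus)
  also have "\<dots> = b v ^ (Poly_Mapping.lookup \<alpha> v - 1) * (\<Prod>u\<in>?K. b u ^ Poly_Mapping.lookup \<alpha> u)"
    by (subst prod.remove[OF finite_keys True]) (auto simp: lookup_minus lookup_single when_def intro!: prod.cong)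
  finally have 2: "monom_value b (\<alpha> - Poly_Mapping.single v 1) = \<dots>" .
  show ?thesis
    unfolding 1 2 by (auto intro!: derivative_eq_intros)
next
  case False
  then have "monom_value (b(v := z)) \<alpha> = monom_value b \<alpha>" for z
    unfolding monom_value_def by (intro prod.cong) auto
  then show ?thesis using False by (simp add: in_keys_iff)
qed

lemma continuous_fun_upd: "continuous_on UNIV (\<lambda>z::complex. b(v := z))"
proof (rule continuous_on_coordinatewise_then_product)
  fix i show "continuous_on UNIV (\<lambda>x. (b(v := x)) i)"
    by (cases "i = v") (auto intro: continuous_on_id)
qed

lemma eventually_fun_upd:
  fixes U :: "('v \<Rightarrow> complex) set"
  assumes "open U" "b \<in> U"
  shows "eventually (\<lambda>z. b(v := z) \<in> U) (nhds (b v))"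
proof -
  have "open ((\<lambda>z. b(v := z)) -` U)"
    by (rule open_vimage[OF assms(1) continuous_fun_upd])
  then show ?thesis
    using assms by (auto simp: eventually_nhds intro!: exI[of _ "(\<lambda>z. b(v := z)) -` U"])
qed

lemma partial_jets:
  assumes J: "jets U J" and F: "\<And>b. b \<in> U \<Longrightarrow> F b = J \<beta> b" and b: "b \<in> U"
  shows "partial v F b = J (\<beta> + Poly_Mapping.single v 1) b"
proof -
  have "((\<lambda>z. J \<beta> (b(v := z))) has_field_derivative J (\<beta> + Poly_Mapping.single v 1) b) (at (b v))"
    using J b by (simp add: jets_def)
  moreover have "eventually (\<lambda>z. F (b(v := z)) = J \<beta> (b(v := z))) (nhds (b v))"
    using eventually_fun_upd[of U b v] J b by (auto simp: jets_def F elim: eventually_mono)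
  ultimately have "((\<lambda>z. F (b(v := z))) has_field_derivative J (\<beta> + Poly_Mapping.single v 1) b) (at (b v))"
    by (subst DERIV_cong_ev[OF refl _ refl])
  then show ?thesis unfolding partial_def by (rule DERIV_imp_deriv)
qed

lemma partial_power_jets:
  assumes J: "jets U J" and F: "\<And>b. b \<in> U \<Longrightarrow> F b = J \<beta> b" and b: "b \<in> U"
  shows "(partial v ^^ n) F b = J (\<beta> + Poly_Mapping.single v n) b"
  using b
proof (induction n arbitrary: b)
  case 0
  then show ?case by (simp add: F)
next
  case (Suc n)
  have "(partial v ^^ Suc n) F b = partial v ((partial v ^^ n) F) b" by simp
  also have "\<dots> = J (\<beta> + Poly_Mapping.single v n + Poly_Mapping.single v 1) b"
    by (rule partial_jets[OF J Suc.IH Suc.prems])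
  also have "\<beta> + Poly_Mapping.single v n + Poly_Mapping.single v 1 = \<beta> + Poly_Mapping.single v (Suc n)"
    by (simp add: add.assoc single_add[symmetric])
  finally show ?case .
qed

lemma foldr_partial_jets:
  assumes J: "jets U J"
  shows "distinct vs \<Longrightarrow> b \<in> U \<Longrightarrow> foldr (\<lambda>v. partial v ^^ Poly_Mapping.lookup \<beta> v) vs (J 0) b =
    J (\<Sum>v\<in>set vs. Poly_Mapping.single v (Poly_Mapping.lookup \<beta> v)) b"
proof (induction vs arbitrary: b)
  case (Cons v vs)
  have "foldr (\<lambda>v. partial v ^^ Poly_Mapping.lookup \<beta> v) (v # vs) (J 0) b =
      J ((\<Sum>v\<in>set vs. Poly_Mapping.single v (Poly_Mapping.lookup \<beta> v)) + Poly_Mapping.single v (Poly_Mapping.lookup \<beta> v)) b"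
    unfolding foldr.simps o_def by (rule partial_power_jets[OF J Cons.IH]) (use Cons.prems in auto)
  then show ?case using Cons.prems by (simp add: add.commute)
qed simp

text \<open>Whichever enumeration SOME selects, the steps add up to the same multi-index.\<close>

lemma mixed_partial_jets:
  assumes J: "jets U J" and b: "b \<in> U"
  shows "mixed_partial \<beta> (J 0) b = J \<beta> b"
proof -
  define vs where "vs = (SOME vs. distinct vs \<and> set vs = Poly_Mapping.keys \<beta>)"
  have ex: "\<exists>vs. distinct vs \<and> set vs = Poly_Mapping.keys \<beta>"
    using finite_distinct_list[OF finite_keys[of \<beta>]] by blast
  have "distinct vs \<and> set vs = Poly_Mapping.keys \<beta>"
    unfolding vs_def by (rule someI_ex[OF ex])
  then have vs: "distinct vs" "set vs = Poly_Mapping.keys \<beta>" by auto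
  have "(\<Sum>v\<in>Poly_Mapping.keys \<beta>. Poly_Mapping.single v (Poly_Mapping.lookup \<beta> v)) = \<beta>"
    by (rule poly_mapping_eqI) (auto simp: lookup_sum lookup_single when_def in_keys_iff)
  then show ?thesis
    unfolding mixed_partial_def vs_def[symmetric] foldr_partial_jets[OF J vs(1) b] by (simp add: vs(2))
qed

lemma weyl_apply_jets:
  assumes "jets U J" "b \<in> U"
  shows "weyl_apply P (J 0) b = weyl_value J b P"
  unfolding weyl_apply_def weyl_value_def lin_ext_def monom_value_def
  by (rule sum.cong[OF refl]) (auto simp: mixed_partial_jets[OF assms])

section \<open>The Leibniz rule for normally ordered products\<close>

definition leibniz_coeff :: "('v \<Rightarrow>\<^sub>0 nat) \<Rightarrow> ('v \<Rightarrow>\<^sub>0 nat) \<Rightarrow> ('v \<Rightarrow>\<^sub>0 nat) \<Rightarrow> nat" where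
  "leibniz_coeff \<beta> \<gamma> \<kappa> = (\<Prod>v\<in>Poly_Mapping.keys \<kappa>. (Poly_Mapping.lookup \<beta> v choose Poly_Mapping.lookup \<kappa> v) *
     (Poly_Mapping.lookup \<gamma> v choose Poly_Mapping.lookup \<kappa> v) * fact (Poly_Mapping.lookup \<kappa> v))"

definition below :: "('v \<Rightarrow>\<^sub>0 nat) \<Rightarrow> ('v \<Rightarrow>\<^sub>0 nat) set" where
  "below \<gamma> = {\<kappa>. \<forall>v. Poly_Mapping.lookup \<kappa> v \<le> Poly_Mapping.lookup \<gamma> v}"

lemma finite_below: "finite (below \<gamma>)"
proof (rule finite_imageD)
  let ?g = "\<lambda>\<kappa>. restrict (Poly_Mapping.lookup \<kappa>) (Poly_Mapping.keys \<gamma>)"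
  have "?g ` below \<gamma> \<subseteq> (\<Pi>\<^sub>E v\<in>Poly_Mapping.keys \<gamma>. {..Poly_Mapping.lookup \<gamma> v})"
    by (auto simp: below_def)
  then show "finite (?g ` below \<gamma>)"
    by (rule finite_subset) (intro finite_PiE finite_keys finite_atMost)
  show "inj_on ?g (below \<gamma>)"
  proof (rule inj_onI)
    fix \<kappa> \<kappa>' assume \<kappa>: "\<kappa> \<in> below \<gamma>" "\<kappa>' \<in> below \<gamma>" and eq: "?g \<kappa> = ?g \<kappa>'"
    show "\<kappa> = \<kappa>'"
    proof (rule poly_mapping_eqI)
      fix v show "Poly_Mapping.lookup \<kappa> v = Poly_Mapping.lookup \<kappa>' v"
      proof (cases "v \<in> Poly_Mapping.keys \<gamma>")
        case True
        then show ?thesis using fun_cong[OF eq, of v] by simp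
      next
        case False
        then show ?thesis using \<kappa> by (simp add: below_def in_keys_iff) (metis le_zero_eq)
      qed
    qed
  qed
qed

lemma leibniz_coeff_keys:
  assumes "\<kappa> \<in> below \<gamma>"
  shows "leibniz_coeff \<beta> \<gamma> \<kappa> = (\<Prod>v\<in>Poly_Mapping.keys \<gamma>. (Poly_Mapping.lookup \<beta> v choose Poly_Mapping.lookup \<kappa> v) *
     (Poly_Mapping.lookup \<gamma> v choose Poly_Mapping.lookup \<kappa> v) * fact (Poly_Mapping.lookup \<kappa> v))"
  unfolding leibniz_coeff_def
proof (rule prod.mono_neutral_left)
  show "Poly_Mapping.keys \<kappa> \<subseteq> Poly_Mapping.keys \<gamma>"
  proof
    fix v assume "v \<in> Poly_Mapping.keys \<kappa>"
    moreover have "Poly_Mapping.lookup \<kappa> v \<le> Poly_Mapping.lookup \<gamma> v" using assms by (simp add: below_def)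
    ultimately show "v \<in> Poly_Mapping.keys \<gamma>" by (simp add: in_keys_iff)
  qed
qed (auto simp: in_keys_iff)

lemma leibniz_coeff_eq_0: "\<kappa> \<notin> below \<beta> \<Longrightarrow> leibniz_coeff \<beta> \<gamma> \<kappa> = 0"
  by (auto simp: leibniz_coeff_def below_def in_keys_iff not_le intro!: binomial_eq_0)

text \<open>The value at \<open>b\<close> of the following operation on \<open>J 0\<close>:
  differentiate by \<open>\<delta>\<close>, multiply by the monomial \<open>\<gamma>\<close>, and
  differentiate by \<open>\<beta>\<close>.\<close>

definition leibniz_term ::
  "(('v \<Rightarrow>\<^sub>0 nat) \<Rightarrow> ('v \<Rightarrow> complex) \<Rightarrow> complex) \<Rightarrow> ('v \<Rightarrow> complex) \<Rightarrow> ('v \<Rightarrow>\<^sub>0 nat) \<Rightarrow> ('v \<Rightarrow>\<^sub>0 nat) \<times> ('v \<Rightarrow>\<^sub>0 nat) \<Rightarrow> complex" where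
  "leibniz_term J b \<beta> = (\<lambda>(\<gamma>, \<delta>). \<Sum>\<kappa>\<in>below \<gamma>.
     of_nat (leibniz_coeff \<beta> \<gamma> \<kappa>) * monom_value b (\<gamma> - \<kappa>) * J (\<beta> - \<kappa> + \<delta>) b)"

lemma choose_fact_step: "(g choose Suc k) * fact (Suc k) = (g choose k) * fact k * (g - k :: nat)"
proof -
  have "Suc k * (g choose Suc k) = (g - k) * (g choose k)"
    using binomial_absorb_comp[of g k] binomial_absorption[of k g]
    by (cases g) (simp_all add: mult.commute)
  moreover have "(g choose Suc k) * fact (Suc k) = (Suc k * (g choose Suc k)) * fact k"
    by (simp only: fact_Suc of_nat_id mult_ac)
  ultimately show ?thesis by (simp only: mult_ac)
qed

text \<open>Pascal's rule in the variable \<open>v\<close>. The factor supplied by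
  \<open>choose_fact_step\<close> is the exponent that appears when the monomial is differentiated
  once more.\<close>

lemma leibniz_coeff_step:
  assumes \<kappa>: "\<kappa> \<in> below \<gamma>"
  shows "leibniz_coeff (\<beta> + Poly_Mapping.single v 1) \<gamma> \<kappa> = leibniz_coeff \<beta> \<gamma> \<kappa> +
    (if Poly_Mapping.lookup \<kappa> v = 0 then 0 else
      leibniz_coeff \<beta> \<gamma> (\<kappa> - Poly_Mapping.single v 1) * (Poly_Mapping.lookup \<gamma> v - Poly_Mapping.lookup (\<kappa> - Poly_Mapping.single v 1) v))"
proof (cases "v \<in> Poly_Mapping.keys \<gamma>")
  case False
  then have "Poly_Mapping.lookup \<kappa> v = 0" using \<kappa> by (simp add: below_def in_keys_iff) (metis le_zero_eq)
  moreover have "leibniz_coeff (\<beta> + Poly_Mapping.single v 1) \<gamma> \<kappa> = leibniz_coeff \<beta> \<gamma> \<kappa>"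
    unfolding leibniz_coeff_keys[OF \<kappa>]
    by (rule prod.cong[OF refl]) (use False in \<open>auto simp: lookup_add lookup_single when_def\<close>)
  ultimately show ?thesis by simp
next
  case True
  let ?K = "Poly_Mapping.keys \<gamma> - {v}" and ?e = "Poly_Mapping.single v 1 :: 'a \<Rightarrow>\<^sub>0 nat"
  let ?F = "\<lambda>b g k. (b choose k) * (g choose k) * (fact k :: nat)"
  let ?l = Poly_Mapping.lookup
  have split: "leibniz_coeff \<beta>' \<gamma> \<kappa>' = ?F (?l \<beta>' v) (?l \<gamma> v) (?l \<kappa>' v) * (\<Prod>u\<in>?K. ?F (?l \<beta>' u) (?l \<gamma> u) (?l \<kappa>' u))"
    if "\<kappa>' \<in> below \<gamma>" for \<beta>' \<kappa>'
    unfolding leibniz_coeff_keys[OF that] by (subst prod.remove[OF finite_keys True]) simp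
  define R where "R = (\<Prod>u\<in>?K. ?F (?l \<beta> u) (?l \<gamma> u) (?l \<kappa> u))"
  have R1: "(\<Prod>u\<in>?K. ?F (?l (\<beta> + ?e) u) (?l \<gamma> u) (?l \<kappa> u)) = R"
    unfolding R_def by (rule prod.cong) (auto simp: lookup_add lookup_single when_def)
  have R2: "(\<Prod>u\<in>?K. ?F (?l \<beta> u) (?l \<gamma> u) (?l (\<kappa> - ?e) u)) = R"
    unfolding R_def by (rule prod.cong) (auto simp: lookup_minus lookup_single when_def)
  have b: "\<kappa> - ?e \<in> below \<gamma>"
    using \<kappa> by (auto simp: below_def lookup_minus intro: order_trans[OF diff_le_self])
  show ?thesis
  proof (cases "?l \<kappa> v")
    case 0
    then show ?thesis unfolding split[OF \<kappa>] R1 R_def[symmetric] by simp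
  next
    case (Suc k)
    have k: "?l (\<kappa> - ?e) v = k" by (simp add: lookup_minus Suc)
    have b1: "?l (\<beta> + ?e) v = Suc (?l \<beta> v)" by (simp add: lookup_add)
    have F: "?F (Suc (?l \<beta> v)) (?l \<gamma> v) (Suc k) = ?F (?l \<beta> v) (?l \<gamma> v) (Suc k) + ?F (?l \<beta> v) (?l \<gamma> v) k * (?l \<gamma> v - k)"
      using choose_fact_step[of "?l \<gamma> v" k] by (simp only: binomial_Suc_Suc distrib_right mult.assoc)
    show ?thesis
      unfolding split[OF \<kappa>] split[OF b] R1 R2 R_def[symmetric] k b1 Suc F distrib_right by (simp add: mult_ac)
  qed
qed

text \<open>By the product rule the new derivative falls on the monomial or on \<open>J\<close>. The
  terms of the first kind are reindexed by raising \<open>\<kappa>\<close> at \<open>v\<close>,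
  after which \<open>leibniz_coeff_step\<close> combines both kinds.\<close>

lemma leibniz_term_deriv:
  assumes J: "jets U J" and b: "b \<in> U"
  shows "((\<lambda>z. leibniz_term J (b(v := z)) \<beta> p) has_field_derivative leibniz_term J b (\<beta> + Poly_Mapping.single v 1) p) (at (b v))"
proof -
  obtain \<gamma> \<delta> where p: "p = (\<gamma>, \<delta>)" by fastforce
  let ?e = "Poly_Mapping.single v 1 :: 'a \<Rightarrow>\<^sub>0 nat" and ?l = Poly_Mapping.lookup
  let ?c = "\<lambda>\<kappa>. of_nat (leibniz_coeff \<beta> \<gamma> \<kappa>) :: complex"
  define D where "D \<kappa> = ?c \<kappa> * of_nat (?l (\<gamma> - \<kappa>) v) * monom_value b (\<gamma> - \<kappa> - ?e) * J (\<beta> - \<kappa> + \<delta>) b" for \<kappa>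
  define f where "f \<kappa> = monom_value b (\<gamma> - \<kappa>) * J (\<beta> + ?e - \<kappa> + \<delta>) b" for \<kappa>
  have "((\<lambda>z. leibniz_term J (b(v := z)) \<beta> p) has_field_derivative
      (\<Sum>\<kappa>\<in>below \<gamma>. D \<kappa> + ?c \<kappa> * monom_value b (\<gamma> - \<kappa>) * J (\<beta> - \<kappa> + \<delta> + ?e) b)) (at (b v))"
  proof -
    have "((\<lambda>z. ?c \<kappa> * monom_value (b(v := z)) (\<gamma> - \<kappa>) * J (\<beta> - \<kappa> + \<delta>) (b(v := z))) has_field_derivative
      (D \<kappa> + ?c \<kappa> * monom_value b (\<gamma> - \<kappa>) * J (\<beta> - \<kappa> + \<delta> + ?e) b)) (at (b v))" for \<kappa>
    proof -
      have "((\<lambda>z. J (\<beta> - \<kappa> + \<delta>) (b(v := z))) has_field_derivative J (\<beta> - \<kappa> + \<delta> + ?e) b) (at (b v))"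
        using J b by (simp add: jets_def)
      from DERIV_mult[OF DERIV_cmult[OF monom_value_deriv[of b v "\<gamma> - \<kappa>"], of "?c \<kappa>"] this] show ?thesis
        by (simp add: D_def mult_ac add.commute)
    qed
    then show ?thesis unfolding p leibniz_term_def prod.case by (rule DERIV_sum)
  qed
  moreover have "(\<Sum>\<kappa>\<in>below \<gamma>. D \<kappa> + ?c \<kappa> * monom_value b (\<gamma> - \<kappa>) * J (\<beta> - \<kappa> + \<delta> + ?e) b) =
      leibniz_term J b (\<beta> + ?e) p"
  proof -
    \<comment> \<open>Moving the new index past the truncated difference
      \<open>\<beta> - \<kappa>\<close> is legitimate only for \<open>\<kappa>\<close> below
      \<open>\<beta>\<close>; in all other cases the coefficient is 0.\<close>
    have 1: "?c \<kappa> * monom_value b (\<gamma> - \<kappa>) * J (\<beta> - \<kappa> + \<delta> + ?e) b = ?c \<kappa> * f \<kappa>" for \<kappa>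
    proof (cases "\<kappa> \<in> below \<beta>")
      case True
      then have "\<beta> - \<kappa> + \<delta> + ?e = \<beta> + ?e - \<kappa> + \<delta>"
      proof (intro poly_mapping_eqI)
        fix k
        have "?l \<kappa> k \<le> ?l \<beta> k" using True by (simp add: below_def)
        then show "?l (\<beta> - \<kappa> + \<delta> + ?e) k = ?l (\<beta> + ?e - \<kappa> + \<delta>) k" by (simp add: lookup_add lookup_minus)
      qed
      then show ?thesis by (simp only: f_def mult.assoc)
    qed (simp add: leibniz_coeff_eq_0)
    let ?P = "{\<kappa>\<in>below \<gamma>. ?l \<kappa> v \<noteq> 0}"
    \<comment> \<open>Where \<open>\<kappa>\<close> has reached \<open>\<gamma>\<close> at
      \<open>v\<close>, the monomial no longer contains \<open>v\<close> and its derivative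
      vanishes.\<close>
    have "(\<Sum>\<kappa>\<in>below \<gamma>. D \<kappa>) = (\<Sum>\<kappa>\<in>{\<kappa>\<in>below \<gamma>. ?l \<kappa> v < ?l \<gamma> v}. D \<kappa>)"
      by (rule sum.mono_neutral_right[OF finite_below]) (auto simp: D_def lookup_minus below_def nat_less_le)
    also have "\<dots> = (\<Sum>\<kappa>\<in>?P. of_nat (leibniz_coeff \<beta> \<gamma> (\<kappa> - ?e) * (?l \<gamma> v - ?l (\<kappa> - ?e) v)) * f \<kappa>)"
    proof (rule sum.reindex_bij_witness[where i = "\<lambda>\<kappa>. \<kappa> - ?e" and j = "\<lambda>\<kappa>. \<kappa> + ?e"])
      fix \<kappa> assume \<kappa>: "\<kappa> \<in> {\<kappa>\<in>below \<gamma>. ?l \<kappa> v < ?l \<gamma> v}"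
      show "\<kappa> + ?e - ?e = \<kappa>" by simp
      show "\<kappa> + ?e \<in> ?P" using \<kappa> by (auto simp: below_def lookup_add lookup_single when_def)
      have "\<gamma> - (\<kappa> + ?e) = \<gamma> - \<kappa> - ?e" "\<beta> + ?e - (\<kappa> + ?e) = \<beta> - \<kappa>"
        by (intro poly_mapping_eqI, simp add: lookup_add lookup_minus)+
      then show "of_nat (leibniz_coeff \<beta> \<gamma> (\<kappa> + ?e - ?e) * (?l \<gamma> v - ?l (\<kappa> + ?e - ?e) v)) * f (\<kappa> + ?e) = D \<kappa>"
        by (simp add: f_def D_def lookup_minus)
    next
      fix \<kappa> assume \<kappa>: "\<kappa> \<in> ?P"
      show eq: "\<kappa> - ?e + ?e = \<kappa>"
        using \<kappa> by (intro poly_mapping_eqI) (auto simp: lookup_add lookup_minus lookup_single when_def)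
      have "?l \<kappa> v \<le> ?l \<gamma> v" "?l \<kappa> v \<noteq> 0" using \<kappa> by (auto simp: below_def)
      then have "?l (\<kappa> - ?e) v < ?l \<gamma> v" by (simp add: lookup_minus)
      moreover have "\<kappa> - ?e \<in> below \<gamma>"
        using \<kappa> by (auto simp: below_def lookup_minus intro: order_trans[OF diff_le_self])
      ultimately show "\<kappa> - ?e \<in> {\<kappa>\<in>below \<gamma>. ?l \<kappa> v < ?l \<gamma> v}" by simp
    qed
    also have "\<dots> = (\<Sum>\<kappa>\<in>below \<gamma>. of_nat (if ?l \<kappa> v = 0 then 0 else
        leibniz_coeff \<beta> \<gamma> (\<kappa> - ?e) * (?l \<gamma> v - ?l (\<kappa> - ?e) v)) * f \<kappa>)"
      by (rule sum.mono_neutral_cong_left) (auto simp: finite_below)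
    finally have 2: "(\<Sum>\<kappa>\<in>below \<gamma>. D \<kappa>) = \<dots>" .
    have "leibniz_term J b (\<beta> + ?e) p = (\<Sum>\<kappa>\<in>below \<gamma>. of_nat (leibniz_coeff (\<beta> + ?e) \<gamma> \<kappa>) * f \<kappa>)"
      by (simp add: p leibniz_term_def f_def mult.assoc)
    also have "\<dots> = (\<Sum>\<kappa>\<in>below \<gamma>. ?c \<kappa> * f \<kappa>) + (\<Sum>\<kappa>\<in>below \<gamma>. D \<kappa>)"
      unfolding 2 sum.distrib[symmetric]
      by (rule sum.cong[OF refl]) (simp only: leibniz_coeff_step of_nat_add distrib_right)
    finally show ?thesis by (simp only: sum.distrib 1) (simp only: add.commute)
  qed
  ultimately show ?thesis by simp
qed

lemma weyl_value_mult:
  "weyl_value J b (weyl_mult A g) =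
    (\<Sum>(\<alpha>, \<beta>)\<in>Poly_Mapping.keys A. Poly_Mapping.lookup A (\<alpha>, \<beta>) * monom_value b \<alpha> * lin_ext (leibniz_term J b \<beta>) g)"
proof -
  have eq: "(\<Sum>\<kappa>\<in>{\<kappa>. \<forall>v. Poly_Mapping.lookup \<kappa> v \<le> Poly_Mapping.lookup \<beta> v \<and> Poly_Mapping.lookup \<kappa> v \<le> Poly_Mapping.lookup \<gamma> v}.
      x * y * of_nat (leibniz_coeff \<beta> \<gamma> \<kappa>) * (monom_value b (\<alpha> + (\<gamma> - \<kappa>)) * J (\<beta> - \<kappa> + \<delta>) b)) =
      x * monom_value b \<alpha> * (y * leibniz_term J b \<beta> (\<gamma>, \<delta>))" for x y \<alpha> \<beta> \<gamma> \<delta>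
  proof -
    have "(\<Sum>\<kappa>\<in>{\<kappa>. \<forall>v. Poly_Mapping.lookup \<kappa> v \<le> Poly_Mapping.lookup \<beta> v \<and> Poly_Mapping.lookup \<kappa> v \<le> Poly_Mapping.lookup \<gamma> v}.
      x * y * of_nat (leibniz_coeff \<beta> \<gamma> \<kappa>) * (monom_value b (\<alpha> + (\<gamma> - \<kappa>)) * J (\<beta> - \<kappa> + \<delta>) b)) =
      (\<Sum>\<kappa>\<in>below \<gamma>. x * y * of_nat (leibniz_coeff \<beta> \<gamma> \<kappa>) * (monom_value b (\<alpha> + (\<gamma> - \<kappa>)) * J (\<beta> - \<kappa> + \<delta>) b))"
      by (rule sum.mono_neutral_left[OF finite_below]) (auto simp: below_def intro!: leibniz_coeff_eq_0)
    then show ?thesis by (simp add: leibniz_term_def monom_value_add sum_distrib_left mult_ac)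
  qed
  show ?thesis
    unfolding weyl_mult_def weyl_value_def lin_ext_sum case_prod_beta leibniz_coeff_def[symmetric] lin_ext_single fst_conv snd_conv
    by (intro sum.cong refl) (simp only: eq, simp add: lin_ext_def sum_distrib_left mult.assoc)
qed

text \<open>A generator annihilates \<open>J 0\<close> on the whole open set \<open>U\<close>, so
  that all partial derivatives of this relation hold there too. By the Leibniz rule they are exactly
  the values that a left factor brings in.\<close>

lemma weyl_left_ideal_annihilates:
  assumes J: "jets U J" and gens: "\<And>g b. g \<in> gens \<Longrightarrow> b \<in> U \<Longrightarrow> weyl_value J b g = 0"
    and Q: "Q \<in> weyl_left_ideal B gens" and b: "b \<in> U"
  shows "weyl_apply Q (J 0) b = 0"
proof -
  have zero: "lin_ext (leibniz_term J b \<beta>) g = 0" if g: "g \<in> gens" and b: "b \<in> U" for g \<beta> b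
    using b
  proof (induction "\<Sum>v\<in>Poly_Mapping.keys \<beta>. Poly_Mapping.lookup \<beta> v" arbitrary: \<beta> b)
    case 0
    then have "\<beta> = 0" by (intro poly_mapping_eqI) (auto simp: in_keys_iff)
    moreover have "leibniz_term J b 0 = (\<lambda>(\<alpha>, \<beta>). monom_value b \<alpha> * J \<beta> b)"
    proof
      fix p :: "('a \<Rightarrow>\<^sub>0 nat) \<times> ('a \<Rightarrow>\<^sub>0 nat)"
      obtain \<gamma> \<delta> where p: "p = (\<gamma>, \<delta>)" by fastforce
      have "(\<Sum>\<kappa>\<in>below \<gamma>. of_nat (leibniz_coeff 0 \<gamma> \<kappa>) * monom_value b (\<gamma> - \<kappa>) * J (0 - \<kappa> + \<delta>) b) =
          (\<Sum>\<kappa>\<in>{0}. of_nat (leibniz_coeff 0 \<gamma> \<kappa>) * monom_value b (\<gamma> - \<kappa>) * J (0 - \<kappa> + \<delta>) b)"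
      proof (rule sum.mono_neutral_right[OF finite_below])
        have "\<kappa> \<in> below 0 \<Longrightarrow> \<kappa> = 0" for \<kappa> :: "'a \<Rightarrow>\<^sub>0 nat"
          by (intro poly_mapping_eqI) (simp add: below_def)
        then show "\<forall>\<kappa>\<in>below \<gamma> - {0}. of_nat (leibniz_coeff 0 \<gamma> \<kappa>) * monom_value b (\<gamma> - \<kappa>) * J (0 - \<kappa> + \<delta>) b = 0"
          using leibniz_coeff_eq_0[of _ 0 \<gamma>] by (metis DiffE insertI1 mult_zero_left of_nat_0)
      qed (simp add: below_def)
      then show "leibniz_term J b 0 p = (case p of (\<alpha>, \<beta>) \<Rightarrow> monom_value b \<alpha> * J \<beta> b)"
        by (simp add: leibniz_term_def p leibniz_coeff_def)
    qed
    ultimately show ?case using gens[OF g 0(2)] by (simp add: weyl_value_def)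
  next
    case (Suc n)
    then obtain v where v: "v \<in> Poly_Mapping.keys \<beta>"
      by (metis Zero_not_Suc sum.neutral)
    let ?e = "Poly_Mapping.single v 1 :: 'a \<Rightarrow>\<^sub>0 nat"
    have \<beta>: "\<beta> = \<beta> - ?e + ?e"
      using v by (intro poly_mapping_eqI) (auto simp: lookup_add lookup_minus lookup_single when_def in_keys_iff)
    have "(\<Sum>u\<in>Poly_Mapping.keys (\<beta> - ?e). Poly_Mapping.lookup (\<beta> - ?e) u) =
        (\<Sum>u\<in>Poly_Mapping.keys \<beta>. Poly_Mapping.lookup (\<beta> - ?e) u)"
      by (rule sum.mono_neutral_left) (auto simp: in_keys_iff lookup_minus)
    also have "\<dots> = (\<Sum>u\<in>Poly_Mapping.keys \<beta> - {v}. Poly_Mapping.lookup \<beta> u) + (Poly_Mapping.lookup \<beta> v - 1)"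
      by (subst sum.remove[OF finite_keys v]) (auto simp: lookup_minus lookup_single when_def intro!: sum.cong split: if_splits)
    also have "\<dots> = n"
      using Suc(2) v by (subst (asm) sum.remove[OF finite_keys v]) (auto simp: in_keys_iff)
    finally have IH: "lin_ext (leibniz_term J b (\<beta> - ?e)) g = 0" if "b \<in> U" for b
      using Suc(1)[of "\<beta> - ?e"] that by simp
    have "((\<lambda>z. lin_ext (leibniz_term J (b(v := z)) (\<beta> - ?e)) g) has_field_derivative
        lin_ext (leibniz_term J b (\<beta> - ?e + ?e)) g) (at (b v))"
      unfolding lin_ext_def by (intro DERIV_sum DERIV_cmult leibniz_term_deriv[OF J Suc(3)])
    moreover have "((\<lambda>z. lin_ext (leibniz_term J (b(v := z)) (\<beta> - ?e)) g) has_field_derivative 0) (at (b v))"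
    proof -
      have "open U" using J by (simp add: jets_def)
      then have "eventually (\<lambda>z. lin_ext (leibniz_term J (b(v := z)) (\<beta> - ?e)) g = 0) (nhds (b v))"
        by (rule eventually_mono[OF eventually_fun_upd[OF _ Suc(3)]]) (rule IH)
      then show ?thesis by (subst DERIV_cong_ev[OF refl _ refl]) auto
    qed
    ultimately show ?case using DERIV_unique \<beta> by metis
  qed
  obtain m A g where A: "\<And>l. l < m \<Longrightarrow> g l \<in> gens" and Q: "Q = (\<Sum>l<(m::nat). weyl_mult (A l) (g l))"
    using Q by (auto simp: weyl_left_ideal_def)
  have "weyl_value J b Q = (\<Sum>l<m. weyl_value J b (weyl_mult (A l) (g l)))"
    unfolding Q weyl_value_def by (rule lin_ext_sum)
  also have "\<dots> = 0"
    using zero[OF A b] by (intro sum.neutral ballI) (simp add: weyl_value_mult)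
  finally show ?thesis by (simp add: weyl_apply_jets[OF J b])
qed

section \<open>Parameter integrals over compact sets\<close>

lemma integrable_on_compact:
  fixes f :: "'a::euclidean_space \<Rightarrow> 'b::euclidean_space"
  assumes "compact S" "continuous_on S f"
  shows "f integrable_on S"
  using set_borel_integral_eq_integral(1)[of S f] borel_integrable_compact[OF assms]
  by (simp add: set_integrable_def)

lemma norm_integral_bound_const:
  fixes f :: "'a::euclidean_space \<Rightarrow> complex"
  assumes "compact S" "continuous_on S f" "\<And>u. u \<in> S \<Longrightarrow> norm (f u) \<le> B"
  shows "norm (integral S f) \<le> B * integral S (\<lambda>_. 1)"
proof -
  have "norm (integral S f) \<le> integral S (\<lambda>_. B * 1)"
    by (rule integral_norm_bound_integral) (use assms in \<open>auto intro!: integrable_on_compact continuous_intros\<close>)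
  then show ?thesis by (simp only: integral_mult_right)
qed

lemma continuous_on_slice:
  assumes "continuous_on (U \<times> S) (\<lambda>(b, u). f b u)" "b \<in> U"
  shows "continuous_on S (f b)"
proof -
  have "continuous_on S (\<lambda>u. (\<lambda>(b, u). f b u) (b, u))"
    by (rule continuous_on_compose2[OF assms(1)]) (use assms(2) in \<open>auto intro!: continuous_on_Pair continuous_on_const continuous_on_id\<close>)
  then show ?thesis by simp
qed

text \<open>The parameters form merely a topological space, namely a space of coefficient functions;
  compactness of \<open>S\<close> supplies uniformity in the integration variable.\<close>

lemma continuous_on_param_integral:
  fixes f :: "'p::topological_space \<Rightarrow> 'a::euclidean_space \<Rightarrow> complex"
  assumes S: "compact S" and f: "continuous_on (U \<times> S) (\<lambda>(b, u). f b u)"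
  shows "continuous_on U (\<lambda>b. integral S (f b))"
  unfolding continuous_on_def
proof
  fix b0 assume b0: "b0 \<in> U"
  define c where "c = integral S (\<lambda>_. 1 :: real)"
  have c: "0 \<le> c" unfolding c_def by (rule integral_nonneg) (auto intro: integrable_on_compact[OF S])
  note fb = continuous_on_slice[OF f]
  show "((\<lambda>b. integral S (f b)) \<longlongrightarrow> integral S (f b0)) (at b0 within U)"
  proof (rule tendstoI)
    fix e :: real assume e: "0 < e"
    define e' where "e' = e / (c + 1)"
    have e': "0 < e'" using e c by (simp add: e'_def)
    obtain X where X: "b0 \<in> X" "open X"
        "\<forall>b\<in>X \<inter> U. \<forall>u\<in>S. dist ((\<lambda>(b, u). f b u) (b, u)) ((\<lambda>(b, u). f b u) (b0, u)) \<le> e'"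
      by (rule continuous_on_prod_compactE[OF f S b0 e'])
    have "dist (integral S (f b)) (integral S (f b0)) < e" if b: "b \<in> X" "b \<in> U" for b
    proof -
      have "norm (integral S (\<lambda>u. f b u - f b0 u)) \<le> e' * c"
        unfolding c_def using X(3) b b0 fb by (intro norm_integral_bound_const[OF S] continuous_intros) (auto simp: dist_norm)
      moreover have "integral S (\<lambda>u. f b u - f b0 u) = integral S (f b) - integral S (f b0)"
        using b b0 fb by (intro integral_diff integrable_on_compact[OF S]) auto
      moreover have "e' * c < e" using e c by (simp add: e'_def field_simps)
      ultimately show ?thesis by (simp add: dist_norm)
    qed
    then show "eventually (\<lambda>b. dist (integral S (f b)) (integral S (f b0)) < e) (at b0 within U)"
      using X(1,2) by (auto simp: eventually_at_topological)
  qed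
qed

text \<open>The mean value inequality for f z u - z f' z0 u on a ball bounds the remainder uniformly
  in \<open>u\<close>.\<close>

lemma has_field_derivative_param_integral:
  fixes f f' :: "complex \<Rightarrow> 'a::euclidean_space \<Rightarrow> complex"
  assumes S: "compact S" and V: "open V" "z0 \<in> V"
    and f: "\<And>z. z \<in> V \<Longrightarrow> continuous_on S (f z)" and f': "continuous_on (V \<times> S) (\<lambda>(z, u). f' z u)"
    and deriv: "\<And>z u. z \<in> V \<Longrightarrow> u \<in> S \<Longrightarrow> ((\<lambda>z. f z u) has_field_derivative f' z u) (at z)"
  shows "((\<lambda>z. integral S (f z)) has_field_derivative integral S (f' z0)) (at z0)"
proof -
  define c where "c = integral S (\<lambda>_. 1 :: real)"
  have c: "0 \<le> c" unfolding c_def by (rule integral_nonneg) (auto intro: integrable_on_compact[OF S])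
  note f'0 = continuous_on_slice[OF f' V(2)]
  show ?thesis
    unfolding has_field_derivative_iff
  proof (rule tendstoI)
    fix e :: real assume e: "0 < e"
    define e' where "e' = e / (c + 1)"
    have e': "0 < e'" using e c by (simp add: e'_def)
    obtain X where X: "z0 \<in> X" "open X" "\<forall>z\<in>X \<inter> V. \<forall>u\<in>S. dist (f' z u) (f' z0 u) \<le> e'"
      using continuous_on_prod_compactE[OF f' S V(2) e'] by auto
    obtain d where d: "0 < d" "ball z0 d \<subseteq> X \<inter> V"
      using open_Int[OF X(2) V(1)] X(1) V(2) by (meson IntI open_contains_ball)
    have "dist ((integral S (f z) - integral S (f z0)) / (z - z0)) (integral S (f' z0)) < e"
      if z: "z \<noteq> z0" "dist z z0 < d" for z
    proof -
      have zV: "z \<in> V" and z0d: "z0 \<in> ball z0 d" and zd: "z \<in> ball z0 d"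
        using d z by (auto simp: dist_commute)
      define r where "r u = f z u - f z0 u - (z - z0) * f' z0 u" for u
      have r: "norm (r u) \<le> e' * norm (z - z0)" if u: "u \<in> S" for u
      proof -
        have "norm ((f z u - z * f' z0 u) - (f z0 u - z0 * f' z0 u)) \<le> e' * norm (z - z0)"
        proof (rule field_differentiable_bound[where S = "ball z0 d" and f' = "\<lambda>z. f' z u - f' z0 u"])
          fix y assume y: "y \<in> ball z0 d"
          have "((\<lambda>z. f z u) has_field_derivative f' y u) (at y)"
            using deriv[of y u] y d u by auto
          from DERIV_diff[OF this DERIV_cmult_right[OF DERIV_ident, of "f' z0 u"]]
          show "((\<lambda>z. f z u - z * f' z0 u) has_field_derivative f' y u - f' z0 u) (at y within ball z0 d)"
            by (simp add: has_field_derivative_at_within)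
          show "norm (f' y u - f' z0 u) \<le> e'"
          proof -
            have "y \<in> X \<inter> V" using y d(2) by blast
            then show ?thesis using X(3) u by (auto simp: dist_norm)
          qed
        qed (use z0d zd in auto)
        then show ?thesis by (simp add: r_def algebra_simps)
      qed
      have cr: "continuous_on S r"
        unfolding r_def by (intro continuous_intros f f'0 zV V(2))
      have "norm (integral S r) \<le> e' * norm (z - z0) * c"
        unfolding c_def by (rule norm_integral_bound_const[OF S cr r])
      moreover have "integral S r = integral S (f z) - integral S (f z0) - (z - z0) * integral S (f' z0)"
      proof -
        have "integral S r = integral S (\<lambda>u. f z u - f z0 u) - integral S (\<lambda>u. (z - z0) * f' z0 u)"
          unfolding r_def by (intro integral_diff integrable_on_compact[OF S] continuous_intros f f'0 zV V(2))
        also have "integral S (\<lambda>u. f z u - f z0 u) = integral S (f z) - integral S (f z0)"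
          by (intro integral_diff integrable_on_compact[OF S] f zV V(2))
        finally show ?thesis by simp
      qed
      ultimately have "norm (integral S (f z) - integral S (f z0) - (z - z0) * integral S (f' z0)) / norm (z - z0) \<le> e' * c"
        using z(1) by (simp add: field_simps)
      moreover have "(integral S (f z) - integral S (f z0)) / (z - z0) - integral S (f' z0) =
          (integral S (f z) - integral S (f z0) - (z - z0) * integral S (f' z0)) / (z - z0)"
        using z(1) by (simp add: field_simps)
      moreover have "e' * c < e" using e c by (simp add: e'_def field_simps)
      ultimately show ?thesis by (simp add: dist_norm norm_divide)
    qed
    then show "eventually (\<lambda>z. dist ((integral S (f z) - integral S (f z0)) / (z - z0)) (integral S (f' z0)) < e) (at z0)"
      using d(1) by (auto simp: eventually_at)
  qed
qed

text \<open>At \<open>b0\<close> the modulus has a positive minimum over \<open>S\<close>, and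
  nearby parameters change the values by at most half of it.\<close>

lemma open_nonvanishing:
  fixes f :: "'p::topological_space \<Rightarrow> 'a::topological_space \<Rightarrow> complex"
  assumes S: "compact S" and f: "continuous_on (UNIV \<times> S) (\<lambda>(b, u). f b u)"
  shows "open {b. \<forall>u\<in>S. f b u \<noteq> 0}"
proof (subst open_subopen, intro ballI)
  fix b0 assume b0: "b0 \<in> {b. \<forall>u\<in>S. f b u \<noteq> 0}"
  show "\<exists>T. open T \<and> b0 \<in> T \<and> T \<subseteq> {b. \<forall>u\<in>S. f b u \<noteq> 0}"
  proof (cases "S = {}")
    case True
    then show ?thesis by (intro exI[of _ UNIV]) auto
  next
    case False
    have c: "continuous_on S (\<lambda>u. norm (f b0 u))"
      by (intro continuous_on_norm continuous_on_slice[OF f]) simp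
    obtain u0 where u0: "u0 \<in> S" "\<And>u. u \<in> S \<Longrightarrow> norm (f b0 u0) \<le> norm (f b0 u)"
      using continuous_attains_inf[OF S False c] by blast
    define e where "e = norm (f b0 u0) / 2"
    have e: "0 < e" using b0 u0(1) by (simp add: e_def)
    obtain X where X: "b0 \<in> X" "open X"
        "\<forall>b\<in>X \<inter> UNIV. \<forall>u\<in>S. dist ((\<lambda>(b, u). f b u) (b, u)) ((\<lambda>(b, u). f b u) (b0, u)) \<le> e"
      by (rule continuous_on_prod_compactE[OF f S UNIV_I e])
    have "f b u \<noteq> 0" if "b \<in> X" "u \<in> S" for b u
    proof
      assume "f b u = 0"
      then have "norm (f b0 u) \<le> e" using X(3) that by (force simp: dist_norm)
      moreover have "2 * e \<le> norm (f b0 u)" using u0(2)[OF that(2)] by (simp add: e_def)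
      ultimately show False using e by linarith
    qed
    then show ?thesis using X(1,2) by (intro exI[of _ X]) auto
  qed
qed

section \<open>The periods and their derivatives in the coefficients\<close>

text \<open>The coordinates of the point of the multicone that belongs to \<open>w\<close>. The
  value 0 off the index set reflects that the sections do not depend on the remaining values of a
  coefficient function.\<close>

definition cox_coord :: "('r::finite \<Rightarrow> int ^ 'd::finite) \<Rightarrow> ('s \<Rightarrow> 'r \<Rightarrow> int) \<Rightarrow> complex ^ 'r \<Rightarrow> ('s, 'd) idx \<Rightarrow> complex" where
  "cox_coord \<rho> a w v = (if v \<in> coeff_index \<rho> a then eval_monom (cox_exponent \<rho> (a (fst v)) (snd v)) w else 0)"

definition weight :: "'s \<Rightarrow> (('s, 'd) idx \<Rightarrow>\<^sub>0 nat) \<Rightarrow> nat" where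
  "weight i \<beta> = (\<Sum>v\<in>Poly_Mapping.keys \<beta>. if fst v = i then Poly_Mapping.lookup \<beta> v else 0)"

text \<open>The m-th derivative of 1 / s.\<close>

definition inv_deriv :: "nat \<Rightarrow> complex \<Rightarrow> complex" where
  "inv_deriv m s = (- 1) ^ m * fact m / s ^ Suc m"

text \<open>The derivative of multi-index \<open>\<beta>\<close>, in the coefficients, of the
  product of the 1 / \<sigma>_i. Each section is linear in its own coefficients, with monomials in
  \<open>w\<close> as slopes, so that the first factor sees only the degree of
  \<open>\<beta>\<close> in each group of variables.\<close>

definition kernel :: "('r::finite \<Rightarrow> int ^ 'd::finite) \<Rightarrow> ('s::finite \<Rightarrow> 'r \<Rightarrow> int) \<Rightarrow>
    (('s, 'd) idx \<Rightarrow>\<^sub>0 nat) \<Rightarrow> (('s, 'd) idx \<Rightarrow> complex) \<Rightarrow> complex ^ 'r \<Rightarrow> complex" where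
  "kernel \<rho> a \<beta> b w = (\<Prod>i\<in>UNIV. inv_deriv (weight i \<beta>) (cox_section \<rho> a b i w)) * monom_value (cox_coord \<rho> a w) \<beta>"

lemma weight_zero [simp]: "weight i 0 = 0"
  by (simp add: weight_def)

lemma weight_single [simp]: "weight i (Poly_Mapping.single v n) = (if fst v = i then n else 0)"
  by (cases "n = 0") (simp_all add: weight_def)

lemma weight_add: "weight i (\<alpha> + \<beta>) = weight i \<alpha> + weight i \<beta>"
proof -
  have sup: "weight i \<gamma> = (\<Sum>v\<in>S. if fst v = i then Poly_Mapping.lookup \<gamma> v else 0)"
    if "finite S" "Poly_Mapping.keys \<gamma> \<subseteq> S" for S and \<gamma> :: "('a, 'b) idx \<Rightarrow>\<^sub>0 nat"
    unfolding weight_def by (rule sum.mono_neutral_left) (use that in \<open>auto simp: in_keys_iff\<close>)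
  let ?S = "Poly_Mapping.keys \<alpha> \<union> Poly_Mapping.keys \<beta>"
  have "weight i (\<alpha> + \<beta>) = (\<Sum>v\<in>?S. if fst v = i then Poly_Mapping.lookup (\<alpha> + \<beta>) v else 0)"
    by (rule sup) (use Poly_Mapping.keys_add[of \<alpha> \<beta>] in auto)
  also have "\<dots> = (\<Sum>v\<in>?S. if fst v = i then Poly_Mapping.lookup \<alpha> v else 0) + (\<Sum>v\<in>?S. if fst v = i then Poly_Mapping.lookup \<beta> v else 0)"
    unfolding sum.distrib[symmetric] by (rule sum.cong) (auto simp: lookup_add)
  finally show ?thesis by (simp add: sup[of ?S \<alpha>] sup[of ?S \<beta>])
qed

lemma inv_deriv_deriv:
  assumes "s \<noteq> 0"
  shows "(inv_deriv m has_field_derivative inv_deriv (Suc m) s) (at s)"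
proof -
  have "((\<lambda>s. s ^ Suc m) has_field_derivative of_nat (Suc m) * s ^ m) (at s)"
    by (rule DERIV_cong[OF DERIV_power[OF DERIV_ident]]) simp
  from DERIV_cmult[OF DERIV_inverse'[OF this], of "(- 1) ^ m * fact m"]
  have "((\<lambda>s. (- 1) ^ m * fact m * inverse (s ^ Suc m)) has_field_derivative
      (- 1) ^ m * fact m * (- (inverse (s ^ Suc m) * (of_nat (Suc m) * s ^ m) * inverse (s ^ Suc m)))) (at s)"
    using assms by simp
  moreover have "(- 1) ^ m * fact m * (- (inverse (s ^ Suc m) * (of_nat (Suc m) * s ^ m) * inverse (s ^ Suc m))) = inv_deriv (Suc m) s"
    using assms by (simp add: inv_deriv_def field_simps)
  moreover have "inv_deriv m = (\<lambda>s. (- 1) ^ m * fact m * inverse (s ^ Suc m))"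
    by (rule ext) (simp only: inv_deriv_def divide_inverse)
  ultimately show ?thesis by (simp only:)
qed

lemma cox_section_upd:
  assumes fin: "finite (polytope_points \<rho> (a i))"
  shows "cox_section \<rho> a (b(v := z)) i w = cox_section \<rho> a b i w + (if fst v = i then (z - b v) * cox_coord \<rho> a w v else 0)"
proof -
  obtain i' \<mu>' where v: "v = (i', \<mu>')" by fastforce
  have "cox_section \<rho> a (b(v := z)) i w = (\<Sum>\<mu>\<in>polytope_points \<rho> (a i). b (i, \<mu>) * eval_monom (cox_exponent \<rho> (a i) \<mu>) w +
      (if \<mu> = \<mu>' then if i' = i then (z - b v) * eval_monom (cox_exponent \<rho> (a i) \<mu>) w else 0 else 0))"
    unfolding cox_section_def by (rule sum.cong[OF refl]) (auto simp: v left_diff_distrib)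
  also have "\<dots> = cox_section \<rho> a b i w + (if \<mu>' \<in> polytope_points \<rho> (a i) then if i' = i then (z - b v) * eval_monom (cox_exponent \<rho> (a i) \<mu>') w else 0 else 0)"
    unfolding sum.distrib using fin by (simp add: cox_section_def)
  finally show ?thesis by (auto simp: v cox_coord_def coeff_index_def)
qed

lemma kernel_deriv:
  assumes fin: "\<And>i. finite (polytope_points \<rho> (a i))" and nz: "\<And>i. cox_section \<rho> a b i w \<noteq> 0"
  shows "((\<lambda>z. kernel \<rho> a \<beta> (b(v := z)) w) has_field_derivative kernel \<rho> a (\<beta> + Poly_Mapping.single v 1) b w) (at (b v))"
proof -
  let ?g = "\<lambda>i. inv_deriv (weight i \<beta>)" and ?i = "fst v" and ?e = "cox_coord \<rho> a w v"
  let ?R = "\<Prod>i\<in>UNIV - {?i}. ?g i (cox_section \<rho> a b i w)"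
  have "cox_section \<rho> a (b(v := z)) i w = cox_section \<rho> a b i w" if "i \<noteq> ?i" for i z
    using that by (simp add: cox_section_upd[OF fin])
  then have "(\<Prod>i\<in>UNIV - {?i}. ?g i (cox_section \<rho> a (b(v := z)) i w)) = ?R" for z
    by (intro prod.cong refl) simp
  then have eq: "kernel \<rho> a \<beta> (b(v := z)) w =
      ?g ?i (cox_section \<rho> a b ?i w + (z - b v) * ?e) * (?R * monom_value (cox_coord \<rho> a w) \<beta>)" for z
    unfolding kernel_def by (subst prod.remove[of UNIV ?i]) (simp_all add: cox_section_upd[OF fin] mult.assoc)
  have "((\<lambda>z. cox_section \<rho> a b ?i w + (z - b v) * ?e) has_field_derivative ?e) (at (b v))"
    by (auto intro!: derivative_eq_intros)
  from DERIV_chain2[OF _ this, of "?g ?i" "inv_deriv (Suc (weight ?i \<beta>)) (cox_section \<rho> a b ?i w)"]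
  have "((\<lambda>z. ?g ?i (cox_section \<rho> a b ?i w + (z - b v) * ?e)) has_field_derivative
      inv_deriv (Suc (weight ?i \<beta>)) (cox_section \<rho> a b ?i w) * ?e) (at (b v))"
    using inv_deriv_deriv[OF nz[of ?i]] by simp
  from DERIV_cmult_right[OF this, of "?R * monom_value (cox_coord \<rho> a w) \<beta>"]
  have "((\<lambda>z. kernel \<rho> a \<beta> (b(v := z)) w) has_field_derivative
      inv_deriv (Suc (weight ?i \<beta>)) (cox_section \<rho> a b ?i w) * ?e * (?R * monom_value (cox_coord \<rho> a w) \<beta>)) (at (b v))"
    unfolding eq by simp
  moreover have "kernel \<rho> a (\<beta> + Poly_Mapping.single v 1) b w =
      inv_deriv (Suc (weight ?i \<beta>)) (cox_section \<rho> a b ?i w) * ?e * (?R * monom_value (cox_coord \<rho> a w) \<beta>)"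
  proof -
    have "(\<Prod>i\<in>UNIV - {?i}. inv_deriv (weight i (\<beta> + Poly_Mapping.single v 1)) (cox_section \<rho> a b i w)) = ?R"
      by (rule prod.cong) (auto simp: weight_add)
    then show ?thesis
      unfolding kernel_def by (subst prod.remove[of UNIV ?i]) (simp_all add: weight_add monom_value_add mult_ac)
  qed
  ultimately show ?thesis by simp
qed

lemma kernel_zero: "kernel \<rho> a 0 b w = 1 / (\<Prod>i\<in>UNIV. cox_section \<rho> a b i w)"
  by (simp add: kernel_def inv_deriv_def prod_dividef)

lemma continuous_on_coeff [continuous_intros]:
  fixes f :: "'p::topological_space \<Rightarrow> 'v \<Rightarrow> complex"
  assumes "continuous_on S f"
  shows "continuous_on S (\<lambda>x. f x v)"
  using continuous_on_compose2[OF continuous_on_product_coordinates[of v] assms] by simp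

lemma continuous_on_section_param:
  assumes "continuous_on S f" "continuous_on S g"
  shows "continuous_on S (\<lambda>x. cox_section \<rho> a (f x) i (g x))"
  unfolding cox_section_def
  by (intro continuous_on_sum continuous_on_mult continuous_on_coeff continuous_on_eval_monom assms)

lemma continuous_on_kernel:
  assumes "continuous_on S f" "continuous_on S g" and nz: "\<And>x i. x \<in> S \<Longrightarrow> cox_section \<rho> a (f x) i (g x) \<noteq> 0"
  shows "continuous_on S (\<lambda>x. kernel \<rho> a \<beta> (f x) (g x))"
proof -
  have "continuous_on S (\<lambda>x. cox_coord \<rho> a (g x) v)" for v
    unfolding cox_coord_def by (cases "v \<in> coeff_index \<rho> a") (auto intro!: continuous_on_eval_monom assms)
  then show ?thesis
    unfolding kernel_def inv_deriv_def monom_value_def using nz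
    by (intro continuous_on_mult continuous_on_prod continuous_on_divide continuous_on_const continuous_on_power
        continuous_on_section_param assms) auto
qed

text \<open>In the application \<open>E\<close> is the numerator of the integrand, which does not
  involve \<open>b\<close>.\<close>

definition kernel_integral :: "('r::finite \<Rightarrow> int ^ 'd::finite) \<Rightarrow> ('s::finite \<Rightarrow> 'r \<Rightarrow> int) \<Rightarrow> ('u::euclidean_space) set \<Rightarrow>
    ('u \<Rightarrow> complex) \<Rightarrow> ('u \<Rightarrow> complex ^ 'r) \<Rightarrow> (('s, 'd) idx \<Rightarrow>\<^sub>0 nat) \<Rightarrow> (('s, 'd) idx \<Rightarrow> complex) \<Rightarrow> complex" where
  "kernel_integral \<rho> a S E T \<beta> b = integral S (\<lambda>u. E u * kernel \<rho> a \<beta> b (T u))"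

lemma jets_kernel_integral:
  assumes fin: "\<And>i. finite (polytope_points \<rho> (a i))" and S: "compact S"
    and E: "continuous_on S E" and T: "continuous_on S T" and U: "open U"
    and nz: "\<And>b u i. b \<in> U \<Longrightarrow> u \<in> S \<Longrightarrow> cox_section \<rho> a b i (T u) \<noteq> 0"
  shows "jets U (kernel_integral \<rho> a S E T)"
  unfolding jets_def
proof (intro conjI allI ballI U)
  fix \<beta> b v assume b: "b \<in> U"
  define V where "V = (\<lambda>z. b(v := z)) -` U"
  have V: "open V" unfolding V_def by (rule open_vimage[OF U]) (rule continuous_fun_upd)
  have bV: "b v \<in> V" using b by (simp add: V_def)
  have cont: "continuous_on (V \<times> S) (\<lambda>(z, u). E u * kernel \<rho> a \<beta>' (b(v := z)) (T u))" for \<beta>'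
    unfolding case_prod_beta
  proof (intro continuous_on_mult continuous_on_kernel)
    show "continuous_on (V \<times> S) (\<lambda>x. b(v := fst x))"
      by (rule continuous_on_compose2[OF continuous_fun_upd]) (auto intro: continuous_on_fst continuous_on_id)
    show "continuous_on (V \<times> S) (\<lambda>x. E (snd x))" "continuous_on (V \<times> S) (\<lambda>x. T (snd x))"
      by (auto intro!: continuous_on_compose2[OF E] continuous_on_compose2[OF T] continuous_on_snd continuous_on_id)
    show "cox_section \<rho> a (b(v := fst x)) i (T (snd x)) \<noteq> 0" if "x \<in> V \<times> S" for x i
      using nz[of "b(v := fst x)" "snd x" i] that by (auto simp: V_def)
  qed
  have "((\<lambda>z. integral S (\<lambda>u. E u * kernel \<rho> a \<beta> (b(v := z)) (T u))) has_field_derivative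
      integral S (\<lambda>u. E u * kernel \<rho> a (\<beta> + Poly_Mapping.single v 1) (b(v := b v)) (T u))) (at (b v))"
  proof (rule has_field_derivative_param_integral[OF S V bV _ cont])
    show "continuous_on S (\<lambda>u. E u * kernel \<rho> a \<beta> (b(v := z)) (T u))" if "z \<in> V" for z
      by (intro continuous_on_mult E continuous_on_kernel continuous_on_const T, rule nz) (use that in \<open>auto simp: V_def\<close>)
    show "((\<lambda>z. E u * kernel \<rho> a \<beta> (b(v := z)) (T u)) has_field_derivative
        E u * kernel \<rho> a (\<beta> + Poly_Mapping.single v 1) (b(v := z)) (T u)) (at z)" if "z \<in> V" "u \<in> S" for z u
      using kernel_deriv[of \<rho> a "b(v := z)" "T u" \<beta> v, OF fin nz] that
      by (intro DERIV_cmult) (auto simp: V_def)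
  qed
  then show "((\<lambda>z. kernel_integral \<rho> a S E T \<beta> (b(v := z))) has_field_derivative
      kernel_integral \<rho> a S E T (\<beta> + Poly_Mapping.single v 1) b) (at (b v))"
    by (simp add: kernel_integral_def)
qed

lemma jets_sum:
  assumes "\<And>k. k \<in> I \<Longrightarrow> jets U (J k)" "open U"
  shows "jets U (\<lambda>\<beta> b. \<Sum>k\<in>I. c k * J k \<beta> b)"
  using assms unfolding jets_def by (auto intro!: DERIV_sum DERIV_cmult)

lemma continuous_on_kernel_integral:
  assumes S: "compact S" and E: "continuous_on S E" and T: "continuous_on S T"
    and nz: "\<And>b u i. b \<in> U \<Longrightarrow> u \<in> S \<Longrightarrow> cox_section \<rho> a b i (T u) \<noteq> 0"
  shows "continuous_on U (kernel_integral \<rho> a S E T \<beta>)"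
  unfolding kernel_integral_def[abs_def]
proof (rule continuous_on_param_integral[OF S])
  show "continuous_on (U \<times> S) (\<lambda>(b, u). E u * kernel \<rho> a \<beta> b (T u))"
    unfolding case_prod_beta
    by (intro continuous_on_mult continuous_on_kernel, simp_all add: nz mem_Times_iff)
      (auto intro!: continuous_on_compose2[OF E] continuous_on_compose2[OF T] continuous_on_fst continuous_on_snd continuous_on_id)
qed

lemma open_sections_nonzero:
  fixes a :: "'s::finite \<Rightarrow> 'r::finite \<Rightarrow> int"
  assumes "finite I" and S: "compact S" and T: "\<And>k. k \<in> I \<Longrightarrow> continuous_on S (T k)"
  shows "open {b. \<forall>k\<in>I. \<forall>u\<in>S. \<forall>i. cox_section \<rho> a b i (T k u) \<noteq> 0}"
proof -
  have eq: "{b. \<forall>k\<in>I. \<forall>u\<in>S. \<forall>i. cox_section \<rho> a b i (T k u) \<noteq> 0} =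
      (\<Inter>k\<in>I. \<Inter>i. {b. \<forall>u\<in>S. cox_section \<rho> a b i (T k u) \<noteq> 0})" by blast
  have "open {b. \<forall>u\<in>S. cox_section \<rho> a b i (T k u) \<noteq> 0}" if "k \<in> I" for k i
  proof (rule open_nonvanishing[OF S])
    show "continuous_on (UNIV \<times> S) (\<lambda>(b, u). cox_section \<rho> a b i (T k u))"
      unfolding case_prod_beta
      by (intro continuous_on_section_param continuous_on_fst continuous_on_id continuous_on_compose2[OF T[OF that]] continuous_on_snd) auto
  qed
  then show ?thesis unfolding eq by (intro open_INT assms(1) finite ballI) auto
qed

lemma weyl_value_kernel_integral:
  fixes E :: "'k \<Rightarrow> 'u::euclidean_space \<Rightarrow> complex" and a :: "'s::finite \<Rightarrow> 'r::finite \<Rightarrow> int"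
  assumes S: "compact S" and E: "\<And>k. k \<in> I \<Longrightarrow> continuous_on S (E k)" and T: "\<And>k. k \<in> I \<Longrightarrow> continuous_on S (T k)"
    and nz: "\<And>k u i. k \<in> I \<Longrightarrow> u \<in> S \<Longrightarrow> cox_section \<rho> a b i (T k u) \<noteq> 0"
  shows "weyl_value (\<lambda>\<beta> b. \<Sum>k\<in>I. c k * kernel_integral \<rho> a S (E k) (T k) \<beta> b) b P =
    (\<Sum>k\<in>I. c k * integral S (\<lambda>u. E k u * weyl_value (\<lambda>\<beta> b. kernel \<rho> a \<beta> b (T k u)) b P))"
proof -
  let ?K = "Poly_Mapping.keys P"
  have cont: "continuous_on S (\<lambda>u. E k u * kernel \<rho> a \<beta> b (T k u))" if "k \<in> I" for k \<beta>
    using that by (intro continuous_on_mult E continuous_on_kernel continuous_on_const T nz)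
  have "integral S (\<lambda>u. E k u * weyl_value (\<lambda>\<beta> b. kernel \<rho> a \<beta> b (T k u)) b P) =
      (\<Sum>x\<in>?K. Poly_Mapping.lookup P x * monom_value b (fst x) * kernel_integral \<rho> a S (E k) (T k) (snd x) b)" if k: "k \<in> I" for k
  proof -
    have "integral S (\<lambda>u. E k u * weyl_value (\<lambda>\<beta> b. kernel \<rho> a \<beta> b (T k u)) b P) =
        integral S (\<lambda>u. \<Sum>x\<in>?K. (Poly_Mapping.lookup P x * monom_value b (fst x)) * (E k u * kernel \<rho> a (snd x) b (T k u)))"
      by (simp add: weyl_value_def lin_ext_def sum_distrib_left case_prod_beta mult_ac)
    also have "\<dots> = (\<Sum>x\<in>?K. integral S (\<lambda>u. (Poly_Mapping.lookup P x * monom_value b (fst x)) * (E k u * kernel \<rho> a (snd x) b (T k u))))"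
      by (rule integral_sum) (auto intro!: integrable_on_compact[OF S] continuous_on_mult[OF continuous_on_const] cont[OF k])
    finally show ?thesis by (simp add: kernel_integral_def)
  qed
  then have "(\<Sum>k\<in>I. c k * integral S (\<lambda>u. E k u * weyl_value (\<lambda>\<beta> b. kernel \<rho> a \<beta> b (T k u)) b P)) =
      (\<Sum>k\<in>I. \<Sum>x\<in>?K. c k * (Poly_Mapping.lookup P x * monom_value b (fst x) * kernel_integral \<rho> a S (E k) (T k) (snd x) b))"
    by (simp add: sum_distrib_left)
  also have "\<dots> = (\<Sum>x\<in>?K. \<Sum>k\<in>I. c k * (Poly_Mapping.lookup P x * monom_value b (fst x) * kernel_integral \<rho> a S (E k) (T k) (snd x) b))"
    by (rule sum.swap)
  also have "\<dots> = weyl_value (\<lambda>\<beta> b. \<Sum>k\<in>I. c k * kernel_integral \<rho> a S (E k) (T k) \<beta> b) b P"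
    by (simp add: weyl_value_def lin_ext_def sum_distrib_left case_prod_beta mult_ac)
  finally show ?thesis by simp
qed

section \<open>The constant coefficient operators\<close>

text \<open>A polynomial function that vanishes everywhere has zero coefficients; the powers of x
  may then be replaced by arbitrary numbers that depend on the exponent.\<close>

lemma sum_powers_zero:
  fixes B :: "'k \<Rightarrow> complex"
  assumes K: "finite K" and zero: "\<And>x. (\<Sum>\<alpha>\<in>K. B \<alpha> * x ^ n \<alpha>) = 0"
  shows "(\<Sum>\<alpha>\<in>K. B \<alpha> * g (n \<alpha>)) = 0"
proof -
  obtain N where N: "\<And>\<alpha>. \<alpha> \<in> K \<Longrightarrow> n \<alpha> \<le> N"
    using finite_nat_set_iff_bounded_le[of "n ` K"] K by auto
  have group: "(\<Sum>\<alpha>\<in>K. B \<alpha> * h (n \<alpha>)) = (\<Sum>k\<le>N. (\<Sum>\<alpha>\<in>{\<alpha>\<in>K. n \<alpha> = k}. B \<alpha>) * h k)" for h :: "nat \<Rightarrow> complex"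
  proof -
    have "(\<Sum>\<alpha>\<in>K. B \<alpha> * h (n \<alpha>)) = (\<Sum>k\<le>N. \<Sum>\<alpha>\<in>{\<alpha>\<in>K. n \<alpha> = k}. B \<alpha> * h (n \<alpha>))"
      by (rule sum.group[symmetric]) (use K N in auto)
    then show ?thesis by (simp add: sum_distrib_right)
  qed
  have "\<forall>k\<le>N. (\<Sum>\<alpha>\<in>{\<alpha>\<in>K. n \<alpha> = k}. B \<alpha>) = 0"
    using zero unfolding group by (subst polyfun_eq_0[symmetric]) simp
  then show ?thesis unfolding group[of g] by simp
qed

text \<open>The replacement of powers is carried out for one index \<open>i\<close> after the
  other.\<close>

lemma sum_multipowers_zero:
  fixes A :: "'k \<Rightarrow> complex" and L :: "'s::finite \<Rightarrow> nat \<Rightarrow> complex"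
  assumes K: "finite K" and zero: "\<And>c. (\<Sum>\<alpha>\<in>K. A \<alpha> * (\<Prod>i\<in>UNIV. c i ^ m i \<alpha>)) = 0"
  shows "(\<Sum>\<alpha>\<in>K. A \<alpha> * (\<Prod>i\<in>UNIV. L i (m i \<alpha>))) = 0"
proof -
  have "(\<Sum>\<alpha>\<in>K. A \<alpha> * (\<Prod>i\<in>I. L i (m i \<alpha>)) * (\<Prod>i\<in>- I. c i ^ m i \<alpha>)) = 0" for I c
    using finite[of I]
  proof (induction I arbitrary: c rule: finite_induct)
    case empty
    then show ?case using zero[of c] by simp
  next
    case (insert j I)
    define B where "B \<alpha> = A \<alpha> * (\<Prod>i\<in>I. L i (m i \<alpha>)) * (\<Prod>i\<in>- insert j I. c i ^ m i \<alpha>)" for \<alpha>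
    have split: "(\<Prod>i\<in>- I. (c(j := x)) i ^ m i \<alpha>) = x ^ m j \<alpha> * (\<Prod>i\<in>- insert j I. c i ^ m i \<alpha>)" for x \<alpha>
    proof -
      have "(\<Prod>i\<in>- I. (c(j := x)) i ^ m i \<alpha>) = x ^ m j \<alpha> * (\<Prod>i\<in>- I - {j}. (c(j := x)) i ^ m i \<alpha>)"
        using insert.hyps by (subst prod.remove[of _ j]) auto
      moreover have "(\<Prod>i\<in>- I - {j}. (c(j := x)) i ^ m i \<alpha>) = (\<Prod>i\<in>- insert j I. c i ^ m i \<alpha>)"
        by (rule prod.cong) auto
      ultimately show ?thesis by simp
    qed
    have "(\<Sum>\<alpha>\<in>K. B \<alpha> * x ^ m j \<alpha>) = 0" for x
      using insert.IH[of "c(j := x)"] unfolding split by (simp add: B_def mult_ac)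
    from sum_powers_zero[OF K this, of "L j"] show ?case
      using insert.hyps by (simp add: B_def mult_ac)
  qed
  from this[of UNIV] show ?thesis by simp
qed

text \<open>The factors of the multicone can be scaled independently, so that \<open>p\<close>
  vanishes for all scalars \<open>c\<close>. Replacing the power of c_i with exponent m by the m-th
  derivative of 1 / s at \<sigma>_i turns this relation into the claim.\<close>

lemma weyl_value_const_coeff_op:
  fixes \<rho> :: "'r::finite \<Rightarrow> int ^ 'd::finite" and a :: "'s::finite \<Rightarrow> 'r \<Rightarrow> int"
  assumes p: "p \<in> cone_ideal K \<rho> a" and w: "w \<in> cox_open K"
  shows "weyl_value (\<lambda>\<beta> b. kernel \<rho> a \<beta> b w) b (const_coeff_op p) = 0"
proof -
  have "(\<Sum>\<alpha>\<in>Poly_Mapping.keys p. (Poly_Mapping.lookup p \<alpha> * monom_value (cox_coord \<rho> a w) \<alpha>) * (\<Prod>i\<in>UNIV. c i ^ weight i \<alpha>)) = 0" for c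
  proof -
    let ?y = "\<lambda>(i, \<mu>). if \<mu> \<in> polytope_points \<rho> (a i) then c i * eval_monom (cox_exponent \<rho> (a i) \<mu>) w else 0"
    have "?y \<in> multicone K \<rho> a" using w by (auto simp: multicone_def)
    then have 1: "(\<Sum>\<alpha>\<in>Poly_Mapping.keys p. Poly_Mapping.lookup p \<alpha> * monom_value ?y \<alpha>) = 0"
      using p unfolding cone_ideal_def monom_value_def by blast
    have y: "?y v = c (fst v) * cox_coord \<rho> a w v" for v
      by (cases v) (auto simp: cox_coord_def coeff_index_def)
    have "(\<Prod>v\<in>Poly_Mapping.keys \<alpha>. c (fst v) ^ Poly_Mapping.lookup \<alpha> v) = (\<Prod>i\<in>UNIV. c i ^ weight i \<alpha>)"
      for \<alpha> :: "('s, 'd) idx \<Rightarrow>\<^sub>0 nat"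
    proof -
      have "(\<Prod>i\<in>UNIV. c i ^ weight i \<alpha>) = (\<Prod>i\<in>UNIV. \<Prod>v\<in>Poly_Mapping.keys \<alpha>. if fst v = i then c i ^ Poly_Mapping.lookup \<alpha> v else 1)"
        by (simp add: weight_def power_sum if_distrib[of "\<lambda>n. _ ^ n"] cong: if_cong)
      also have "\<dots> = (\<Prod>v\<in>Poly_Mapping.keys \<alpha>. \<Prod>i\<in>UNIV. if fst v = i then c i ^ Poly_Mapping.lookup \<alpha> v else 1)"
        by (rule prod.swap)
      also have "\<dots> = (\<Prod>v\<in>Poly_Mapping.keys \<alpha>. c (fst v) ^ Poly_Mapping.lookup \<alpha> v)" by simp
      finally show ?thesis by simp
    qed
    then have "monom_value ?y \<alpha> = monom_value (cox_coord \<rho> a w) \<alpha> * (\<Prod>i\<in>UNIV. c i ^ weight i \<alpha>)" for \<alpha>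
      unfolding monom_value_def y power_mult_distrib prod.distrib by (simp only: mult.commute)
    with 1 show ?thesis by (simp only: mult.assoc)
  qed
  from sum_multipowers_zero[OF finite_keys this, of "\<lambda>i n. inv_deriv n (cox_section \<rho> a b i w)"]
  have "(\<Sum>\<alpha>\<in>Poly_Mapping.keys p. Poly_Mapping.lookup p \<alpha> * kernel \<rho> a \<alpha> b w) = 0"
    by (simp add: kernel_def mult_ac)
  then show ?thesis
    by (simp add: weyl_value_def const_coeff_op_def lin_ext_sum)
qed

section \<open>Infinitesimal graded automorphisms\<close>

text \<open>The sum runs over a finite set that depends on \<open>\<alpha>\<close> alone, which
  permits differentiation of the coefficient when both factors move.\<close>

lemma lookup_mult_below:
  fixes p q :: "('r \<Rightarrow>\<^sub>0 nat) \<Rightarrow>\<^sub>0 complex"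
  shows "Poly_Mapping.lookup (p * q) \<alpha> =
    (\<Sum>\<beta>\<in>below \<alpha>. Poly_Mapping.lookup p \<beta> * Poly_Mapping.lookup q (\<alpha> - \<beta>))"
proof -
  have inner: "(\<Sum>\<delta>. Poly_Mapping.lookup q \<delta> when \<alpha> = \<beta> + \<delta>) =
      (if \<beta> \<in> below \<alpha> then Poly_Mapping.lookup q (\<alpha> - \<beta>) else 0)" for \<beta>
  proof (cases "\<beta> \<in> below \<alpha>")
    case True
    then have \<alpha>: "\<alpha> = \<beta> + \<delta> \<longleftrightarrow> \<alpha> - \<beta> = \<delta>" for \<delta>
      by (auto simp: below_def lookup_add lookup_minus intro!: poly_mapping_eqI)
    show ?thesis using True unfolding \<alpha> by simp
  next
    case False
    then have "\<alpha> \<noteq> \<beta> + \<delta>" for \<delta> by (auto simp: below_def lookup_add)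
    then show ?thesis using False by simp
  qed
  have "Poly_Mapping.lookup (p * q) \<alpha> = (\<Sum>\<beta>. Poly_Mapping.lookup p \<beta> *
      (if \<beta> \<in> below \<alpha> then Poly_Mapping.lookup q (\<alpha> - \<beta>) else 0))"
    unfolding lookup_mult inner ..
  also have "\<dots> = (\<Sum>\<beta>\<in>below \<alpha>. Poly_Mapping.lookup p \<beta> *
      (if \<beta> \<in> below \<alpha> then Poly_Mapping.lookup q (\<alpha> - \<beta>) else 0))"
    by (rule Sum_any.expand_superset[OF finite_below]) (auto split: if_splits)
  finally show ?thesis by simp
qed

lemma lin_ext_mult:
  assumes f: "\<And>\<alpha> \<beta>. f (\<alpha> + \<beta>) = f \<alpha> * f \<beta>"
  shows "lin_ext f (p * q) = lin_ext f p * lin_ext f q"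
proof -
  have rep: "r = (\<Sum>k\<in>Poly_Mapping.keys r. Poly_Mapping.single k (Poly_Mapping.lookup r k))" for r :: "'a \<Rightarrow>\<^sub>0 complex"
    by (rule poly_mapping_eqI) (auto simp: lookup_sum lookup_single when_def in_keys_iff)
  have "p * q = (\<Sum>k\<in>Poly_Mapping.keys p. \<Sum>l\<in>Poly_Mapping.keys q.
      Poly_Mapping.single (k + l) (Poly_Mapping.lookup p k * Poly_Mapping.lookup q l))"
    by (subst rep[of p], subst rep[of q]) (simp add: sum_product mult_single)
  then have "lin_ext f (p * q) = (\<Sum>k\<in>Poly_Mapping.keys p. \<Sum>l\<in>Poly_Mapping.keys q.
      Poly_Mapping.lookup p k * Poly_Mapping.lookup q l * (f k * f l))"
    by (simp add: lin_ext_sum f)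
  then show ?thesis by (simp add: lin_ext_def sum_product mult_ac)
qed

lemma aut_curve_mult:
  assumes "aut_curve \<rho> \<phi> x"
  shows "x (p * q) = x p * q + p * x q"
proof (rule poly_mapping_eqI)
  fix \<alpha>
  have d: "((\<lambda>t. Poly_Mapping.lookup (\<phi> t p) \<alpha>) has_field_derivative Poly_Mapping.lookup (x p) \<alpha>) (at 0)" for p \<alpha>
    using assms by (simp add: aut_curve_def)
  have \<phi>0: "\<phi> 0 p = p" for p using assms by (simp add: aut_curve_def)
  have "\<phi> t (p * q) = \<phi> t p * \<phi> t q" for t
    using assms by (simp add: aut_curve_def Aut_g_def)
  moreover have "((\<lambda>t. Poly_Mapping.lookup (\<phi> t p * \<phi> t q) \<alpha>) has_field_derivative
      Poly_Mapping.lookup (x p * q + p * x q) \<alpha>) (at 0)"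
  proof -
    have "((\<lambda>t. \<Sum>\<beta>\<in>below \<alpha>. Poly_Mapping.lookup (\<phi> t p) \<beta> * Poly_Mapping.lookup (\<phi> t q) (\<alpha> - \<beta>)) has_field_derivative
        (\<Sum>\<beta>\<in>below \<alpha>. Poly_Mapping.lookup (x p) \<beta> * Poly_Mapping.lookup (\<phi> 0 q) (\<alpha> - \<beta>) +
          Poly_Mapping.lookup (x q) (\<alpha> - \<beta>) * Poly_Mapping.lookup (\<phi> 0 p) \<beta>)) (at 0)"
      by (intro DERIV_sum DERIV_mult d)
    then show ?thesis
      by (simp add: lookup_mult_below lookup_add \<phi>0 sum.distrib mult.commute[of "Poly_Mapping.lookup (x q) _"])
  qed
  ultimately show "Poly_Mapping.lookup (x (p * q)) \<alpha> = Poly_Mapping.lookup (x p * q + p * x q) \<alpha>"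
    using DERIV_unique[OF d[of "p * q" \<alpha>]] by simp
qed

lemma aut_curve_const:
  assumes "aut_curve \<rho> \<phi> x"
  shows "x (Poly_Mapping.single 0 c) = 0"
proof (rule poly_mapping_eqI)
  fix \<alpha>
  have "\<phi> t (Poly_Mapping.single 0 c) = Poly_Mapping.single 0 c" for t
    using assms by (simp add: aut_curve_def Aut_g_def)
  moreover have "((\<lambda>t. Poly_Mapping.lookup (\<phi> t (Poly_Mapping.single 0 c)) \<alpha>) has_field_derivative
      Poly_Mapping.lookup (x (Poly_Mapping.single 0 c)) \<alpha>) (at 0)"
    using assms unfolding aut_curve_def by blast
  ultimately have "((\<lambda>t. Poly_Mapping.lookup (Poly_Mapping.single 0 c) \<alpha>) has_field_derivative
      Poly_Mapping.lookup (x (Poly_Mapping.single 0 c)) \<alpha>) (at 0)"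
    by simp
  from DERIV_unique[OF this DERIV_const]
  show "Poly_Mapping.lookup (x (Poly_Mapping.single 0 c)) \<alpha> = Poly_Mapping.lookup 0 \<alpha>" by simp
qed

lemma aut_curve_keys:
  assumes "aut_curve \<rho> \<phi> x" "\<beta> \<in> Poly_Mapping.keys (x (monom_of \<alpha>))"
  shows "same_degree \<rho> \<alpha> \<beta>"
proof (rule ccontr)
  assume "\<not> same_degree \<rho> \<alpha> \<beta>"
  moreover have "\<phi> t \<in> Aut_g \<rho>" for t
    using assms(1) by (simp add: aut_curve_def)
  then have "\<forall>\<beta>\<in>Poly_Mapping.keys (\<phi> t (monom_of \<alpha>)). same_degree \<rho> \<alpha> \<beta>" for t
    unfolding Aut_g_def by blast
  ultimately have "Poly_Mapping.lookup (\<phi> t (monom_of \<alpha>)) \<beta> = 0" for t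
    by (metis in_keys_iff)
  moreover have "((\<lambda>t. Poly_Mapping.lookup (\<phi> t (monom_of \<alpha>)) \<beta>) has_field_derivative
      Poly_Mapping.lookup (x (monom_of \<alpha>)) \<beta>) (at 0)"
    using assms(1) unfolding aut_curve_def by blast
  ultimately have "((\<lambda>t. 0) has_field_derivative Poly_Mapping.lookup (x (monom_of \<alpha>)) \<beta>) (at 0)" by simp
  from DERIV_unique[OF this DERIV_const] show False using assms(2) by (simp add: in_keys_iff)
qed

lemma same_degree_sym: "same_degree \<rho> \<alpha> \<beta> \<Longrightarrow> same_degree \<rho> \<beta> \<alpha>"
proof -
  assume "same_degree \<rho> \<alpha> \<beta>"
  then obtain m where m: "\<And>j. int (Poly_Mapping.lookup \<alpha> j) - int (Poly_Mapping.lookup \<beta> j) = pairing m (\<rho> j)"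
    by (auto simp: same_degree_def lin_equiv_def)
  have "int (Poly_Mapping.lookup \<beta> j) - int (Poly_Mapping.lookup \<alpha> j) = pairing (- m) (\<rho> j)" for j
    using m[of j] by (simp add: pairing_def sum_negf)
  then show ?thesis unfolding same_degree_def lin_equiv_def by blast
qed

lemma same_degree_refl: "same_degree \<rho> \<alpha> \<alpha>"
  unfolding same_degree_def lin_equiv_def by (intro exI[of _ 0]) (simp add: pairing_def)

lemma same_degree_trans: "same_degree \<rho> \<alpha> \<beta> \<Longrightarrow> same_degree \<rho> \<beta> \<gamma> \<Longrightarrow> same_degree \<rho> \<alpha> \<gamma>"
proof -
  assume "same_degree \<rho> \<alpha> \<beta>" "same_degree \<rho> \<beta> \<gamma>"
  then obtain m m' where m: "\<And>j. int (Poly_Mapping.lookup \<alpha> j) - int (Poly_Mapping.lookup \<beta> j) = pairing m (\<rho> j)"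
    "\<And>j. int (Poly_Mapping.lookup \<beta> j) - int (Poly_Mapping.lookup \<gamma> j) = pairing m' (\<rho> j)"
    by (auto simp: same_degree_def lin_equiv_def)
  have "int (Poly_Mapping.lookup \<alpha> j) - int (Poly_Mapping.lookup \<gamma> j) = pairing (m + m') (\<rho> j)" for j
    using m[of j] by (simp add: pairing_def distrib_right sum.distrib)
  then show ?thesis unfolding same_degree_def lin_equiv_def by blast
qed

abbreviation var_field :: "('r cox_ring \<Rightarrow> 'r cox_ring) \<Rightarrow> 'r \<Rightarrow> 'r cox_ring" where
  "var_field x j \<equiv> x (monom_of (var j))"

lemma graded_var_field: "aut_curve \<rho> \<phi> x \<Longrightarrow> graded_field \<rho> (var_field x)"
  unfolding graded_field_def by (blast intro: same_degree_sym aut_curve_keys)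

lemma eval_monom_add: "eval_monom (\<alpha> + \<beta>) w = eval_monom \<alpha> w * eval_monom \<beta> w"
  by (simp add: eval_monom_def lookup_add power_add prod.distrib)

lemma eval_monom_var: "eval_monom (var j) w = w $ j"
proof -
  have "eval_monom (var j) w = (\<Prod>l\<in>UNIV. if l = j then w $ l else 1)"
    unfolding eval_monom_def by (rule prod.cong[OF refl]) (auto simp: lookup_single when_def)
  then show ?thesis by simp
qed

lemma line_derivative: "((\<lambda>s::real. w + s *\<^sub>R \<tau>) has_vector_derivative \<tau>) (at 0)"
  by (auto intro!: derivative_eq_intros)

lemma deriv_monom_add:
  "deriv_monom (\<alpha> + \<beta>) w \<tau> = deriv_monom \<alpha> w \<tau> * eval_monom \<beta> w + eval_monom \<alpha> w * deriv_monom \<beta> w \<tau>"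
proof -
  note d = has_vector_derivative_eval_monom[OF line_derivative, of _ w \<tau>]
  have "((\<lambda>s::real. eval_monom (\<alpha> + \<beta>) (w + s *\<^sub>R \<tau>)) has_vector_derivative
      eval_monom \<alpha> (w + 0 *\<^sub>R \<tau>) * deriv_monom \<beta> (w + 0 *\<^sub>R \<tau>) \<tau> + deriv_monom \<alpha> (w + 0 *\<^sub>R \<tau>) \<tau> * eval_monom \<beta> (w + 0 *\<^sub>R \<tau>)) (at 0)"
    unfolding eval_monom_add by (rule has_vector_derivative_mult[OF d d])
  from vector_derivative_unique_at[OF d this] show ?thesis by simp
qed

lemma deriv_monom_var: "deriv_monom (var j) w \<tau> = \<tau> $ j"
proof -
  note d = has_vector_derivative_eval_monom[OF line_derivative, of "var j" w \<tau>]
  have "((\<lambda>s::real. eval_monom (var j) (w + s *\<^sub>R \<tau>)) has_vector_derivative \<tau> $ j) (at 0)"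
    unfolding eval_monom_var by (rule has_vector_derivative_vec_nth[OF line_derivative])
  from vector_derivative_unique_at[OF d this] show ?thesis by simp
qed

text \<open>A derivation is determined by its values on the variables; the induction on the degree
  splits off one variable at a time.\<close>

lemma eval_derivation:
  fixes x :: "'r::finite cox_ring \<Rightarrow> 'r cox_ring"
  assumes x: "aut_curve \<rho> \<phi> x"
  shows "lin_ext (\<lambda>\<beta>. eval_monom \<beta> w) (x (monom_of \<alpha>)) = deriv_monom \<alpha> w (field_at (var_field x) w)"
proof (induction "\<Sum>l\<in>UNIV. Poly_Mapping.lookup \<alpha> l" arbitrary: \<alpha>)
  case 0
  then have "\<alpha> = 0" by (intro poly_mapping_eqI) simp
  then show ?case using aut_curve_const[OF x, of 1] by (simp add: deriv_monom_def)
next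
  case (Suc n)
  then obtain j where j: "Poly_Mapping.lookup \<alpha> j \<noteq> 0"
    by (metis Zero_not_Suc sum.neutral)
  have \<alpha>: "\<alpha> = \<alpha> - var j + var j"
    using j by (intro poly_mapping_eqI) (auto simp: lookup_add lookup_minus lookup_single when_def)
  have "(\<Sum>l\<in>UNIV. Poly_Mapping.lookup \<alpha> l) = (\<Sum>l\<in>UNIV. Poly_Mapping.lookup (\<alpha> - var j) l) + (\<Sum>l\<in>UNIV. Poly_Mapping.lookup (var j) l)"
    unfolding sum.distrib[symmetric] lookup_add[symmetric] using \<alpha> by simp
  moreover have "(\<Sum>l\<in>UNIV. Poly_Mapping.lookup (var j) l) = 1"
    by (simp add: lookup_single when_def)
  ultimately have IH: "lin_ext (\<lambda>\<beta>. eval_monom \<beta> w) (x (monom_of (\<alpha> - var j))) = deriv_monom (\<alpha> - var j) w (field_at (var_field x) w)"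
    using Suc by simp
  have "x (monom_of (\<alpha> - var j + var j)) = x (monom_of (\<alpha> - var j)) * monom_of (var j) + monom_of (\<alpha> - var j) * x (monom_of (var j))"
    using aut_curve_mult[OF x, of "monom_of (\<alpha> - var j)" "monom_of (var j)"] by (simp only: mult_single mult_1)
  then have "lin_ext (\<lambda>\<beta>. eval_monom \<beta> w) (x (monom_of (\<alpha> - var j + var j))) =
      deriv_monom (\<alpha> - var j) w (field_at (var_field x) w) * eval_monom (var j) w +
      eval_monom (\<alpha> - var j) w * lin_ext (\<lambda>\<beta>. eval_monom \<beta> w) (x (monom_of (var j)))"
    by (simp only: lin_ext_add lin_ext_mult[OF eval_monom_add] IH lin_ext_single mult_1)
  also have "lin_ext (\<lambda>\<beta>. eval_monom \<beta> w) (x (monom_of (var j))) = field_at (var_field x) w $ j"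
    by (simp add: lin_ext_def field_at_def)
  finally have "lin_ext (\<lambda>\<beta>. eval_monom \<beta> w) (x (monom_of (\<alpha> - var j + var j))) =
      deriv_monom (\<alpha> - var j + var j) w (field_at (var_field x) w)"
    by (simp only: deriv_monom_add deriv_monom_var)
  then show ?case using \<alpha> by simp
qed

text \<open>Completeness of the fan in dual form: an effective divisor linearly equivalent to 0 is
  0.\<close>

definition complete_rays :: "('r::finite \<Rightarrow> int ^ 'd::finite) \<Rightarrow> bool" where
  "complete_rays \<rho> \<longleftrightarrow> (\<forall>m. (\<forall>j. 0 \<le> pairing m (\<rho> j)) \<longrightarrow> m = 0)"

lemma pairing_diff: "pairing (m - m') v = pairing m v - pairing m' v"
  by (simp add: pairing_def left_diff_distrib sum_subtractf)

lemma cox_exponent_inj: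
  assumes \<rho>: "complete_rays \<rho>" and \<mu>: "\<mu> \<in> polytope_points \<rho> A" "\<nu> \<in> polytope_points \<rho> A"
    and eq: "cox_exponent \<rho> A \<mu> = cox_exponent \<rho> A \<nu>"
  shows "\<mu> = \<nu>"
proof -
  have "pairing \<mu> (\<rho> j) = pairing \<nu> (\<rho> j)" for j
  proof -
    have "nat (pairing \<mu> (\<rho> j) + A j) = nat (pairing \<nu> (\<rho> j) + A j)"
      using eq by (metis lookup_cox_exponent)
    moreover have "- A j \<le> pairing \<mu> (\<rho> j)" "- A j \<le> pairing \<nu> (\<rho> j)"
      using \<mu> unfolding polytope_points_def by blast+
    ultimately show ?thesis by linarith
  qed
  then have "0 \<le> pairing (\<mu> - \<nu>) (\<rho> j)" for j by (simp add: pairing_diff)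
  then have "\<mu> - \<nu> = 0" using \<rho> unfolding complete_rays_def by blast
  then show ?thesis by simp
qed

text \<open>The derivation preserves degrees, so all monomials of the image come from lattice points
  of the same polytope and the sum misses none of them.\<close>

lemma eval_derivation_section:
  assumes x: "aut_curve \<rho> \<phi> x" and \<rho>: "complete_rays \<rho>"
    and fin: "finite (polytope_points \<rho> A)" and \<mu>: "\<mu> \<in> polytope_points \<rho> A"
  shows "(\<Sum>\<nu>\<in>polytope_points \<rho> A. Poly_Mapping.lookup (x (monom_of (cox_exponent \<rho> A \<mu>))) (cox_exponent \<rho> A \<nu>) *
      eval_monom (cox_exponent \<rho> A \<nu>) w) = deriv_monom (cox_exponent \<rho> A \<mu>) w (field_at (var_field x) w)"
proof -
  let ?e = "cox_exponent \<rho> A" and ?P = "polytope_points \<rho> A"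
  have keys: "Poly_Mapping.keys (x (monom_of (?e \<mu>))) \<subseteq> ?e ` ?P"
  proof
    fix \<beta> assume "\<beta> \<in> Poly_Mapping.keys (x (monom_of (?e \<mu>)))"
    from aut_curve_keys[OF x this] obtain m where
      m: "\<And>j. int (Poly_Mapping.lookup (?e \<mu>) j) - int (Poly_Mapping.lookup \<beta> j) = pairing m (\<rho> j)"
      by (auto simp: same_degree_def lin_equiv_def)
    have l: "int (Poly_Mapping.lookup \<beta> j) = pairing (\<mu> - m) (\<rho> j) + A j" for j
    proof -
      have "- A j \<le> pairing \<mu> (\<rho> j)" using \<mu> unfolding polytope_points_def by blast
      then show ?thesis using m[of j] by (simp add: pairing_diff)
    qed
    have "\<mu> - m \<in> ?P"
      unfolding polytope_points_def
    proof (intro CollectI allI)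
      fix j
      have "0 \<le> int (Poly_Mapping.lookup \<beta> j)" by simp
      then show "- A j \<le> pairing (\<mu> - m) (\<rho> j)" unfolding l by simp
    qed
    moreover have "\<beta> = ?e (\<mu> - m)"
      by (rule poly_mapping_eqI) (simp flip: l)
    ultimately show "\<beta> \<in> ?e ` ?P" by blast
  qed
  have "inj_on ?e ?P" using cox_exponent_inj[OF \<rho>] by (auto intro: inj_onI)
  then have "(\<Sum>\<nu>\<in>?P. Poly_Mapping.lookup (x (monom_of (?e \<mu>))) (?e \<nu>) * eval_monom (?e \<nu>) w) =
      (\<Sum>\<beta>\<in>?e ` ?P. Poly_Mapping.lookup (x (monom_of (?e \<mu>))) \<beta> * eval_monom \<beta> w)"
    by (simp add: sum.reindex)
  also have "\<dots> = lin_ext (\<lambda>\<beta>. eval_monom \<beta> w) (x (monom_of (?e \<mu>)))"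
    by (rule lin_ext_superset[symmetric]) (use fin keys in auto)
  finally show ?thesis by (simp only: eval_derivation[OF x])
qed

text \<open>If another monomial of the degree of w_j contained w_j, division by w_j would leave a
  nonzero effective divisor linearly equivalent to 0. Hence differentiation in direction
  \<open>j\<close> sees only the linear term w_j.\<close>

lemma div_field_const:
  assumes x: "aut_curve \<rho> \<phi> x" and \<rho>: "complete_rays \<rho>"
  shows "div_field (var_field x) w = (\<Sum>j\<in>UNIV. Poly_Mapping.lookup (var_field x j) (var j))"
proof -
  have "deriv_field (var_field x) w (axis j 1) $ j = Poly_Mapping.lookup (var_field x j) (var j)" for j
  proof -
    have zero: "deriv_monom \<alpha> w (axis j 1) = 0" if \<alpha>: "\<alpha> \<in> Poly_Mapping.keys (var_field x j)" "\<alpha> \<noteq> var j" for \<alpha>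
    proof -
      obtain m where m: "\<And>l. int (Poly_Mapping.lookup \<alpha> l) - int (Poly_Mapping.lookup (var j) l) = pairing m (\<rho> l)"
        using graded_var_field[OF x] \<alpha>(1) unfolding graded_field_def same_degree_def lin_equiv_def by blast
      have "Poly_Mapping.lookup \<alpha> j = 0"
      proof (rule ccontr)
        assume nz: "Poly_Mapping.lookup \<alpha> j \<noteq> 0"
        have "0 \<le> pairing m (\<rho> l)" for l
          using m[of l] nz by (cases "l = j") (auto simp: lookup_single when_def)
        then have "m = 0" using \<rho> by (simp add: complete_rays_def)
        then have "Poly_Mapping.lookup \<alpha> l = Poly_Mapping.lookup (var j) l" for l
          using m[of l] by (simp add: pairing_def)
        then show False using \<alpha>(2) by (metis poly_mapping_eqI)
      qed
      then show ?thesis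
        unfolding deriv_monom_def by (intro sum.neutral ballI) (auto simp: axis_def)
    qed
    have "deriv_field (var_field x) w (axis j 1) $ j = lin_ext (\<lambda>\<alpha>. deriv_monom \<alpha> w (axis j 1)) (var_field x j)"
      by (simp add: deriv_field_def lin_ext_def)
    also have "\<dots> = (\<Sum>\<alpha>\<in>insert (var j) (Poly_Mapping.keys (var_field x j)). Poly_Mapping.lookup (var_field x j) \<alpha> * deriv_monom \<alpha> w (axis j 1))"
      by (rule lin_ext_superset) auto
    also have "\<dots> = (\<Sum>\<alpha>\<in>{var j}. Poly_Mapping.lookup (var_field x j) \<alpha> * deriv_monom \<alpha> w (axis j 1))"
      by (rule sum.mono_neutral_right) (auto simp: zero)
    also have "\<dots> = Poly_Mapping.lookup (var_field x j) (var j)"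
      by (simp only: deriv_monom_var axis_nth sum.insert finite.emptyI empty_iff not_False_eq_True sum.empty
        add_0_right mult_1_right)
    finally show ?thesis .
  qed
  then show ?thesis by (simp add: div_field_def)
qed

lemma equiv_same_degree: "equiv UNIV {(j, l). same_degree \<rho> (var j) (var l)}"
  unfolding equiv_def refl_on_def sym_def trans_def
  using same_degree_refl same_degree_sym same_degree_trans by blast

section \<open>The derivative of the character\<close>

lemma DERIV_prod:
  fixes f :: "'i \<Rightarrow> complex \<Rightarrow> complex"
  assumes "\<And>i. i \<in> I \<Longrightarrow> (f i has_field_derivative f' i) (at x)"
  shows "((\<lambda>y. \<Prod>i\<in>I. f i y) has_field_derivative (\<Sum>i\<in>I. f' i * (\<Prod>l\<in>I - {i}. f l x))) (at x)"
  unfolding has_field_derivative_def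
  by (rule has_derivative_eq_rhs[OF has_derivative_prod[OF assms[unfolded has_field_derivative_def]]])
    (auto simp: fun_eq_iff sum_distrib_left mult_ac)

text \<open>A moved point has a moved image. In the expansion of a determinant at the identity
  matrix, the term of such a permutation thus keeps a zero factor even after one factor has been
  removed.\<close>

lemma permutes_nontrivial:
  assumes p: "p permutes C" "p \<noteq> id" and fin: "finite C"
  shows "\<exists>i\<in>C. \<exists>j\<in>C - {i}. p i \<noteq> i \<and> p j \<noteq> j"
proof -
  obtain i where i: "p i \<noteq> i" using p(2) by (auto simp: fun_eq_iff)
  then have "i \<in> C" using p(1) by (meson permutes_not_in)
  moreover have "p (p i) \<noteq> p i" using i p(1) by (metis permutes_inverses(2))
  moreover have "p i \<in> C" using \<open>i \<in> C\<close> p(1) by (simp add: permutes_in_image)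
  ultimately show ?thesis using i by blast
qed

lemma DERIV_det_on_identity:
  fixes M :: "complex \<Rightarrow> 'r \<Rightarrow> 'r \<Rightarrow> complex"
  assumes fin: "finite C"
    and M: "\<And>j l. j \<in> C \<Longrightarrow> ((\<lambda>t. M t j l) has_field_derivative M' j l) (at 0)"
    and M0: "\<And>j l. M 0 j l = (if j = l then 1 else 0)"
  shows "((\<lambda>t. det_on C (M t)) has_field_derivative (\<Sum>j\<in>C. M' j j)) (at 0)"
proof -
  have "((\<lambda>t. det_on C (M t)) has_field_derivative
      (\<Sum>p | p permutes C. of_int (sign p) * (\<Sum>j\<in>C. M' j (p j) * (\<Prod>l\<in>C - {j}. M 0 l (p l))))) (at 0)"
    unfolding det_on_def by (intro DERIV_sum DERIV_cmult DERIV_prod M)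
  moreover have "(\<Sum>p | p permutes C. of_int (sign p) * (\<Sum>j\<in>C. M' j (p j) * (\<Prod>l\<in>C - {j}. M 0 l (p l)))) =
      (\<Sum>p\<in>{id}. of_int (sign p) * (\<Sum>j\<in>C. M' j (p j) * (\<Prod>l\<in>C - {j}. M 0 l (p l))))"
  proof (rule sum.mono_neutral_right)
    show "\<forall>p\<in>{p. p permutes C} - {id}. of_int (sign p) * (\<Sum>j\<in>C. M' j (p j) * (\<Prod>l\<in>C - {j}. M 0 l (p l))) = 0"
    proof
      fix p assume "p \<in> {p. p permutes C} - {id}"
      then have "p permutes C" "p \<noteq> id" by auto
      from permutes_nontrivial[OF this fin] obtain i j where
        ij: "i \<in> C" "j \<in> C" "i \<noteq> j" "p i \<noteq> i" "p j \<noteq> j" by blast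
      have "(\<Prod>l\<in>C - {e}. M 0 l (p l)) = 0" for e
      proof -
        have "\<exists>l\<in>C - {e}. M 0 l (p l) = 0"
          using ij M0 by (cases "e = i") (metis Diff_iff singletonD)+
        then show ?thesis using fin by (simp add: prod_zero_iff)
      qed
      then show "of_int (sign p) * (\<Sum>j\<in>C. M' j (p j) * (\<Prod>l\<in>C - {j}. M 0 l (p l))) = 0" by simp
    qed
  qed (use fin in \<open>auto simp: finite_permutations permutes_id\<close>)
  ultimately show ?thesis by (simp add: M0)
qed

text \<open>Along every curve with velocity \<open>x\<close> the derivative is the sum of the traces
  over the ray classes; this independence of the curve is what makes THE in
  \<open>d_aut_char\<close> meaningful.\<close>

lemma d_aut_char_eq:
  fixes \<rho> :: "'r::finite \<Rightarrow> int ^ 'd::finite"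
  assumes x: "x \<in> lie_Aut_g \<rho>"
  shows "d_aut_char \<rho> x = (\<Sum>j\<in>UNIV. Poly_Mapping.lookup (var_field x j) (var j))"
proof -
  let ?R = "{(j, l). same_degree \<rho> (var j) (var l)}"
  have D: "((\<lambda>t. aut_char \<rho> (\<phi> t)) has_field_derivative (\<Sum>j\<in>UNIV. Poly_Mapping.lookup (var_field x j) (var j))) (at 0)"
    if \<phi>: "aut_curve \<rho> \<phi> x" for \<phi>
  proof -
    let ?M = "\<lambda>t j l. Poly_Mapping.lookup (\<phi> t (monom_of (var j))) (var l)"
    have M: "((\<lambda>t. ?M t j l) has_field_derivative Poly_Mapping.lookup (var_field x j) (var l)) (at 0)" for j l
      using \<phi> unfolding aut_curve_def by blast
    have inj: "var j = var l \<longleftrightarrow> j = l" for j l :: 'r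
      by (metis keys_single zero_neq_one singleton_inject)
    have M0: "?M 0 j l = (if j = l then 1 else 0)" for j l
    proof -
      have "\<phi> 0 = id" using \<phi> by (simp add: aut_curve_def)
      then show ?thesis using inj[of j l] unfolding lookup_single when_def by (simp only: id_apply lookup_single when_def)
    qed
    have C: "((\<lambda>t. det_on C (?M t)) has_field_derivative (\<Sum>j\<in>C. Poly_Mapping.lookup (var_field x j) (var j))) (at 0)" for C
      by (rule DERIV_det_on_identity[OF _ M M0]) simp
    have one: "det_on C (?M 0) = 1" for C
    proof -
      have "det_on C (?M 0) = (\<Sum>p\<in>{id}. of_int (sign p) * (\<Prod>j\<in>C. ?M 0 j (p j)))"
        unfolding det_on_def
      proof (rule sum.mono_neutral_right)
        show "\<forall>p\<in>{p. p permutes C} - {id}. of_int (sign p) * (\<Prod>j\<in>C. ?M 0 j (p j)) = 0"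
        proof
          fix p assume "p \<in> {p. p permutes C} - {id}"
          then obtain i where i: "i \<in> C" "p i \<noteq> i" using permutes_nontrivial[of p C] by auto
          have "(\<Prod>j\<in>C. ?M 0 j (p j)) = 0" unfolding M0 by (rule prod_zero) (use i in \<open>auto intro!: bexI[of _ i]\<close>)
          then show "of_int (sign p) * (\<Prod>j\<in>C. ?M 0 j (p j)) = 0" by (rule ssubst) simp
        qed
      qed (auto simp: finite_permutations permutes_id)
      then show ?thesis unfolding M0 by simp
    qed
    have "((\<lambda>t. aut_char \<rho> (\<phi> t)) has_field_derivative
        (\<Sum>C\<in>ray_classes \<rho>. (\<Sum>j\<in>C. Poly_Mapping.lookup (var_field x j) (var j)) * (\<Prod>C'\<in>ray_classes \<rho> - {C}. det_on C' (?M 0)))) (at 0)"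
      unfolding aut_char_def by (rule DERIV_prod[OF C])
    moreover have "(\<Sum>C\<in>ray_classes \<rho>. (\<Sum>j\<in>C. Poly_Mapping.lookup (var_field x j) (var j)) * (\<Prod>C'\<in>ray_classes \<rho> - {C}. det_on C' (?M 0))) =
        (\<Sum>C\<in>UNIV // ?R. \<Sum>j\<in>C. Poly_Mapping.lookup (var_field x j) (var j))"
      unfolding one ray_classes_def by simp
    moreover have "\<dots> = (\<Sum>j\<in>\<Union>(UNIV // ?R). Poly_Mapping.lookup (var_field x j) (var j))"
      by (rule sum.Union_disjoint[symmetric, unfolded o_def])
        (use quotient_disj[OF equiv_same_degree] in \<open>auto simp: disjnt_def\<close>)
    ultimately show ?thesis unfolding Union_quotient[OF equiv_same_degree] by simp
  qed
  obtain \<phi> where \<phi>: "aut_curve \<rho> \<phi> x" using x unfolding lie_Aut_g_def by blast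
  show ?thesis
    unfolding d_aut_char_def
  proof (rule the_equality)
    fix c assume "\<forall>\<phi>. aut_curve \<rho> \<phi> x \<longrightarrow> ((\<lambda>t. aut_char \<rho> (\<phi> t)) has_field_derivative c) (at 0)"
    with \<phi> have "((\<lambda>t. aut_char \<rho> (\<phi> t)) has_field_derivative c) (at 0)" by blast
    from DERIV_unique[OF this D[OF \<phi>]]
    show "c = (\<Sum>j\<in>UNIV. Poly_Mapping.lookup (var_field x j) (var j))" .
  qed (use D in blast)
qed

lemma kernel_single:
  assumes "\<mu> \<in> polytope_points \<rho> (a i)"
  shows "kernel \<rho> a (Poly_Mapping.single (i, \<mu>) 1) b w =
    - (eval_monom (cox_exponent \<rho> (a i) \<mu>) w / cox_section \<rho> a b i w) * (1 / (\<Prod>i\<in>UNIV. cox_section \<rho> a b i w))"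
proof -
  have "(\<Prod>l\<in>UNIV. inv_deriv (weight l (Poly_Mapping.single (i, \<mu>) (1::nat))) (cox_section \<rho> a b l w)) =
      (\<Prod>l\<in>UNIV. (if l = i then - 1 / cox_section \<rho> a b i w else 1) * (1 / cox_section \<rho> a b l w))"
    by (rule prod.cong) (simp_all add: inv_deriv_def power2_eq_square)
  also have "\<dots> = - 1 / cox_section \<rho> a b i w * (1 / (\<Prod>i\<in>UNIV. cox_section \<rho> a b i w))"
    by (simp add: prod.distrib prod_dividef)
  finally show ?thesis
    using assms unfolding kernel_def by (simp add: monom_value_def cox_coord_def coeff_index_def)
qed

text \<open>On the product of the 1 / \<sigma>_i the i-th Euler operator acts as -1, so that the
  terms with c_i cancel against those in \<open>beta_char\<close>. The sum over \<open>\<nu>\<close>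
  turns the action of \<open>x\<close> on coefficients into the derivative of the section along the
  field.\<close>

lemma weyl_value_Z_op:
  fixes \<rho> :: "'r::finite \<Rightarrow> int ^ 'd::finite" and a :: "'s::finite \<Rightarrow> 'r \<Rightarrow> int"
  assumes x: "x \<in> lie_Aut_g \<rho>" and \<rho>: "complete_rays \<rho>"
    and fin: "\<And>i. finite (polytope_points \<rho> (a i))" and nz: "\<And>i. cox_section \<rho> a b i w \<noteq> 0"
  shows "weyl_value (\<lambda>\<beta> b. kernel \<rho> a \<beta> b w) b (Z_op \<rho> a x c + Poly_Mapping.single 0 (beta_char \<rho> x c)) =
    (div_field (var_field x) w - (\<Sum>i\<in>UNIV. deriv_section \<rho> a b i w (field_at (var_field x) w) / cox_section \<rho> a b i w)) *
      (1 / (\<Prod>i\<in>UNIV. cox_section \<rho> a b i w))"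
proof -
  obtain \<phi> where \<phi>: "aut_curve \<rho> \<phi> x" using x unfolding lie_Aut_g_def by blast
  let ?\<sigma> = "\<lambda>i. cox_section \<rho> a b i w" and ?P = "\<lambda>i. polytope_points \<rho> (a i)"
    and ?E = "\<lambda>i \<nu>. eval_monom (cox_exponent \<rho> (a i) \<nu>) w" and ?X = "field_at (var_field x) w"
  let ?q = "1 / (\<Prod>i\<in>UNIV. ?\<sigma> i)"
  let ?J = "\<lambda>\<beta>. kernel \<rho> a \<beta> b w"
  let ?c = "\<lambda>i \<mu> \<nu>. Poly_Mapping.lookup (x (monom_of (cox_exponent \<rho> (a i) \<mu>))) (cox_exponent \<rho> (a i) \<nu>)"
  have mv: "monom_value b (Poly_Mapping.single v 1) = b v" for v by (simp add: monom_value_def)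
  have "weyl_value (\<lambda>\<beta> b. kernel \<rho> a \<beta> b w) b (Z_op \<rho> a x c + Poly_Mapping.single 0 (beta_char \<rho> x c)) =
      (\<Sum>i\<in>UNIV. \<Sum>\<mu>\<in>?P i. \<Sum>\<nu>\<in>?P i. ?c i \<mu> \<nu> * (b (i, \<mu>) * ?J (Poly_Mapping.single (i, \<nu>) 1))) +
      (\<Sum>i\<in>UNIV. \<Sum>\<mu>\<in>?P i. c i * (b (i, \<mu>) * ?J (Poly_Mapping.single (i, \<mu>) 1))) +
      beta_char \<rho> x c * ?J 0"
    unfolding weyl_value_def Z_op_def lin_ext_add lin_ext_sum lin_ext_single zero_prod_def prod.case mv
    by (simp add: monom_value_def)
  moreover have D: "(\<Sum>\<mu>\<in>?P i. \<Sum>\<nu>\<in>?P i. ?c i \<mu> \<nu> * (b (i, \<mu>) * ?J (Poly_Mapping.single (i, \<nu>) 1))) =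
      - (deriv_section \<rho> a b i w ?X / ?\<sigma> i) * ?q" for i
  proof -
    have "(\<Sum>\<nu>\<in>?P i. ?c i \<mu> \<nu> * (b (i, \<mu>) * ?J (Poly_Mapping.single (i, \<nu>) 1))) =
        b (i, \<mu>) * deriv_monom (cox_exponent \<rho> (a i) \<mu>) w ?X * (- (1 / ?\<sigma> i) * ?q)" if \<mu>: "\<mu> \<in> ?P i" for \<mu>
    proof -
      have "(\<Sum>\<nu>\<in>?P i. ?c i \<mu> \<nu> * (b (i, \<mu>) * ?J (Poly_Mapping.single (i, \<nu>) 1))) =
          (\<Sum>\<nu>\<in>?P i. (?c i \<mu> \<nu> * ?E i \<nu>) * (b (i, \<mu>) * (- (1 / ?\<sigma> i) * ?q)))"
        by (rule sum.cong[OF refl]) (simp only: kernel_single, simp)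
      then show ?thesis
        unfolding sum_distrib_right[symmetric] eval_derivation_section[OF \<phi> \<rho> fin \<mu>] by simp
    qed
    then have "(\<Sum>\<mu>\<in>?P i. \<Sum>\<nu>\<in>?P i. ?c i \<mu> \<nu> * (b (i, \<mu>) * ?J (Poly_Mapping.single (i, \<nu>) 1))) =
        deriv_section \<rho> a b i w ?X * (- (1 / ?\<sigma> i) * ?q)"
      unfolding deriv_section_def sum_distrib_right by (rule sum.cong[OF refl])
    then show ?thesis by simp
  qed
  moreover have C: "(\<Sum>\<mu>\<in>?P i. c i * (b (i, \<mu>) * ?J (Poly_Mapping.single (i, \<mu>) 1))) = - c i * ?q" for i
  proof -
    have "(\<Sum>\<mu>\<in>?P i. c i * (b (i, \<mu>) * ?J (Poly_Mapping.single (i, \<mu>) 1))) =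
        (\<Sum>\<mu>\<in>?P i. (b (i, \<mu>) * ?E i \<mu>) * (- c i * (1 / ?\<sigma> i) * ?q))"
      by (rule sum.cong[OF refl]) (simp only: kernel_single, simp)
    also have "\<dots> = ?\<sigma> i * (- c i * (1 / ?\<sigma> i) * ?q)"
      unfolding sum_distrib_right[symmetric] cox_section_def ..
    finally show ?thesis using nz[of i] by simp
  qed
  moreover have "- D * q + - C * q + (L + C) * q = (L - D) * q" for D q C L :: complex
    by (simp add: algebra_simps)
  ultimately show ?thesis
    unfolding beta_char_def d_aut_char_eq[OF x] kernel_zero div_field_const[OF \<phi> \<rho>]
    by (simp only: D C sum_distrib_right[symmetric] sum_negf)
qed

section \<open>The ladder diagram\<close>

text \<open>The linear form as a function on all dots, extended by 0 to the extra ones. Its value on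
  an edge vector is then the increment along the edge, without special cases.\<close>

definition vertex_value :: "('d::finite \<Rightarrow> dot) \<Rightarrow> int ^ 'd \<Rightarrow> dot \<Rightarrow> int" where
  "vertex_value dot m x = (\<Sum>d | dot d = x. m $ d)"

lemma pairing_edge_vec:
  "pairing m (edge_vec dot e) = vertex_value dot m (snd e) - vertex_value dot m (fst e)"
proof -
  have "pairing m (edge_vec dot e) =
      (\<Sum>d\<in>UNIV. (if dot d = snd e then m $ d else 0) - (if dot d = fst e then m $ d else 0))"
    unfolding pairing_def edge_vec_def by (rule sum.cong) (auto simp: algebra_simps)
  also have "\<dots> = vertex_value dot m (snd e) - vertex_value dot m (fst e)"
    unfolding vertex_value_def sum_subtractf
    by (simp add: sum.If_cases)
  finally show ?thesis .
qed

lemma vertex_value_outside: "x \<notin> range dot \<Longrightarrow> vertex_value dot m x = 0"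
  unfolding vertex_value_def by (rule sum.neutral) auto

lemma vertex_value_dot: "inj dot \<Longrightarrow> vertex_value dot m (dot d) = m $ d"
proof -
  assume "inj dot"
  then have "{d'. dot d' = dot d} = {d}" by (auto dest: injD)
  then show ?thesis by (simp add: vertex_value_def)
qed

lemma top_in_edges: "top_edge \<in> edges k n" "end_edge k n \<in> edges k n"
  by (auto simp: edges_def)

lemma vertical_in_edges: "1 \<le> i \<Longrightarrow> i < k \<Longrightarrow> 1 \<le> j \<Longrightarrow> j \<le> n - k \<Longrightarrow> ((i, j), (Suc i, j)) \<in> edges k n"
  by (auto simp: edges_def dots_def)

lemma horizontal_in_edges: "1 \<le> i \<Longrightarrow> i \<le> k \<Longrightarrow> 1 \<le> j \<Longrightarrow> j < n - k \<Longrightarrow> ((i, j), (i, Suc j)) \<in> edges k n"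
  by (auto simp: edges_def dots_def)

text \<open>Every dot lies on a directed path from one extra dot to the other.\<close>

lemma vertex_value_bounds:
  fixes dot :: "'d::finite \<Rightarrow> dot"
  assumes kn: "1 \<le> k" "k < n" and dot: "bij_betw dot UNIV (dots k n)" and B: "0 \<le> B"
    and e: "\<And>e. e \<in> edges k n \<Longrightarrow> - B \<le> vertex_value dot m (snd e) - vertex_value dot m (fst e)"
    and x: "x \<in> dots k n"
  shows "\<bar>vertex_value dot m x\<bar> \<le> int (n + 1) * B"
proof -
  let ?f = "\<lambda>i j. vertex_value dot m (i, j)"
  have range: "range dot = dots k n" using dot by (simp add: bij_betw_def)
  have out: "?f 0 1 = 0" "?f k (n - k + 1) = 0"
    by (rule vertex_value_outside, simp add: range dots_def)+
  \<comment> \<open>The index \<open>l\<close> counts the edges of a path from the upper extra dot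
    to (i, j).\<close>
  have lower: "- (int l * B) \<le> ?f i j" if "l = i + j - 1" "1 \<le> i" "i \<le> k" "1 \<le> j" "j \<le> n - k" for l i j
    using that
  proof (induction l arbitrary: i j)
    case 0
    then show ?case by simp
  next
    case (Suc l)
    have step: "- (int (Suc l) * B) = - (int l * B) - B" by (simp add: algebra_simps)
    consider "i = 1" "j = 1" | "2 \<le> i" | "i = 1" "2 \<le> j" using Suc.prems by linarith
    then show ?case
    proof cases
      case 1
      then have "l = 0" using Suc.prems by simp
      then show ?thesis using e[OF top_in_edges(1)] out(1) 1 by (simp add: top_edge_def)
    next
      case 2
      have "- (int l * B) \<le> ?f (i - 1) j" by (rule Suc.IH) (use Suc.prems 2 in auto)
      moreover have "- B \<le> ?f i j - ?f (i - 1) j"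
        using e[OF vertical_in_edges[of "i - 1" k j n]] Suc.prems 2 by simp
      ultimately show ?thesis using step by linarith
    next
      case 3
      have "- (int l * B) \<le> ?f i (j - 1)" by (rule Suc.IH) (use Suc.prems 3 in auto)
      moreover have "- B \<le> ?f i j - ?f i (j - 1)"
        using e[OF horizontal_in_edges[of i k "j - 1" n]] Suc.prems 3 by simp
      ultimately show ?thesis using step by linarith
    qed
  qed
  \<comment> \<open>Here \<open>l\<close> counts the edges of a path from (i, j) to the other extra
    dot.\<close>
  have upper: "?f i j \<le> int l * B" if "l = n + 1 - (i + j)" "1 \<le> i" "i \<le> k" "1 \<le> j" "j \<le> n - k" for l i j
    using that
  proof (induction l arbitrary: i j)
    case 0
    then show ?case using kn by simp
  next
    case (Suc l)
    have step: "int (Suc l) * B = int l * B + B" by (simp add: algebra_simps)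
    consider "i = k" "j = n - k" | "i < k" | "i = k" "j < n - k" using Suc.prems by linarith
    then show ?case
    proof cases
      case 1
      then have "l = 0" using Suc.prems by simp
      then show ?thesis using e[OF top_in_edges(2)] out(2) 1 by (simp add: end_edge_def)
    next
      case 2
      have "?f (Suc i) j \<le> int l * B" by (rule Suc.IH) (use Suc.prems 2 in auto)
      moreover have "- B \<le> ?f (Suc i) j - ?f i j"
        using e[OF vertical_in_edges[of i k j n]] Suc.prems 2 by simp
      ultimately show ?thesis using step by linarith
    next
      case 3
      have "?f i (Suc j) \<le> int l * B" by (rule Suc.IH) (use Suc.prems 3 in auto)
      moreover have "- B \<le> ?f i (Suc j) - ?f i j"
        using e[OF horizontal_in_edges[of i k j n]] Suc.prems 3 by simp
      ultimately show ?thesis using step by linarith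
    qed
  qed
  obtain i j where ij: "x = (i, j)" "1 \<le> i" "i \<le> k" "1 \<le> j" "j \<le> n - k"
    using x by (auto simp: dots_def)
  have "int (i + j - 1) * B \<le> int (n + 1) * B" "int (n + 1 - (i + j)) * B \<le> int (n + 1) * B"
    using ij kn by (intro mult_right_mono B; simp)+
  then show ?thesis
    unfolding ij(1) abs_le_iff minus_le_iff[of "vertex_value dot m (i, j)"]
    using order_trans[OF upper[OF refl ij(2-5)]] order_trans[OF _ lower[OF refl ij(2-5)]] by (meson neg_le_iff_le)
qed

text \<open>Increments that are nonnegative along a path whose two ends carry the value 0 must all
  vanish: the vertex bound with \<open>B = 0\<close>.\<close>

lemma ladder_complete_rays:
  fixes dot :: "'d::finite \<Rightarrow> dot" and ray :: "'r::finite \<Rightarrow> edge"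
  assumes kn: "1 \<le> k" "k < n" and dot: "bij_betw dot UNIV (dots k n)" and ray: "bij_betw ray UNIV (edges k n)"
  shows "complete_rays (\<lambda>j. edge_vec dot (ray j))"
  unfolding complete_rays_def
proof (intro allI impI)
  fix m assume m: "\<forall>j. 0 \<le> pairing m (edge_vec dot (ray j))"
  have "0 \<le> vertex_value dot m (snd e) - vertex_value dot m (fst e)" if "e \<in> edges k n" for e
    using m that ray unfolding pairing_edge_vec bij_betw_def by (metis imageE)
  then have "\<bar>vertex_value dot m (dot d)\<bar> \<le> int (n + 1) * 0" for d
    using dot by (intro vertex_value_bounds[OF kn dot]) (auto simp: bij_betw_def)
  then have "m $ d = 0" for d
    using dot vertex_value_dot[of dot m d] by (simp add: bij_betw_def)
  then show "m = 0" by (simp add: vec_eq_iff)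
qed

text \<open>The divisor bounds the increments from below, hence all vertex values, which are the
  coordinates of the lattice point.\<close>

lemma ladder_finite_polytope_points:
  fixes dot :: "'d::finite \<Rightarrow> dot" and ray :: "'r::finite \<Rightarrow> edge"
  assumes kn: "1 \<le> k" "k < n" and dot: "bij_betw dot UNIV (dots k n)" and ray: "bij_betw ray UNIV (edges k n)"
  shows "finite (polytope_points (\<lambda>j. edge_vec dot (ray j)) A)"
proof -
  define B where "B = (\<Sum>j\<in>UNIV. \<bar>A j\<bar>)"
  have B: "\<bar>A j\<bar> \<le> B" for j unfolding B_def by (rule member_le_sum) auto
  let ?S = "{- (int (n + 1) * B)..int (n + 1) * B}"
  have sub: "vec_nth ` polytope_points (\<lambda>j. edge_vec dot (ray j)) A \<subseteq> (UNIV \<rightarrow>\<^sub>E ?S)"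
  proof (rule image_subsetI)
    fix m assume m: "m \<in> polytope_points (\<lambda>j. edge_vec dot (ray j)) A"
    have "- B \<le> vertex_value dot m (snd e) - vertex_value dot m (fst e)" if e: "e \<in> edges k n" for e
    proof -
      obtain j where "e = ray j" using e ray by (auto simp: bij_betw_def)
      moreover have "- A j \<le> pairing m (edge_vec dot (ray j))" using m by (simp add: polytope_points_def)
      ultimately show ?thesis using B[of j] unfolding pairing_edge_vec by simp
    qed
    then have "\<bar>vertex_value dot m (dot d)\<bar> \<le> int (n + 1) * B" for d
      using dot B by (intro vertex_value_bounds[OF kn dot]) (auto simp: bij_betw_def B_def intro: sum_nonneg)
    moreover have "vertex_value dot m (dot d) = m $ d" for d
      using dot by (intro vertex_value_dot) (simp add: bij_betw_def)
    ultimately have "\<bar>m $ d\<bar> \<le> int (n + 1) * B" for d by metis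
    then show "vec_nth m \<in> (UNIV \<rightarrow>\<^sub>E ?S)" by (auto simp: abs_le_iff minus_le_iff)
  qed
  have "finite (vec_nth ` polytope_points (\<lambda>j. edge_vec dot (ray j)) A)"
    by (rule finite_subset[OF sub finite_PiE]) auto
  then show ?thesis by (rule finite_imageD) (auto simp: inj_on_def vec_eq_iff)
qed

text \<open>The values of a function on the dots, prescribed by \<open>h\<close> on the roof, are propagated downward and
  to the left along the edges in \<open>J\<close>.  Away from the roof at most one of the two edges entering the
  recursion belongs to \<open>J\<close>, as they form a corner.\<close>

function propagate :: "nat \<Rightarrow> (nat \<Rightarrow> int) \<Rightarrow> edge set \<Rightarrow> (edge \<Rightarrow> int) \<Rightarrow> nat \<Rightarrow> nat \<Rightarrow> int" where
  "propagate q h J c i j = (if i \<le> 1 \<or> q \<le> j then h (i + j - 1)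
     else if ((i - 1, j), (i, j)) \<in> J then propagate q h J c (i - 1) j + c ((i - 1, j), (i, j))
     else propagate q h J c i (Suc j) - c ((i, j), (i, Suc j)))"
  by auto
termination by (relation "Wellfounded.measure (\<lambda>(q, h, J, c, i, j). i + (q - j))") auto

declare propagate.simps [simp del]

text \<open>Row and column of the t-th dot of the roof path sum to t + 1, so that the value
  \<open>h (i + j - 1)\<close> in \<open>propagate\<close> is \<open>h t\<close> there.\<close>

definition roof_point :: "nat \<Rightarrow> nat \<Rightarrow> nat \<Rightarrow> dot" where
  "roof_point k n t = (if t = 0 then (0, 1) else if t \<le> n - k then (1, t)
     else if t < n then (t + 1 - (n - k), n - k) else (k, n - k + 1))"

lemma roof_edge_cases:
  assumes kn: "1 \<le> k" "k < n" and e: "e \<in> roof k n"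
  obtains t where "t < n" "e = (roof_point k n t, roof_point k n (Suc t))"
    "snd (roof_point k n t) + fst (roof_point k n t) = Suc t" "snd (roof_point k n (Suc t)) + fst (roof_point k n (Suc t)) = Suc (Suc t)"
proof -
  consider "e = top_edge" | "e = end_edge k n" | j where "e = ((1, j), (1, j + 1))" "1 \<le> j" "j < n - k"
    | i where "e = ((i, n - k), (i + 1, n - k))" "1 \<le> i" "i < k"
    using e by (auto simp: roof_def)
  then show thesis
  proof cases
    case 1
    then show thesis using kn by (intro that[of 0]) (auto simp: roof_point_def top_edge_def)
  next
    case 2
    then show thesis using kn by (intro that[of "n - 1"]) (auto simp: roof_point_def end_edge_def)
  next
    case (3 j)
    then show thesis using kn by (intro that[of j]) (auto simp: roof_point_def)
  next
    case (4 i)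
    then show thesis using kn by (intro that[of "n - k + i - 1"]) (auto simp: roof_point_def)
  qed
qed

text \<open>An edge off the roof is the left or the lower edge of a box, that is, one half of a
  corner.\<close>

lemma edges_cases:
  assumes "e \<in> edges k n"
  obtains "e \<in> roof k n" | i j where "e = ((i, j), (i + 1, j))" "1 \<le> i" "i < k" "1 \<le> j" "j < n - k"
    | i j where "e = ((i + 1, j), (i + 1, j + 1))" "1 \<le> i" "i < k" "1 \<le> j" "j < n - k"
proof -
  consider "e = top_edge" | "e = end_edge k n"
    | i j where "e = ((i, j), (i + 1, j))" "1 \<le> i" "i < k" "1 \<le> j" "j \<le> n - k"
    | i j where "e = ((i, j), (i, j + 1))" "1 \<le> i" "i \<le> k" "1 \<le> j" "j < n - k"
    using assms by (auto simp: edges_def dots_def)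
  then show thesis
  proof cases
    case 1 then show thesis using that(1) by (simp add: roof_def)
  next
    case 2 then show thesis using that(1) by (simp add: roof_def)
  next
    case (3 i j)
    then show thesis using that(2)[of i j] that(1) by (cases "j = n - k") (auto simp: roof_def)
  next
    case (4 i j)
    then show thesis using that(3)[of "i - 1" j] that(1) by (cases "i = 1") (auto simp: roof_def)
  qed
qed

text \<open>A cone misses some edge of the roof, so that the values on the roof can be prescribed
  from both extra dots up to the gap. Every remaining dot is the lower left vertex of one box, and
  at most one of the two corner edges there imposes a condition.\<close>

lemma ladder_solve:
  fixes dot :: "'d::finite \<Rightarrow> dot" and c :: "edge \<Rightarrow> int"
  assumes kn: "1 \<le> k" "k < n" and dot: "bij_betw dot UNIV (dots k n)" and J: "J \<in> ladder_cones k n"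
  shows "\<exists>m. \<forall>e\<in>J. pairing m (edge_vec dot e) = c e"
proof -
  have JE: "J \<subseteq> edges k n" and corner: "\<And>i j. 1 \<le> i \<Longrightarrow> i < k \<Longrightarrow> 1 \<le> j \<Longrightarrow> j < n - k \<Longrightarrow> \<not> corner i j \<subseteq> J"
    using J by (auto simp: ladder_cones_def)
  obtain e0 where e0: "e0 \<in> roof k n" "e0 \<notin> J" using J by (auto simp: ladder_cones_def)
  obtain t0 where t0: "t0 < n" "e0 = (roof_point k n t0, roof_point k n (Suc t0))"
    using roof_edge_cases[OF kn e0(1)] by metis
  let ?r = "\<lambda>t. (roof_point k n t, roof_point k n (Suc t))"
  \<comment> \<open>Summed forward from the upper extra dot up to the missing edge, and backward
    from the other extra dot behind it; the discrepancy falls on the missing edge.\<close>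
  define h where "h t = (if t \<le> t0 then \<Sum>s<t. c (?r s) else - (\<Sum>s=t..<n. c (?r s)))" for t
  have h: "h (Suc t) - h t = c (?r t)" if "t < n" "t \<noteq> t0" for t
    using that by (auto simp: h_def sum.atLeast_Suc_lessThan)
  have h0: "h 0 = 0" "h n = 0" using t0 by (simp_all add: h_def)
  define q where "q = n - k"
  let ?g = "propagate q h J c"
  define m where "m = (\<chi> d. ?g (fst (dot d)) (snd (dot d)))"
  have inj: "inj dot" and range: "range dot = dots k n" using dot by (simp_all add: bij_betw_def)
  have v: "vertex_value dot m x = ?g (fst x) (snd x)" if "x \<in> dots k n \<or> x = (0, 1) \<or> x = (k, n - k + 1)" for x
  proof (cases "x \<in> dots k n")
    case True
    then obtain d where "x = dot d" using range by blast
    then show ?thesis by (simp add: vertex_value_dot[OF inj] m_def)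
  next
    case False
    moreover have "?g 0 1 = 0" "?g k (n - k + 1) = 0"
      using h0 kn by (subst propagate.simps, simp add: q_def)+
    ultimately show ?thesis using that range by (auto simp: vertex_value_outside)
  qed
  have ends: "x \<in> dots k n \<or> x = (0, 1) \<or> x = (k, n - k + 1)" if "e \<in> edges k n" "x = fst e \<or> x = snd e" for e x
    using that kn by (auto simp: edges_def dots_def top_edge_def end_edge_def)
  have roof_val: "?g i j = h (i + j - 1)" if "i \<le> 1 \<or> q \<le> j" for i j
    using that by (subst propagate.simps) simp
  have "pairing m (edge_vec dot e) = c e" if e: "e \<in> J" for e
  proof -
    have eE: "e \<in> edges k n" using e JE by blast
    have p: "pairing m (edge_vec dot e) = ?g (fst (snd e)) (snd (snd e)) - ?g (fst (fst e)) (snd (fst e))"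
      unfolding pairing_edge_vec using v ends[OF eE] by simp
    show ?thesis
      using eE
    proof (cases rule: edges_cases)
      case 1
      from roof_edge_cases[OF kn 1] obtain t where t: "t < n" "e = ?r t"
        "snd (roof_point k n t) + fst (roof_point k n t) = Suc t" "snd (roof_point k n (Suc t)) + fst (roof_point k n (Suc t)) = Suc (Suc t)"
        by metis
      have on: "fst (roof_point k n t) \<le> 1 \<or> q \<le> snd (roof_point k n t)" for t
        by (auto simp: roof_point_def q_def)
      have "t \<noteq> t0" using t(2) t0(2) e e0(2) by auto
      then show ?thesis unfolding p using h[OF t(1)] t(2-4) by (simp add: roof_val[OF on] add.commute)
    next
      case (2 i j)
      then have "?g (i + 1) j = ?g i j + c e"
        using e by (subst propagate.simps) (simp add: q_def)
      then show ?thesis unfolding p using 2 by simp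
    next
      case (3 i j)
      then have "((i, j), (i + 1, j)) \<notin> J" using corner[of i j] e by (auto simp: corner_def)
      then have "?g (i + 1) j = ?g (i + 1) (j + 1) - c e"
        using 3 by (subst propagate.simps) (simp add: q_def)
      then show ?thesis unfolding p using 3 by simp
    qed
  qed
  then show ?thesis by blast
qed

text \<open>This is smoothness of the cones: their generators are part of a lattice basis. For
  \<open>j\<close> outside \<open>J\<close> the vector is just orthogonal to the cone.\<close>

lemma ladder_dual_vectors:
  fixes dot :: "'d::finite \<Rightarrow> dot" and ray :: "'r::finite \<Rightarrow> edge"
  assumes kn: "1 \<le> k" "k < n" and dot: "bij_betw dot UNIV (dots k n)" and ray: "inj ray"
    and J: "ray ` J \<in> ladder_cones k n"
  shows "\<exists>m. \<forall>l\<in>J. pairing m (edge_vec dot (ray l)) = (if l = j then 1 else 0)"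
proof -
  obtain m where m: "\<And>e. e \<in> ray ` J \<Longrightarrow> pairing m (edge_vec dot e) = (if e = ray j then 1 else 0)"
    using ladder_solve[OF kn dot J, of "\<lambda>e. if e = ray j then 1 else 0"] by blast
  have "pairing m (edge_vec dot (ray l)) = (if l = j then 1 else 0)" if "l \<in> J" for l
    using m[of "ray l"] that ray by (auto dest: injD)
  then show ?thesis by blast
qed

section \<open>Stokes' theorem for the contracted period form\<close>

definition pd :: "(real ^ 'd \<Rightarrow> 'b) \<Rightarrow> 'd \<Rightarrow> real ^ 'd \<Rightarrow> 'b::real_normed_vector" where
  "pd f c z = frechet_derivative f (at z) (axis c (1 :: real))"

text \<open>The Lie derivative of the period form along the field. By \<open>weyl_value_Z_op\<close>
  it is also the integrand that the operator of an infinitesimal automorphism produces.\<close>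

definition lie_form :: "('r::finite \<Rightarrow> int ^ 'd::finite) \<Rightarrow> ('s::finite \<Rightarrow> 'r \<Rightarrow> int) \<Rightarrow>
    (('s, 'd) idx \<Rightarrow> complex) \<Rightarrow> ('r \<Rightarrow> 'r cox_ring) \<Rightarrow> complex ^ 'r \<Rightarrow> ('d \<Rightarrow> complex ^ 'r) \<Rightarrow> complex" where
  "lie_form \<rho> a b x w \<tau> =
     (div_field x w - (\<Sum>i\<in>UNIV. deriv_section \<rho> a b i w (field_at x w) / cox_section \<rho> a b i w)) *
       period_form \<rho> a b w \<tau>"

lemma has_vector_derivative_upd:
  fixes f :: "real ^ 'd::finite \<Rightarrow> 'b::real_normed_vector"
  assumes "f differentiable (at s)"
  shows "((\<lambda>t. f (upd s c t)) has_vector_derivative pd f c s) (at (s $ c))"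
proof -
  have f: "(f has_derivative frechet_derivative f (at s)) (at (upd s c (s $ c)))"
    using assms by (simp add: frechet_derivative_works)
  have "((\<lambda>t. upd s c t) has_derivative (\<lambda>t. t *\<^sub>R axis c 1)) (at (s $ c))"
    unfolding upd_eq_add by (auto intro!: derivative_eq_intros)
  from has_derivative_compose[OF this f]
  have "((\<lambda>t. f (upd s c t)) has_derivative (\<lambda>t. frechet_derivative f (at s) (t *\<^sub>R axis c 1))) (at (s $ c))" .
  moreover have "linear (frechet_derivative f (at s))"
    using assms by (rule linear_frechet_derivative)
  ultimately show ?thesis
    by (simp add: has_vector_derivative_def pd_def linear_cmul)
qed

lemma k_smooth_on_pd: "k_smooth_on (Suc m) W f \<Longrightarrow> k_smooth_on m W (pd f c)"
  unfolding pd_def[abs_def] by simp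

lemma k_smooth_on_differentiable: "k_smooth_on (Suc m) W f \<Longrightarrow> z \<in> W \<Longrightarrow> f differentiable (at z)"
  by simp

lemma continuous_on_lie_form:
  assumes "continuous_on S f" "\<And>c. continuous_on S (\<lambda>x. g x c)"
    and "\<And>z i. z \<in> S \<Longrightarrow> cox_section \<rho> a b i (f z) \<noteq> 0"
  shows "continuous_on S (\<lambda>z. lie_form \<rho> a b x (f z) (g z))"
  unfolding lie_form_def
  by (intro continuous_on_mult continuous_on_diff continuous_on_sum continuous_on_divide continuous_on_div_field
      continuous_on_deriv_section continuous_on_field_at continuous_on_cox_section continuous_on_period_form ballI assms)

context tube_slots
begin

text \<open>\<open>G c\<close> carries the field in column \<open>c\<close> and is, up to sign, a
  coefficient of the contracted form; the derivatives of the \<open>G c\<close> in their own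
  directions sum to its exterior derivative. Angle directions contribute nothing, and a simplex
  direction contributes the two faces between which it runs.\<close>

lemma stokes_ord_cell:
  fixes T :: "real ^ 'd \<Rightarrow> complex ^ 'r::finite" and \<rho> :: "'r \<Rightarrow> int ^ 'd" and a :: "'q::finite \<Rightarrow> 'r \<Rightarrow> int"
  assumes W: "open W" "ord_cell p \<subseteq> W" and T: "k_smooth_on (Suc (Suc 0)) W T"
    and nz: "\<And>z i. z \<in> ord_cell p \<Longrightarrow> cox_section \<rho> a b i (T z) \<noteq> 0"
    and a: "\<And>j. (\<Sum>i\<in>UNIV. a i j) = 1" and x: "graded_field \<rho> x"
    and per: "\<And>z i. z \<in> ord_cell p \<Longrightarrow> T (upd z (slot (Inr i)) 1) = T (upd z (slot (Inr i)) 0)"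
    and per': "\<And>z i c. z \<in> ord_cell p \<Longrightarrow> pd T c (upd z (slot (Inr i)) 1) = pd T c (upd z (slot (Inr i)) 0)"
  defines "G \<equiv> \<lambda>c z. period_form \<rho> a b (T z) ((\<lambda>e. pd T e z)(c := field_at x (T z)))"
  shows "integral (ord_cell p) (\<lambda>z. lie_form \<rho> a b x (T z) (\<lambda>c. pd T c z)) =
    (\<Sum>l=1..p. integral (ord_cell (p - 1)) (\<lambda>z. G (slot (Inl l)) (face l z) - G (slot (Inl l)) (face (l - 1) z)))"
proof -
  let ?C = "ord_cell p"
  define G' where "G' c z = deriv_period \<rho> a b (T z) (pd T c z) ((\<lambda>e. pd T e z)(c := field_at x (T z)))
      (\<lambda>e. if e = c then deriv_field x (T z) (pd T c z) else pd (pd T e) c z)" for c z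
  have cT: "continuous_on ?C T" and c1: "continuous_on ?C (pd T e)" and c2: "continuous_on ?C (pd (pd T e) c)" for e c
    using k_smooth_on_continuous[OF T] k_smooth_on_continuous[OF k_smooth_on_pd[OF T]]
      k_smooth_on_continuous[OF k_smooth_on_pd[OF k_smooth_on_pd[OF T]]] W(2)
    by (auto intro: continuous_on_subset)
  have cols: "continuous_on ?C (\<lambda>z. ((\<lambda>e. pd T e z)(c := field_at x (T z))) e)" for c e
    by (cases "e = c") (simp_all add: c1[unfolded eta_contract_eq] continuous_on_field_at[OF cT])
  have cG: "continuous_on ?C (G c)" for c
    unfolding G_def by (intro continuous_on_period_form cT cols nz)
  have cG': "continuous_on ?C (G' c)" for c
  proof -
    have "continuous_on ?C (\<lambda>z. if e = c then deriv_field x (T z) (pd T c z) else pd (pd T e) c z)" for e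
      by (cases "e = c") (simp_all add: continuous_on_deriv_field[OF cT c1] c2)
    then show ?thesis unfolding G'_def[abs_def] by (intro continuous_on_deriv_period cT c1 cols nz)
  qed
  have deriv: "((\<lambda>t. G c (upd s c t)) has_vector_derivative G' c s) (at (s $ c))" if s: "s \<in> ?C" for c s
  proof -
    have sW: "s \<in> W" using s W(2) by blast
    have dT: "((\<lambda>t. T (upd s c t)) has_vector_derivative pd T c s) (at (s $ c))"
      by (rule has_vector_derivative_upd[OF k_smooth_on_differentiable[OF T sW]])
    have d1: "((\<lambda>t. pd T e (upd s c t)) has_vector_derivative pd (pd T e) c s) (at (s $ c))" for e
      by (rule has_vector_derivative_upd[OF k_smooth_on_differentiable[OF k_smooth_on_pd[OF T] sW]])
    have "((\<lambda>t. ((\<lambda>e. pd T e (upd s c t))(c := field_at x (T (upd s c t)))) e) has_vector_derivative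
        (if e = c then deriv_field x (T s) (pd T c s) else pd (pd T e) c s)) (at (s $ c))" for e
      using has_vector_derivative_field_at[OF dT, of x] d1[of e] by (cases "e = c") simp_all
    then have "((\<lambda>t. period_form \<rho> a b (T (upd s c t)) ((\<lambda>e. pd T e (upd s c t))(c := field_at x (T (upd s c t))))) has_vector_derivative
        deriv_period \<rho> a b (T (upd s c (s $ c))) (pd T c s) ((\<lambda>e. pd T e (upd s c (s $ c)))(c := field_at x (T (upd s c (s $ c)))))
          (\<lambda>e. if e = c then deriv_field x (T s) (pd T c s) else pd (pd T e) c s)) (at (s $ c))"
      by (intro has_vector_derivative_period_form[where w = "\<lambda>t. T (upd s c t)" and \<tau> = "\<lambda>t. (\<lambda>e. pd T e (upd s c t))(c := field_at x (T (upd s c t)))"] dT)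
        (use nz[OF s] in simp_all)
    then show ?thesis by (simp only: G_def G'_def upd_same)
  qed
  have lie: "lie_form \<rho> a b x (T z) (\<lambda>c. pd T c z) = (\<Sum>c\<in>UNIV. G' c z)" if z: "z \<in> ?C" for z
  proof -
    have sym: "pd (pd T e) c z = pd (pd T c) e z" for c e
      using second_derivative_symmetric[OF W(1) _ T[folded numeral_2_eq_2], of z "axis e 1" "axis c 1"] z W(2)
      unfolding pd_def by blast
    show ?thesis
      unfolding lie_form_def G'_def
      by (rule lie_derivative_period_form[symmetric]) (use nz[OF z] a x sym in simp_all)
  qed
  have "integral ?C (\<lambda>z. lie_form \<rho> a b x (T z) (\<lambda>c. pd T c z)) = integral ?C (\<lambda>z. \<Sum>c\<in>UNIV. G' c z)"
    by (rule integral_cong) (rule lie)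
  also have "\<dots> = (\<Sum>c\<in>UNIV. integral ?C (G' c))"
    by (rule integral_sum) (auto intro: integrable_on_compact[OF compact_ord_cell cG'])
  also have "\<dots> = (\<Sum>l=1..p. integral ?C (G' (slot (Inl l)))) + (\<Sum>i\<in>UNIV. integral ?C (G' (slot (Inr i))))"
    by (rule sum_slots)
  also have "(\<Sum>i\<in>UNIV. integral ?C (G' (slot (Inr i)))) = 0"
  proof (intro sum.neutral ballI)
    fix i
    show "integral ?C (G' (slot (Inr i))) = 0"
      by (rule integral_angle_direction[OF cG cG' order_refl deriv]) (simp_all add: G_def per per')
  qed
  finally have "integral ?C (\<lambda>z. lie_form \<rho> a b x (T z) (\<lambda>c. pd T c z)) = (\<Sum>l=1..p. integral ?C (G' (slot (Inl l))))"
    by simp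
  also have "\<dots> = (\<Sum>l=1..p. integral (ord_cell (p - 1)) (\<lambda>z. G (slot (Inl l)) (face l z) - G (slot (Inl l)) (face (l - 1) z)))"
  proof (rule sum.cong[OF refl])
    fix l assume l: "l \<in> {1..p}"
    show "integral ?C (G' (slot (Inl l))) = integral (ord_cell (p - 1)) (\<lambda>z. G (slot (Inl l)) (face l z) - G (slot (Inl l)) (face (l - 1) z))"
      by (rule integral_simplex_direction[OF _ _ cG cG' deriv]) (use l in auto)
  qed
  finally show ?thesis .
qed

end

section \<open>Pulling the contracted form back to the faces\<close>

definition real_affine :: "('a::real_normed_vector \<Rightarrow> 'b::real_normed_vector) \<Rightarrow> bool" where
  "real_affine F \<longleftrightarrow> bounded_linear (\<lambda>z. F z - F 0)"

lemma real_affine_has_derivative: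
  assumes "real_affine F"
  shows "(F has_derivative (\<lambda>v. F v - F 0)) (at z)"
proof -
  have "((\<lambda>z. (F z - F 0) + F 0) has_derivative (\<lambda>v. F v - F 0)) (at z)"
    using bounded_linear.has_derivative[OF assms[unfolded real_affine_def] has_derivative_ident]
    by (intro has_derivative_add_const)
  then show ?thesis by simp
qed

lemma k_smooth_on_real_affine:
  assumes "real_affine F" "open U"
  shows "k_smooth_on m U F"
proof -
  have "k_smooth_on m U (\<lambda>z. (F z - F 0) + F 0)"
    using assms by (intro k_smooth_on_add k_smooth_on_const k_smooth_on_id_linear) (auto simp: real_affine_def)
  then show ?thesis by simp
qed

lemma pd_compose_affine:
  fixes F :: "real ^ 'd::finite \<Rightarrow> real ^ 'd" and T :: "real ^ 'd \<Rightarrow> 'b::real_normed_vector"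
  assumes F: "real_affine F" and T: "T differentiable (at (F z))"
  shows "pd (\<lambda>z. T (F z)) c z = (\<Sum>e\<in>UNIV. (F (axis c 1) - F 0) $ e *\<^sub>R pd T e (F z))"
proof -
  let ?D = "frechet_derivative T (at (F z))"
  have D: "(T has_derivative ?D) (at (F z))" using T by (simp add: frechet_derivative_works)
  have lin: "linear ?D" by (rule linear_frechet_derivative[OF T])
  have "((\<lambda>z. T (F z)) has_derivative (\<lambda>v. ?D (F v - F 0))) (at z)"
    by (rule has_derivative_compose[OF real_affine_has_derivative[OF F] D])
  then have "pd (\<lambda>z. T (F z)) c z = ?D (F (axis c 1) - F 0)"
    unfolding pd_def using frechet_derivative_at by metis
  also have "F (axis c 1) - F 0 = (\<Sum>e\<in>UNIV. (F (axis c 1) - F 0) $ e *\<^sub>R axis e 1)"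
    using basis_expansion[of "F (axis c 1) - F 0"] by (simp add: scalar_mult_eq_scaleR)
  finally show ?thesis
    using lin by (simp add: linear_sum linear_cmul pd_def)
qed

lemma euler_form_swap:
  assumes "c \<noteq> e"
  shows "euler_form \<rho> w (\<tau>(c := \<tau> e, e := \<tau> c)) = - euler_form \<rho> w \<tau>"
proof -
  have "det (\<chi> d k. (\<tau>(c := \<tau> e, e := \<tau> c)) k $ f d) = - det (\<chi> d k. \<tau> k $ f d)" for f
  proof -
    let ?A = "\<chi> d k. \<tau> k $ f d"
    have "det (\<chi> i j. ?A $ i $ (Transposition.transpose c e j)) = of_int (sign (Transposition.transpose c e)) * det ?A"
      by (rule det_permute_columns) (rule permutes_swap_id, simp_all)
    moreover have "(\<chi> i j. ?A $ i $ (Transposition.transpose c e j)) = (\<chi> d k. (\<tau>(c := \<tau> e, e := \<tau> c)) k $ f d)"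
      by (simp add: vec_eq_iff Transposition.transpose_def)
    ultimately show ?thesis using assms by (simp add: sign_swap_id)
  qed
  then show ?thesis unfolding euler_form_def by (simp add: sum_negf)
qed

lemma euler_form_add_column:
  fixes \<tau> :: "'d::finite \<Rightarrow> complex ^ 'r::finite"
  shows "euler_form \<rho> w (\<tau>(c := u + v)) = euler_form \<rho> w (\<tau>(c := u)) + euler_form \<rho> w (\<tau>(c := v))"
proof -
  have "det (\<chi> d k. (\<tau>(c := u + v)) k $ f d) = det (\<chi> d k. (\<tau>(c := u)) k $ f d) + det (\<chi> d k. (\<tau>(c := v)) k $ f d)" for f
  proof -
    let ?r = "\<lambda>k. \<chi> d. \<tau> k $ f d"
    have tr: "det (\<chi> d k. (\<tau>(c := y)) k $ f d) = det (\<chi> k. if k = c then (\<chi> d. y $ f d) else ?r k)" for y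
      by (subst det_transpose[symmetric]) (auto simp: transpose_def vec_eq_iff intro!: arg_cong[of _ _ det])
    have uv: "(\<chi> d. (u + v) $ f d) = (\<chi> d. u $ f d) + (\<chi> d. v $ f d)" by (simp add: vec_eq_iff)
    show ?thesis unfolding tr uv by (rule det_row_add)
  qed
  then show ?thesis unfolding euler_form_def by (simp add: sum.distrib distrib_left)
qed

lemma period_form_swap:
  "c \<noteq> e \<Longrightarrow> period_form \<rho> a b w (\<tau>(c := \<tau> e, e := \<tau> c)) = - period_form \<rho> a b w \<tau>"
  by (simp add: period_form_def euler_form_swap)

lemma period_form_add_column:
  fixes \<tau> :: "'d::finite \<Rightarrow> complex ^ 'r::finite"
  shows "period_form \<rho> a b w (\<tau>(c := u + v)) = period_form \<rho> a b w (\<tau>(c := u)) + period_form \<rho> a b w (\<tau>(c := v))"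
  by (simp add: period_form_def euler_form_add_column add_divide_distrib)

context tube_slots
begin

lemma real_affine_face: "real_affine (face k)"
proof -
  have "linear (\<lambda>z. face k z - face k 0)"
  proof (rule linearI)
    have oc: "ord_coord q (z + z') l - ord_coord q 0 l = (ord_coord q z l - ord_coord q 0 l) + (ord_coord q z' l - ord_coord q 0 l)"
      "ord_coord q (r *\<^sub>R z) l - ord_coord q 0 l = r * (ord_coord q z l - ord_coord q 0 l)" for q z z' l r
      by (simp_all add: ord_coord_def)
    show "face k (x + y) - face k 0 = face k x - face k 0 + (face k y - face k 0)" for x y
      by (rule vec_eq_slots) (simp_all only: vector_minus_component vector_add_component face_Inl face_Inr oc, simp)
    show "face k (r *\<^sub>R x) - face k 0 = r *\<^sub>R (face k x - face k 0)" for r x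
      by (rule vec_eq_slots) (simp_all only: vector_minus_component vector_scaleR_component real_scaleR_def face_Inl face_Inr oc, simp)
  qed
  then show ?thesis unfolding real_affine_def by (simp add: linear_conv_bounded_linear)
qed

lemma real_affine_diff_coords: "real_affine (diff_coords m)"
proof -
  have "linear (\<lambda>z. diff_coords m z - diff_coords m 0)"
  proof (rule linearI)
    show "diff_coords m (x + y) - diff_coords m 0 = diff_coords m x - diff_coords m 0 + (diff_coords m y - diff_coords m 0)" for x y
      by (rule vec_eq_slots) (simp_all add: diff_coords_Inl ord_coord_def)
    show "diff_coords m (r *\<^sub>R x) - diff_coords m 0 = r *\<^sub>R (diff_coords m x - diff_coords m 0)" for r x
      by (rule vec_eq_slots) (simp_all add: diff_coords_Inl ord_coord_def algebra_simps)
  qed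
  then show ?thesis unfolding real_affine_def by (simp add: linear_conv_bounded_linear)
qed

text \<open>A coordinate of the face moves one coordinate of the cell, except for
  \<open>l = k\<close>, where it moves both z_k and z_(k+1).\<close>

lemma pd_face:
  assumes T: "T differentiable (at (face k z))"
  shows "pd (\<lambda>z. T (face k z)) (slot (Inr i)) z = pd T (slot (Inr i)) (face k z)"
    and "1 \<le> l \<Longrightarrow> l < p \<Longrightarrow> pd (\<lambda>z. T (face k z)) (slot (Inl l)) z =
      (if l \<le> k then pd T (slot (Inl l)) (face k z) else 0) + (if k \<le> l then pd T (slot (Inl (Suc l))) (face k z) else 0)"
proof -
  note * = pd_compose_affine[OF real_affine_face T]
  have "(face k (axis (slot (Inr i)) 1) - face k 0) $ e = (if e = slot (Inr i) then 1 else 0)" for e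
    by (cases e rule: slot_cases) (auto simp: face_Inl ord_coord_def axis_def)
  then show "pd (\<lambda>z. T (face k z)) (slot (Inr i)) z = pd T (slot (Inr i)) (face k z)"
    unfolding * by (simp add: if_distrib[of "\<lambda>t. t *\<^sub>R _"] cong: if_cong)
  assume l: "1 \<le> l" "l < p"
  have "(face k (axis (slot (Inl l)) 1) - face k 0) $ e =
      (if e = slot (Inl l) then if l \<le> k then 1 else 0 else 0) + (if e = slot (Inl (Suc l)) then if k \<le> l then 1 else 0 else 0)" for e
  proof (cases e rule: slot_cases)
    case (Inl j)
    have "ord_coord (p - 1) (axis (slot (Inl l)) 1) j' - ord_coord (p - 1) 0 j' = (if j' = l then 1 else 0)" for j'
      using l by (auto simp: ord_coord_def axis_def)
    then have "(face k (axis (slot (Inl l)) 1) - face k 0) $ e = (if (if j \<le> k then j else j - 1) = l then 1 else 0)"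
      using Inl by (simp add: face_Inl)
    then show ?thesis using Inl l by auto
  next
    case (Inr j)
    then show ?thesis using l by (simp add: axis_def)
  qed
  then show "pd (\<lambda>z. T (face k z)) (slot (Inl l)) z =
      (if l \<le> k then pd T (slot (Inl l)) (face k z) else 0) + (if k \<le> l then pd T (slot (Inl (Suc l))) (face k z) else 0)"
    unfolding * by (simp add: scaleR_add_left sum.distrib if_distrib[of "\<lambda>t. t *\<^sub>R _"] cong: if_cong)
qed

text \<open>On a face slot \<open>p\<close> is the dummy coordinate. Its column is free to hold the
  field, so that the contracted form is again evaluated on a full frame.\<close>

definition face_form :: "('r::finite \<Rightarrow> int ^ 'd) \<Rightarrow> ('q::finite \<Rightarrow> 'r \<Rightarrow> int) \<Rightarrow> (('q, 'd) idx \<Rightarrow> complex) \<Rightarrow>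
    ('r \<Rightarrow> 'r cox_ring) \<Rightarrow> (real ^ 'd \<Rightarrow> complex ^ 'r) \<Rightarrow> real ^ 'd \<Rightarrow> complex" where
  "face_form \<rho> a b x R z = period_form \<rho> a b (R z) ((\<lambda>c. pd R c z)(slot (Inl p) := field_at x (R z)))"

text \<open>Column \<open>l\<close> is carried to place \<open>m\<close> and the columns between
  move down by one place, which amounts to m - l neighbouring transpositions.\<close>

definition rotate_columns :: "nat \<Rightarrow> nat \<Rightarrow> ('d \<Rightarrow> 'v) \<Rightarrow> 'd \<Rightarrow> 'v" where
  "rotate_columns l m \<tau> c = (case unslot c of Inr i \<Rightarrow> \<tau> c
     | Inl j \<Rightarrow> if j < l \<or> m < j then \<tau> c else if j = m then \<tau> (slot (Inl l)) else \<tau> (slot (Inl (Suc j))))"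

lemma period_form_rotate_columns:
  assumes "1 \<le> l" "l \<le> m" "m \<le> p"
  shows "period_form \<rho> a b w (rotate_columns l m \<tau>) = (- 1) ^ (m - l) * period_form \<rho> a b w \<tau>"
  using assms(2,3)
proof (induction m rule: dec_induct)
  case base
  have "rotate_columns l l \<tau> = \<tau>"
  proof
    fix c show "rotate_columns l l \<tau> c = \<tau> c"
      using assms(1) by (cases c rule: slot_cases) (auto simp: rotate_columns_def)
  qed
  then show ?case by simp
next
  case (step m)
  let ?N = "rotate_columns l m \<tau>" and ?c = "slot (Inl m)" and ?e = "slot (Inl (Suc m))"
  have m: "1 \<le> m" "Suc m \<le> p" using assms(1) step by auto
  have rot: "rotate_columns l (Suc m) \<tau> = ?N(?c := ?N ?e, ?e := ?N ?c)"
  proof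
    fix c show "rotate_columns l (Suc m) \<tau> c = (?N(?c := ?N ?e, ?e := ?N ?c)) c"
      using assms(1) m step.hyps by (cases c rule: slot_cases) (auto simp: rotate_columns_def)
  qed
  have neq: "?c \<noteq> ?e" using m by simp
  have "period_form \<rho> a b w (rotate_columns l (Suc m) \<tau>) = - period_form \<rho> a b w ?N"
    unfolding rot by (rule period_form_swap[OF neq])
  moreover have "Suc m - l = Suc (m - l)" using step.hyps by simp
  ultimately show ?case using step.IH m by simp
qed

text \<open>On face k, column k is the sum of the derivatives in z_k and z_(k+1). Multilinearity
  splits the form accordingly, and moving the field from the last place to place k or k + 1 produces
  the signs. On the faces 0 and p only one of the two terms exists.\<close>

lemma face_form_face:
  fixes T :: "real ^ 'd \<Rightarrow> complex ^ 'r::finite" and \<rho> :: "'r \<Rightarrow> int ^ 'd" and a :: "'q::finite \<Rightarrow> 'r \<Rightarrow> int"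
    and b :: "('q, 'd) idx \<Rightarrow> complex" and x :: "'r \<Rightarrow> 'r cox_ring"
  assumes p: "1 \<le> p" and k: "k \<le> p" and T: "T differentiable (at (face k z))"
  defines "H \<equiv> \<lambda>l. period_form \<rho> a b (T (face k z)) ((\<lambda>c. pd T c (face k z))(slot (Inl l) := field_at x (T (face k z))))"
  shows "(- 1) ^ (p - k) * face_form \<rho> a b x (\<lambda>z. T (face k z)) z = (if 1 \<le> k then H k else 0) - (if k < p then H (Suc k) else 0)"
proof -
  let ?w = "T (face k z)" and ?X = "field_at x (T (face k z))" and ?P = "period_form \<rho> a b (T (face k z))"
  let ?\<delta> = "\<lambda>c. pd T c (face k z)"
  let ?Q = "(\<lambda>c. pd (\<lambda>z. T (face k z)) c z)(slot (Inl p) := ?X)"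
  let ?H = "\<lambda>l. ?\<delta>(slot (Inl l) := ?X)"
  let ?M = "\<lambda>l. rotate_columns l p (?H l)"
  have M: "?P (?M l) = (- 1) ^ (p - l) * H l" if "1 \<le> l" "l \<le> p" for l
    unfolding H_def by (rule period_form_rotate_columns) (use that in auto)
  have FF: "face_form \<rho> a b x (\<lambda>z. T (face k z)) z = ?P ?Q" by (simp add: face_form_def)
  have pm: "(- 1) ^ n * ((- 1) ^ n * y) = y" for n and y :: complex
    by (simp add: mult.assoc[symmetric] power_mult_distrib[symmetric])
  consider "k = 0" | "k = p" | "1 \<le> k" "k < p" using k by linarith
  then show ?thesis
  proof cases
    case 1
    have "?Q c = ?M 1 c" for c
      using p 1 T by (cases c rule: slot_cases) (auto simp: rotate_columns_def pd_face)
    then have "?Q = ?M 1" by blast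
    then have "(- 1) ^ p * ?P ?Q = (- 1) ^ p * ((- 1) ^ (p - 1) * H 1)" using M[of 1] p by simp
    also have "\<dots> = - H 1" using p pm[of "p - 1" "H 1"] by (cases p) simp_all
    finally show ?thesis unfolding FF using 1 p by simp
  next
    case 2
    have "?Q c = ?M p c" for c
      using p 2 T by (cases c rule: slot_cases) (auto simp: rotate_columns_def pd_face)
    then have "?Q = ?M p" by blast
    then show ?thesis unfolding FF using 2 p M[of p] by simp
  next
    case 3
    have "?Q c = ((?M k)(slot (Inl k) := ?\<delta> (slot (Inl (Suc k))) + ?\<delta> (slot (Inl k)))) c" for c
      using 3 T by (cases c rule: slot_cases) (auto simp: rotate_columns_def pd_face)
    then have "?P ?Q = ?P ((?M k)(slot (Inl k) := ?\<delta> (slot (Inl (Suc k))))) + ?P ((?M k)(slot (Inl k) := ?\<delta> (slot (Inl k))))"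
      unfolding period_form_add_column[symmetric] by presburger
    moreover have "((?M k)(slot (Inl k) := ?\<delta> (slot (Inl (Suc k))))) c = ?M k c" for c
      using 3 by (cases c rule: slot_cases) (auto simp: rotate_columns_def)
    moreover have "((?M k)(slot (Inl k) := ?\<delta> (slot (Inl k)))) c = ?M (Suc k) c" for c
      using 3 by (cases c rule: slot_cases) (auto simp: rotate_columns_def)
    ultimately have "?P ?Q = ?P (?M k) + ?P (?M (Suc k))" by presburger
    then have Q: "?P ?Q = (- 1) ^ (p - k) * H k + (- 1) ^ (p - Suc k) * H (Suc k)"
      using M 3 by simp
    have "p - k = Suc (p - Suc k)" using 3 by simp
    then have "(- 1) ^ (p - k) * ?P ?Q = H k - H (Suc k)"
      using pm[of "p - Suc k" "H k"] pm[of "p - Suc k" "H (Suc k)"] unfolding Q by (simp add: algebra_simps)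
    then show ?thesis unfolding FF using 3 by simp
  qed
qed

end

context tube_slots
begin

lemma continuous_on_contraction:
  fixes T :: "real ^ 'd \<Rightarrow> complex ^ 'r::finite" and \<rho> :: "'r \<Rightarrow> int ^ 'd" and a :: "'q::finite \<Rightarrow> 'r \<Rightarrow> int"
  assumes S: "S \<subseteq> W" and T: "k_smooth_on (Suc 0) W T"
    and nz: "\<And>z i. z \<in> S \<Longrightarrow> cox_section \<rho> a b i (T z) \<noteq> 0"
  shows "continuous_on S (\<lambda>z. period_form \<rho> a b (T z) ((\<lambda>e. pd T e z)(c := field_at x (T z))))"
proof -
  have cT: "continuous_on S T" and c1: "continuous_on S (\<lambda>z. pd T e z)" for e
    using k_smooth_on_continuous[OF T] k_smooth_on_continuous[OF k_smooth_on_pd[OF T], of e] S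
    by (auto intro: continuous_on_subset)
  have "continuous_on S (\<lambda>z. ((\<lambda>e. pd T e z)(c := field_at x (T z))) e)" for e
    by (cases "e = c") (simp_all add: c1 continuous_on_field_at[OF cT])
  then show ?thesis by (intro continuous_on_period_form cT nz)
qed

text \<open>The differences are regrouped by faces: face k is the upper end of direction k and the
  lower end of direction k + 1, which are the two terms of \<open>face_form_face\<close>. For
  \<open>p = 0\<close> only angles remain and there is no boundary.\<close>

lemma stokes_faces:
  fixes T :: "real ^ 'd \<Rightarrow> complex ^ 'r::finite" and \<rho> :: "'r \<Rightarrow> int ^ 'd" and a :: "'q::finite \<Rightarrow> 'r \<Rightarrow> int"
  assumes W: "open W" "ord_cell p \<subseteq> W" and T: "k_smooth_on (Suc (Suc 0)) W T"
    and nz: "\<And>z i. z \<in> ord_cell p \<Longrightarrow> cox_section \<rho> a b i (T z) \<noteq> 0"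
    and a: "\<And>j. (\<Sum>i\<in>UNIV. a i j) = 1" and x: "graded_field \<rho> x"
    and per: "\<And>z i. z \<in> ord_cell p \<Longrightarrow> T (upd z (slot (Inr i)) 1) = T (upd z (slot (Inr i)) 0)"
    and per': "\<And>z i c. z \<in> ord_cell p \<Longrightarrow> pd T c (upd z (slot (Inr i)) 1) = pd T c (upd z (slot (Inr i)) 0)"
  shows "integral (ord_cell p) (\<lambda>z. lie_form \<rho> a b x (T z) (\<lambda>c. pd T c z)) =
    (if p = 0 then 0 else (\<Sum>k\<le>p. (- 1) ^ (p - k) * integral (ord_cell (p - 1)) (face_form \<rho> a b x (\<lambda>z. T (face k z)))))"
proof (cases "p = 0")
  case True
  then show ?thesis using stokes_ord_cell[OF W T nz a x per per'] by simp
next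
  case False
  then have p: "1 \<le> p" by simp
  let ?D = "ord_cell (p - 1)"
  define G where "G c z = period_form \<rho> a b (T z) ((\<lambda>e. pd T e z)(c := field_at x (T z)))" for c z
  define A where "A l k = integral ?D (\<lambda>z. G (slot (Inl l)) (face k z))" for l k
  have fD: "face k ` ?D \<subseteq> ord_cell p" for k using face_in_ord_cell by blast
  have cG: "continuous_on ?D (\<lambda>z. G c (face k z))" for c k
  proof -
    have "continuous_on (ord_cell p) (G c)"
      unfolding G_def by (rule continuous_on_contraction[OF W(2) k_smooth_on_SucD[OF T] nz])
    from continuous_on_compose2[OF this continuous_on_face fD] show ?thesis .
  qed
  note int = integrable_on_compact[OF compact_ord_cell cG]
  have int': "(\<lambda>z. if P then G c (face k z) else 0) integrable_on ?D" for P c k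
    using int[of c k] by (cases P) (simp_all add: integrable_on_compact[OF compact_ord_cell continuous_on_const])
  have "(- 1) ^ (p - k) * integral ?D (face_form \<rho> a b x (\<lambda>z. T (face k z))) =
      (if 1 \<le> k then A k k else 0) - (if k < p then A (Suc k) k else 0)" if k: "k \<le> p" for k
  proof -
    have "(- 1) ^ (p - k) * integral ?D (face_form \<rho> a b x (\<lambda>z. T (face k z))) =
        integral ?D (\<lambda>z. (- 1) ^ (p - k) * face_form \<rho> a b x (\<lambda>z. T (face k z)) z)"
      by simp
    also have "\<dots> = integral ?D (\<lambda>z. (if 1 \<le> k then G (slot (Inl k)) (face k z) else 0) - (if k < p then G (slot (Inl (Suc k))) (face k z) else 0))"
    proof (rule integral_cong)
      fix z assume "z \<in> ?D"
      then have "face k z \<in> W" using fD W(2) by blast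
      then have "T differentiable (at (face k z))" using T by simp
      from face_form_face[OF p k this, of \<rho> a b x]
      show "(- 1) ^ (p - k) * face_form \<rho> a b x (\<lambda>z. T (face k z)) z =
          (if 1 \<le> k then G (slot (Inl k)) (face k z) else 0) - (if k < p then G (slot (Inl (Suc k))) (face k z) else 0)"
        unfolding G_def .
    qed
    also have "\<dots> = integral ?D (\<lambda>z. if 1 \<le> k then G (slot (Inl k)) (face k z) else 0) -
        integral ?D (\<lambda>z. if k < p then G (slot (Inl (Suc k))) (face k z) else 0)"
      by (rule integral_diff) (rule int')+
    finally show ?thesis by (auto simp: A_def)
  qed
  then have "(\<Sum>k\<le>p. (- 1) ^ (p - k) * integral ?D (face_form \<rho> a b x (\<lambda>z. T (face k z)))) =
      (\<Sum>k\<le>p. if 1 \<le> k then A k k else 0) - (\<Sum>k\<le>p. if k < p then A (Suc k) k else 0)"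
    unfolding sum_subtractf[symmetric] by (intro sum.cong) auto
  also have "(\<Sum>k\<le>p. if 1 \<le> k then A k k else 0) = (\<Sum>l=1..p. A l l)"
    by (rule sum.mono_neutral_cong_right) auto
  also have "(\<Sum>k\<le>p. if k < p then A (Suc k) k else 0) = (\<Sum>k<p. A (Suc k) k)"
    by (rule sum.mono_neutral_cong_right) auto
  also have "\<dots> = (\<Sum>l=1..p. A l (l - 1))"
    by (rule sum.reindex_bij_witness[of _ "\<lambda>l. l - 1" Suc]) auto
  also have "(\<Sum>l=1..p. A l l) - (\<Sum>l=1..p. A l (l - 1)) =
      (\<Sum>l=1..p. integral ?D (\<lambda>z. G (slot (Inl l)) (face l z) - G (slot (Inl l)) (face (l - 1) z)))"
    unfolding sum_subtractf[symmetric] A_def by (intro sum.cong refl integral_diff[symmetric] int)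
  also have "\<dots> = integral (ord_cell p) (\<lambda>z. lie_form \<rho> a b x (T z) (\<lambda>c. pd T c z))"
    using stokes_ord_cell[OF W T nz a x per per'] unfolding G_def by simp
  finally show ?thesis using False by simp
qed

section \<open>The change back to barycentric coordinates\<close>

text \<open>The Jacobian of the inverse of \<open>diff_coords p\<close>, which reads z_l = 1 - t_l -
  ... - t_p in the simplex slots. Its determinant is a constant that can be taken out of every
  integral.\<close>

definition diff_matrix :: "complex ^ 'd ^ 'd" where
  "diff_matrix = (\<chi> e c. case (unslot e, unslot c) of
     (Inl l, Inl l') \<Rightarrow> if l \<le> l' then - 1 else 0 | (Inr i, Inr i') \<Rightarrow> if i = i' then 1 else 0 | _ \<Rightarrow> 0)"

lemma pd_diff_coords:
  fixes T :: "real ^ 'd \<Rightarrow> complex ^ 'r::finite"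
  assumes T: "T differentiable (at (diff_coords p z))"
  shows "pd T c (diff_coords p z) = (\<Sum>e\<in>UNIV. diff_matrix $ e $ c *s pd (\<lambda>z. T (diff_coords p z)) e z)"
proof -
  let ?M = "diff_coords p" and ?D = "\<lambda>e. pd T e (diff_coords p z)" and ?D' = "\<lambda>e. pd (\<lambda>z. T (diff_coords p z)) e z"
  note * = pd_compose_affine[OF real_affine_diff_coords T]
  have IR: "?D' (slot (Inr i)) = ?D (slot (Inr i))" for i
  proof -
    have "(?M (axis (slot (Inr i)) 1) - ?M 0) $ e = (if e = slot (Inr i) then 1 else 0)" for e
      by (cases e rule: slot_cases) (auto simp: diff_coords_Inl ord_coord_def axis_def)
    then show ?thesis unfolding * by (simp add: if_distrib[of "\<lambda>t. t *\<^sub>R _"] cong: if_cong)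
  qed
  have IL: "?D' (slot (Inl l)) = (if 2 \<le> l then ?D (slot (Inl (l - 1))) else 0) - ?D (slot (Inl l))" if l: "1 \<le> l" "l \<le> p" for l
  proof -
    have "(?M (axis (slot (Inl l)) 1) - ?M 0) $ e =
        (if e = slot (Inl (l - 1)) then if 2 \<le> l then 1 else 0 else 0) - (if e = slot (Inl l) then 1 else 0)" for e
    proof (cases e rule: slot_cases)
      case (Inl j)
      have "ord_coord p (axis (slot (Inl l)) 1) j' - ord_coord p 0 j' = (if j' = l then 1 else 0)" for j'
        using l by (auto simp: ord_coord_def axis_def)
      from this[of "Suc j"] have "(?M (axis (slot (Inl l)) 1) - ?M 0) $ e = (if Suc j = l then 1 else 0) - (if j = l then 1 else 0)"
        using Inl l by (auto simp: diff_coords_Inl axis_def)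
      then show ?thesis using Inl l by (cases "2 \<le> l") auto
    next
      case (Inr i)
      then show ?thesis using l by (cases "2 \<le> l") (auto simp: axis_def)
    qed
    then show ?thesis
      unfolding * by (simp add: scaleR_diff_left sum_subtractf if_distrib[of "\<lambda>t. t *\<^sub>R _"] cong: if_cong)
  qed
  show ?thesis
  proof (cases c rule: slot_cases)
    case (Inl m)
    have "(\<Sum>l=1..j. ?D' (slot (Inl l))) = (if 1 \<le> j then - ?D (slot (Inl j)) else 0)" if "j \<le> p" for j
      using that by (induction j) (auto simp: IL)
    from this[of m] have "(\<Sum>l=1..m. ?D' (slot (Inl l))) = - ?D c" using Inl by simp
    moreover have "(\<Sum>l=1..p. diff_matrix $ slot (Inl l) $ c *s ?D' (slot (Inl l))) = (\<Sum>l=1..m. - ?D' (slot (Inl l)))"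
      by (rule sum.mono_neutral_cong_right) (use Inl in \<open>auto simp: diff_matrix_def\<close>)
    ultimately show ?thesis using Inl unfolding sum_slots by (simp add: diff_matrix_def sum_negf)
  next
    case (Inr i)
    have "(\<Sum>i'\<in>UNIV. diff_matrix $ slot (Inr i') $ c *s ?D' (slot (Inr i'))) = (\<Sum>i'\<in>{i}. ?D' (slot (Inr i')))"
      by (rule sum.mono_neutral_cong_right) (use Inr in \<open>auto simp: diff_matrix_def\<close>)
    then show ?thesis using Inr unfolding sum_slots by (simp add: diff_matrix_def IR)
  qed
qed

lemma lie_form_diff_coords:
  fixes T :: "real ^ 'd \<Rightarrow> complex ^ 'r::finite"
  assumes T: "T differentiable (at (diff_coords p z))"
  shows "lie_form \<rho> a b x w (\<lambda>c. pd T c (diff_coords p z)) =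
    det diff_matrix * lie_form \<rho> a b x w (\<lambda>c. pd (\<lambda>z. T (diff_coords p z)) c z)"
  unfolding pd_diff_coords[OF T] lie_form_def period_form_def euler_form_matrix by simp

end

section \<open>Comparing two lifts of the same face\<close>

lemma bounded_bilinear_act: "bounded_bilinear (act :: complex ^ 'r \<Rightarrow> complex ^ 'r \<Rightarrow> complex ^ 'r::finite)"
proof -
  have "bilinear (act :: complex ^ 'r \<Rightarrow> complex ^ 'r \<Rightarrow> complex ^ 'r)"
    unfolding bilinear_def by (auto intro!: linearI simp: vec_eq_iff algebra_simps)
  then show ?thesis by (simp add: bilinear_conv_bounded_bilinear)
qed

text \<open>Logarithmic differentiation of the relations that define the class torus.\<close>

lemma class_torus_tangent:
  fixes h :: "'a::real_normed_vector \<Rightarrow> complex ^ 'r::finite"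
  assumes V: "open V" "z0 \<in> V" and h: "(h has_derivative h') (at z0)" and ct: "\<And>z. z \<in> V \<Longrightarrow> h z \<in> class_torus \<rho>"
  shows "(\<Sum>j\<in>UNIV. of_int (pairing m (\<rho> j)) * (h' v $ j / h z0 $ j)) = 0"
proof -
  let ?k = "\<lambda>j. pairing m (\<rho> j)"
  have nz: "h z $ j \<noteq> 0" if "z \<in> V" for z j using ct[OF that] by (simp add: class_torus_def)
  have one: "(\<Prod>j\<in>UNIV. h z $ j powi ?k j) = 1" if "z \<in> V" for z using ct[OF that] by (simp add: class_torus_def)
  have "((\<lambda>z. h z $ j powi ?k j) has_derivative (\<lambda>v. h' v $ j * (of_int (?k j) * h z0 $ j powi (?k j - 1)))) (at z0)" for j
  proof (rule has_derivative_power_int)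
    show "h z0 $ j \<noteq> 0" by (rule nz[OF V(2)])
    show "((\<lambda>z. h z $ j) has_derivative (\<lambda>v. h' v $ j)) (at z0)"
      by (rule bounded_linear.has_derivative[OF bounded_linear_vec_nth h])
  qed
  then have "((\<lambda>z. \<Prod>j\<in>UNIV. h z $ j powi ?k j) has_derivative
      (\<lambda>v. \<Sum>j\<in>UNIV. (h' v $ j * (of_int (?k j) * h z0 $ j powi (?k j - 1))) * (\<Prod>i\<in>UNIV - {j}. h z0 $ i powi ?k i))) (at z0)"
    by (intro has_derivative_prod)
  moreover have "((\<lambda>z. \<Prod>j\<in>UNIV. h z $ j powi ?k j) has_derivative (\<lambda>v. 0)) (at z0)"
    by (rule has_derivative_transform_within_open[OF has_derivative_const[of 1] V]) (simp add: one)
  ultimately have "(\<lambda>v. \<Sum>j\<in>UNIV. (h' v $ j * (of_int (?k j) * h z0 $ j powi (?k j - 1))) * (\<Prod>i\<in>UNIV - {j}. h z0 $ i powi ?k i)) = (\<lambda>v. 0)"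
    by (rule has_derivative_unique)
  then have "(\<Sum>j\<in>UNIV. (h' v $ j * (of_int (?k j) * h z0 $ j powi (?k j - 1))) * (\<Prod>i\<in>UNIV - {j}. h z0 $ i powi ?k i)) = 0"
    by (rule fun_cong)
  moreover have "(h' v $ j * (of_int (?k j) * h z0 $ j powi (?k j - 1))) * (\<Prod>i\<in>UNIV - {j}. h z0 $ i powi ?k i) =
      of_int (?k j) * (h' v $ j / h z0 $ j)" for j
  proof -
    have "h z0 $ j powi ?k j * (\<Prod>i\<in>UNIV - {j}. h z0 $ i powi ?k i) = 1"
      using one[OF V(2)] by (subst (asm) prod.remove[of _ j]) auto
    moreover have "h z0 $ j powi (?k j - 1) = h z0 $ j powi ?k j / h z0 $ j"
      by (rule power_int_diff[of _ _ 1, simplified]) (simp add: nz[OF V(2)])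
    ultimately show ?thesis by (simp add: field_simps)
  qed
  ultimately show ?thesis by simp
qed

lemma frechet_derivative_eq_zero:
  fixes f :: "'a::real_normed_vector \<Rightarrow> 'b::real_normed_vector"
  assumes "f differentiable (at z)" "\<And>t::real. f (z + t *\<^sub>R v) = f z"
  shows "frechet_derivative f (at z) v = 0"
proof -
  let ?D = "frechet_derivative f (at z)"
  have D: "(f has_derivative ?D) (at (z + 0 *\<^sub>R v))" using assms(1) by (simp add: frechet_derivative_works)
  have "((\<lambda>t::real. z + t *\<^sub>R v) has_derivative (\<lambda>t. t *\<^sub>R v)) (at 0)"
    by (auto intro!: derivative_eq_intros)
  from has_derivative_compose[OF this D] have "((\<lambda>t::real. f z) has_derivative (\<lambda>t. ?D (t *\<^sub>R v))) (at 0)"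
    unfolding assms(2) .
  from has_derivative_unique[OF this has_derivative_const] have "?D (1 *\<^sub>R v) = 0" by (rule fun_cong)
  then show ?thesis by simp
qed

context tube_slots
begin

text \<open>Replacing a lift by another one multiplies the tube by a function with values in the class torus
  and turns the angles by functions of the simplex coordinates.  This adds vertical vectors to the
  columns, which the form does not see, and changes them by a unipotent matrix.\<close>

lemma face_form_transport:
  fixes R1 R2 h :: "real ^ 'd \<Rightarrow> complex ^ 'r::finite" and B :: "'s \<Rightarrow> real ^ 'd \<Rightarrow> real"
    and \<rho> :: "'r \<Rightarrow> int ^ 'd" and a :: "'q::finite \<Rightarrow> 'r \<Rightarrow> int"
  defines "S \<equiv> \<lambda>z. z - (\<Sum>i\<in>UNIV. B i z *\<^sub>R axis (slot (Inr i)) 1)"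
  assumes p: "1 \<le> p" and V: "open V" "z0 \<in> V" and R1: "R1 differentiable (at (S z0))"
    and h: "h differentiable (at z0)" and ct: "\<And>z. z \<in> V \<Longrightarrow> h z \<in> class_torus \<rho>"
    and B: "\<And>i. B i differentiable (at z0)"
    and rel: "\<And>z. z \<in> V \<Longrightarrow> R2 z = act (h z) (R1 (S z))"
    and B_angle: "\<And>i i'. pd (B i) (slot (Inr i')) z0 = 0"
    and a: "\<And>j. (\<Sum>i\<in>UNIV. a i j) = 1" and x: "graded_field \<rho> x"
  shows "face_form \<rho> a b x R2 z0 = face_form \<rho> a b x R1 (S z0)"
proof -
  let ?w = "R1 (S z0)" and ?h = "h z0"
  define D1 where "D1 = frechet_derivative R1 (at (S z0))"
  have D1: "(R1 has_derivative D1) (at (S z0))" using R1 by (simp add: D1_def frechet_derivative_works)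
  have lin1: "linear D1" unfolding D1_def by (rule linear_frechet_derivative[OF R1])
  define h' where "h' = frechet_derivative h (at z0)"
  have h': "(h has_derivative h') (at z0)" using h by (simp add: h'_def frechet_derivative_works)
  define B' where "B' i = frechet_derivative (B i) (at z0)" for i
  have B': "(B i has_derivative B' i) (at z0)" for i using B by (simp add: B'_def frechet_derivative_works)
  have S': "(S has_derivative (\<lambda>v. v - (\<Sum>i\<in>UNIV. B' i v *\<^sub>R axis (slot (Inr i)) 1))) (at z0)"
    unfolding S_def by (intro has_derivative_diff has_derivative_ident has_derivative_sum has_derivative_scaleR_left B')
  have "((\<lambda>z. act (h z) (R1 (S z))) has_derivative
      (\<lambda>v. act ?h (D1 (v - (\<Sum>i\<in>UNIV. B' i v *\<^sub>R axis (slot (Inr i)) 1))) + act (h' v) ?w)) (at z0)"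
    by (rule bounded_bilinear.FDERIV[OF bounded_bilinear_act h' has_derivative_compose[OF S' D1]])
  from has_derivative_transform_within_open[OF this V rel[symmetric]]
  have R2: "(R2 has_derivative (\<lambda>v. act ?h (D1 (v - (\<Sum>i\<in>UNIV. B' i v *\<^sub>R axis (slot (Inr i)) 1))) + act (h' v) ?w)) (at z0)" .
  have nz: "?h $ j \<noteq> 0" for j using ct[OF V(2)] by (simp add: class_torus_def)
  let ?d = "slot (Inl p)"
  \<comment> \<open>The logarithmic derivative of \<open>h\<close>, which gives a vertical vector.
    It is 0 in the column of the field, because the field is carried along by \<open>h\<close>
    without an extra term.\<close>
  define \<xi> where "\<xi> c = (if c = ?d then 0 else \<chi> j. pd h c z0 $ j / ?h $ j)" for c
  \<comment> \<open>Through the shift \<open>S\<close> the columns acquire multiples of the angle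
    columns, with derivatives of the \<open>B i\<close> as coefficients.\<close>
  define E :: "complex ^ 'd ^ 'd" where "E = (\<chi> e c. case unslot e of Inl l \<Rightarrow> 0
      | Inr i \<Rightarrow> if c = ?d then 0 else - of_real (pd (B i) c z0))"
  define \<tau>1 where "\<tau>1 = (\<lambda>c. pd R1 c (S z0))(?d := field_at x ?w)"
  define \<tau>1' where "\<tau>1' c = (\<Sum>e\<in>UNIV. (mat 1 + E) $ e $ c *s \<tau>1 e)" for c
  have d_angle: "slot (Inr i) \<noteq> ?d" for i using p by simp
  have \<tau>1': "\<tau>1' c = \<tau>1 c + (\<Sum>i\<in>UNIV. E $ slot (Inr i) $ c *s pd R1 (slot (Inr i)) (S z0))" for c
  proof -
    have "\<tau>1' c = (\<Sum>e\<in>UNIV. (if e = c then \<tau>1 e else 0) + E $ e $ c *s \<tau>1 e)"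
      unfolding \<tau>1'_def by (rule sum.cong) (auto simp: mat_def vector_sadd_rdistrib)
    also have "\<dots> = \<tau>1 c + (\<Sum>e\<in>UNIV. E $ e $ c *s \<tau>1 e)" by (simp add: sum.distrib)
    also have "(\<Sum>e\<in>UNIV. E $ e $ c *s \<tau>1 e) = (\<Sum>i\<in>UNIV. E $ slot (Inr i) $ c *s \<tau>1 (slot (Inr i)))"
      unfolding sum_slots by (simp add: E_def)
    finally show ?thesis using d_angle by (simp add: \<tau>1_def)
  qed
  have fa: "field_at x (act ?h ?w) = act ?h (field_at x ?w)"
    by (rule field_at_act[OF ct[OF V(2)] x])
  have sc: "t *\<^sub>R v = of_real t *s v" for t :: real and v :: "complex ^ 'r"
    by (simp add: vec_eq_iff scaleR_conv_of_real[where 'a = complex])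
  have cols: "((\<lambda>c. pd R2 c z0)(?d := field_at x (R2 z0))) c = act ?h (\<tau>1' c + act (\<xi> c) ?w)" for c
  proof (cases "c = ?d")
    case True
    then show ?thesis unfolding \<tau>1' by (simp add: E_def \<xi>_def rel[OF V(2)] fa \<tau>1_def vec_eq_iff)
  next
    case False
    have "pd R2 c z0 = act ?h (D1 (axis c 1 - (\<Sum>i\<in>UNIV. B' i (axis c 1) *\<^sub>R axis (slot (Inr i)) 1))) + act (h' (axis c 1)) ?w"
      unfolding pd_def frechet_derivative_at[OF R2, symmetric] ..
    also have "D1 (axis c 1 - (\<Sum>i\<in>UNIV. B' i (axis c 1) *\<^sub>R axis (slot (Inr i)) 1)) =
        pd R1 c (S z0) - (\<Sum>i\<in>UNIV. pd (B i) c z0 *\<^sub>R pd R1 (slot (Inr i)) (S z0))"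
      using lin1 by (simp add: linear_diff linear_sum linear_cmul pd_def D1_def B'_def)
    also have "\<dots> = \<tau>1' c"
      unfolding \<tau>1' sc using False by (simp add: E_def \<tau>1_def sum_negf vec_eq_iff)
    also have "act (h' (axis c 1)) ?w = act ?h (act (\<xi> c) ?w)"
      using False nz by (simp add: \<xi>_def vec_eq_iff pd_def h'_def)
    finally show ?thesis using False by (simp add: vec_eq_iff algebra_simps)
  qed
  have vert: "(\<Sum>j\<in>UNIV. of_int (pairing m (\<rho> j)) * \<xi> c $ j) = 0" for c m
    using class_torus_tangent[OF V h' ct, of m "axis c 1"] by (simp add: \<xi>_def pd_def h'_def)
  \<comment> \<open>As the shifts do not vary with the angles, the nonzero entries of
    \<open>E\<close> lie in angle rows and outside the angle columns.\<close>
  have det: "det (mat 1 + E) = 1"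
  proof (rule det_unipotent[where P = "range (\<lambda>i. slot (Inr i))"])
    fix e c assume "E $ e $ c \<noteq> 0"
    then show "e \<in> range (\<lambda>i. slot (Inr i)) \<and> c \<notin> range (\<lambda>i. slot (Inr i))"
      by (cases e rule: slot_cases) (auto simp: E_def B_angle split: if_splits)
  qed
  have "face_form \<rho> a b x R2 z0 = period_form \<rho> a b (act ?h ?w) (\<lambda>c. act ?h (\<tau>1' c + act (\<xi> c) ?w))"
    unfolding face_form_def cols[abs_def, symmetric] by (simp only: rel[OF V(2)])
  also have "\<dots> = period_form \<rho> a b ?w (\<lambda>c. \<tau>1' c + act (\<xi> c) ?w)"
    by (rule period_form_act[OF ct[OF V(2)] a])
  also have "\<dots> = period_form \<rho> a b ?w \<tau>1"
    unfolding period_form_def euler_form_vertical[OF vert] unfolding \<tau>1'_def[abs_def] euler_form_matrix det by simp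
  also have "\<dots> = face_form \<rho> a b x R1 (S z0)" by (simp add: face_form_def \<tau>1_def)
  finally show ?thesis .
qed

end

text \<open>Away from zeros of \<open>w\<close> a coordinate of \<open>h\<close> is a quotient of
  coordinates. At a zero it is recovered from the relation of the class torus for the dual vector
  \<open>M j\<close>, which involves no other index of \<open>J\<close>.\<close>

lemma class_torus_ratio:
  fixes \<rho> :: "'r::finite \<Rightarrow> int ^ 'd::finite"
  assumes h: "h \<in> class_torus \<rho>" and w: "\<And>l. l \<notin> J \<Longrightarrow> w $ l \<noteq> 0"
    and M: "\<And>j l. l \<in> J \<Longrightarrow> pairing (M j) (\<rho> l) = (if l = j then 1 else 0)"
  shows "h $ j = (if j \<in> J then \<Prod>l\<in>- J. (act h w $ l / w $ l) powi (- pairing (M j) (\<rho> l)) else act h w $ j / w $ j)"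
proof (cases "j \<in> J")
  case False
  then show ?thesis using w by simp
next
  case True
  let ?k = "\<lambda>l. pairing (M j) (\<rho> l)"
  have nz: "h $ l \<noteq> 0" for l using h by (simp add: class_torus_def)
  have "1 = (\<Prod>l\<in>UNIV. h $ l powi ?k l)" using h by (simp add: class_torus_def)
  also have "\<dots> = (\<Prod>l\<in>J. h $ l powi ?k l) * (\<Prod>l\<in>- J. h $ l powi ?k l)"
    by (subst prod.union_disjoint[symmetric]) (auto simp: Compl_partition)
  also have "(\<Prod>l\<in>J. h $ l powi ?k l) = (\<Prod>l\<in>J. if l = j then h $ j else 1)"
    by (rule prod.cong) (auto simp: M)
  also have "\<dots> = h $ j" using True by simp
  finally have "h $ j = 1 / (\<Prod>l\<in>- J. h $ l powi ?k l)"
    using nz by (simp add: field_simps)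
  also have "\<dots> = (\<Prod>l\<in>- J. (act h w $ l / w $ l) powi (- ?k l))"
    unfolding prod_dividef[of "\<lambda>_. 1", simplified, symmetric]
  proof (rule prod.cong[OF refl])
    fix l assume "l \<in> - J"
    then have "act h w $ l / w $ l = h $ l" using w by simp
    then show "1 / h $ l powi ?k l = (act h w $ l / w $ l) powi (- ?k l)"
      by (simp only: power_int_minus inverse_eq_divide)
  qed
  finally show ?thesis using True by simp
qed

lemma differentiable_vec_lambda:
  fixes f :: "'a::real_normed_vector \<Rightarrow> 'r::finite \<Rightarrow> complex"
  assumes "\<And>j. (\<lambda>z. f z j) differentiable (at z0 within D)"
  shows "(\<lambda>z. \<chi> j. f z j) differentiable (at z0 within D)"
proof -
  have bl: "bounded_linear (axis j :: complex \<Rightarrow> complex ^ 'r)" for j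
    unfolding linear_conv_bounded_linear[symmetric] by (intro linearI) (auto simp: axis_def vec_eq_iff)
  have "(\<lambda>z. \<Sum>j\<in>UNIV. axis j (f z j)) differentiable (at z0 within D)"
  proof (intro differentiable_sum ballI)
    show "(\<lambda>z. axis j (f z j)) differentiable (at z0 within D)" for j
      using assms[of j] bounded_linear.has_derivative[OF bl] unfolding differentiable_def by blast
  qed simp
  moreover have "(\<Sum>j\<in>UNIV. axis j (f z j)) = (\<chi> j. f z j)" for z
    by (simp add: vec_eq_iff axis_def)
  ultimately show ?thesis by simp
qed

lemma differentiable_nth:
  fixes f :: "'a::real_normed_vector \<Rightarrow> ('b::real_normed_vector) ^ 'r::finite"
  shows "f differentiable (at z0 within D) \<Longrightarrow> (\<lambda>z. f z $ j) differentiable (at z0 within D)"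
  unfolding differentiable_def using bounded_linear.has_derivative[OF bounded_linear_vec_nth] by blast

lemma differentiable_prod:
  fixes f :: "'i \<Rightarrow> 'a::real_normed_vector \<Rightarrow> complex"
  assumes "\<And>i. i \<in> I \<Longrightarrow> f i differentiable (at z0 within D)"
  shows "(\<lambda>z. \<Prod>i\<in>I. f i z) differentiable (at z0 within D)"
  using assms by (induction I rule: infinite_finite_induct) auto

text \<open>The formula of \<open>class_torus_ratio\<close> is used with the zero set of
  \<open>y1 z0\<close>. Near \<open>z0\<close> no further coordinate vanishes, so the formula stays
  valid and exhibits \<open>h\<close> through quotients and products of differentiable
  functions.\<close>

lemma class_torus_differentiable:
  fixes \<rho> :: "'r::finite \<Rightarrow> int ^ 'd::finite" and y1 y2 h :: "'a::real_normed_vector \<Rightarrow> complex ^ 'r"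
  assumes z0: "z0 \<in> D" and y: "y1 differentiable (at z0 within D)" "y2 differentiable (at z0 within D)"
    and h: "\<And>z. z \<in> D \<Longrightarrow> h z \<in> class_torus \<rho>" "\<And>z. z \<in> D \<Longrightarrow> y2 z = act (h z) (y1 z)"
    and M: "\<And>j l. y1 z0 $ l = 0 \<Longrightarrow> pairing (M j) (\<rho> l) = (if l = j then 1 else 0)"
  shows "h differentiable (at z0 within D)"
proof -
  let ?J = "{l. y1 z0 $ l = 0}"
  let ?h = "\<lambda>z. \<chi> j. if j \<in> ?J then \<Prod>l\<in>- ?J. (y2 z $ l / y1 z $ l) powi (- pairing (M j) (\<rho> l)) else y2 z $ j / y1 z $ j"
  have eq: "h z = ?h z" if z: "z \<in> D" "\<And>l. l \<notin> ?J \<Longrightarrow> y1 z $ l \<noteq> 0" for z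
  proof -
    have "h z $ j = ?h z $ j" for j
      unfolding h(2)[OF z(1)] vec_lambda_beta
      by (rule class_torus_ratio[OF h(1)[OF z(1)] z(2)]) (use M in auto)
    then show ?thesis by (simp only: vec_eq_iff) blast
  qed
  have ratio: "y2 z0 $ l / y1 z0 $ l \<noteq> 0" if "l \<notin> ?J" for l
    using that h(1)[OF z0] by (simp add: h(2)[OF z0] class_torus_def)
  have "?h differentiable (at z0 within D)"
  proof (rule differentiable_vec_lambda)
    have q: "(\<lambda>z. y2 z $ l / y1 z $ l) differentiable (at z0 within D)" if "l \<notin> ?J" for l
      using that by (intro differentiable_divide differentiable_nth y) simp
    show "(\<lambda>z. if j \<in> ?J then \<Prod>l\<in>- ?J. (y2 z $ l / y1 z $ l) powi (- pairing (M j) (\<rho> l)) else y2 z $ j / y1 z $ j) differentiable (at z0 within D)" for j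
    proof (cases "j \<in> ?J")
      case True
      have "(\<lambda>z. \<Prod>l\<in>- ?J. (y2 z $ l / y1 z $ l) powi (- pairing (M j) (\<rho> l))) differentiable (at z0 within D)"
        by (intro differentiable_prod differentiable_power_int q ratio) auto
      then show ?thesis using True by simp
    next
      case False
      then show ?thesis using q[OF False] by simp
    qed
  qed
  then obtain h' where h': "(?h has_derivative h') (at z0 within D)" unfolding differentiable_def by blast
  have "\<forall>\<^sub>F z in at z0 within D. \<forall>l\<in>- ?J. y1 z $ l \<noteq> 0"
  proof (subst eventually_ball_finite_distrib, simp, intro ballI)
    fix l assume "l \<in> - ?J"
    moreover have "((\<lambda>z. y1 z $ l) \<longlongrightarrow> y1 z0 $ l) (at z0 within D)"
      using differentiable_imp_continuous_within[OF y(1)] unfolding continuous_within by (rule tendsto_vec_nth)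
    ultimately show "\<forall>\<^sub>F z in at z0 within D. y1 z $ l \<noteq> 0"
      by (intro tendsto_imp_eventually_ne) auto
  qed
  moreover have "\<forall>\<^sub>F z in at z0 within D. z \<in> D" by (auto simp: eventually_at_filter)
  ultimately have "\<forall>\<^sub>F z in at z0 within D. ?h z = h z"
    by eventually_elim (use eq in auto)
  moreover have "?h z0 = h z0" by (rule eq[symmetric, OF z0]) simp
  ultimately have "(h has_derivative h') (at z0 within D)"
    using has_derivative_transform_eventually[OF h' _ _ z0] by blast
  then show ?thesis unfolding differentiable_def by blast
qed

lemma frechet_derivative_translate:
  fixes T :: "'a::real_normed_vector \<Rightarrow> 'b::real_normed_vector"
  assumes per: "\<And>z. T (z + e) = T z" and T: "T differentiable (at (z + e))"
  shows "frechet_derivative T (at (z + e)) = frechet_derivative T (at z)"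
proof -
  have "(T has_derivative frechet_derivative T (at (z + e))) (at (z + e))"
    using T by (simp add: frechet_derivative_works)
  from has_derivative_compose[OF has_derivative_add_const[OF has_derivative_ident] this]
  have "((\<lambda>z. T (z + e)) has_derivative frechet_derivative T (at (z + e))) (at z)" by simp
  then show ?thesis unfolding per by (rule frechet_derivative_at)
qed

section \<open>Tubes over smooth cycles\<close>

text \<open>The tubular neighbourhood belongs to the fixed coefficients \<open>b0\<close>; the forms
  are evaluated on the same tubes for other coefficients \<open>b\<close> as well.\<close>

locale tube_bundle = tube_slots p slot for p and slot :: "nat + 's::finite \<Rightarrow> 'd::finite" +
  fixes K :: "'r::finite set set" and \<rho> :: "'r \<Rightarrow> int ^ 'd" and a :: "'s \<Rightarrow> 'r \<Rightarrow> int" and b0 :: "('s, 'd) idx \<Rightarrow> complex"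
    and \<Phi> :: "(complex ^ 'r) \<times> (complex ^ 's) \<Rightarrow> complex ^ 'r" and rad :: "complex ^ 'r \<Rightarrow> real ^ 's"
  assumes tub: "tubular_nbhd K \<rho> a b0 \<Phi> rad"
begin

text \<open>The tube in ordered coordinates. For \<open>q = p - 1\<close> it is a tube over a face
  and does not depend on slot \<open>p\<close>.\<close>

definition tube :: "((nat \<Rightarrow> real) \<Rightarrow> complex ^ 'r) \<Rightarrow> nat \<Rightarrow> real ^ 'd \<Rightarrow> complex ^ 'r" where
  "tube g q z = (let w = g (ord_point q z) in \<Phi> (w, \<chi> i. of_real (rad w $ i) * cis (2 * pi * z $ slot (Inr i))))"

text \<open>Stokes' theorem consumes two derivatives: one forms the columns, the other
  differentiates them.\<close>

definition smooth_lift :: "nat \<Rightarrow> ((nat \<Rightarrow> real) \<Rightarrow> complex ^ 'r) \<Rightarrow> bool" where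
  "smooth_lift q g \<longleftrightarrow> g ` standard_simplex q \<subseteq> zero_locus K \<rho> a b0 \<and>
     (\<exists>W. open W \<and> ord_cell q \<subseteq> W \<and> k_smooth_on (Suc (Suc 0)) W (\<lambda>z. g (ord_point q z)))"

lemma disc_bundle_circle:
  assumes "w \<in> zero_locus K \<rho> a b0" "\<And>i. norm (u i) = 1"
  shows "(w, \<chi> i. of_real (rad w $ i) * u i) \<in> disc_bundle K \<rho> a b0 rad"
proof -
  have "rad w $ i > 0" for i using tub assms(1) unfolding tubular_nbhd_def by blast
  then show ?thesis using assms by (simp add: disc_bundle_def norm_mult less_imp_le)
qed

text \<open>On the tube the sections for \<open>b0\<close> coincide with the normal coordinates,
  whose moduli are the positive radii.\<close>

lemma tube_in_cox_open:
  assumes "g (ord_point q z) \<in> zero_locus K \<rho> a b0"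
  shows "tube g q z \<in> cox_open K"
    and "cox_section \<rho> a b0 i (tube g q z) \<noteq> 0"
proof -
  let ?w = "g (ord_point q z)" and ?v = "\<chi> i. of_real (rad (g (ord_point q z)) $ i) * cis (2 * pi * z $ slot (Inr i))"
  have d: "(?w, ?v) \<in> disc_bundle K \<rho> a b0 rad" by (rule disc_bundle_circle[OF assms]) simp
  have *: "\<Phi> (?w, ?v) \<in> cox_open K \<and> (\<forall>i. cox_section \<rho> a b0 i (\<Phi> (?w, ?v)) = ?v $ i)"
    using tub d unfolding tubular_nbhd_def by blast
  have "rad ?w $ i > 0" using tub assms unfolding tubular_nbhd_def by blast
  then have "?v $ i \<noteq> 0" by simp
  with * show "tube g q z \<in> cox_open K" "cox_section \<rho> a b0 i (tube g q z) \<noteq> 0"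
    unfolding tube_def Let_def by metis+
qed

lemma ord_point_cong:
  "(\<And>l. 1 \<le> l \<Longrightarrow> l \<le> q \<Longrightarrow> z $ slot (Inl l) = z' $ slot (Inl l)) \<Longrightarrow> ord_point q z = ord_point q z'"
  by (auto simp: ord_point_def ord_coord_def fun_eq_iff)

text \<open>Equivariance of the tubular neighbourhood multiplies the normal coordinates by the
  bundle characters. The moduli are absorbed by the equivariance of \<open>rad\<close>, the
  arguments by a shift of the angles.\<close>

lemma tube_transport:
  assumes w: "g1 (ord_point q z) \<in> zero_locus K \<rho> a b0" and h: "h \<in> class_torus \<rho>"
    and g2: "g2 (ord_point q z) = act h (g1 (ord_point q z))"
    and B: "\<And>i. bundle_char (a i) h = of_real (norm (bundle_char (a i) h)) * cis (2 * pi * B i)"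
    and q: "q \<le> p"
  shows "tube g2 q z = act h (tube g1 q (z - (\<Sum>i\<in>UNIV. B i *\<^sub>R axis (slot (Inr i)) 1)))"
proof -
  let ?S = "z - (\<Sum>i\<in>UNIV. B i *\<^sub>R axis (slot (Inr i)) 1)" and ?w = "g1 (ord_point q z)"
  have SInl: "?S $ slot (Inl l) = z $ slot (Inl l)" if "1 \<le> l" "l \<le> p" for l
    using that by (simp add: axis_def)
  have SInr: "?S $ slot (Inr i) = z $ slot (Inr i) - B i" for i
    by (simp add: axis_def if_distrib[of "\<lambda>t. _ * t"] cong: if_cong)
  have op: "ord_point q ?S = ord_point q z"
    by (rule ord_point_cong) (use SInl q in auto)
  let ?v = "\<chi> i. of_real (rad ?w $ i) * cis (2 * pi * ?S $ slot (Inr i))"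
  have "(?w, ?v) \<in> disc_bundle K \<rho> a b0 rad" by (rule disc_bundle_circle[OF w]) simp
  then have eqv: "\<Phi> (act h ?w, \<chi> i. bundle_char (a i) h * ?v $ i) = act h (\<Phi> (?w, ?v))"
    using tub h unfolding tubular_nbhd_def by blast
  have rad: "rad (act h ?w) $ i = norm (bundle_char (a i) h) * rad ?w $ i" for i
    using tub h w unfolding tubular_nbhd_def by blast
  have "bundle_char (a i) h * ?v $ i = of_real (rad (act h ?w) $ i) * cis (2 * pi * z $ slot (Inr i))" for i
  proof -
    have "bundle_char (a i) h * ?v $ i = of_real (rad (act h ?w) $ i) * (cis (2 * pi * B i) * cis (2 * pi * ?S $ slot (Inr i)))"
      by (subst B) (simp add: rad)
    also have "cis (2 * pi * B i) * cis (2 * pi * ?S $ slot (Inr i)) = cis (2 * pi * z $ slot (Inr i))"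
      unfolding SInr cis_mult by (simp add: algebra_simps)
    finally show ?thesis .
  qed
  with eqv show ?thesis unfolding tube_def Let_def op g2 by simp
qed

end

context tube_bundle
begin

lemma k_smooth_on_preimage:
  fixes f :: "'b::euclidean_space \<Rightarrow> 'c::real_normed_vector" and g :: "'a::real_normed_vector \<Rightarrow> 'b"
  assumes "open W" "open U" "k_smooth_on m W g" "k_smooth_on m U f"
  shows "open {z \<in> W. g z \<in> U}" "k_smooth_on m {z \<in> W. g z \<in> U} g" "k_smooth_on m {z \<in> W. g z \<in> U} (\<lambda>z. f (g z))"
proof -
  have "{z \<in> W. g z \<in> U} = W \<inter> g -` U" by auto
  then show o: "open {z \<in> W. g z \<in> U}"
    using continuous_open_preimage[OF k_smooth_on_continuous[OF assms(3)] assms(1,2)] by simp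
  show g: "k_smooth_on m {z \<in> W. g z \<in> U} g" by (rule k_smooth_on_subset[OF assms(3)]) auto
  show "k_smooth_on m {z \<in> W. g z \<in> U} (\<lambda>z. f (g z))"
    by (rule k_smooth_on_compose[OF o _ assms(4) g]) auto
qed

text \<open>An arbitrary parametrization \<open>y\<close> of points of the zero locus is allowed, so
  that the result serves ordered and barycentric coordinates alike.\<close>

lemma smooth_torus_bundle:
  assumes W: "open W" "C \<subseteq> W" "k_smooth_on m W y" and zl: "y ` C \<subseteq> zero_locus K \<rho> a b0"
  shows "\<exists>W. open W \<and> C \<subseteq> W \<and>
    k_smooth_on m W (\<lambda>z. \<Phi> (y z, \<chi> i. of_real (rad (y z) $ i) * cis (2 * pi * z $ slot (Inr i))))"
proof -
  obtain U where U: "open U" "zero_locus K \<rho> a b0 \<subseteq> U" "k_smooth_on m U rad"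
    using tub unfolding tubular_nbhd_def smooth_near_def by blast
  obtain X where X: "open X" "disc_bundle K \<rho> a b0 rad \<subseteq> X" "k_smooth_on m X \<Phi>"
    using tub unfolding tubular_nbhd_def smooth_near_def by blast
  let ?v = "\<lambda>z. (\<chi> i. of_real (rad (y z) $ i) * cis (2 * pi * z $ slot (Inr i))) :: complex ^ 's"
  define W1 where "W1 = {z \<in> W. y z \<in> U}"
  note W1 = k_smooth_on_preimage[OF W(1) U(1) W(3) U(3), folded W1_def]
  have in_zl: "y z \<in> zero_locus K \<rho> a b0" if "z \<in> C" for z
    using that zl by blast
  have sv: "k_smooth_on m W1 ?v"
  proof -
    have bl: "bounded_linear (axis i :: complex \<Rightarrow> complex ^ 's)" for i
      unfolding linear_conv_bounded_linear[symmetric] by (intro linearI) (auto simp: axis_def vec_eq_iff)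
    have "k_smooth_on m W1 (\<lambda>z. \<Sum>i\<in>UNIV. axis i (rad (y z) $ i *\<^sub>R (1 * cis (2 * pi * z $ slot (Inr i)))) :: complex ^ 's)"
    proof (rule k_smooth_on_sum[OF W1(1)], rule k_smooth_on_bounded_linear[OF bl W1(1)], rule k_smooth_on_scaleR[OF W1(1)])
      show "k_smooth_on m W1 (\<lambda>z. rad (y z) $ i)" for i
        by (rule k_smooth_on_bounded_linear[OF bounded_linear_vec_nth W1(1) W1(3)])
      show "k_smooth_on m W1 (\<lambda>z. 1 * cis (2 * pi * z $ slot (Inr i)))" for i
        by (rule k_smooth_on_cis[OF W1(1)])
    qed
    moreover have "(\<Sum>i\<in>UNIV. axis i (rad (y z) $ i *\<^sub>R (1 * cis (2 * pi * z $ slot (Inr i)))) :: complex ^ 's) = ?v z" for z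
      by (simp add: vec_eq_iff axis_def scaleR_conv_of_real)
    ultimately show ?thesis by (simp only:)
  qed
  have bl1: "bounded_linear (\<lambda>x. (x, 0) :: (complex ^ 'r) \<times> (complex ^ 's))"
    and bl2: "bounded_linear (\<lambda>x. (0, x) :: (complex ^ 'r) \<times> (complex ^ 's))"
    unfolding linear_conv_bounded_linear[symmetric] by (auto intro!: linearI)
  have "k_smooth_on m W1 (\<lambda>z. (y z, 0) + (0, ?v z))"
    by (rule k_smooth_on_add[OF W1(1) k_smooth_on_bounded_linear[OF bl1 W1(1) W1(2)] k_smooth_on_bounded_linear[OF bl2 W1(1) sv]])
  then have pair: "k_smooth_on m W1 (\<lambda>z. (y z, ?v z))" by (simp only: add_Pair add_0_right add_0_left)
  define W2 where "W2 = {z \<in> W1. (y z, ?v z) \<in> X}"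
  note W2 = k_smooth_on_preimage[OF W1(1) X(1) pair X(3), folded W2_def]
  have "C \<subseteq> W2"
  proof
    fix z assume z: "z \<in> C"
    have "(y z, ?v z) \<in> disc_bundle K \<rho> a b0 rad" by (rule disc_bundle_circle[OF in_zl[OF z]]) simp
    then show "z \<in> W2" using z in_zl[OF z] W(2) U(2) X(2) by (auto simp: W1_def W2_def)
  qed
  then show ?thesis using W2(1,3) by blast
qed

lemma smooth_tube:
  assumes "smooth_lift q g"
  shows "\<exists>W. open W \<and> ord_cell q \<subseteq> W \<and> k_smooth_on (Suc (Suc 0)) W (tube g q)"
proof -
  obtain W where zl: "g ` standard_simplex q \<subseteq> zero_locus K \<rho> a b0"
    and W: "open W" "ord_cell q \<subseteq> W" "k_smooth_on (Suc (Suc 0)) W (\<lambda>z. g (ord_point q z))"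
    using assms unfolding smooth_lift_def by blast
  have "(\<lambda>z. g (ord_point q z)) ` ord_cell q \<subseteq> zero_locus K \<rho> a b0"
    using zl ord_point_in_simplex by blast
  from smooth_torus_bundle[OF W this] show ?thesis by (simp only: tube_def[abs_def] Let_def)
qed

lemma ord_cell_angle: "z \<in> ord_cell q \<Longrightarrow> q \<le> p \<Longrightarrow> 0 \<le> t \<Longrightarrow> t \<le> 1 \<Longrightarrow> upd z (slot (Inr i)) t \<in> ord_cell q"
proof -
  assume z: "z \<in> ord_cell q" "q \<le> p" and t: "0 \<le> t" "t \<le> 1"
  have c: "slot (Inl l) \<noteq> slot (Inr i)" if "1 \<le> l" "l \<le> q" for l using that z(2) by simp
  have "upd z (slot (Inr i)) (z $ slot (Inr i)) \<in> ord_cell q" using z by simp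
  then have "upd z (slot (Inr i)) 0 \<in> ord_cell q" using ord_cell_upd[of q "slot (Inr i)", OF c] by blast
  then show ?thesis using ord_cell_upd[of q "slot (Inr i)", OF c] t by blast
qed

lemma tube_add_angle:
  assumes "q \<le> p"
  shows "tube g q (z + axis (slot (Inr i)) 1) = tube g q z"
proof -
  have "ord_point q (z + axis (slot (Inr i)) 1) = ord_point q z"
    by (rule ord_point_cong) (use assms in \<open>auto simp: axis_def\<close>)
  moreover have "cis (2 * pi * (z + axis (slot (Inr i)) 1) $ slot (Inr i')) = cis (2 * pi * z $ slot (Inr i'))" for i'
    by (cases "i' = i") (simp_all add: axis_def distrib_left cis_mult[symmetric])
  ultimately show ?thesis by (simp add: tube_def Let_def)
qed

lemma tube_periodic:
  assumes g: "smooth_lift q g" and q: "q \<le> p" and z: "z \<in> ord_cell q"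
  shows "tube g q (upd z (slot (Inr i)) 1) = tube g q (upd z (slot (Inr i)) 0)"
    and "pd (tube g q) c (upd z (slot (Inr i)) 1) = pd (tube g q) c (upd z (slot (Inr i)) 0)"
proof -
  have e: "upd z (slot (Inr i)) 1 = upd z (slot (Inr i)) 0 + axis (slot (Inr i)) 1"
    by (simp add: vec_eq_iff axis_def)
  show "tube g q (upd z (slot (Inr i)) 1) = tube g q (upd z (slot (Inr i)) 0)"
    unfolding e by (rule tube_add_angle[OF q])
  obtain W where W: "ord_cell q \<subseteq> W" "k_smooth_on (Suc (Suc 0)) W (tube g q)"
    using smooth_tube[OF g] by blast
  have "upd z (slot (Inr i)) 1 \<in> W" using ord_cell_angle[OF z q] W(1) by auto
  then have "tube g q differentiable (at (upd z (slot (Inr i)) 1))" using W(2) by simp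
  then show "pd (tube g q) c (upd z (slot (Inr i)) 1) = pd (tube g q) c (upd z (slot (Inr i)) 0)"
    unfolding pd_def e by (subst frechet_derivative_translate[where T = "tube g q", OF tube_add_angle[OF q]]) auto
qed

lemma continuous_on_face_form:
  assumes "smooth_lift q g" "\<And>z i. z \<in> ord_cell q \<Longrightarrow> cox_section \<rho> a b i (tube g q z) \<noteq> 0"
  shows "continuous_on (ord_cell q) (face_form \<rho> a b x (tube g q))"
proof -
  obtain W where W: "ord_cell q \<subseteq> W" "k_smooth_on (Suc (Suc 0)) W (tube g q)"
    using smooth_tube[OF assms(1)] by blast
  show ?thesis
    unfolding face_form_def[abs_def]
    by (rule continuous_on_contraction[OF W(1) k_smooth_on_SucD[OF W(2)] assms(2)])
qed

text \<open>Points of the same orbit differ by a factor \<open>h\<close> in the class torus, and by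
  \<open>tube_transport\<close> the tubes then differ by \<open>h\<close> and a shift of angles
  modulo 1. The shift \<open>A\<close> used in the integral is only measurable; for the equality of
  the forms at an interior point, a differentiable branch \<open>B\<close> of the same argument
  replaces it nearby.\<close>

lemma face_integral_eq:
  fixes b :: "('s, 'd) idx \<Rightarrow> complex"
  assumes p: "1 \<le> p" and g1: "smooth_lift (p - 1) g1" and g2: "smooth_lift (p - 1) g2"
    and orb: "\<And>y. y \<in> standard_simplex (p - 1) \<Longrightarrow> orbit \<rho> (g1 y) = orbit \<rho> (g2 y)"
    and dual: "\<And>J j. J \<in> K \<Longrightarrow> \<exists>m. \<forall>l\<in>J. pairing m (\<rho> l) = (if l = j then 1 else 0)"
    and nz1: "\<And>z i. z \<in> ord_cell (p - 1) \<Longrightarrow> cox_section \<rho> a b i (tube g1 (p - 1) z) \<noteq> 0"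
    and nz2: "\<And>z i. z \<in> ord_cell (p - 1) \<Longrightarrow> cox_section \<rho> a b i (tube g2 (p - 1) z) \<noteq> 0"
    and a: "\<And>j. (\<Sum>i\<in>UNIV. a i j) = 1" and x: "graded_field \<rho> x"
  shows "integral (ord_cell (p - 1)) (face_form \<rho> a b x (tube g1 (p - 1))) =
    integral (ord_cell (p - 1)) (face_form \<rho> a b x (tube g2 (p - 1)))"
proof -
  define q where "q = p - 1"
  have q: "q \<le> p" by (simp add: q_def)
  let ?D = "ord_cell q"
  obtain W where W: "open W" "?D \<subseteq> W" "k_smooth_on (Suc (Suc 0)) W (\<lambda>z. g1 (ord_point q z))"
      and zl: "g1 ` standard_simplex q \<subseteq> zero_locus K \<rho> a b0"
    using g1 unfolding smooth_lift_def q_def by blast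
  obtain W' where W': "open W'" "?D \<subseteq> W'" "k_smooth_on (Suc (Suc 0)) W' (\<lambda>z. g2 (ord_point q z))"
    using g2 unfolding smooth_lift_def q_def by blast
  have zl': "g1 (ord_point q z) \<in> zero_locus K \<rho> a b0" if "z \<in> ?D" for z
    using ord_point_in_simplex[OF that] zl by blast
  obtain X where X: "?D \<subseteq> X" "k_smooth_on (Suc (Suc 0)) X (tube g1 q)"
    using smooth_tube[OF g1] unfolding q_def by blast
  have "\<exists>h. h \<in> class_torus \<rho> \<and> g2 y = act h (g1 y)" if "y \<in> standard_simplex q" for y
  proof -
    have "(\<chi> j. 1) \<in> class_torus \<rho>" by (simp add: class_torus_def)
    moreover have "act (\<chi> j. 1) (g2 y) = g2 y" by (simp add: vec_eq_iff)
    ultimately have "g2 y \<in> orbit \<rho> (g2 y)" unfolding orbit_def by (metis imageI)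
    then have "g2 y \<in> orbit \<rho> (g1 y)" unfolding orb[OF that[unfolded q_def]] .
    then show ?thesis unfolding orbit_def by blast
  qed
  then obtain H where H: "\<And>y. y \<in> standard_simplex q \<Longrightarrow> H y \<in> class_torus \<rho> \<and> g2 y = act (H y) (g1 y)"
    by metis
  define h where "h z = H (ord_point q z)" for z
  have ct: "h z \<in> class_torus \<rho>" and rel: "g2 (ord_point q z) = act (h z) (g1 (ord_point q z))" if "z \<in> ?D" for z
    using H[OF ord_point_in_simplex[OF that]] by (simp_all add: h_def)
  have h_cong: "h z = h z'" if "\<And>l. 1 \<le> l \<Longrightarrow> l \<le> q \<Longrightarrow> z $ slot (Inl l) = z' $ slot (Inl l)" for z z'
    unfolding h_def by (subst ord_point_cong[OF that]) auto
  \<comment> \<open>The vanishing coordinates of the lift at a point form a cone of the fan, whose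
    dual vectors allow solving for \<open>h\<close>.\<close>
  have dh: "h differentiable (at z within ?D)" if z: "z \<in> ?D" for z
  proof -
    have "{l. g1 (ord_point q z) $ l = 0} \<in> K" using zl'[OF z] by (simp add: zero_locus_def cox_open_def)
    then have "\<exists>M. \<forall>j. \<forall>l\<in>{l. g1 (ord_point q z) $ l = 0}. pairing (M j) (\<rho> l) = (if l = j then 1 else 0)"
      using dual by (intro choice) blast
    then obtain M where M: "\<And>j l. g1 (ord_point q z) $ l = 0 \<Longrightarrow> pairing (M j) (\<rho> l) = (if l = j then 1 else 0)"
      by blast
    have d: "(\<lambda>z. g1 (ord_point q z)) differentiable (at z within ?D)" "(\<lambda>z. g2 (ord_point q z)) differentiable (at z within ?D)"
      using k_smooth_on_differentiable[OF W(3)] k_smooth_on_differentiable[OF W'(3)] z W(2) W'(2)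
      by (blast intro: differentiable_at_withinI)+
    show ?thesis by (rule class_torus_differentiable[OF z d ct rel M])
  qed
  let ?\<chi> = "\<lambda>i z. bundle_char (a i) (h z)"
  have \<chi>0: "?\<chi> i z \<noteq> 0" if "z \<in> ?D" for i z
    using ct[OF that] by (simp add: bundle_char_def class_torus_def)
  have d\<chi>: "?\<chi> i differentiable (at z within ?D)" if z: "z \<in> ?D" for i z
    unfolding bundle_char_def
    by (intro differentiable_prod differentiable_power_int differentiable_nth dh z)
      (use ct[OF z] in \<open>simp add: class_torus_def\<close>)
  let ?C = "range (\<lambda>i. slot (Inr i))"
  \<comment> \<open>Setting the angles to 0 makes the shifts independent of them also outside the
    cell, as \<open>integral_eq_shift_coords\<close> demands.\<close>
  define flat where "flat z = (\<chi> c. if c \<in> ?C then 0 else z $ c)" for z :: "real ^ 'd"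
  have flat: "flat z \<in> ?D" if "z \<in> ?D" for z
    using that q by (auto simp: ord_cell_def flat_def image_iff)
  have h_flat: "h (flat z) = h z" for z
    by (rule h_cong) (use q in \<open>auto simp: flat_def image_iff\<close>)
  \<comment> \<open>The principal argument in units of a full turn. The indicator extends it to a
    measurable function on the whole space.\<close>
  define A where "A i z = Im (Ln (indicat_real ?D (flat z) *\<^sub>R ?\<chi> i (flat z))) / (2 * pi)" for i z
  have mA: "A i \<in> borel_measurable borel" for i
  proof -
    have "continuous_on ?D (?\<chi> i)"
      unfolding continuous_on_eq_continuous_within using differentiable_imp_continuous_within[OF d\<chi>] by blast
    then have m: "(\<lambda>z. indicat_real ?D z *\<^sub>R ?\<chi> i z) \<in> borel_measurable borel"
      by (intro borel_measurable_continuous_on_indicator borel_compact compact_ord_cell)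
    have "continuous_on UNIV flat"
      unfolding flat_def
    proof (rule continuous_on_vec_lambda)
      show "continuous_on UNIV (\<lambda>z::real ^ 'd. if c \<in> ?C then 0 else z $ c)" for c
        by (cases "c \<in> ?C") (simp_all add: continuous_on_component)
    qed
    then have "flat \<in> borel_measurable borel" by (rule borel_measurable_continuous_onI)
    from measurable_compose[OF measurable_compose[OF this m] Ln_measurable]
    have "(\<lambda>z. Ln (indicat_real ?D (flat z) *\<^sub>R ?\<chi> i (flat z))) \<in> borel_measurable borel" .
    then show ?thesis unfolding A_def[abs_def] by measurable
  qed
  have A: "?\<chi> i z = of_real (norm (?\<chi> i z)) * cis (2 * pi * A i z)" if z: "z \<in> ?D" for i z
  proof -
    have "A i z = Arg (?\<chi> i z) / (2 * pi)"
      using flat[OF z] \<chi>0[OF z] by (simp add: A_def h_flat Arg_eq_Im_Ln)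
    then show ?thesis using rcis_cmod_Arg[of "?\<chi> i z"] by (simp add: rcis_def cis_Arg_unique)
  qed
  define \<alpha> where "\<alpha> c = (case unslot c of Inl l \<Rightarrow> \<lambda>z. 0 | Inr i \<Rightarrow> A i)" for c
  have m\<alpha>: "\<alpha> c \<in> borel_measurable borel" for c
    by (cases c rule: slot_cases) (simp_all add: \<alpha>_def mA)
  have ind: "\<alpha> c u = \<alpha> c v" if "\<And>d. d \<notin> ?C \<Longrightarrow> u $ d = v $ d" for c u v
  proof -
    have "flat u = flat v" using that by (simp add: flat_def vec_eq_iff)
    then show ?thesis by (cases c rule: slot_cases) (simp_all add: \<alpha>_def A_def)
  qed
  let ?\<sigma> = "\<lambda>u. \<chi> c. if c \<in> ?C then frac (u $ c - \<alpha> c u) else u $ c"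
  have "integral ?D (face_form \<rho> a b x (tube g1 q)) = integral ?D (face_form \<rho> a b x (tube g2 q))"
  proof (rule integral_eq_shift_coords[where C = ?C and \<alpha> = \<alpha> and N = "frontier ?D"])
    show "compact ?D" by (rule compact_ord_cell)
    show "continuous_on ?D (face_form \<rho> a b x (tube g1 q))" "continuous_on ?D (face_form \<rho> a b x (tube g2 q))"
      unfolding q_def by (rule continuous_on_face_form, fact, fact)+
    show "\<alpha> c \<in> borel_measurable borel" for c by (rule m\<alpha>)
    show "\<alpha> c u = \<alpha> c v" if "\<And>d. d \<notin> ?C \<Longrightarrow> u $ d = v $ d" for c u v by (rule ind[OF that])
    show "negligible (frontier ?D)" by (rule negligible_convex_frontier[OF convex_ord_cell])
    show "upd u c t \<in> ?D \<longleftrightarrow> upd u c 0 \<in> ?D \<and> 0 \<le> t \<and> t \<le> 1" if "c \<in> ?C" for u c t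
      by (rule ord_cell_upd) (use that q in auto)
    fix z0 assume "z0 \<in> ?D - frontier ?D"
    then have z0: "z0 \<in> interior ?D" and z0D: "z0 \<in> ?D"
      using compact_imp_closed[OF compact_ord_cell] by (auto simp: frontier_def)
    show "?\<sigma> z0 \<in> ?D \<and> face_form \<rho> a b x (tube g1 q) (?\<sigma> z0) = face_form \<rho> a b x (tube g2 q) z0"
    proof
      show \<sigma>D: "?\<sigma> z0 \<in> ?D"
        using z0D q by (auto simp: ord_cell_def image_iff frac_lt_1 less_imp_le)
      \<comment> \<open>The displacement of angle \<open>i\<close> at \<open>z0\<close>: it differs
        from \<open>A i z0\<close> by an integer, which leaves the phase unchanged.\<close>
      define \<beta> where "\<beta> i = z0 $ slot (Inr i) - frac (z0 $ slot (Inr i) - A i z0)" for i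
      \<comment> \<open>The quotient inside \<open>Ln\<close> is 1 at \<open>z0\<close> and so lies
        off the branch cut, which makes this choice of the argument differentiable at
        \<open>z0\<close>. The constant \<beta> gives it the correct value there.\<close>
      define B where "B i z = \<beta> i + Im (Ln (?\<chi> i z / ?\<chi> i z0)) / (2 * pi)" for i z
      have B0: "B i z0 = \<beta> i" for i using \<chi>0[OF z0D] by (simp add: B_def)
      have S0: "z0 - (\<Sum>i\<in>UNIV. B i z0 *\<^sub>R axis (slot (Inr i)) 1) = ?\<sigma> z0"
      proof (rule vec_eq_slots)
        show "(z0 - (\<Sum>i\<in>UNIV. B i z0 *\<^sub>R axis (slot (Inr i)) 1)) $ slot (Inl l) = ?\<sigma> z0 $ slot (Inl l)" if "1 \<le> l" "l \<le> p" for l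
          using that by (simp add: axis_def image_iff)
        show "(z0 - (\<Sum>i\<in>UNIV. B i z0 *\<^sub>R axis (slot (Inr i)) 1)) $ slot (Inr i) = ?\<sigma> z0 $ slot (Inr i)" for i
          by (simp add: axis_def image_iff B0 \<beta>_def \<alpha>_def if_distrib[of "\<lambda>t. _ * t"] cong: if_cong)
      qed
      have int: "at z within ?D = at z" if "z \<in> interior ?D" for z by (rule at_within_interior[OF that])
      have d\<chi>': "?\<chi> i differentiable (at z0)" for i using d\<chi>[OF z0D] unfolding int[OF z0] .
      have dB: "B i differentiable (at z0)" for i
      proof -
        have "Ln differentiable (at (?\<chi> i z0 / ?\<chi> i z0))"
          using \<chi>0[OF z0D] has_field_derivative_Ln[of 1]
          unfolding differentiable_def has_field_derivative_def by auto
        moreover have "(\<lambda>z. ?\<chi> i z / ?\<chi> i z0) differentiable (at z0)"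
          by (intro differentiable_divide d\<chi>' differentiable_const \<chi>0[OF z0D])
        ultimately have "(\<lambda>z. Ln (?\<chi> i z / ?\<chi> i z0)) differentiable (at z0)"
          by (rule differentiable_compose)
        then have "(\<lambda>z. Im (Ln (?\<chi> i z / ?\<chi> i z0))) differentiable (at z0)"
          using bounded_linear.has_derivative[OF bounded_linear_Im] unfolding differentiable_def by blast
        then show ?thesis unfolding B_def[abs_def] by (intro differentiable_add differentiable_divide differentiable_const) auto
      qed
      have Bcis: "?\<chi> i z = of_real (norm (?\<chi> i z)) * cis (2 * pi * B i z)" if z: "z \<in> interior ?D" for i z
      proof -
        have zD: "z \<in> ?D" using z interior_subset by blast
        let ?u = "?\<chi> i z / ?\<chi> i z0"
        have u: "?u \<noteq> 0" using \<chi>0[OF zD] \<chi>0[OF z0D] by simp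
        have "?u = of_real (norm ?u) * cis (Im (Ln ?u))"
          using rcis_cmod_Arg[of ?u] u by (simp add: rcis_def Arg_eq_Im_Ln)
        then have "?\<chi> i z = ?\<chi> i z0 * (of_real (norm ?u) * cis (Im (Ln ?u)))"
          using \<chi>0[OF z0D] by (metis nonzero_eq_divide_eq mult.commute)
        also have "\<dots> = (of_real (norm (?\<chi> i z0)) * cis (2 * pi * A i z0)) * (of_real (norm ?u) * cis (Im (Ln ?u)))"
          using A[OF z0D] by simp
        also have "\<dots> = of_real (norm (?\<chi> i z0) * norm ?u) * (cis (2 * pi * A i z0) * cis (Im (Ln ?u)))"
          by simp
        also have "norm (?\<chi> i z0) * norm ?u = norm (?\<chi> i z)"
          using \<chi>0[OF z0D] by (simp add: norm_divide)
        also have "cis (2 * pi * A i z0) = cis (2 * pi * \<beta> i)"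
        proof -
          have "\<beta> i = A i z0 + of_int \<lfloor>z0 $ slot (Inr i) - A i z0\<rfloor>" by (simp add: \<beta>_def frac_def)
          then have "2 * pi * \<beta> i = 2 * pi * A i z0 + 2 * pi * of_int \<lfloor>z0 $ slot (Inr i) - A i z0\<rfloor>"
            by (simp add: algebra_simps)
          then show ?thesis by (simp add: cis_mult[symmetric] cis_multiple_2pi)
        qed
        also have "cis (2 * pi * \<beta> i) * cis (Im (Ln ?u)) = cis (2 * pi * B i z)"
          by (simp add: cis_mult B_def algebra_simps)
        finally show ?thesis .
      qed
      have "face_form \<rho> a b x (tube g2 q) z0 = face_form \<rho> a b x (tube g1 q) (z0 - (\<Sum>i\<in>UNIV. B i z0 *\<^sub>R axis (slot (Inr i)) 1))"
      proof (rule face_form_transport[OF p open_interior z0 _ _ _ dB _ _ a x])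
        show "tube g1 q differentiable (at (z0 - (\<Sum>i\<in>UNIV. B i z0 *\<^sub>R axis (slot (Inr i)) 1)))"
          unfolding S0 using \<sigma>D X by (meson k_smooth_on_differentiable subsetD)
        show "h differentiable (at z0)" using dh[OF z0D] unfolding int[OF z0] .
        show "h z \<in> class_torus \<rho>" if "z \<in> interior ?D" for z using ct that interior_subset by blast
        show "tube g2 q z = act (h z) (tube g1 q (z - (\<Sum>i\<in>UNIV. B i z *\<^sub>R axis (slot (Inr i)) 1)))" if z: "z \<in> interior ?D" for z
        proof -
          have zD: "z \<in> ?D" using z interior_subset by blast
          show ?thesis by (rule tube_transport[where ?g1.0 = g1 and ?g2.0 = g2 and q = q and z = z and h = "h z" and B = "\<lambda>i. B i z", OF zl'[OF zD] ct[OF zD] rel[OF zD] Bcis[OF z] q])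
        qed
        show "pd (B i) (slot (Inr i')) z0 = 0" for i i'
          unfolding pd_def
        proof (rule frechet_derivative_eq_zero[OF dB])
          fix t :: real
          have "h (z0 + t *\<^sub>R axis (slot (Inr i')) 1) = h z0"
            by (rule h_cong) (use q in \<open>auto simp: axis_def\<close>)
          then show "B i (z0 + t *\<^sub>R axis (slot (Inr i')) 1) = B i z0" by (simp add: B_def)
        qed
      qed
      then show "face_form \<rho> a b x (tube g1 q) (?\<sigma> z0) = face_form \<rho> a b x (tube g2 q) z0" unfolding S0 by simp
    qed
  qed
  then show ?thesis by (simp add: q_def)
qed

end

context tube_slots
begin

lemma tube_cell_eq: "tube_cell p slot = diff_coords p ` ord_cell p"
proof
  show "diff_coords p ` ord_cell p \<subseteq> tube_cell p slot" using diff_coords_vimage_tube_cell by blast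
  show "tube_cell p slot \<subseteq> diff_coords p ` ord_cell p"
  proof
    fix u assume u: "u \<in> tube_cell p slot"
    let ?s = "simplex_point p slot u"
    \<comment> \<open>Ordered coordinates are the partial sums of the barycentric ones.\<close>
    define z where "z = (\<chi> c. case unslot c of Inl l \<Rightarrow> \<Sum>l'<l. ?s l' | Inr i \<Rightarrow> u $ c)"
    have zl: "z $ slot (Inl l) = (\<Sum>l'<l. ?s l')" if "1 \<le> l" "l \<le> p" for l
      using that by (simp add: z_def)
    have "(\<Sum>l\<le>p. ?s l) = ?s 0 + (\<Sum>l=1..p. ?s l)"
      by (simp add: sum.atMost_shift sum.atLeast1_atMost_eq)
    also have "(\<Sum>l=1..p. ?s l) = (\<Sum>l=1..p. u $ slot (Inl l))"
      by (rule sum.cong) (simp_all add: simplex_point_def)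
    finally have total: "(\<Sum>l<p. ?s l) + ?s p = 1"
      by (simp add: simplex_point_def lessThan_Suc_atMost[symmetric])
    have "diff_coords p z = u"
    proof (rule vec_eq_slots)
      show "diff_coords p z $ slot (Inl l) = u $ slot (Inl l)" if l: "1 \<le> l" "l \<le> p" for l
      proof (cases "l = p")
        case True
        then show ?thesis using l total by (simp add: diff_coords_Inl ord_coord_def zl simplex_point_def)
      next
        case False
        then have "diff_coords p z $ slot (Inl l) = ?s l"
          using l by (simp add: diff_coords_Inl ord_coord_def zl)
        then show ?thesis using l by (simp add: simplex_point_def)
      qed
      show "diff_coords p z $ slot (Inr i) = u $ slot (Inr i)" for i by (simp add: z_def)
    qed
    moreover from this u have "z \<in> ord_cell p" using diff_coords_vimage_tube_cell by blast
    ultimately show "u \<in> diff_coords p ` ord_cell p" by blast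
  qed
qed

lemma compact_tube_cell: "compact (tube_cell p slot)"
  unfolding tube_cell_eq by (rule compact_continuous_image[OF continuous_on_diff_coords compact_ord_cell])

end

section \<open>Cancellation of the faces of a cycle\<close>

text \<open>The linear extension of \<open>J\<close> to chains takes the value 0 on a zero boundary.
  Sorting the faces by the singular simplex \<open>\<psi>\<close> makes the coefficients of the
  boundary appear.\<close>

lemma chain_boundary_sum_zero:
  fixes \<gamma> :: "'a chain" and J :: "((nat \<Rightarrow> real) \<Rightarrow> 'a) \<Rightarrow> complex"
  assumes p: "1 \<le> p" and \<gamma>: "chain_boundary p \<gamma> = 0"
  shows "(\<Sum>\<phi>\<in>Poly_Mapping.keys \<gamma>. \<Sum>k\<le>p. of_int (Poly_Mapping.lookup \<gamma> \<phi>) * (- 1) ^ k * J (singular_face p k \<phi>)) = 0"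
proof -
  let ?K = "Poly_Mapping.keys \<gamma>" and ?s = "\<lambda>\<phi> k. singular_face p k \<phi>"
  let ?\<Psi> = "(\<lambda>(\<phi>, k). ?s \<phi> k) ` (?K \<times> {..p})"
  have coeff: "(\<Sum>\<phi>\<in>?K. \<Sum>k\<le>p. of_int (Poly_Mapping.lookup \<gamma> \<phi>) * (- 1) ^ k * (if \<psi> = ?s \<phi> k then 1 else 0)) = (0::complex)" for \<psi>
  proof -
    have "Poly_Mapping.lookup (chain_boundary p \<gamma>) \<psi> =
        (\<Sum>\<phi>\<in>?K. Poly_Mapping.lookup \<gamma> \<phi> * (\<Sum>k\<le>p. (- 1) ^ k * (if \<psi> = ?s \<phi> k then 1 else 0)))"
      using p by (simp add: chain_boundary_def frag_extend_def lookup_sum lookup_frag_cmul lookup_frag_of when_def)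
    then have "of_int (\<Sum>\<phi>\<in>?K. Poly_Mapping.lookup \<gamma> \<phi> * (\<Sum>k\<le>p. (- 1) ^ k * (if \<psi> = ?s \<phi> k then 1 else 0))) = (0::complex)"
      using \<gamma> by simp
    then show ?thesis
      by (simp add: sum_distrib_left mult.assoc if_distrib[of of_int] cong: if_cong)
  qed
  have "(\<Sum>\<phi>\<in>?K. \<Sum>k\<le>p. of_int (Poly_Mapping.lookup \<gamma> \<phi>) * (- 1) ^ k * J (?s \<phi> k)) =
      (\<Sum>\<phi>\<in>?K. \<Sum>k\<le>p. \<Sum>\<psi>\<in>?\<Psi>. of_int (Poly_Mapping.lookup \<gamma> \<phi>) * (- 1) ^ k * (if \<psi> = ?s \<phi> k then 1 else 0) * J \<psi>)"
  proof (intro sum.cong refl)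
    fix \<phi> k assume "\<phi> \<in> ?K" "k \<in> {..p}"
    then have "?s \<phi> k \<in> ?\<Psi>" by (intro image_eqI[of _ _ "(\<phi>, k)"]) auto
    then have "(\<Sum>\<psi>\<in>?\<Psi>. if \<psi> = ?s \<phi> k then J \<psi> else 0) = J (?s \<phi> k)"
      by (subst sum.delta) auto
    then have "of_int (Poly_Mapping.lookup \<gamma> \<phi>) * (- 1) ^ k * J (?s \<phi> k) =
        (\<Sum>\<psi>\<in>?\<Psi>. of_int (Poly_Mapping.lookup \<gamma> \<phi>) * (- 1) ^ k * (if \<psi> = ?s \<phi> k then J \<psi> else 0))"
      unfolding sum_distrib_left[symmetric] by simp
    also have "\<dots> = (\<Sum>\<psi>\<in>?\<Psi>. of_int (Poly_Mapping.lookup \<gamma> \<phi>) * (- 1) ^ k * (if \<psi> = ?s \<phi> k then 1 else 0) * J \<psi>)"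
      by (rule sum.cong) auto
    finally show "of_int (Poly_Mapping.lookup \<gamma> \<phi>) * (- 1) ^ k * J (?s \<phi> k) =
        (\<Sum>\<psi>\<in>?\<Psi>. of_int (Poly_Mapping.lookup \<gamma> \<phi>) * (- 1) ^ k * (if \<psi> = ?s \<phi> k then 1 else 0) * J \<psi>)" .
  qed
  also have "\<dots> = (\<Sum>\<phi>\<in>?K. \<Sum>\<psi>\<in>?\<Psi>. \<Sum>k\<le>p. of_int (Poly_Mapping.lookup \<gamma> \<phi>) * (- 1) ^ k * (if \<psi> = ?s \<phi> k then 1 else 0) * J \<psi>)"
    by (rule sum.cong[OF refl]) (rule sum.swap)
  also have "\<dots> = (\<Sum>\<psi>\<in>?\<Psi>. \<Sum>\<phi>\<in>?K. \<Sum>k\<le>p. of_int (Poly_Mapping.lookup \<gamma> \<phi>) * (- 1) ^ k * (if \<psi> = ?s \<phi> k then 1 else 0) * J \<psi>)"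
    by (rule sum.swap)
  also have "\<dots> = 0"
    unfolding sum_distrib_right[symmetric] coeff by simp
  finally show ?thesis .
qed

context tube_bundle
begin

lemma smooth_lift_simplex:
  assumes g: "smooth_near (tube_cell p slot) (\<lambda>u. g (simplex_point p slot u))"
    and zl: "g ` standard_simplex p \<subseteq> zero_locus K \<rho> a b0"
  shows "smooth_lift p g"
proof -
  obtain U where U: "open U" "tube_cell p slot \<subseteq> U" "k_smooth_on (Suc (Suc 0)) U (\<lambda>u. g (simplex_point p slot u))"
    using g unfolding smooth_near_def by blast
  let ?W = "{z \<in> UNIV. diff_coords p z \<in> U}"
  note W = k_smooth_on_preimage[OF open_UNIV U(1) k_smooth_on_real_affine[OF real_affine_diff_coords[of p] open_UNIV] U(3)]
  have "ord_cell p \<subseteq> ?W" using U(2) diff_coords_vimage_tube_cell by blast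
  then show ?thesis
    using zl W(1,3) unfolding smooth_lift_def simplex_point_diff_coords by blast
qed

lemma smooth_lift_face:
  assumes p: "1 \<le> p" "k \<le> p" and g: "smooth_lift p g"
  shows "smooth_lift (p - 1) (\<lambda>y. g (simplical_face k y))"
proof -
  obtain U where U: "open U" "ord_cell p \<subseteq> U" "k_smooth_on (Suc (Suc 0)) U (\<lambda>z. g (ord_point p z))"
    and zl: "g ` standard_simplex p \<subseteq> zero_locus K \<rho> a b0"
    using g unfolding smooth_lift_def by blast
  let ?W = "{z \<in> UNIV. face k z \<in> U}"
  note W = k_smooth_on_preimage[OF open_UNIV U(1) k_smooth_on_real_affine[OF real_affine_face[of k] open_UNIV] U(3)]
  have "ord_cell (p - 1) \<subseteq> ?W" using U(2) face_in_ord_cell by blast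
  moreover have "(\<lambda>y. g (simplical_face k y)) ` standard_simplex (p - 1) \<subseteq> zero_locus K \<rho> a b0"
    using zl simplical_face_in_standard_simplex[OF p] by (auto simp: image_subset_iff)
  ultimately show ?thesis
    using W(1,3) unfolding smooth_lift_def ord_point_face[OF p] by blast
qed

lemma tube_face:
  assumes "1 \<le> p" "k \<le> p"
  shows "tube (\<lambda>y. g (simplical_face k y)) (p - 1) = (\<lambda>z. tube g p (face k z))"
  by (simp add: fun_eq_iff tube_def Let_def ord_point_face[OF assms])

lemma tube_map_diff_coords: "tube_map p slot \<Phi> rad g (diff_coords p z) = tube g p z"
  by (simp add: tube_map_def tube_def Let_def simplex_point_diff_coords)

lemma smooth_tube_map:
  assumes g: "smooth_near (tube_cell p slot) (\<lambda>u. g (simplex_point p slot u))"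
    and zl: "g ` standard_simplex p \<subseteq> zero_locus K \<rho> a b0"
  shows "\<exists>W. open W \<and> tube_cell p slot \<subseteq> W \<and> k_smooth_on (Suc 0) W (tube_map p slot \<Phi> rad g)"
proof -
  obtain U where U: "open U" "tube_cell p slot \<subseteq> U" "k_smooth_on (Suc 0) U (\<lambda>u. g (simplex_point p slot u))"
    using g unfolding smooth_near_def by blast
  have "(\<lambda>u. g (simplex_point p slot u)) ` tube_cell p slot \<subseteq> zero_locus K \<rho> a b0"
    using zl by (auto simp: tube_cell_def)
  from smooth_torus_bundle[OF U this] show ?thesis by (simp only: tube_map_def[abs_def] Let_def)
qed

lemma tube_map_in_cox_open:
  assumes "g ` standard_simplex p \<subseteq> zero_locus K \<rho> a b0" "u \<in> tube_cell p slot"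
  shows "tube_map p slot \<Phi> rad g u \<in> cox_open K"
    and "cox_section \<rho> a b0 i (tube_map p slot \<Phi> rad g u) \<noteq> 0"
proof -
  have "\<exists>z\<in>ord_cell p. u = diff_coords p z"
    using assms(2) unfolding tube_cell_eq by blast
  then obtain z where z: "z \<in> ord_cell p" "u = diff_coords p z" by blast
  have "g (ord_point p z) \<in> zero_locus K \<rho> a b0" using ord_point_in_simplex[OF z(1)] assms(1) by blast
  then show "tube_map p slot \<Phi> rad g u \<in> cox_open K" "cox_section \<rho> a b0 i (tube_map p slot \<Phi> rad g u) \<noteq> 0"
    unfolding z(2) tube_map_diff_coords by (rule tube_in_cox_open)+
qed

text \<open>The integral is moved to ordered coordinates, where Stokes' theorem leaves the faces;
  the constant Jacobian stays in front.\<close>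

lemma integral_lie_form_tube:
  fixes b :: "('s, 'd) idx \<Rightarrow> complex"
  assumes g: "smooth_near (tube_cell p slot) (\<lambda>u. g (simplex_point p slot u))"
    and zl: "g ` standard_simplex p \<subseteq> zero_locus K \<rho> a b0"
    and nz: "\<And>u i. u \<in> tube_cell p slot \<Longrightarrow> cox_section \<rho> a b i (tube_map p slot \<Phi> rad g u) \<noteq> 0"
    and a: "\<And>j. (\<Sum>i\<in>UNIV. a i j) = 1" and x: "graded_field \<rho> x"
  shows "integral (tube_cell p slot) (\<lambda>u. lie_form \<rho> a b x (tube_map p slot \<Phi> rad g u) (\<lambda>c. pd (tube_map p slot \<Phi> rad g) c u)) =
    det diff_matrix * (if p = 0 then 0 else
      (\<Sum>k\<le>p. (- 1) ^ (p - k) * integral (ord_cell (p - 1)) (face_form \<rho> a b x (tube (\<lambda>y. g (simplical_face k y)) (p - 1)))))"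
proof -
  let ?C = "tube_cell p slot" and ?T = "tube_map p slot \<Phi> rad g"
  obtain W where W: "open W" "?C \<subseteq> W" "k_smooth_on (Suc 0) W ?T" using smooth_tube_map[OF g zl] by blast
  have sl: "smooth_lift p g" by (rule smooth_lift_simplex[OF g zl])
  obtain X where X: "open X" "ord_cell p \<subseteq> X" "k_smooth_on (Suc (Suc 0)) X (tube g p)" using smooth_tube[OF sl] by blast
  have cell: "diff_coords p z \<in> ?C" if "z \<in> ord_cell p" for z
    using that diff_coords_vimage_tube_cell by blast
  have nz': "cox_section \<rho> a b i (tube g p z) \<noteq> 0" if "z \<in> ord_cell p" for z i
    using nz[OF cell[OF that]] by (simp add: tube_map_diff_coords)
  have cT: "continuous_on ?C ?T" "continuous_on ?C (pd ?T c)" for c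
    using k_smooth_on_continuous[OF W(3)] k_smooth_on_continuous[OF k_smooth_on_pd[OF W(3)]] W(2)
    by (auto intro: continuous_on_subset)
  have "integral ?C (\<lambda>u. lie_form \<rho> a b x (?T u) (\<lambda>c. pd ?T c u)) =
      integral (ord_cell p) (\<lambda>z. lie_form \<rho> a b x (?T (diff_coords p z)) (\<lambda>c. pd ?T c (diff_coords p z)))"
    by (rule integral_tube_cell[OF compact_tube_cell]) (rule continuous_on_lie_form[OF cT nz])
  also have "\<dots> = integral (ord_cell p) (\<lambda>z. det diff_matrix * lie_form \<rho> a b x (tube g p z) (\<lambda>c. pd (tube g p) c z))"
  proof (rule integral_cong)
    fix z assume "z \<in> ord_cell p"
    then have "?T differentiable (at (diff_coords p z))" using cell W by (meson k_smooth_on_differentiable subsetD)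
    from lie_form_diff_coords[OF this]
    show "lie_form \<rho> a b x (?T (diff_coords p z)) (\<lambda>c. pd ?T c (diff_coords p z)) =
        det diff_matrix * lie_form \<rho> a b x (tube g p z) (\<lambda>c. pd (tube g p) c z)"
      by (simp only: tube_map_diff_coords)
  qed
  also have "\<dots> = det diff_matrix * integral (ord_cell p) (\<lambda>z. lie_form \<rho> a b x (tube g p z) (\<lambda>c. pd (tube g p) c z))"
    by simp
  also have "integral (ord_cell p) (\<lambda>z. lie_form \<rho> a b x (tube g p z) (\<lambda>c. pd (tube g p) c z)) =
      (if p = 0 then 0 else (\<Sum>k\<le>p. (- 1) ^ (p - k) * integral (ord_cell (p - 1)) (face_form \<rho> a b x (\<lambda>z. tube g p (face k z)))))"
    by (rule stokes_faces[OF X nz' a x tube_periodic[OF sl order_refl]])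
  also have "\<dots> = (if p = 0 then 0 else
      (\<Sum>k\<le>p. (- 1) ^ (p - k) * integral (ord_cell (p - 1)) (face_form \<rho> a b x (tube (\<lambda>y. g (simplical_face k y)) (p - 1)))))"
  proof (cases "p = 0")
    case False
    then have "1 \<le> p" by simp
    from tube_face[OF this] show ?thesis
      unfolding if_not_P[OF False] by (intro sum.cong refl) (metis atMost_iff)
  qed simp
  finally show ?thesis .
qed

text \<open>By \<open>face_integral_eq\<close> a face integral depends on the singular face alone
  and not on the lift from which it was computed. It is thus a function of singular simplices, and
  such a function sums to 0 over the boundary of a cycle.\<close>

lemma integral_lie_form_cycle:
  fixes b :: "('s, 'd) idx \<Rightarrow> complex"
  assumes cycle: "smooth_cycle K \<rho> a b0 p slot \<gamma> lift"
    and dual: "\<And>J j. J \<in> K \<Longrightarrow> \<exists>m. \<forall>l\<in>J. pairing m (\<rho> l) = (if l = j then 1 else 0)"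
    and nz: "\<And>\<phi> u i. \<phi> \<in> Poly_Mapping.keys \<gamma> \<Longrightarrow> u \<in> tube_cell p slot \<Longrightarrow>
      cox_section \<rho> a b i (tube_map p slot \<Phi> rad (lift \<phi>) u) \<noteq> 0"
    and a: "\<And>j. (\<Sum>i\<in>UNIV. a i j) = 1" and x: "graded_field \<rho> x"
  shows "(\<Sum>\<phi>\<in>Poly_Mapping.keys \<gamma>. of_int (Poly_Mapping.lookup \<gamma> \<phi>) * integral (tube_cell p slot)
    (\<lambda>u. lie_form \<rho> a b x (tube_map p slot \<Phi> rad (lift \<phi>) u) (\<lambda>c. pd (tube_map p slot \<Phi> rad (lift \<phi>)) c u))) = 0"
proof -
  let ?K = "Poly_Mapping.keys \<gamma>" and ?C = "tube_cell p slot"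
  have g: "smooth_near ?C (\<lambda>u. lift \<phi> (simplex_point p slot u))" and zl: "lift \<phi> ` standard_simplex p \<subseteq> zero_locus K \<rho> a b0"
    and orb: "\<phi> = restrict (\<lambda>x. orbit \<rho> (lift \<phi> x)) (standard_simplex p)" if "\<phi> \<in> ?K" for \<phi>
    using cycle that unfolding smooth_cycle_def by blast+
  note int = integral_lie_form_tube[OF g zl nz a x]
  show ?thesis
  proof (cases "p = 0")
    case True
    then show ?thesis using int by simp
  next
    case False
    then have p: "1 \<le> p" by simp
    let ?g = "\<lambda>\<phi> k y. lift \<phi> (simplical_face k y)"
    let ?I = "\<lambda>\<phi> k. integral (ord_cell (p - 1)) (face_form \<rho> a b x (tube (?g \<phi> k) (p - 1)))"
    have sl: "smooth_lift (p - 1) (?g \<phi> k)" if "\<phi> \<in> ?K" "k \<le> p" for \<phi> k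
      by (rule smooth_lift_face[OF p that(2) smooth_lift_simplex[OF g zl]]) (rule that)+
    have nz': "cox_section \<rho> a b i (tube (?g \<phi> k) (p - 1) z) \<noteq> 0" if "\<phi> \<in> ?K" "k \<le> p" "z \<in> ord_cell (p - 1)" for \<phi> k z i
    proof -
      have "diff_coords p (face k z) \<in> ?C"
        using face_in_ord_cell[OF that(3)] diff_coords_vimage_tube_cell by blast
      from nz[OF that(1) this] show ?thesis unfolding tube_face[OF p that(2)] tube_map_diff_coords .
    qed
    have well: "?I \<phi> k = ?I \<phi>' k'" if \<phi>: "\<phi> \<in> ?K" "k \<le> p" "\<phi>' \<in> ?K" "k' \<le> p" and eq: "singular_face p k \<phi> = singular_face p k' \<phi>'" for \<phi> \<phi>' k k'
    proof (rule face_integral_eq[OF p sl sl _ dual nz' nz' a x])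
      fix y assume y: "y \<in> standard_simplex (p - 1)"
      have o: "singular_face p k \<phi> y = orbit \<rho> (?g \<phi> k y)" if "\<phi> \<in> ?K" "k \<le> p" for \<phi> k
      proof -
        have "simplical_face k y \<in> standard_simplex p"
          using simplical_face_in_standard_simplex[OF p that(2)] y by simp
        then have "\<phi> (simplical_face k y) = orbit \<rho> (?g \<phi> k y)" using orb[OF that(1)] by (metis restrict_apply')
        then show ?thesis using y by (simp add: singular_face_def)
      qed
      show "orbit \<rho> (?g \<phi> k y) = orbit \<rho> (?g \<phi>' k' y)"
        using o[OF \<phi>(1,2)] o[OF \<phi>(3,4)] eq by simp
    qed (use \<phi> in auto)
    \<comment> \<open>The value comes from an arbitrary occurrence of \<open>\<psi>\<close> as a
      face; by \<open>well\<close> all occurrences agree.\<close>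
    define J where "J \<psi> = (case SOME (\<phi>, k). \<phi> \<in> ?K \<and> k \<le> p \<and> singular_face p k \<phi> = \<psi> of (\<phi>, k) \<Rightarrow> ?I \<phi> k)" for \<psi>
    have J: "?I \<phi> k = J (singular_face p k \<phi>)" if "\<phi> \<in> ?K" "k \<le> p" for \<phi> k
    proof -
      obtain \<phi>' k' where s: "(SOME (\<phi>', k'). \<phi>' \<in> ?K \<and> k' \<le> p \<and> singular_face p k' \<phi>' = singular_face p k \<phi>) = (\<phi>', k')"
        by (cases "SOME (\<phi>', k'). \<phi>' \<in> ?K \<and> k' \<le> p \<and> singular_face p k' \<phi>' = singular_face p k \<phi>")
      have "(\<lambda>(\<phi>', k'). \<phi>' \<in> ?K \<and> k' \<le> p \<and> singular_face p k' \<phi>' = singular_face p k \<phi>)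
          (SOME (\<phi>', k'). \<phi>' \<in> ?K \<and> k' \<le> p \<and> singular_face p k' \<phi>' = singular_face p k \<phi>)"
        by (rule someI[of _ "(\<phi>, k)"]) (use that in simp)
      then have "\<phi>' \<in> ?K" "k' \<le> p" "singular_face p k' \<phi>' = singular_face p k \<phi>" unfolding s by auto
      from well[OF that this(1,2) this(3)[symmetric]] show ?thesis unfolding J_def s by simp
    qed
    have "of_int (Poly_Mapping.lookup \<gamma> \<phi>) * integral ?C
        (\<lambda>u. lie_form \<rho> a b x (tube_map p slot \<Phi> rad (lift \<phi>) u) (\<lambda>c. pd (tube_map p slot \<Phi> rad (lift \<phi>)) c u)) =
      det diff_matrix * (- 1) ^ p * (\<Sum>k\<le>p. of_int (Poly_Mapping.lookup \<gamma> \<phi>) * (- 1) ^ k * J (singular_face p k \<phi>))" if \<phi>: "\<phi> \<in> ?K" for \<phi>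
    proof -
      \<comment> \<open>The sign from Stokes' theorem differs from that of the singular boundary by
        the common factor (-1)^p.\<close>
      have "(- 1) ^ (p - k) * ?I \<phi> k = (- 1) ^ p * ((- 1) ^ k * J (singular_face p k \<phi>))" if k: "k \<le> p" for k
      proof -
        have "(- 1 :: complex) ^ p * (- 1) ^ k = (- 1) ^ (p - k) * ((- 1) ^ k * (- 1) ^ k)"
          using power_add[of "- 1 :: complex" "p - k" k] k by (simp add: mult.assoc)
        also have "(- 1 :: complex) ^ k * (- 1) ^ k = 1" by (simp add: power_mult_distrib[symmetric])
        finally have s: "(- 1 :: complex) ^ p * (- 1) ^ k = (- 1) ^ (p - k)" by simp
        show ?thesis unfolding J[OF \<phi> k] mult.assoc[symmetric] s ..
      qed
      then have "(\<Sum>k\<le>p. (- 1) ^ (p - k) * ?I \<phi> k) = (- 1) ^ p * (\<Sum>k\<le>p. (- 1) ^ k * J (singular_face p k \<phi>))"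
        unfolding sum_distrib_left by (intro sum.cong) auto
      then show ?thesis using int[OF \<phi> \<phi> \<phi>] False by (simp add: sum_distrib_left mult_ac)
    qed
    then have "(\<Sum>\<phi>\<in>?K. of_int (Poly_Mapping.lookup \<gamma> \<phi>) * integral ?C
        (\<lambda>u. lie_form \<rho> a b x (tube_map p slot \<Phi> rad (lift \<phi>) u) (\<lambda>c. pd (tube_map p slot \<Phi> rad (lift \<phi>)) c u))) =
      det diff_matrix * (- 1) ^ p * (\<Sum>\<phi>\<in>?K. \<Sum>k\<le>p. of_int (Poly_Mapping.lookup \<gamma> \<phi>) * (- 1) ^ k * J (singular_face p k \<phi>))"
      unfolding sum_distrib_left by (intro sum.cong) (simp_all add: sum_distrib_left)
    also have "\<dots> = 0"
      using chain_boundary_sum_zero[OF p, of \<gamma> J] cycle by (simp add: smooth_cycle_def)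
    finally show ?thesis .
  qed
qed

end

section \<open>The operators of the tautological system applied to the periods\<close>

theorem proposition3p4:
  fixes k n :: nat
    and dot :: "'d::finite \<Rightarrow> nat \<times> nat"
    and ray :: "'r::finite \<Rightarrow> edge"
    and nn :: "'s::finite \<Rightarrow> nat"
    and a :: "'s \<Rightarrow> 'r \<Rightarrow> int"
    and b0 :: "'s \<times> (int ^ 'd) \<Rightarrow> complex"
    and slot :: "nat + 's \<Rightarrow> 'd"
    and \<gamma> :: "(complex ^ 'r) set chain"
    and lift :: "((nat \<Rightarrow> real) \<Rightarrow> (complex ^ 'r) set) \<Rightarrow> (nat \<Rightarrow> real) \<Rightarrow> complex ^ 'r"
    and \<Phi> :: "(complex ^ 'r) \<times> (complex ^ 's) \<Rightarrow> complex ^ 'r"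
    and rad :: "complex ^ 'r \<Rightarrow> real ^ 's"
  defines "\<rho> \<equiv> \<lambda>j. edge_vec dot (ray j)"
    and "K \<equiv> {J. ray ` J \<in> ladder_cones k n}"
    and "p \<equiv> CARD('d) - CARD('s)"
  assumes kn: "1 \<le> k" "k < n"
    and dot: "bij_betw dot UNIV (dots k n)"
    and ray: "bij_betw ray UNIV (edges k n)"
    and nn_pos: "\<forall>i. 0 < nn i"
    and nn_sum: "(\<Sum>i\<in>UNIV. nn i) = n"
    and a_bundle: "\<forall>i. lin_equiv \<rho> (a i) (\<lambda>j. if ray j = top_edge then int (nn i) else 0)"
    and a_sum: "\<forall>j. (\<Sum>i\<in>UNIV. a i j) = 1"
    and smooth: "smooth_ci K \<rho> a b0"
    and slot: "slots slot"
    and cycle: "smooth_cycle K \<rho> a b0 p slot \<gamma> lift"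
    and tube: "tubular_nbhd K \<rho> a b0 \<Phi> rad"
  shows "\<exists>U. open U \<and> b0 \<in> U \<and>
    (\<forall>b\<in>U. \<forall>\<phi>\<in>Poly_Mapping.keys \<gamma>. \<forall>u\<in>tube_cell p slot. \<forall>i.
       cox_section \<rho> a b i (tube_map p slot \<Phi> rad (lift \<phi>) u) \<noteq> 0) \<and>
    holomorphic_in (coeff_index \<rho> a) U (period \<rho> a p slot \<Phi> rad \<gamma> lift) \<and>
    (\<forall>Q\<in>tautological_ideal K \<rho> a. \<forall>b\<in>U.
       weyl_apply Q (period \<rho> a p slot \<Phi> rad \<gamma> lift) b = 0)"
proof -
  have J_cone: "J \<in> K \<Longrightarrow> ray ` J \<in> ladder_cones k n" for J by (simp add: K_def)
  have "tube_slots p slot" using slot by (simp add: tube_slots_def slots_def p_def)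
  then interpret tube_bundle p slot K \<rho> a b0 \<Phi> rad
    by (rule tube_bundle.intro) (rule tube_bundle_axioms.intro[OF tube])
  have inj: "inj ray" using ray by (simp add: bij_betw_def)
  have complete: "complete_rays \<rho>" unfolding \<rho>_def by (rule ladder_complete_rays[OF kn dot ray])
  have fin: "finite (polytope_points \<rho> (a i))" for i
    unfolding \<rho>_def by (rule ladder_finite_polytope_points[OF kn dot ray])
  have dual: "\<exists>m. \<forall>l\<in>J. pairing m (\<rho> l) = (if l = j then 1 else 0)" if "J \<in> K" for J j
    unfolding \<rho>_def by (rule ladder_dual_vectors[OF kn dot inj J_cone[OF that]])
  have a: "(\<Sum>i\<in>UNIV. a i j) = 1" for j using a_sum by blast
  let ?C = "tube_cell p slot" and ?K = "Poly_Mapping.keys \<gamma>"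
  let ?T = "\<lambda>\<phi>. tube_map p slot \<Phi> rad (lift \<phi>)"
  let ?E = "\<lambda>\<phi> u. euler_form \<rho> (?T \<phi> u) (\<lambda>c. pd (?T \<phi>) c u)"
  have g: "smooth_near ?C (\<lambda>u. lift \<phi> (simplex_point p slot u))" and zl: "lift \<phi> ` standard_simplex p \<subseteq> zero_locus K \<rho> a b0" if "\<phi> \<in> ?K" for \<phi>
    using cycle that unfolding smooth_cycle_def by blast+
  have cT: "continuous_on ?C (?T \<phi>)" and cE: "continuous_on ?C (?E \<phi>)" if \<phi>: "\<phi> \<in> ?K" for \<phi>
  proof -
    obtain W where W: "?C \<subseteq> W" "k_smooth_on (Suc 0) W (?T \<phi>)" using smooth_tube_map[OF g[OF \<phi>] zl[OF \<phi>]] by blast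
    show c: "continuous_on ?C (?T \<phi>)"
      using k_smooth_on_continuous[OF W(2)] W(1) by (rule continuous_on_subset)
    have "continuous_on ?C (pd (?T \<phi>) c)" for c
      using k_smooth_on_continuous[OF k_smooth_on_pd[OF W(2)]] W(1) by (rule continuous_on_subset)
    then show "continuous_on ?C (?E \<phi>)" by (intro continuous_on_euler_form c)
  qed
  \<comment> \<open>The coefficients for which no section vanishes on the tubes, which remain those
    constructed from \<open>b0\<close>.\<close>
  define U where "U = {b. \<forall>\<phi>\<in>?K. \<forall>u\<in>?C. \<forall>i. cox_section \<rho> a b i (?T \<phi> u) \<noteq> 0}"
  have U: "open U" unfolding U_def by (rule open_sections_nonzero[OF finite_keys compact_tube_cell cT])
  have nz: "cox_section \<rho> a b i (?T \<phi> u) \<noteq> 0" if "b \<in> U" "\<phi> \<in> ?K" "u \<in> ?C" for b \<phi> u i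
    using that by (simp add: U_def)
  have b0: "b0 \<in> U" unfolding U_def using tube_map_in_cox_open(2)[OF zl] by blast
  \<comment> \<open>The period together with all its partial derivatives in closed form, the period
    itself being the member of index 0.\<close>
  define P where "P \<beta> b = (\<Sum>\<phi>\<in>?K. of_int (Poly_Mapping.lookup \<gamma> \<phi>) * kernel_integral \<rho> a ?C (?E \<phi>) (?T \<phi>) \<beta> b)" for \<beta> b
  have period: "period \<rho> a p slot \<Phi> rad \<gamma> lift = P 0"
    by (simp add: fun_eq_iff period_def P_def kernel_integral_def kernel_zero period_form_def pd_def Let_def)
  have jets: "jets U P"
    unfolding P_def[abs_def] by (rule jets_sum[OF jets_kernel_integral[OF fin compact_tube_cell cE cT U nz] U])
  have P_value: "weyl_value P b Q = (\<Sum>\<phi>\<in>?K. of_int (Poly_Mapping.lookup \<gamma> \<phi>) *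
      integral ?C (\<lambda>u. ?E \<phi> u * weyl_value (\<lambda>\<beta> b. kernel \<rho> a \<beta> b (?T \<phi> u)) b Q))" if "b \<in> U" for b Q
    unfolding P_def[abs_def] by (rule weyl_value_kernel_integral[OF compact_tube_cell cE cT nz[OF that]])
  have cone: "weyl_value P b (const_coeff_op q) = 0" if b: "b \<in> U" and q: "q \<in> cone_ideal K \<rho> a" for b q
  proof -
    have "integral ?C (\<lambda>u. ?E \<phi> u * weyl_value (\<lambda>\<beta> b. kernel \<rho> a \<beta> b (?T \<phi> u)) b (const_coeff_op q)) = integral ?C (\<lambda>u. 0)" if "\<phi> \<in> ?K" for \<phi>
      by (rule integral_cong) (simp add: weyl_value_const_coeff_op[OF q tube_map_in_cox_open(1)[OF zl[OF that]]])
    then show ?thesis unfolding P_value[OF b] by simp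
  qed
  \<comment> \<open>Unlike for the constant coefficient operators, the integrand need not vanish
    here; it is the Lie derivative of the period form, and the sum over the whole cycle
    vanishes.\<close>
  have lie: "weyl_value P b (Z_op \<rho> a x c + Poly_Mapping.single 0 (beta_char \<rho> x c)) = 0" if b: "b \<in> U" and x: "x \<in> lie_Aut_g \<rho>" for b x c
  proof -
    obtain \<psi> where \<psi>: "aut_curve \<rho> \<psi> x" using x unfolding lie_Aut_g_def by blast
    have "integral ?C (\<lambda>u. ?E \<phi> u * weyl_value (\<lambda>\<beta> b. kernel \<rho> a \<beta> b (?T \<phi> u)) b (Z_op \<rho> a x c + Poly_Mapping.single 0 (beta_char \<rho> x c))) =
        integral ?C (\<lambda>u. lie_form \<rho> a b (var_field x) (?T \<phi> u) (\<lambda>c. pd (?T \<phi>) c u))" if \<phi>: "\<phi> \<in> ?K" for \<phi>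
      by (rule integral_cong) (simp only: weyl_value_Z_op[OF x complete fin nz[OF b \<phi>]] lie_form_def period_form_def, simp)
    then show ?thesis
      unfolding P_value[OF b]
      using integral_lie_form_cycle[OF cycle dual nz[OF b] a graded_var_field[OF \<psi>]] by simp
  qed
  show ?thesis
  proof (intro exI[of _ U] conjI ballI allI)
    show "open U" by (rule U)
    show "b0 \<in> U" by (rule b0)
    show "cox_section \<rho> a b i (?T \<phi> u) \<noteq> 0" if "b \<in> U" "\<phi> \<in> ?K" "u \<in> ?C" for b \<phi> u i
      by (rule nz[OF that])
    have "continuous_on U (P 0)"
      unfolding P_def
      by (intro continuous_on_sum continuous_on_mult continuous_on_const continuous_on_kernel_integral compact_tube_cell cE cT nz)
    moreover have "(\<lambda>z. P 0 (b(v := z))) field_differentiable at (b v)" if "b \<in> U" for b v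
      using jets that unfolding jets_def field_differentiable_def by blast
    ultimately show "holomorphic_in (coeff_index \<rho> a) U (period \<rho> a p slot \<Phi> rad \<gamma> lift)"
      unfolding period holomorphic_in_def by blast
    fix Q b assume Q: "Q \<in> tautological_ideal K \<rho> a" and b: "b \<in> U"
    show "weyl_apply Q (period \<rho> a p slot \<Phi> rad \<gamma> lift) b = 0"
      unfolding period
      by (rule weyl_left_ideal_annihilates[OF jets _ Q[unfolded tautological_ideal_def] b]) (use cone lie in blast)
  qed
qed

end
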